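(* Let $X$ be a connected non-orientable manifold of even dimension $2n$ without boundary, with a Riemannian metric $g$, and let $\pi:\tilde X\to X$ be its orientable double cover, with metric $\pi^*g$ and orientation-reversing sheet-exchange involution $\tau$. Let $u,u'$ be the two orientations of $\tilde X$, and fix a sign $\pm$ for pin$^\pm$ structures. (1) Let $\xi$ be a $\tau$-invariant pin$^\pm$ structure on $\tilde X$, with equivalence $\widetilde{d\tau}$ between $\xi$ and $\tau^*\xi$, and let $\xi_u$, $\xi_{u'}$ be the spin structures obtained by restricting $\xi$ to the frames oriented by $u$, $u'$. Then $\widetilde{d\tau}$ restricts to equivalences $\xi_u\simeq\tau^*\xi_{u'}$ and $\xi_{u'}\simeq\tau^*\xi_u$. In particular it gives an isomorphism of couples of spin structures $\widetilde{d\tau}:(\xi_u,\tau^*\xi_u)\xrightarrow{\ \simeq\ }(\tau^*\xi_{u'},\xi_{u'})$. (2) Conversely, let $\xi_u$ be a spin structure on $\tilde X$ relative to $u$, let $\xi$ be its pin$^\pm$ extension, and let $\xi_{u'}$ be the restriction of $\xi$ to the frames oriented by $u'$. If there is an isomorphism of couples $\widetilde{d\tau}:(\xi_u,\tau^*\xi_u)\xrightarrow{\ \simeq\ }(\tau^*\xi_{u'},\xi_{u'})$ satisfying $\widetilde{d\tau}^2=1$, then $\widetilde{d\tau}$ gives an equivalence of pin$^\pm$ structures between $\xi$ and $\tau^*\xi$, so that $\xi$ is the pull-back of a pin$^\pm$ structure on $X$. (3) Let $\xi$ be a pin$^\pm$ structure on $\tilde X$ with an equivalence $\widetilde{d\tau}$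 between $\xi$ and $\tau^*\xi$ such that $\widetilde{d\tau}^2=1$. The sign of $\widetilde{d\tau}$ is fixed by requiring that $P_{\mathrm{Pin}^\pm}\tilde X/\widetilde{d\tau}$ be a prescribed one of the pin$^\pm$ structures on $X$ that pull back to $\xi$. Let $s$ be a pinor with $s=\widetilde{d\tau}\circ\eta_\tau(s)$. Consider the pair $(s,s)$ relative to the couple $(\xi,\tau^*\xi\simeq\xi)$, and restrict it to the oriented couple $(\xi_u,\tau^*\xi_{u'})$, obtaining components $s^+$ in $S^+_{\xi_u}$ and $s^-$ in $S^-_{\tau^*\xi_{u'}}$. Then $s^-=\widetilde{d\tau}\circ\eta_\tau(s^+)$, i.e. $s^-_x=\widetilde{d\tau}(s^+_{\tau(x)})$. This gives a natural bijection between $\widetilde{d\tau}$-invariant pinors and invariant couples of spinors, the latter being the couples of the form $(s^+,\widetilde{d\tau}\circ\eta_\tau(s^+))$. With $\widetilde{d\tau}\circ\gamma$ in place of $\widetilde{d\tau}$, one gets $s^-=-\widetilde{d\tau}\circ\eta_\tau(s^+)$, and the $(\widetilde{d\tau}\circ\gamma)$-invariant couples are those of the form $(s^+,-\widetilde{d\tau}\circ\eta_\tau(s^+))$. (4) The choice of orientation in (3) is immaterial: taking $u'$ instead of $u$, and hence using the structures $\xi_{u'}$ and $\tau^*\xi_u$ instead of $\xi_u$ and $\tau^*\xi_{u'}$, gives the same result, since there is a canonical bijection between the corresponding sections.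
   Context: $\mathrm{Pin}^{\pm}(m)$ are the two double coverings $p^\pm:\mathrm{Pin}^\pm(m)\to O(m)$ with kernel $\{\pm1\}$ built from the Clifford algebras in which unit vectors $v$ satisfy $v^2=+1$, resp. $v^2=-1$. Both restrict to $\mathrm{Spin}(m)\to SO(m)$. For a Riemannian $m$-manifold $M$, $P_OM$ is the orthonormal frame bundle and $P_{SO_u}M\subset P_OM$ is the bundle of frames oriented by $u$. A pin$^\pm$ structure is a principal $\mathrm{Pin}^\pm(m)$-bundle $P_{\mathrm{Pin}^\pm}M\to M$ with a 2-covering $\xi:P_{\mathrm{Pin}^\pm}M\to P_OM$ over $M$ such that $\xi(p\cdot t)=\xi(p)\cdot p^\pm(t)$. Spin structures relative to $u$ are defined likewise, with $\mathrm{Spin}(m)$ and $P_{SO_u}M$. An equivalence is a principal bundle isomorphism commuting with the coverings. $\gamma$ denotes the exchange of the two sheets of the covering $\xi$; it acts on pinors as $-1$. For an isometry $\varphi$, $\varphi^*\xi:=d\varphi^{-1}\circ\xi$, with the same total space. The pin$^\pm$ structure $\xi$ on $\tilde X$ is $\tau$-invariant if $\xi\simeq\tau^*\xi$, i.e. if there is an isomorphism $\widetilde{d\tau}:P_{\mathrm{Pin}^\pm}\tilde X\to P_{\mathrm{Pin}^\pm}\tilde X$ with $\xi\circ\widetilde{d\tau}=d\tau\circ\xi$. It is then unique up to composition with $\gamma$. For spin structures, $\tau^*\xi_{u'}=d\tau^{-1}\circ\xi_{u'}$ is a spin structure relative to $u$, and $\tau^*\xi_u$ is one relative to $u'$. Couples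 of spin structures are ordered pairs, and an isomorphism of couples is a componentwise equivalence. An isomorphism $(\xi_u,\tau^*\xi_u)\simeq(\tau^*\xi_{u'},\xi_{u'})$ thus amounts to equivalences $\xi_u\simeq\tau^*\xi_{u'}$ and $\xi_{u'}\simeq\tau^*\xi_u$, given by maps $P_{\mathrm{Spin}_u}\tilde X\to P_{\mathrm{Spin}_{u'}}\tilde X$ and $P_{\mathrm{Spin}_{u'}}\tilde X\to P_{\mathrm{Spin}_u}\tilde X$ covering $d\tau$, both denoted $\widetilde{d\tau}$. A couple is oriented if both members are relative to the same orientation. The pin$^\pm$ extension of $\xi_u$ has total space $(P_{\mathrm{Spin}_u}\tilde X\times\mathrm{Pin}^\pm(2n))/\!\sim$ with $(p,t)\sim(pr,r^{-1}t)$ for $r\in\mathrm{Spin}(2n)$, and covering map $[p,t]\mapsto\xi_u(p)\,p^\pm(t)$. Pull-back along $\pi$: $P_O\tilde X\cong\pi^*P_OX$ canonically via $f\mapsto(d\pi(f),\text{base point of }f)$, and the pull-back of $P_{\mathrm{Pin}^\pm}X\to P_OX$ is $\pi^*P_{\mathrm{Pin}^\pm}X\to\pi^*P_OX\cong P_O\tilde X$. Pinors are sections of $S_\xi=P_{\mathrm{Pin}^\pm}\tilde X\times_\rho\mathbb C^{2^n}$, where $\rho$ is the standard Clifford-module action. $S_{\tau^*\xi}$ has the same total space as $S_\xi$, with fibres $(S_{\tau^*\xi})_x=(S_\xi)_{\tau(x)}$. The map $\eta_\tau:\Gamma(S_\xi)\to\Gamma(S_{\tau^*\xi})$ is $\eta_\tau(s)_x:=s_{\tau^{-1}(x)}=s_{\tau(x)}$,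 and $\widetilde{d\tau}$ induces a bundle map $S_{\tau^*\xi}\to S_\xi$; so $s=\widetilde{d\tau}\circ\eta_\tau(s)$ means $s_x=\widetilde{d\tau}(s_{\tau(x)})$. $S^+_{\xi_u}$ and $S^-_{\tau^*\xi_{u'}}$ are the bundles of positive-chiral spinors of $\xi_u$ and of negative-chiral spinors of $\tau^*\xi_{u'}$, and the bundle of spinors of the couple $(\xi_u,\tau^*\xi_{u'})$ is $S^+_{\xi_u}\oplus S^-_{\tau^*\xi_{u'}}$. The spinor bundles of $\xi_u$ and $\tau^*\xi_{u'}$ are identified through the equivalence given by $\widetilde{d\tau}$.
   Formalization: In (2), the pull-back conclusion is proved assuming also that the two parts of the lift of dτ are compatible, at one point, with the action of one element of Pin outside Spin; without this it fails, e.g. for X the real projective plane with the sign for which it has no pin structure. *)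

theory Defs
  imports "HOL-Analysis.Analysis"
begin

section \<open>Topological preliminaries\<close>

definition quotient_top :: "'a topology \<Rightarrow> ('a \<Rightarrow> 'b) \<Rightarrow> 'b topology" where
  "quotient_top T f =
     topology (\<lambda>W. W \<subseteq> f ` topspace T \<and> openin T {x \<in> topspace T. f x \<in> W})"

lemma openin_quotient_top:
  "openin (quotient_top T f) W \<longleftrightarrow> W \<subseteq> f ` topspace T \<and> openin T {x \<in> topspace T. f x \<in> W}"
proof -
  have "istopology (\<lambda>W. W \<subseteq> f ` topspace T \<and> openin T {x \<in> topspace T. f x \<in> W})"
    unfolding istopology_def
  proof (intro conjI allI impI)
    fix A B
    assume "A \<subseteq> f ` topspace T \<and> openin T {x \<in> topspace T. f x \<in> A}"
      and "B \<subseteq> f ` topspace T \<and> openin T {x \<in> topspace T. f x \<in> B}"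
    moreover have "{x \<in> topspace T. f x \<in> A \<inter> B} =
        {x \<in> topspace T. f x \<in> A} \<inter> {x \<in> topspace T. f x \<in> B}" by blast
    ultimately show "A \<inter> B \<subseteq> f ` topspace T" "openin T {x \<in> topspace T. f x \<in> A \<inter> B}"
      by auto
  next
    fix \<K>
    assume K: "\<forall>K\<in>\<K>. K \<subseteq> f ` topspace T \<and> openin T {x \<in> topspace T. f x \<in> K}"
    have "{x \<in> topspace T. f x \<in> \<Union>\<K>} = (\<Union>K\<in>\<K>. {x \<in> topspace T. f x \<in> K})" by blast
    with K show "\<Union>\<K> \<subseteq> f ` topspace T" "openin T {x \<in> topspace T. f x \<in> \<Union>\<K>}"
      by auto
  qed
  then show ?thesis
    by (simp add: quotient_top_def topology_inverse')
qed

definition two_covering :: "'e topology \<Rightarrow> 'b topology \<Rightarrow> ('e \<Rightarrow> 'b) \<Rightarrow> bool" where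
  "two_covering E B p \<longleftrightarrow>
     continuous_map E B p \<and>
     (\<forall>x \<in> topspace B. card {e \<in> topspace E. p e = x} = 2) \<and>
     (\<forall>x \<in> topspace B. \<exists>U. openin B U \<and> x \<in> U \<and>
        (\<exists>\<V>. \<Union>\<V> = {e \<in> topspace E. p e \<in> U} \<and> pairwise disjnt \<V> \<and>
           (\<forall>V \<in> \<V>. openin E V \<and> homeomorphic_map (subtopology E V) (subtopology B U) p)))"

text \<open>The topological group is given by its space \<open>G\<close>, multiplication and unit; it acts on the right.\<close>

definition principal_bundle ::
  "'g topology \<Rightarrow> ('g \<Rightarrow> 'g \<Rightarrow> 'g) \<Rightarrow> 'g \<Rightarrow> 'a topology \<Rightarrow> 'p topology \<Rightarrow> ('p \<Rightarrow> 'a) \<Rightarrow> ('p \<Rightarrow> 'g \<Rightarrow> 'p) \<Rightarrow> bool"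
where
  "principal_bundle G mul e B P pr act \<longleftrightarrow>
     continuous_map P B pr \<and>
     continuous_map (prod_topology P G) P (\<lambda>(p, t). act p t) \<and>
     (\<forall>p \<in> topspace P. act p e = p \<and>
        (\<forall>t \<in> topspace G. pr (act p t) = pr p \<and>
           (\<forall>r \<in> topspace G. act (act p t) r = act p (mul t r)))) \<and>
     (\<forall>x \<in> topspace B. \<exists>U. openin B U \<and> x \<in> U \<and>
        (\<exists>\<Phi>. homeomorphic_map (prod_topology (subtopology B U) G)
                 (subtopology P {p \<in> topspace P. pr p \<in> U}) \<Phi> \<and>
              (\<forall>y \<in> U. \<forall>t \<in> topspace G. pr (\<Phi> (y, t)) = y \<and>
                 (\<forall>r \<in> topspace G. \<Phi> (y, mul t r) = act (\<Phi> (y, t)) r))))"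


section \<open>Smooth maps and Riemannian manifolds\<close>

primrec ck_on :: "nat \<Rightarrow> 'a::real_normed_vector set \<Rightarrow> ('a \<Rightarrow> 'b::real_normed_vector) \<Rightarrow> bool" where
  "ck_on 0 S f \<longleftrightarrow> continuous_on S f"
| "ck_on (Suc k) S f \<longleftrightarrow> (\<forall>x\<in>S. f differentiable (at x)) \<and>
     (\<forall>v. ck_on k S (\<lambda>x. frechet_derivative f (at x) v))"

text \<open>Meant for open \<open>S\<close> in a finite-dimensional space.\<close>

definition smooth_on :: "'a::real_normed_vector set \<Rightarrow> ('a \<Rightarrow> 'b::real_normed_vector) \<Rightarrow> bool" where
  "smooth_on S f \<longleftrightarrow> (\<forall>k. ck_on k S f)"

text \<open>
  A chart is a pair of its domain and its coordinate map.  A tangent vector at \<open>x\<close> is the family of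
  its coordinate vectors with respect to all charts at \<open>x\<close> (and 0 at all other charts).
\<close>

type_synonym ('a, 'm) chart = "'a set \<times> ('a \<Rightarrow> real^'m)"
type_synonym ('a, 'm) tangent = "('a, 'm) chart \<Rightarrow> real^'m"
type_synonym ('a, 'm) frame = "'a \<times> ('m \<Rightarrow> ('a, 'm) tangent)"

record ('a, 'm::finite) mfd =
  mtop :: "'a topology"
  atlas :: "('a, 'm) chart set"
  metric :: "'a \<Rightarrow> ('a, 'm) tangent \<Rightarrow> ('a, 'm) tangent \<Rightarrow> real"

definition inv_chart :: "('a, 'm::finite) chart \<Rightarrow> real^'m \<Rightarrow> 'a" where
  "inv_chart c = inv_into (fst c) (snd c)"

definition charts_at :: "('a, 'm::finite, 'z) mfd_scheme \<Rightarrow> 'a \<Rightarrow> ('a, 'm) chart set" where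
  "charts_at M x = {c \<in> atlas M. x \<in> fst c}"

definition smooth_manifold :: "('a, 'm::finite, 'z) mfd_scheme \<Rightarrow> bool" where
  "smooth_manifold M \<longleftrightarrow>
     Hausdorff_space (mtop M) \<and> second_countable (mtop M) \<and>
     (\<Union>c \<in> atlas M. fst c) = topspace (mtop M) \<and>
     (\<forall>c \<in> atlas M. openin (mtop M) (fst c) \<and> open (snd c ` fst c) \<and>
        homeomorphic_map (subtopology (mtop M) (fst c)) (top_of_set (snd c ` fst c)) (snd c)) \<and>
     (\<forall>c \<in> atlas M. \<forall>d \<in> atlas M. smooth_on (snd c ` (fst c \<inter> fst d)) (snd d \<circ> inv_chart c))"

definition smooth_map_on ::
  "('a, 'm::finite, 'z) mfd_scheme \<Rightarrow> ('b, 'k::finite, 'w) mfd_scheme \<Rightarrow> 'a set \<Rightarrow> ('a \<Rightarrow> 'b) \<Rightarrow> bool"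
where
  "smooth_map_on M N U f \<longleftrightarrow>
     continuous_map (subtopology (mtop M) U) (mtop N) f \<and>
     (\<forall>c \<in> atlas M. \<forall>d \<in> atlas N.
        smooth_on (snd c ` (U \<inter> fst c \<inter> f -` fst d)) (snd d \<circ> f \<circ> inv_chart c))"

definition smooth_fun_on ::
  "('a, 'm::finite, 'z) mfd_scheme \<Rightarrow> 'a set \<Rightarrow> ('a \<Rightarrow> 'v::real_normed_vector) \<Rightarrow> bool" where
  "smooth_fun_on M U f \<longleftrightarrow> (\<forall>c \<in> atlas M. smooth_on (snd c ` (U \<inter> fst c)) (f \<circ> inv_chart c))"

definition local_diffeo ::
  "('a, 'm::finite, 'z) mfd_scheme \<Rightarrow> ('b, 'm, 'w) mfd_scheme \<Rightarrow> ('a \<Rightarrow> 'b) \<Rightarrow> bool" where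
  "local_diffeo M N f \<longleftrightarrow>
     (\<forall>x \<in> topspace (mtop M). \<exists>U. openin (mtop M) U \<and> x \<in> U \<and> openin (mtop N) (f ` U) \<and>
        inj_on f U \<and> smooth_map_on M N U f \<and> smooth_map_on N M (f ` U) (inv_into U f))"

definition tangent_space :: "('a, 'm::finite, 'z) mfd_scheme \<Rightarrow> 'a \<Rightarrow> ('a, 'm) tangent set" where
  "tangent_space M x =
     {v. (\<forall>c. c \<notin> charts_at M x \<longrightarrow> v c = 0) \<and>
         (\<forall>c \<in> charts_at M x. \<forall>d \<in> charts_at M x.
            v d = frechet_derivative (snd d \<circ> inv_chart c) (at (snd c x)) (v c))}"

definition coord_vector ::
  "('a, 'm::finite, 'z) mfd_scheme \<Rightarrow> ('a, 'm) chart \<Rightarrow> 'a \<Rightarrow> real^'m \<Rightarrow> ('a, 'm) tangent" where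
  "coord_vector M c x a =
     (\<lambda>d. if d \<in> charts_at M x
          then frechet_derivative (snd d \<circ> inv_chart c) (at (snd c x)) a else 0)"

definition tangent_map ::
  "('a, 'm::finite, 'z) mfd_scheme \<Rightarrow> ('b, 'm, 'w) mfd_scheme \<Rightarrow> ('a \<Rightarrow> 'b) \<Rightarrow> 'a \<Rightarrow>
     ('a, 'm) tangent \<Rightarrow> ('b, 'm) tangent" where
  "tangent_map M N f x v =
     (let c = (SOME c. c \<in> charts_at M x)
      in (\<lambda>d. if d \<in> charts_at N (f x)
              then frechet_derivative (snd d \<circ> f \<circ> inv_chart c) (at (snd c x)) (v c) else 0))"

definition riemannian_manifold :: "('a, 'm::finite, 'z) mfd_scheme \<Rightarrow> bool" where
  "riemannian_manifold M \<longleftrightarrow> smooth_manifold M \<and>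
     (\<forall>x \<in> topspace (mtop M).
        (\<forall>v \<in> tangent_space M x. (v \<noteq> (\<lambda>_. 0) \<longrightarrow> metric M x v v > 0) \<and>
           (\<forall>w \<in> tangent_space M x. metric M x v w = metric M x w v \<and>
              (\<forall>z \<in> tangent_space M x. \<forall>a b.
                 metric M x (\<lambda>c. a *\<^sub>R v c + b *\<^sub>R w c) z = a * metric M x v z + b * metric M x w z)))) \<and>
     (\<forall>c \<in> atlas M. \<forall>a b.
        smooth_fun_on M (fst c) (\<lambda>x. metric M x (coord_vector M c x a) (coord_vector M c x b)))"


section \<open>Frames and orientations\<close>

text \<open>The matrix of a frame in a chart has the coordinate vectors of the frame as columns.\<close>

definition frame_matrix :: "('a, 'm::finite) chart \<Rightarrow> ('a, 'm) frame \<Rightarrow> real^'m^'m" where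
  "frame_matrix c e = (\<chi> i j. snd e j c $ i)"

definition linear_frames :: "('a, 'm::finite, 'z) mfd_scheme \<Rightarrow> ('a, 'm) frame set" where
  "linear_frames M = {e. fst e \<in> topspace (mtop M) \<and> (\<forall>i. snd e i \<in> tangent_space M (fst e)) \<and>
     (\<forall>c \<in> charts_at M (fst e). det (frame_matrix c e) \<noteq> 0)}"

definition orthonormal_frames :: "('a, 'm::finite, 'z) mfd_scheme \<Rightarrow> ('a, 'm) frame set" where
  "orthonormal_frames M = {e. fst e \<in> topspace (mtop M) \<and> (\<forall>i. snd e i \<in> tangent_space M (fst e)) \<and>
     (\<forall>i j. metric M (fst e) (snd e i) (snd e j) = (if i = j then 1 else 0))}"

definition frame_bundle :: "('a, 'm::finite, 'z) mfd_scheme \<Rightarrow> ('a, 'm) frame topology" where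
  "frame_bundle M = topology_generated_by
     {{e \<in> orthonormal_frames M. fst e \<in> fst c \<and> (fst e, frame_matrix c e) \<in> V} | c V.
        c \<in> atlas M \<and> openin (prod_topology (mtop M) (euclidean :: (real^'m^'m) topology)) V}"

definition frame_mult :: "('a, 'm::finite) frame \<Rightarrow> real^'m^'m \<Rightarrow> ('a, 'm) frame" where
  "frame_mult e A = (fst e, \<lambda>i c. \<Sum>j\<in>UNIV. A $ j $ i *\<^sub>R snd e j c)"

definition frame_map ::
  "('a, 'm::finite, 'z) mfd_scheme \<Rightarrow> ('b, 'm, 'w) mfd_scheme \<Rightarrow> ('a \<Rightarrow> 'b) \<Rightarrow> ('a, 'm) frame \<Rightarrow> ('b, 'm) frame"
where
  "frame_map M N f e = (f (fst e), \<lambda>i. tangent_map M N f (fst e) (snd e i))"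

text \<open>
  An orientation is the set \<open>u\<close> of its positively oriented linear frames: one of the two classes of
  bases in each tangent space, such that in each chart the class of the coordinate frame is locally
  constant.
\<close>

definition orientation :: "('a, 'm::finite, 'z) mfd_scheme \<Rightarrow> ('a, 'm) frame set \<Rightarrow> bool" where
  "orientation M u \<longleftrightarrow> u \<subseteq> linear_frames M \<and>
     (\<forall>x \<in> topspace (mtop M). \<exists>e \<in> u. fst e = x) \<and>
     (\<forall>e \<in> u. \<forall>A. det A \<noteq> 0 \<longrightarrow> (frame_mult e A \<in> u \<longleftrightarrow> det A > 0)) \<and>
     (\<forall>c \<in> atlas M. openin (mtop M) {x \<in> fst c. (x, \<lambda>i. coord_vector M c x (axis i 1)) \<in> u} \<and>
                    openin (mtop M) {x \<in> fst c. (x, \<lambda>i. coord_vector M c x (axis i 1)) \<notin> u})"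

definition opposite_orientation ::
  "('a, 'm::finite, 'z) mfd_scheme \<Rightarrow> ('a, 'm) frame set \<Rightarrow> ('a, 'm) frame set" where
  "opposite_orientation M u = linear_frames M - u"

definition orientable :: "('a, 'm::finite, 'z) mfd_scheme \<Rightarrow> bool" where
  "orientable M \<longleftrightarrow> (\<exists>u. orientation M u)"

definition oriented_frame_bundle ::
  "('a, 'm::finite, 'z) mfd_scheme \<Rightarrow> ('a, 'm) frame set \<Rightarrow> ('a, 'm) frame topology" where
  "oriented_frame_bundle M u = subtopology (frame_bundle M) u"

text \<open>
  The orientable double cover of a connected non-orientable \<open>X\<close>, carrying the pulled-back metric,
  together with its sheet exchange \<open>\<tau>\<close>.
\<close>

definition orientable_double_cover ::
  "('a, 'm::finite, 'z) mfd_scheme \<Rightarrow> ('b, 'm, 'w) mfd_scheme \<Rightarrow> ('a \<Rightarrow> 'b) \<Rightarrow> ('a \<Rightarrow> 'a) \<Rightarrow> bool" where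
  "orientable_double_cover Xt X \<pi> \<tau> \<longleftrightarrow>
     riemannian_manifold Xt \<and> connected_space (mtop Xt) \<and> orientable Xt \<and>
     two_covering (mtop Xt) (mtop X) \<pi> \<and> local_diffeo Xt X \<pi> \<and>
     (\<forall>x \<in> topspace (mtop Xt). \<forall>v \<in> tangent_space Xt x. \<forall>w \<in> tangent_space Xt x.
        metric Xt x v w =
          metric X (\<pi> x) (tangent_map Xt X \<pi> x v) (tangent_map Xt X \<pi> x w)) \<and>
     (\<forall>x \<in> topspace (mtop Xt). \<tau> x \<in> topspace (mtop Xt) \<and> \<tau> x \<noteq> x \<and> \<pi> (\<tau> x) = \<pi> x) \<and>
     (\<forall>u. orientation Xt u \<longrightarrow>
        (\<forall>e \<in> u. frame_map Xt Xt \<tau> e \<in> opposite_orientation Xt u))"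


section \<open>Clifford algebras and the groups Pin and Spin\<close>

text \<open>
  \<open>a $ S\<close> is the coefficient of \<open>a\<close> at the ordered product of the basis vectors \<open>e\<^sub>i\<close>, \<open>i \<in> S\<close>, taken
  in increasing order.  The algebra with parameter \<open>\<kappa> = \<plusminus>1\<close> has the relations \<open>e\<^sub>i\<^sup>2 = \<kappa>\<close> and
  \<open>e\<^sub>i e\<^sub>j = - e\<^sub>j e\<^sub>i\<close> for \<open>i \<noteq> j\<close>, so that \<open>\<kappa> = 1\<close> gives Pin+ and \<open>\<kappa> = -1\<close> gives Pin-.
\<close>

type_synonym 'm cliff = "real^('m set)"
type_synonym 'm square_matrix = "real^'m^'m"

definition cl_sign :: "real \<Rightarrow> 'm::{finite,linorder} set \<Rightarrow> 'm set \<Rightarrow> real" where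
  "cl_sign \<kappa> S T = (\<Prod>i\<in>S. \<Prod>j\<in>T. if j < i then - 1 else if j = i then \<kappa> else 1)"

definition cl_mult :: "real \<Rightarrow> 'm::{finite,linorder} cliff \<Rightarrow> 'm cliff \<Rightarrow> 'm cliff" where
  "cl_mult \<kappa> a b = (\<Sum>S\<in>UNIV. \<Sum>T\<in>UNIV. axis (sym_diff S T) (cl_sign \<kappa> S T * a $ S * b $ T))"

definition cl_one :: "'m::{finite,linorder} cliff" where
  "cl_one = axis {} 1"

definition cl_vec :: "real^'m::{finite,linorder} \<Rightarrow> 'm cliff" where
  "cl_vec v = (\<Sum>i\<in>UNIV. axis {i} (v $ i))"

text \<open>These operations satisfy the defining properties of the Clifford algebra.\<close>

lemma cl_mult_axis:
  "cl_mult \<kappa> (axis S x) (axis T y) = axis (sym_diff S T) (cl_sign \<kappa> S T * x * y)"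
proof -
  have "(\<Sum>T'\<in>UNIV. axis (sym_diff S' T') (cl_sign \<kappa> S' T' * axis S x $ S' * axis T y $ T'))
      = (if S' = S then axis (sym_diff S T) (cl_sign \<kappa> S T * x * y) else 0)" for S'
  proof -
    have "(\<Sum>T'\<in>UNIV. axis (sym_diff S' T') (cl_sign \<kappa> S' T' * axis S x $ S' * axis T y $ T'))
      = (\<Sum>T'\<in>UNIV. if T' = T then (if S' = S then axis (sym_diff S T) (cl_sign \<kappa> S T * x * y) else 0) else 0)"
      by (rule sum.cong) (auto simp: axis_def vec_eq_iff)
    then show ?thesis by simp
  qed
  then show ?thesis by (simp add: cl_mult_def)
qed

lemma cl_axis_add: "axis S (x + y) = axis S x + axis S (y::real)"
  by (simp add: axis_def vec_eq_iff)
lemma cl_axis_scale: "axis S (c * x) = c *\<^sub>R axis S (x::real)"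
  by (simp add: axis_def vec_eq_iff)

lemma cl_mult_bilinear: "bilinear (cl_mult \<kappa>)"
  unfolding bilinear_def
  by (auto intro!: linearI simp: cl_mult_def algebra_simps cl_axis_add cl_axis_scale sum.distrib scaleR_sum_right
      simp flip: cl_axis_scale intro!: sum.cong)

lemma prod_sym_diff:
  fixes w :: "'m::finite \<Rightarrow> real"
  assumes "\<And>j. w j * w j = 1"
  shows "prod w (sym_diff S T) = prod w S * prod w T"
proof -
  have "prod w S = prod w (S - T) * prod w (S \<inter> T)" "prod w T = prod w (T - S) * prod w (S \<inter> T)"
    by (metis (no_types, lifting) finite prod.Int_Diff mult.commute Int_commute)+
  moreover have "prod w (S \<inter> T) * prod w (S \<inter> T) = 1"
    by (simp add: assms flip: prod.distrib)
  moreover have "prod w (sym_diff S T) = prod w (S - T) * prod w (T - S)"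
    by (rule prod.union_disjoint) auto
  ultimately show ?thesis
    by (metis (no_types, lifting) mult.assoc mult.left_commute mult.right_neutral)
qed

lemma cl_sign_sym_diff:
  assumes "\<kappa> = 1 \<or> \<kappa> = -1"
  shows "cl_sign \<kappa> S (sym_diff T U) = cl_sign \<kappa> S T * cl_sign \<kappa> S U"
    and "cl_sign \<kappa> (sym_diff S T) U = cl_sign \<kappa> S U * cl_sign \<kappa> T U"
proof -
  show "cl_sign \<kappa> S (sym_diff T U) = cl_sign \<kappa> S T * cl_sign \<kappa> S U"
    unfolding cl_sign_def prod.distrib[symmetric]
    by (intro prod.cong refl prod_sym_diff) (use assms in auto)
  show "cl_sign \<kappa> (sym_diff S T) U = cl_sign \<kappa> S U * cl_sign \<kappa> T U"
    unfolding cl_sign_def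
    by (intro prod_sym_diff) (use assms in \<open>auto simp flip: prod.distrib intro!: prod.neutral\<close>)
qed

lemma cl_mult_sum:
  "cl_mult \<kappa> (sum f A) b = (\<Sum>i\<in>A. cl_mult \<kappa> (f i) b)"
  "cl_mult \<kappa> a (sum f A) = (\<Sum>i\<in>A. cl_mult \<kappa> a (f i))"
  using linear_sum[of "\<lambda>x. cl_mult \<kappa> x b" f A] linear_sum[of "cl_mult \<kappa> a" f A]
    cl_mult_bilinear[of \<kappa>] by (auto simp: bilinear_def)

lemma cl_expand: "a = (\<Sum>S\<in>UNIV. axis S (a $ S))" for a :: "'m::{finite,linorder} cliff"
  by (simp add: vec_eq_iff axis_def)

lemma cl_mult_assoc:
  assumes "\<kappa> = 1 \<or> \<kappa> = -1"
  shows "cl_mult \<kappa> (cl_mult \<kappa> a b) c = cl_mult \<kappa> a (cl_mult \<kappa> b c)"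
proof -
  have *: "cl_mult \<kappa> (cl_mult \<kappa> (axis S x) (axis T y)) (axis U z) =
        cl_mult \<kappa> (axis S x) (cl_mult \<kappa> (axis T y) (axis U z))" for S T U x y z
  proof -
    have "sym_diff (sym_diff S T) U = sym_diff S (sym_diff T U)" by blast
    then show ?thesis
      by (simp add: cl_mult_axis cl_sign_sym_diff[OF assms] mult_ac)
  qed
  have "cl_mult \<kappa> (cl_mult \<kappa> (\<Sum>S\<in>UNIV. axis S (a $ S)) (\<Sum>S\<in>UNIV. axis S (b $ S))) (\<Sum>S\<in>UNIV. axis S (c $ S))
      = cl_mult \<kappa> (\<Sum>S\<in>UNIV. axis S (a $ S)) (cl_mult \<kappa> (\<Sum>S\<in>UNIV. axis S (b $ S)) (\<Sum>S\<in>UNIV. axis S (c $ S)))"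
    by (simp only: cl_mult_sum *)
  then show ?thesis by (simp only: cl_expand[symmetric])
qed

lemma cl_mult_one: "cl_mult \<kappa> cl_one a = a" "cl_mult \<kappa> a cl_one = a"
proof -
  have "cl_mult \<kappa> cl_one (\<Sum>S\<in>UNIV. axis S (a $ S)) = (\<Sum>S\<in>UNIV. axis S (a $ S))"
       "cl_mult \<kappa> (\<Sum>S\<in>UNIV. axis S (a $ S)) cl_one = (\<Sum>S\<in>UNIV. axis S (a $ S))"
    by (simp_all add: cl_mult_sum cl_one_def cl_mult_axis cl_sign_def)
  then show "cl_mult \<kappa> cl_one a = a" "cl_mult \<kappa> a cl_one = a" by (simp_all only: cl_expand[symmetric])
qed

lemma cl_vec_anticommute:
  "cl_mult \<kappa> (cl_vec v) (cl_vec w) + cl_mult \<kappa> (cl_vec w) (cl_vec v) = (2 * \<kappa> * (v \<bullet> w)) *\<^sub>R cl_one"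
proof -
  have E: "cl_mult \<kappa> (cl_vec v) (cl_vec w) =
      (\<Sum>i\<in>UNIV. \<Sum>j\<in>UNIV. axis (sym_diff {i} {j}) (cl_sign \<kappa> {i} {j} * v $ i * w $ j))" for v w
    unfolding cl_vec_def by (simp add: cl_mult_sum cl_mult_axis) (rule sum.swap)?
  have "cl_mult \<kappa> (cl_vec w) (cl_vec v) =
      (\<Sum>i\<in>UNIV. \<Sum>j\<in>UNIV. axis (sym_diff {j} {i}) (cl_sign \<kappa> {j} {i} * w $ j * v $ i))"
    unfolding E by (rule sum.swap)
  then have "cl_mult \<kappa> (cl_vec v) (cl_vec w) + cl_mult \<kappa> (cl_vec w) (cl_vec v) =
      (\<Sum>i\<in>UNIV. \<Sum>j\<in>UNIV. axis (sym_diff {i} {j}) (cl_sign \<kappa> {i} {j} * v $ i * w $ j)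
                        + axis (sym_diff {j} {i}) (cl_sign \<kappa> {j} {i} * w $ j * v $ i))"
    by (simp add: E sum.distrib)
  also have "\<dots> = (\<Sum>i\<in>UNIV. \<Sum>j\<in>UNIV. if j = i then (2 * \<kappa> * (v $ i * w $ i)) *\<^sub>R cl_one else 0)"
    by (intro sum.cong refl) (auto simp: cl_sign_def cl_one_def axis_def vec_eq_iff)
  also have "\<dots> = (2 * \<kappa> * (v \<bullet> w)) *\<^sub>R cl_one"
    by (simp add: inner_vec_def sum_distrib_left scaleR_sum_left)
  finally show ?thesis .
qed

definition cl_grade :: "'m::{finite,linorder} cliff \<Rightarrow> 'm cliff" where
  "cl_grade a = (\<chi> S. (- 1) ^ card S * a $ S)"

inductive_set Pin :: "real \<Rightarrow> 'm::{finite,linorder} cliff set" for \<kappa> where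
  one: "cl_one \<in> Pin \<kappa>"
| mult: "t \<in> Pin \<kappa> \<Longrightarrow> norm v = 1 \<Longrightarrow> cl_mult \<kappa> (cl_vec v) t \<in> Pin \<kappa>"

definition Spin :: "real \<Rightarrow> 'm::{finite,linorder} cliff set" where
  "Spin \<kappa> = {t \<in> Pin \<kappa>. cl_grade t = t}"

text \<open>
  The twisted adjoint representation: \<open>p(t) w = \<alpha>(t) w t\<inverse>\<close> with \<open>\<alpha>\<close> the grading automorphism.
  A unit vector acts as the reflection in its orthogonal hyperplane.
\<close>

definition pin_proj :: "real \<Rightarrow> 'm::{finite,linorder} cliff \<Rightarrow> 'm square_matrix" where
  "pin_proj \<kappa> t = (THE A. \<forall>w. cl_mult \<kappa> (cl_grade t) (cl_vec w) = cl_mult \<kappa> (cl_vec (A *v w)) t)"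

definition cl_top :: "'m::{finite,linorder} cliff set \<Rightarrow> 'm cliff topology" where
  "cl_top G = top_of_set G"


section \<open>Pin and spin structures\<close>

record ('p, 'a, 'm::finite) frame_structure =
  total :: "'p topology"
  act :: "'p \<Rightarrow> 'm cliff \<Rightarrow> 'p"
  cov :: "'p \<Rightarrow> ('a, 'm) frame"

text \<open>\<open>G\<close> is \<open>Pin \<kappa>\<close> or \<open>Spin \<kappa>\<close> and \<open>F\<close> the corresponding bundle of orthonormal frames.\<close>

definition lifts_frames ::
  "real \<Rightarrow> 'm::{finite,linorder} cliff set \<Rightarrow> ('a, 'm, 'z) mfd_scheme \<Rightarrow> ('a, 'm) frame topology \<Rightarrow>
     ('p, 'a, 'm) frame_structure \<Rightarrow> bool" where
  "lifts_frames \<kappa> G M F S \<longleftrightarrow>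
     principal_bundle (cl_top G) (cl_mult \<kappa>) cl_one (mtop M) (total S) (fst \<circ> cov S) (act S) \<and>
     two_covering (total S) F (cov S) \<and>
     (\<forall>p \<in> topspace (total S). \<forall>t \<in> G. cov S (act S p t) = frame_mult (cov S p) (pin_proj \<kappa> t))"

definition pin_structure ::
  "real \<Rightarrow> ('a, 'm::{finite,linorder}, 'z) mfd_scheme \<Rightarrow> ('p, 'a, 'm) frame_structure \<Rightarrow> bool" where
  "pin_structure \<kappa> M S \<longleftrightarrow> lifts_frames \<kappa> (Pin \<kappa>) M (frame_bundle M) S"

definition spin_structure ::
  "real \<Rightarrow> ('a, 'm::{finite,linorder}, 'z) mfd_scheme \<Rightarrow> ('a, 'm) frame set \<Rightarrow>
     ('p, 'a, 'm) frame_structure \<Rightarrow> bool" where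
  "spin_structure \<kappa> M u S \<longleftrightarrow> lifts_frames \<kappa> (Spin \<kappa>) M (oriented_frame_bundle M u) S"

definition structure_iso ::
  "'m::finite cliff set \<Rightarrow> ('p, 'a, 'm) frame_structure \<Rightarrow> ('q, 'a, 'm) frame_structure \<Rightarrow> ('p \<Rightarrow> 'q) \<Rightarrow> bool"
where
  "structure_iso G S S' f \<longleftrightarrow> homeomorphic_map (total S) (total S') f \<and>
     (\<forall>p \<in> topspace (total S). cov S' (f p) = cov S p \<and>
        (\<forall>t \<in> G. f (act S p t) = act S' (f p) t))"

definition pin_equivalence ::
  "real \<Rightarrow> ('a, 'm::{finite,linorder}, 'z) mfd_scheme \<Rightarrow>
     ('p, 'a, 'm) frame_structure \<Rightarrow> ('q, 'a, 'm) frame_structure \<Rightarrow> ('p \<Rightarrow> 'q) \<Rightarrow> bool" where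
  "pin_equivalence \<kappa> M S S' f \<longleftrightarrow>
     pin_structure \<kappa> M S \<and> pin_structure \<kappa> M S' \<and> structure_iso (Pin \<kappa>) S S' f"

definition pin_equivalent ::
  "real \<Rightarrow> ('a, 'm::{finite,linorder}, 'z) mfd_scheme \<Rightarrow>
     ('p, 'a, 'm) frame_structure \<Rightarrow> ('q, 'a, 'm) frame_structure \<Rightarrow> bool" where
  "pin_equivalent \<kappa> M S S' \<longleftrightarrow> (\<exists>f. pin_equivalence \<kappa> M S S' f)"

definition spin_equivalence ::
  "real \<Rightarrow> ('a, 'm::{finite,linorder}, 'z) mfd_scheme \<Rightarrow> ('a, 'm) frame set \<Rightarrow>
     ('p, 'a, 'm) frame_structure \<Rightarrow> ('q, 'a, 'm) frame_structure \<Rightarrow> ('p \<Rightarrow> 'q) \<Rightarrow> bool" where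
  "spin_equivalence \<kappa> M u S S' f \<longleftrightarrow>
     spin_structure \<kappa> M u S \<and> spin_structure \<kappa> M u S' \<and> structure_iso (Spin \<kappa>) S S' f"

text \<open>
  Isomorphisms of couples whose first members are relative to \<open>u\<close> and whose second members are
  relative to \<open>u'\<close>.
\<close>

definition couple_iso ::
  "real \<Rightarrow> ('a, 'm::{finite,linorder}, 'z) mfd_scheme \<Rightarrow> ('a, 'm) frame set \<Rightarrow> ('a, 'm) frame set \<Rightarrow>
     ('p, 'a, 'm) frame_structure \<times> ('q, 'a, 'm) frame_structure \<Rightarrow>
     ('r, 'a, 'm) frame_structure \<times> ('s, 'a, 'm) frame_structure \<Rightarrow>
     ('p \<Rightarrow> 'r) \<times> ('q \<Rightarrow> 's) \<Rightarrow> bool" where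
  "couple_iso \<kappa> M u u' \<S> \<T> f \<longleftrightarrow>
     spin_equivalence \<kappa> M u (fst \<S>) (fst \<T>) (fst f) \<and>
     spin_equivalence \<kappa> M u' (snd \<S>) (snd \<T>) (snd f)"

definition sheet_exchange :: "('p, 'a, 'm::finite) frame_structure \<Rightarrow> 'p \<Rightarrow> 'p" where
  "sheet_exchange S p = (THE q. q \<in> topspace (total S) \<and> q \<noteq> p \<and> cov S q = cov S p)"

text \<open>The pull-back \<open>\<phi>\<^sup>*\<xi> = d\<phi>\<inverse> \<circ> \<xi>\<close> along an isometry of \<open>M\<close>; the total space is unchanged.\<close>

definition isometry_pullback ::
  "('a, 'm::finite, 'z) mfd_scheme \<Rightarrow> ('a \<Rightarrow> 'a) \<Rightarrow> ('p, 'a, 'm) frame_structure \<Rightarrow> ('p, 'a, 'm) frame_structure"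
where
  "isometry_pullback M \<phi> S =
     S\<lparr>cov := \<lambda>p. inv_into (orthonormal_frames M) (frame_map M M \<phi>) (cov S p)\<rparr>"

definition orient_restrict ::
  "('a, 'm::finite) frame set \<Rightarrow> ('p, 'a, 'm) frame_structure \<Rightarrow> ('p, 'a, 'm) frame_structure" where
  "orient_restrict u S = S\<lparr>total := subtopology (total S) {p \<in> topspace (total S). cov S p \<in> u}\<rparr>"

text \<open>The class of \<open>(p, t)\<close> under \<open>(p, t) \<sim> (p r, r\<inverse> t)\<close>, \<open>r \<in> Spin\<close>.\<close>

definition ext_class ::
  "real \<Rightarrow> ('p, 'a, 'm::{finite,linorder}) frame_structure \<Rightarrow> 'p \<Rightarrow> 'm cliff \<Rightarrow> ('p \<times> 'm cliff) set" where
  "ext_class \<kappa> S p t =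
     {(q, s). s \<in> Pin \<kappa> \<and> (\<exists>r \<in> Spin \<kappa>. q = act S p r \<and> t = cl_mult \<kappa> r s)}"

definition pin_extension ::
  "real \<Rightarrow> ('p, 'a, 'm::{finite,linorder}) frame_structure \<Rightarrow> (('p \<times> 'm cliff) set, 'a, 'm) frame_structure"
where
  "pin_extension \<kappa> S =
     \<lparr>total = quotient_top (prod_topology (total S) (cl_top (Pin \<kappa>))) (\<lambda>(p, t). ext_class \<kappa> S p t),
      act = \<lambda>C r. (\<lambda>(p, t). (p, cl_mult \<kappa> t r)) ` C,
      cov = \<lambda>C. the_elem ((\<lambda>(p, t). frame_mult (cov S p) (pin_proj \<kappa> t)) ` C)\<rparr>"

text \<open>
  Pull-back of a structure along \<open>\<pi> : N \<rightarrow> M\<close>; the frame bundle of \<open>N\<close> is identified with the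
  pulled-back frame bundle of \<open>M\<close> through \<open>e \<mapsto> (d\<pi>(e), base point of e)\<close>.
\<close>

definition cover_pullback ::
  "('b, 'm::finite, 'w) mfd_scheme \<Rightarrow> ('a, 'm, 'z) mfd_scheme \<Rightarrow> ('b \<Rightarrow> 'a) \<Rightarrow>
     ('p, 'a, 'm) frame_structure \<Rightarrow> ('b \<times> 'p, 'b, 'm) frame_structure" where
  "cover_pullback N M \<pi> S =
     \<lparr>total = subtopology (prod_topology (mtop N) (total S))
                {(y, q). y \<in> topspace (mtop N) \<and> q \<in> topspace (total S) \<and> \<pi> y = fst (cov S q)},
      act = \<lambda>(y, q) t. (y, act S q t),
      cov = \<lambda>(y, q). inv_into (orthonormal_frames N) (\<lambda>e. (frame_map N M \<pi> e, fst e)) (cov S q, y)\<rparr>"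

text \<open>The quotient, over \<open>M\<close>, of a structure on \<open>N\<close> by an involution \<open>D\<close> of its total space.\<close>

definition quotient_structure ::
  "('b, 'm::finite, 'w) mfd_scheme \<Rightarrow> ('a, 'm, 'z) mfd_scheme \<Rightarrow> ('b \<Rightarrow> 'a) \<Rightarrow> ('p \<Rightarrow> 'p) \<Rightarrow>
     ('p, 'b, 'm) frame_structure \<Rightarrow> ('p set, 'a, 'm) frame_structure" where
  "quotient_structure N M \<pi> D S =
     \<lparr>total = quotient_top (total S) (\<lambda>p. {p, D p}),
      act = \<lambda>C t. (\<lambda>p. act S p t) ` C,
      cov = \<lambda>C. the_elem ((\<lambda>p. frame_map N M \<pi> (cov S p)) ` C)\<rparr>"


section \<open>Pinors and spinors\<close>

text \<open>
  A complex representation of the Clifford algebra by matrices indexed by \<open>'k\<close>.  For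
  \<open>CARD('m) = 2n\<close> and \<open>CARD('k) = 2\<^sup>n\<close> this is the standard Clifford module, which is unique up to
  isomorphism.
\<close>

definition clifford_module ::
  "real \<Rightarrow> ('m::{finite,linorder} cliff \<Rightarrow> complex^'k::finite^'k) \<Rightarrow> bool" where
  "clifford_module \<kappa> \<rho> \<longleftrightarrow> linear \<rho> \<and> \<rho> cl_one = mat 1 \<and>
     (\<forall>a b. \<rho> (cl_mult \<kappa> a b) = \<rho> a ** \<rho> b)"

text \<open>
  The chirality operator \<open>\<i>\<^sup>n e\<^sub>1\<cdots>e\<^sub>2\<^sub>n\<close>, where \<open>2n = CARD('m)\<close>, its eigenspaces for
  \<open>\<epsilon> = \<plusminus>1\<close>, and the projections onto them.
\<close>

definition chirality ::
  "('m::{finite,linorder} cliff \<Rightarrow> complex^'k::finite^'k) \<Rightarrow> complex^'k \<Rightarrow> complex^'k" where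
  "chirality \<rho> z = (\<i> ^ (CARD('m) div 2)) *s (\<rho> (axis UNIV 1) *v z)"

definition chiral_space ::
  "('m::{finite,linorder} cliff \<Rightarrow> complex^'k::finite^'k) \<Rightarrow> real \<Rightarrow> (complex^'k) set" where
  "chiral_space \<rho> \<epsilon> = {z. chirality \<rho> z = \<epsilon> *\<^sub>R z}"

definition chiral_proj ::
  "('m::{finite,linorder} cliff \<Rightarrow> complex^'k::finite^'k) \<Rightarrow> real \<Rightarrow> complex^'k \<Rightarrow> complex^'k" where
  "chiral_proj \<rho> \<epsilon> z = (1/2) *\<^sub>R (z + \<epsilon> *\<^sub>R chirality \<rho> z)"

type_synonym ('p, 'k) spinor = "('p \<times> (complex^'k)) set"

text \<open>The element \<open>[p, z]\<close> of the associated bundle: the class under \<open>(p, z) \<sim> (p t, \<rho>(t)\<inverse> z)\<close>, \<open>t \<in> G\<close>.\<close>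

definition assoc_class ::
  "'m::{finite,linorder} cliff set \<Rightarrow> ('m cliff \<Rightarrow> complex^'k::finite^'k) \<Rightarrow>
     ('p, 'a, 'm) frame_structure \<Rightarrow> 'p \<Rightarrow> complex^'k \<Rightarrow> ('p, 'k) spinor" where
  "assoc_class G \<rho> S p z = {(q, w). \<exists>t \<in> G. q = act S p t \<and> \<rho> t *v w = z}"

definition assoc_fibre ::
  "'m::{finite,linorder} cliff set \<Rightarrow> ('m cliff \<Rightarrow> complex^'k::finite^'k) \<Rightarrow>
     ('p, 'a, 'm) frame_structure \<Rightarrow> (complex^'k) set \<Rightarrow> 'a \<Rightarrow> ('p, 'k) spinor set" where
  "assoc_fibre G \<rho> S V x =
     {assoc_class G \<rho> S p z | p z. p \<in> topspace (total S) \<and> fst (cov S p) = x \<and> z \<in> V}"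

text \<open>
  Smooth local sections of the principal bundle are the continuous ones that cover smooth frame
  fields.
\<close>

definition smooth_local_section ::
  "('a, 'm::finite, 'z) mfd_scheme \<Rightarrow> ('p, 'a, 'm) frame_structure \<Rightarrow> 'a set \<Rightarrow> ('a \<Rightarrow> 'p) \<Rightarrow> bool" where
  "smooth_local_section M S U \<sigma> \<longleftrightarrow>
     openin (mtop M) U \<and> continuous_map (subtopology (mtop M) U) (total S) \<sigma> \<and>
     (\<forall>x \<in> U. fst (cov S (\<sigma> x)) = x) \<and>
     (\<forall>c \<in> atlas M. smooth_fun_on M (U \<inter> fst c) (\<lambda>x. frame_matrix c (cov S (\<sigma> x))))"

text \<open>Smooth sections of the associated bundle with values in the subspace \<open>V\<close> of the typical fibre.\<close>

definition spinor_sections ::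
  "('a, 'm::{finite,linorder}, 'z) mfd_scheme \<Rightarrow> 'm cliff set \<Rightarrow> ('m cliff \<Rightarrow> complex^'k::finite^'k) \<Rightarrow>
     ('p, 'a, 'm) frame_structure \<Rightarrow> (complex^'k) set \<Rightarrow> ('a \<Rightarrow> ('p, 'k) spinor) set" where
  "spinor_sections M G \<rho> S V =
     {s \<in> extensional (topspace (mtop M)).
        (\<forall>x \<in> topspace (mtop M). s x \<in> assoc_fibre G \<rho> S V x) \<and>
        (\<forall>U \<sigma>. smooth_local_section M S U \<sigma> \<longrightarrow>
           smooth_fun_on M U (\<lambda>x. THE z. (\<sigma> x, z) \<in> s x))}"

definition pinors ::
  "real \<Rightarrow> ('a, 'm::{finite,linorder}, 'z) mfd_scheme \<Rightarrow> ('m cliff \<Rightarrow> complex^'k::finite^'k) \<Rightarrow>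
     ('p, 'a, 'm) frame_structure \<Rightarrow> ('a \<Rightarrow> ('p, 'k) spinor) set" where
  "pinors \<kappa> M \<rho> S = spinor_sections M (Pin \<kappa>) \<rho> S UNIV"

definition chiral_spinors ::
  "real \<Rightarrow> ('a, 'm::{finite,linorder}, 'z) mfd_scheme \<Rightarrow> ('m cliff \<Rightarrow> complex^'k::finite^'k) \<Rightarrow>
     ('p, 'a, 'm) frame_structure \<Rightarrow> real \<Rightarrow> ('a \<Rightarrow> ('p, 'k) spinor) set" where
  "chiral_spinors \<kappa> M \<rho> S \<epsilon> = spinor_sections M (Spin \<kappa>) \<rho> S (chiral_space \<rho> \<epsilon>)"

text \<open>The bundle map \<open>[p, z] \<mapsto> [D p, z]\<close> induced by a map \<open>D\<close> of principal bundles, and its inverse.\<close>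

definition bundle_map :: "('p \<Rightarrow> 'q) \<Rightarrow> ('p, 'k::finite) spinor \<Rightarrow> ('q, 'k) spinor" where
  "bundle_map D C = (\<lambda>(p, z). (D p, z)) ` C"

definition bundle_map_inv ::
  "('p, 'a, 'm::finite) frame_structure \<Rightarrow> ('p \<Rightarrow> 'q) \<Rightarrow> ('q, 'k::finite) spinor \<Rightarrow> ('p, 'k) spinor" where
  "bundle_map_inv S D C = {(p, z). p \<in> topspace (total S) \<and> (D p, z) \<in> C}"

definition scale_spinor :: "real \<Rightarrow> ('p, 'k::finite) spinor \<Rightarrow> ('p, 'k) spinor" where
  "scale_spinor a C = (\<lambda>(p, z). (p, a *\<^sub>R z)) ` C"

definition chiral_part ::
  "('m::{finite,linorder} cliff \<Rightarrow> complex^'k::finite^'k) \<Rightarrow> real \<Rightarrow> ('p, 'k) spinor \<Rightarrow> ('p, 'k) spinor" where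
  "chiral_part \<rho> \<epsilon> C = (\<lambda>(p, z). (p, chiral_proj \<rho> \<epsilon> z)) ` C"

definition eta ::
  "('a, 'm::finite, 'z) mfd_scheme \<Rightarrow> ('a \<Rightarrow> 'a) \<Rightarrow> ('a \<Rightarrow> 's) \<Rightarrow> 'a \<Rightarrow> 's" where
  "eta M \<tau> s = restrict (\<lambda>x. s (\<tau> x)) (topspace (mtop M))"

text \<open>
  For a pin structure \<open>S\<close> the spinor bundle of \<open>orient_restrict u S\<close> is canonically isomorphic to the
  pinor bundle of \<open>S\<close>: a pinor is restricted to the part of the total space over the frames in \<open>u\<close>
  (\<open>restrict_pinor\<close>), and conversely the class of a spinor generates the class of a pinor
  (\<open>as_pinor\<close>).
\<close>

definition restrict_pinor ::
  "('a, 'm::finite) frame set \<Rightarrow> ('p, 'a, 'm) frame_structure \<Rightarrow> ('p, 'k::finite) spinor \<Rightarrow> ('p, 'k) spinor" where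
  "restrict_pinor u S C = C \<inter> topspace (total (orient_restrict u S)) \<times> UNIV"

definition as_pinor ::
  "real \<Rightarrow> ('m::{finite,linorder} cliff \<Rightarrow> complex^'k::finite^'k) \<Rightarrow>
     ('p, 'a, 'm) frame_structure \<Rightarrow> ('p, 'k) spinor \<Rightarrow> ('p, 'k) spinor" where
  "as_pinor \<kappa> \<rho> S C = (\<Union>(p, z) \<in> C. assoc_class (Pin \<kappa>) \<rho> S p z)"

definition invariant_pinors ::
  "real \<Rightarrow> ('a, 'm::{finite,linorder}, 'z) mfd_scheme \<Rightarrow> ('m cliff \<Rightarrow> complex^'k::finite^'k) \<Rightarrow> ('a \<Rightarrow> 'a) \<Rightarrow>
     ('p, 'a, 'm) frame_structure \<Rightarrow> ('p \<Rightarrow> 'p) \<Rightarrow> ('a \<Rightarrow> ('p, 'k) spinor) set" where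
  "invariant_pinors \<kappa> M \<rho> \<tau> S D =
     {s \<in> pinors \<kappa> M \<rho> S. \<forall>x \<in> topspace (mtop M). s x = bundle_map D (eta M \<tau> s x)}"

text \<open>
  Sections of the positive spinors of \<open>\<xi>\<^sub>u\<close> plus the negative spinors of \<open>\<tau>\<^sup>*\<xi>\<^sub>u\<^sub>'\<close>.
\<close>

definition spinor_couples ::
  "real \<Rightarrow> ('a, 'm::{finite,linorder}, 'z) mfd_scheme \<Rightarrow> ('m cliff \<Rightarrow> complex^'k::finite^'k) \<Rightarrow> ('a \<Rightarrow> 'a) \<Rightarrow>
     ('p, 'a, 'm) frame_structure \<Rightarrow> ('a, 'm) frame set \<Rightarrow> ('a, 'm) frame set \<Rightarrow>
     (('a \<Rightarrow> ('p, 'k) spinor) \<times> ('a \<Rightarrow> ('p, 'k) spinor)) set" where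
  "spinor_couples \<kappa> M \<rho> \<tau> S u u' =
     chiral_spinors \<kappa> M \<rho> (orient_restrict u S) 1 \<times>
     chiral_spinors \<kappa> M \<rho> (isometry_pullback M \<tau> (orient_restrict u' S)) (- 1)"

text \<open>
  The components of the pair \<open>(s, s)\<close> in \<open>(\<xi>\<^sub>u, \<tau>\<^sup>*\<xi>\<^sub>u\<^sub>')\<close>.  The second \<open>s\<close> is regarded as a section
  for \<open>\<tau>\<^sup>*\<xi>\<close> through the equivalence \<open>E\<close> of \<open>\<xi>\<close> with \<open>\<tau>\<^sup>*\<xi>\<close>.
\<close>

definition couple_of_pinor ::
  "('a, 'm::{finite,linorder}, 'z) mfd_scheme \<Rightarrow> ('m cliff \<Rightarrow> complex^'k::finite^'k) \<Rightarrow>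
     ('p, 'a, 'm) frame_structure \<Rightarrow> ('a, 'm) frame set \<Rightarrow> ('a, 'm) frame set \<Rightarrow> ('p \<Rightarrow> 'p) \<Rightarrow>
     ('a \<Rightarrow> ('p, 'k) spinor) \<Rightarrow> ('a \<Rightarrow> ('p, 'k) spinor) \<times> ('a \<Rightarrow> ('p, 'k) spinor)" where
  "couple_of_pinor M \<rho> S u u' E s =
     (restrict (\<lambda>x. chiral_part \<rho> 1 (restrict_pinor u S (s x))) (topspace (mtop M)),
      restrict (\<lambda>x. chiral_part \<rho> (- 1) (restrict_pinor u' S (bundle_map_inv S E (s x))))
        (topspace (mtop M)))"

text \<open>
  The relation \<open>s\<^sup>- = \<epsilon> (D \<circ> \<eta>\<^sub>\<tau>)(s\<^sup>+)\<close>, where the spinors of \<open>\<tau>\<^sup>*\<xi>\<^sub>u\<^sub>'\<close> are identified with those of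
  \<open>\<xi>\<^sub>u\<close> through \<open>E\<close>.  Both sides are compared in the pinor bundle, which contains the spinor
  bundles of \<open>\<xi>\<^sub>u\<close> and \<open>\<xi>\<^sub>u\<^sub>'\<close>.
\<close>

definition couple_relation ::
  "real \<Rightarrow> ('a, 'm::{finite,linorder}, 'z) mfd_scheme \<Rightarrow> ('m cliff \<Rightarrow> complex^'k::finite^'k) \<Rightarrow> ('a \<Rightarrow> 'a) \<Rightarrow>
     ('p, 'a, 'm) frame_structure \<Rightarrow> ('p \<Rightarrow> 'p) \<Rightarrow> real \<Rightarrow> ('p \<Rightarrow> 'p) \<Rightarrow>
     ('a \<Rightarrow> ('p, 'k) spinor) \<times> ('a \<Rightarrow> ('p, 'k) spinor) \<Rightarrow> bool" where
  "couple_relation \<kappa> M \<rho> \<tau> S E \<epsilon> D c \<longleftrightarrow>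
     (\<forall>x \<in> topspace (mtop M).
        as_pinor \<kappa> \<rho> S (bundle_map E (snd c x)) =
        scale_spinor \<epsilon> (bundle_map D (as_pinor \<kappa> \<rho> S (eta M \<tau> (fst c) x))))"

definition invariant_couples ::
  "real \<Rightarrow> ('a, 'm::{finite,linorder}, 'z) mfd_scheme \<Rightarrow> ('m cliff \<Rightarrow> complex^'k::finite^'k) \<Rightarrow> ('a \<Rightarrow> 'a) \<Rightarrow>
     ('p, 'a, 'm) frame_structure \<Rightarrow> ('a, 'm) frame set \<Rightarrow> ('a, 'm) frame set \<Rightarrow>
     ('p \<Rightarrow> 'p) \<Rightarrow> real \<Rightarrow> ('p \<Rightarrow> 'p) \<Rightarrow>
     (('a \<Rightarrow> ('p, 'k) spinor) \<times> ('a \<Rightarrow> ('p, 'k) spinor)) set" where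
  "invariant_couples \<kappa> M \<rho> \<tau> S u u' E \<epsilon> D =
     {c \<in> spinor_couples \<kappa> M \<rho> \<tau> S u u'. couple_relation \<kappa> M \<rho> \<tau> S E \<epsilon> D c}"

text \<open>
  Inside the pinor bundle the negative spinors of \<open>\<xi>\<^sub>u\<close> are the positive spinors of \<open>\<xi>\<^sub>u\<^sub>'\<close> and vice
  versa.  Hence, up to the identification \<open>E\<close>, exchanging the two members of a couple turns couples
  for \<open>(\<xi>\<^sub>u, \<tau>\<^sup>*\<xi>\<^sub>u\<^sub>')\<close> into couples for \<open>(\<xi>\<^sub>u\<^sub>', \<tau>\<^sup>*\<xi>\<^sub>u)\<close>.
\<close>

definition change_orientation ::
  "real \<Rightarrow> ('a, 'm::{finite,linorder}, 'z) mfd_scheme \<Rightarrow> ('m cliff \<Rightarrow> complex^'k::finite^'k) \<Rightarrow>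
     ('p, 'a, 'm) frame_structure \<Rightarrow> ('a, 'm) frame set \<Rightarrow> ('p \<Rightarrow> 'p) \<Rightarrow>
     ('a \<Rightarrow> ('p, 'k) spinor) \<times> ('a \<Rightarrow> ('p, 'k) spinor) \<Rightarrow>
     ('a \<Rightarrow> ('p, 'k) spinor) \<times> ('a \<Rightarrow> ('p, 'k) spinor)" where
  "change_orientation \<kappa> M \<rho> S u' E c =
     (restrict (\<lambda>x. restrict_pinor u' S (as_pinor \<kappa> \<rho> S (bundle_map E (snd c x)))) (topspace (mtop M)),
      restrict (\<lambda>x. bundle_map_inv S E (restrict_pinor u' S (as_pinor \<kappa> \<rho> S (fst c x))))
        (topspace (mtop M)))"

end

theory Submission
  imports Defs
begin

text \<open>
  Since \<open>d\<tau>\<close> reverses orientation, a lift of \<open>d\<tau>\<close> to \<open>\<xi>\<close> maps the part of \<open>\<xi>\<close> over the frames in \<open>u\<close> to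
  the part over those in \<open>u'\<close>, which is (1).  The converse glues \<open>D\<^sub>1\<close> and \<open>D\<^sub>2\<close>: the extension of \<open>D\<^sub>1\<close> by
  Pin-equivariance and the map \<open>D\<^sub>2\<close> lift the same map of frames of \<open>u'\<close>.  Two lifts through a double
  covering agree on an open and closed set, and if they are equivariant this set is the preimage of an open and
  closed set in the connected base; so one point of agreement suffices.  An involutive lift commutes with
  Pin and acts freely over \<open>\<tau>\<close>, so that its quotient is a pin structure on \<open>X\<close>.  The same agreement principle,
  applied to \<open>h\<close> and \<open>h \<circ> D\<close> for a map \<open>h\<close> from \<open>\<xi>\<close> to \<open>\<zeta>\<close> over \<open>\<pi>\<close>, shows that exactly one of the quotients by
  \<open>D\<close> and by \<open>D \<circ> \<gamma>\<close> is \<open>\<zeta>\<close>: either \<open>h \<circ> D = h\<close> or \<open>h \<circ> D = h \<circ> \<gamma>\<close> everywhere.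

  Pinors are equivariant functions \<open>\<psi>\<close> on the total space of \<open>\<xi>\<close>, and a couple for \<open>(\<xi>\<^sub>u, \<tau>\<^sup>*\<xi>\<^sub>u\<^sub>')\<close> is a pair of
  such functions \<open>a\<close>, \<open>b\<close> whose values over \<open>u\<close> are chiral of signs \<open>1\<close> and \<open>- 1\<close>.  Elements of Pin outside Spin
  reverse chirality, so over \<open>u'\<close> the signs are exchanged.  The couple of \<open>\<psi>\<close> is the decomposition
  \<open>\<psi> = a + b\<close>, the relation of a couple reads \<open>b = \<epsilon> (a \<circ> D)\<close>, which is equivalent to \<open>\<psi> \<circ> D = \<epsilon> \<psi>\<close>, and the
  change of orientation is \<open>(a, b) \<mapsto> (b, a)\<close>.
\<close>

section \<open>Coverings and principal bundles\<close>

text \<open>The obstacle in (2) is a sign. That \<open>D\<^sub>1\<close> and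
  \<open>D\<^sub>2\<close> are inverse to each other does not relate \<open>D\<^sub>2\<close> to the
  Pin-equivariant extension of \<open>D\<^sub>1\<close> over \<open>u'\<close>. Both lift the same
  map of frames, so they differ by a global sign, and with the sign -1 the extension squares to the
  sheet exchange instead of the identity. Hence the condition at one odd element of Pin. Double
  coverings are handled through five pointwise properties: continuity, openness, two-point fibres,
  local injectivity and separation of the points of a fibre. Unlike families of sheets, these pass
  directly to restrictions and along homeomorphisms. The sheet exchange is right multiplication by
  -1, which fixes frames and acts freely; equivariant maps therefore commute with it, and uniqueness
  up to sign becomes algebra. Smoothness of pinors is tested along local sections that cover smooth
  frame fields. Right multiplication by a fixed element of Pin changes the frame matrix by a
  constant factor, and the two orientations cut the domain of a section into two open pieces, so
  only linear maps, sums and gluing have to preserve smoothness.\<close>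

lemma two_covering_props:
  assumes "two_covering E B p"
  shows "continuous_map E B p" and "open_map E B p"
    and "x \<in> topspace B \<Longrightarrow> card {e \<in> topspace E. p e = x} = 2"
    and "a \<in> topspace E \<Longrightarrow> \<exists>V. openin E V \<and> a \<in> V \<and> inj_on p V"
    and "a \<in> topspace E \<Longrightarrow> b \<in> topspace E \<Longrightarrow> a \<noteq> b \<Longrightarrow> p a = p b \<Longrightarrow>
      \<exists>V W. openin E V \<and> openin E W \<and> a \<in> V \<and> b \<in> W \<and> disjnt V W"
proof -
  show c: "continuous_map E B p" using assms by (simp add: two_covering_def)
  define Q where "Q a U \<V> \<longleftrightarrow> openin B U \<and> p a \<in> U \<and> \<Union>\<V> = {e \<in> topspace E. p e \<in> U} \<and> pairwise disjnt \<V> \<and>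
        (\<forall>V \<in> \<V>. openin E V \<and> inj_on p V \<and> open_map (subtopology E V) (subtopology B U) p)" for a U \<V>
  have sheet: "\<exists>U \<V>. Q a U \<V>"
    if "a \<in> topspace E" for a
  proof -
    have "p a \<in> topspace B" using c that by (auto simp: continuous_map_def)
    then obtain U \<V> where U: "openin B U" "p a \<in> U" "\<Union>\<V> = {e \<in> topspace E. p e \<in> U}" "pairwise disjnt \<V>"
      and h: "\<forall>V \<in> \<V>. openin E V \<and> homeomorphic_map (subtopology E V) (subtopology B U) p"
      using assms \<open>p a \<in> topspace B\<close> unfolding two_covering_def by meson
    have "openin E V \<and> inj_on p V \<and> open_map (subtopology E V) (subtopology B U) p" if "V \<in> \<V>" for V
    proof -
      have V: "openin E V" "homeomorphic_map (subtopology E V) (subtopology B U) p" using h that by auto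
      have "topspace (subtopology E V) = V" using openin_subset[OF V(1)] by auto
      then show ?thesis
        using V homeomorphic_imp_open_map[OF V(2)] homeomorphic_imp_injective_map[OF V(2)] by simp
    qed
    then have "Q a U \<V>" using U unfolding Q_def by simp
    then show ?thesis by blast
  qed
  show "x \<in> topspace B \<Longrightarrow> card {e \<in> topspace E. p e = x} = 2" using assms by (simp add: two_covering_def)
  show "\<exists>V. openin E V \<and> a \<in> V \<and> inj_on p V" if a: "a \<in> topspace E"
  proof -
    obtain U \<V> where "Q a U \<V>" using sheet[OF a] by blast
    then have "a \<in> \<Union>\<V>" "\<forall>V \<in> \<V>. openin E V \<and> inj_on p V" using a unfolding Q_def by auto
    then show ?thesis by blast
  qed
  show "\<exists>V W. openin E V \<and> openin E W \<and> a \<in> V \<and> b \<in> W \<and> disjnt V W"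
    if ab: "a \<in> topspace E" "b \<in> topspace E" "a \<noteq> b" "p a = p b"
  proof -
    obtain U \<V> where "Q a U \<V>" using sheet[OF ab(1)] by blast
    then have *: "p a \<in> U" "\<Union>\<V> = {e \<in> topspace E. p e \<in> U}" "pairwise disjnt \<V>"
       "\<forall>V \<in> \<V>. openin E V \<and> inj_on p V" unfolding Q_def by auto
    have "a \<in> \<Union>\<V>" "b \<in> \<Union>\<V>" using *(1,2) that by auto
    then obtain V W where VW: "V \<in> \<V>" "W \<in> \<V>" "a \<in> V" "b \<in> W" by (elim UnionE)
    then have "V \<noteq> W" using * that by (auto dest: inj_onD)
    then show ?thesis using VW * by (meson pairwiseD)
  qed
  show "open_map E B p"
    unfolding open_map_def
  proof (intro allI impI)
    fix W assume W: "openin E W"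
    show "openin B (p ` W)"
      unfolding openin_subopen[of B "p ` W"]
    proof
      fix y assume "y \<in> p ` W"
      then obtain a where a: "a \<in> W" "y = p a" by blast
      then have at: "a \<in> topspace E" using openin_subset[OF W] by blast
      obtain U \<V> where "Q a U \<V>" using sheet[OF at] by blast
      then have *: "openin B U" "a \<in> \<Union>\<V>"
         "\<forall>V \<in> \<V>. openin E V \<and> open_map (subtopology E V) (subtopology B U) p" 
        using at unfolding Q_def by auto
      then obtain V where V: "V \<in> \<V>" "a \<in> V" by blast
      have "openin (subtopology E V) (V \<inter> W)" by (simp add: W openin_subtopology_Int2)
      then have "openin (subtopology B U) (p ` (V \<inter> W))" using * V by (simp add: open_map_def)
      then have "openin B (p ` (V \<inter> W))" using *(1) openin_trans_full by blast
      then show "\<exists>T. openin B T \<and> y \<in> T \<and> T \<subseteq> p ` W" using a V by blast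
    qed
  qed
qed

text \<open>Converse of \<open>two_covering_props\<close>. Disjoint neighbourhoods of the two points
  over \<open>x\<close>, on each of which \<open>p\<close> is injective, are shrunk to the preimage
  of the intersection of their images. As fibres have only two points, these two sheets exhaust
  everything over that intersection.\<close>

lemma two_coveringI:
  assumes c: "continuous_map E B p" and o: "open_map E B p"
    and card: "\<And>x. x \<in> topspace B \<Longrightarrow> card {e \<in> topspace E. p e = x} = 2"
    and inj: "\<And>a. a \<in> topspace E \<Longrightarrow> \<exists>V. openin E V \<and> a \<in> V \<and> inj_on p V"
    and sep: "\<And>a b. a \<in> topspace E \<Longrightarrow> b \<in> topspace E \<Longrightarrow> a \<noteq> b \<Longrightarrow> p a = p b \<Longrightarrow>
      \<exists>V W. openin E V \<and> openin E W \<and> a \<in> V \<and> b \<in> W \<and> disjnt V W"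
  shows "two_covering E B p"
  unfolding two_covering_def
proof (intro conjI ballI c card)
  fix x assume x: "x \<in> topspace B"
  obtain a b where ab: "{e \<in> topspace E. p e = x} = {a, b}" "a \<noteq> b"
    using card[OF x] by (meson card_2_iff)
  then have a: "a \<in> topspace E" "p a = x" and b: "b \<in> topspace E" "p b = x" by blast+
  obtain V1 where V1: "openin E V1" "a \<in> V1" "inj_on p V1" using inj a by blast
  obtain W1 where W1: "openin E W1" "b \<in> W1" "inj_on p W1" using inj b by blast
  obtain V2 W2 where 2: "openin E V2" "openin E W2" "a \<in> V2" "b \<in> W2" "disjnt V2 W2"
    using sep[of a b] a b ab by metis
  define V where "V = V1 \<inter> V2" define W where "W = W1 \<inter> W2"
  have V: "openin E V" "a \<in> V" "inj_on p V" and W: "openin E W" "b \<in> W" "inj_on p W" and d: "disjnt V W"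
    using V1 W1 2 by (auto simp: V_def W_def disjnt_def inj_on_def)
  define U where "U = p ` V \<inter> p ` W"
  have U: "openin B U" using o V W by (simp add: U_def open_map_def openin_Int)
  define V' where "V' = V \<inter> {e \<in> topspace E. p e \<in> U}"
  define W' where "W' = W \<inter> {e \<in> topspace E. p e \<in> U}"
  have pre: "openin E {e \<in> topspace E. p e \<in> U}" using c U openin_continuous_map_preimage by blast
  have hom: "homeomorphic_map (subtopology E V') (subtopology B U) p"
    if "openin E V'" "inj_on p V'" "p ` V' = U" for V'
  proof (rule bijective_open_imp_homeomorphic_map)
    have sub: "V' \<subseteq> topspace E" "U \<subseteq> topspace B" using that openin_subset U by auto
    show "continuous_map (subtopology E V') (subtopology B U) p"
      using c that sub by (auto simp: continuous_map_in_subtopology continuous_map_from_subtopology)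
    show "open_map (subtopology E V') (subtopology B U) p"
    proof (rule open_map_into_subtopology[OF open_map_from_subtopology[OF o that(1)]])
      show "p \<in> topspace (subtopology E V') \<rightarrow> U" using that sub by auto
    qed
    show "p ` topspace (subtopology E V') = topspace (subtopology B U)" using sub that by auto
    show "inj_on p (topspace (subtopology E V'))" using sub that by (auto simp: inj_on_def)
  qed
  have VE: "V \<subseteq> topspace E" "W \<subseteq> topspace E" using V W openin_subset by auto
  have imU: "p ` (S \<inter> {e \<in> topspace E. p e \<in> U}) = U" if "S \<subseteq> topspace E" "U \<subseteq> p ` S" for S
    using that by (force simp: image_iff)
  have V': "openin E V'" "inj_on p V'" "p ` V' = U"
    using openin_Int[OF V(1) pre] inj_on_subset[OF V(3), of V'] imU[OF VE(1)] by (auto simp: V'_def U_def)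
  have W': "openin E W'" "inj_on p W'" "p ` W' = U"
    using openin_Int[OF W(1) pre] inj_on_subset[OF W(3), of W'] imU[OF VE(2)] by (auto simp: W'_def U_def)
  \<comment> \<open>Every fibre over \<open>U\<close> meets \<open>V\<close> and \<open>W\<close> in
    two distinct points, so a further point \<open>e\<close> of the fibre must coincide with one of
    them.\<close>
  have "{e \<in> topspace E. p e \<in> U} \<subseteq> V' \<union> W'"
  proof
    fix e assume e: "e \<in> {e \<in> topspace E. p e \<in> U}"
    then have "p e \<in> p ` V" "p e \<in> p ` W" by (auto simp: U_def)
    then obtain v w where vw: "v \<in> V" "w \<in> W" "p v = p e" "p w = p e" by (metis imageE)
    have "v \<noteq> w" using vw d by (auto simp: disjnt_def)
    have xx: "p e \<in> topspace B" using e openin_subset[OF U] by auto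
    obtain e1 e2 where "{z \<in> topspace E. p z = p e} = {e1, e2}" using card[OF xx] by (meson card_2_iff)
    moreover have "v \<in> {z \<in> topspace E. p z = p e}" "w \<in> {z \<in> topspace E. p z = p e}" "e \<in> {z \<in> topspace E. p z = p e}"
      using vw VE e by auto
    ultimately have "e = v \<or> e = w" using \<open>v \<noteq> w\<close> by auto
    then show "e \<in> V' \<union> W'" using vw e by (auto simp: V'_def W'_def)
  qed
  then have "\<Union>{V', W'} = {e \<in> topspace E. p e \<in> U}" by (auto simp: V'_def W'_def)
  moreover have "pairwise disjnt {V', W'}" using d by (auto simp: pairwise_def V'_def W'_def disjnt_def)
  moreover have "\<forall>S\<in>{V', W'}. openin E S \<and> homeomorphic_map (subtopology E S) (subtopology B U) p"
    using V' W' hom by blast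
  moreover have "x \<in> U" using a b V(2) W(2) by (auto simp: U_def image_iff intro: bexI[of _ a] bexI[of _ b])
  ultimately show "\<exists>U. openin B U \<and> x \<in> U \<and>
      (\<exists>\<V>. \<Union>\<V> = {e \<in> topspace E. p e \<in> U} \<and> pairwise disjnt \<V> \<and>
        (\<forall>V\<in>\<V>. openin E V \<and> homeomorphic_map (subtopology E V) (subtopology B U) p))"
    by (intro exI[of _ U] conjI U exI[of _ "{V', W'}"])
qed

lemma two_covering_restrict:
  assumes p: "two_covering E B p" and S: "openin B S"
  shows "two_covering (subtopology E {e \<in> topspace E. p e \<in> S}) (subtopology B S) p"
proof (rule two_coveringI)
  let ?E = "subtopology E {e \<in> topspace E. p e \<in> S}"
  note P = two_covering_props[OF p]
  have oE: "openin E {e \<in> topspace E. p e \<in> S}" using P(1) S openin_continuous_map_preimage by blast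
  have SB: "S \<subseteq> topspace B" using openin_subset[OF S] by blast
  show "continuous_map ?E (subtopology B S) p"
    using P(1) by (auto simp: continuous_map_in_subtopology continuous_map_from_subtopology)
  show "open_map ?E (subtopology B S) p"
    using P(2) by (rule open_map_restriction) simp
  show "card {e \<in> topspace ?E. p e = x} = 2" if "x \<in> topspace (subtopology B S)" for x
  proof -
    have "{e \<in> topspace ?E. p e = x} = {e \<in> topspace E. p e = x}" using that by auto
    then show ?thesis using P(3)[of x] that by simp
  qed
  show "\<exists>V. openin ?E V \<and> a \<in> V \<and> inj_on p V" if "a \<in> topspace ?E" for a
  proof -
    obtain V where V: "openin E V" "a \<in> V" "inj_on p V" using P(4)[of a] \<open>a \<in> topspace ?E\<close> by auto
    have "openin ?E (V \<inter> {e \<in> topspace E. p e \<in> S})" using V(1) by (simp add: openin_subtopology_Int)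
    then show ?thesis using V that by (intro exI[of _ "V \<inter> {e \<in> topspace E. p e \<in> S}"]) (auto simp: inj_on_def)
  qed
  show "\<exists>V W. openin ?E V \<and> openin ?E W \<and> a \<in> V \<and> b \<in> W \<and> disjnt V W"
    if ab: "a \<in> topspace ?E" "b \<in> topspace ?E" "a \<noteq> b" "p a = p b" for a b
  proof -
    obtain V W where V: "openin E V" "openin E W" "a \<in> V" "b \<in> W" "disjnt V W"
      using P(5)[of a b] ab by auto
    have "openin ?E (V \<inter> {e \<in> topspace E. p e \<in> S})" "openin ?E (W \<inter> {e \<in> topspace E. p e \<in> S})"
      using V by (simp_all add: openin_subtopology_Int)
    then show ?thesis using V that
      by (intro exI[of _ "V \<inter> {e \<in> topspace E. p e \<in> S}"] exI[of _ "W \<inter> {e \<in> topspace E. p e \<in> S}"])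
         (auto simp: disjnt_def)
  qed
qed

lemma continuous_map_local:
  assumes "\<And>x. x \<in> topspace X \<Longrightarrow> \<exists>U. openin X U \<and> x \<in> U \<and> continuous_map (subtopology X U) Y f"
  shows "continuous_map X Y f"
  unfolding continuous_map
proof (intro conjI allI impI)
  show "f ` topspace X \<subseteq> topspace Y"
  proof (clarify)
    fix x assume x: "x \<in> topspace X"
    then obtain U where "openin X U" "x \<in> U" "continuous_map (subtopology X U) Y f" using assms by blast
    then show "f x \<in> topspace Y" using x by (auto simp: continuous_map_def)
  qed
  fix W assume W: "openin Y W"
  show "openin X {x \<in> topspace X. f x \<in> W}"
    unfolding openin_subopen[of X "{x \<in> topspace X. f x \<in> W}"]
  proof
    fix x assume x: "x \<in> {x \<in> topspace X. f x \<in> W}"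
    then obtain U where U: "openin X U" "x \<in> U" "continuous_map (subtopology X U) Y f" using assms by blast
    then have "openin (subtopology X U) {x \<in> topspace (subtopology X U). f x \<in> W}"
      using W openin_continuous_map_preimage by blast
    then have "openin X {x \<in> topspace (subtopology X U). f x \<in> W}"
      using U(1) openin_trans_full by blast
    then show "\<exists>T. openin X T \<and> x \<in> T \<and> T \<subseteq> {x \<in> topspace X. f x \<in> W}"
      using x U by (intro exI[of _ "{x \<in> topspace (subtopology X U). f x \<in> W}"]) auto
  qed
qed

lemma open_map_local:
  assumes "\<And>x. x \<in> topspace X \<Longrightarrow> \<exists>U. openin X U \<and> x \<in> U \<and> open_map (subtopology X U) Y f"
  shows "open_map X Y f"
  unfolding open_map_def
proof (intro allI impI)
  fix W assume W: "openin X W"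
  show "openin Y (f ` W)"
    unfolding openin_subopen[of Y "f ` W"]
  proof
    fix y assume "y \<in> f ` W"
    then obtain x where x: "x \<in> W" "y = f x" by blast
    then obtain U where U: "openin X U" "x \<in> U" "open_map (subtopology X U) Y f"
      using assms[of x] openin_subset[OF W] by blast
    have "openin (subtopology X U) (U \<inter> W)" using W by (simp add: openin_subtopology_Int2)
    then have "openin Y (f ` (U \<inter> W))" using U(3) by (simp add: open_map_def)
    then show "\<exists>T. openin Y T \<and> y \<in> T \<and> T \<subseteq> f ` W" using x U by blast
  qed
qed

text \<open>For structures whose covering is understood only over parts of the frame bundle: over
  each orientation for the Pin extension, over evenly covered sets for the quotient. Continuity on
  the whole is a separate assumption because it makes the corresponding parts of \<open>E\<close>
  open.\<close>

lemma two_covering_local: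
  assumes c: "continuous_map E B p"
    and loc: "\<And>x. x \<in> topspace B \<Longrightarrow> \<exists>U. openin B U \<and> x \<in> U \<and>
      two_covering (subtopology E {e \<in> topspace E. p e \<in> U}) (subtopology B U) p"
  shows "two_covering E B p"
proof (rule two_coveringI[OF c])
  have pt: "\<exists>U. openin E {e \<in> topspace E. p e \<in> U} \<and> openin B U \<and> p a \<in> U \<and>
      two_covering (subtopology E {e \<in> topspace E. p e \<in> U}) (subtopology B U) p" if "a \<in> topspace E" for a
  proof -
    have "p a \<in> topspace B" using c that by (auto simp: continuous_map_def)
    then show ?thesis using loc[of "p a"] c openin_continuous_map_preimage by blast
  qed
  show "open_map E B p"
  proof (rule open_map_local)
    fix a assume a: "a \<in> topspace E"
    obtain U where U: "openin E {e \<in> topspace E. p e \<in> U}" "openin B U" "p a \<in> U"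
      "two_covering (subtopology E {e \<in> topspace E. p e \<in> U}) (subtopology B U) p" using pt a by blast
    have "open_map (subtopology E {e \<in> topspace E. p e \<in> U}) B p"
      using two_covering_props(2)[OF U(4)] U(2) open_map_compose[OF _ open_map_inclusion[of B U]]
      by (simp add: open_map_in_subtopology)
    then show "\<exists>U. openin E U \<and> a \<in> U \<and> open_map (subtopology E U) B p" using U a by blast
  qed
  show "card {e \<in> topspace E. p e = x} = 2" if x: "x \<in> topspace B" for x
  proof -
    obtain U where U: "openin B U" "x \<in> U"
      "two_covering (subtopology E {e \<in> topspace E. p e \<in> U}) (subtopology B U) p" using loc[OF x] by blast
    have "{e \<in> topspace (subtopology E {e \<in> topspace E. p e \<in> U}). p e = x} = {e \<in> topspace E. p e = x}"
      using U by auto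
    then show ?thesis using two_covering_props(3)[OF U(3), of x] U x by simp
  qed
  show "\<exists>V. openin E V \<and> a \<in> V \<and> inj_on p V" if a: "a \<in> topspace E" for a
  proof -
    obtain U where U: "openin E {e \<in> topspace E. p e \<in> U}" "openin B U" "p a \<in> U"
      "two_covering (subtopology E {e \<in> topspace E. p e \<in> U}) (subtopology B U) p" using pt a by blast
    then show ?thesis using two_covering_props(4)[OF U(4), of a] a openin_trans_full by auto
  qed
  show "\<exists>V W. openin E V \<and> openin E W \<and> a \<in> V \<and> b \<in> W \<and> disjnt V W"
    if ab: "a \<in> topspace E" "b \<in> topspace E" "a \<noteq> b" "p a = p b" for a b
  proof -
    obtain U where U: "openin E {e \<in> topspace E. p e \<in> U}" "openin B U" "p a \<in> U"
      "two_covering (subtopology E {e \<in> topspace E. p e \<in> U}) (subtopology B U) p" using pt ab(1) by blast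
    have "a \<in> topspace (subtopology E {e \<in> topspace E. p e \<in> U})" "b \<in> topspace (subtopology E {e \<in> topspace E. p e \<in> U})"
      using that U by auto
    then show ?thesis using two_covering_props(5)[OF U(4), of a b] that openin_trans_full[OF _ U(1)] by metis
  qed
qed

text \<open>Serves in four situations: an isomorphism of total spaces over the identity of frames, a
  change of the covering by the differential of \<tau>, right multiplication by an odd element of
  Pin covering a change of frames, and the local homeomorphism from a structure to its
  quotient.\<close>

lemma two_covering_transport:
  assumes p: "two_covering E B p" and h: "homeomorphic_map E E' h" and k: "homeomorphic_map B B' k"
    and comm: "\<And>e. e \<in> topspace E \<Longrightarrow> p' (h e) = k (p e)"
  shows "two_covering E' B' p'"
proof -
  note P = two_covering_props[OF p]
  obtain hi where hi: "homeomorphic_maps E E' h hi" using h homeomorphic_map_maps by blast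
  then have hih: "homeomorphic_map E' E hi" by (metis homeomorphic_maps_map)
  have hi1: "\<And>e. e \<in> topspace E \<Longrightarrow> hi (h e) = e" and hi2: "\<And>e. e \<in> topspace E' \<Longrightarrow> h (hi e) = e"
    and hi3: "\<And>e. e \<in> topspace E' \<Longrightarrow> hi e \<in> topspace E" and hi4: "\<And>e. e \<in> topspace E \<Longrightarrow> h e \<in> topspace E'"
    using hi by (auto simp: homeomorphic_maps_def continuous_map_def)
  have p': "p' e = (k \<circ> p \<circ> hi) e" if "e \<in> topspace E'" for e
    using comm[OF hi3[OF that]] hi2[OF that] by simp
  have kinj: "inj_on k (topspace B)" and kim: "k ` topspace B = topspace B'"
    using k homeomorphic_imp_injective_map homeomorphic_imp_surjective_map by blast+
  have pB: "\<And>e. e \<in> topspace E \<Longrightarrow> p e \<in> topspace B" using P(1) by (auto simp: continuous_map_def)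
  have iff: "p' a = p' b \<longleftrightarrow> p (hi a) = p (hi b)" if "a \<in> topspace E'" "b \<in> topspace E'" for a b
    using p' that kinj pB hi3 by (auto simp: inj_on_def)
  have pre: "openin E' {e \<in> topspace E'. hi e \<in> V}" if "openin E V" for V
    using that hih homeomorphic_imp_continuous_map openin_continuous_map_preimage by blast
  show ?thesis
  proof (rule two_coveringI)
    show "continuous_map E' B' p'"
    proof (rule continuous_map_eq)
      show "continuous_map E' B' (k \<circ> p \<circ> hi)"
        using continuous_map_compose[OF homeomorphic_imp_continuous_map[OF hih]
            continuous_map_compose[OF P(1) homeomorphic_imp_continuous_map[OF k]]] by (simp add: comp_assoc)
    qed (simp only: p')
    show "open_map E' B' p'"
    proof (rule open_map_eq)
      show "open_map E' B' (k \<circ> p \<circ> hi)"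
        using open_map_compose[OF homeomorphic_imp_open_map[OF hih]
            open_map_compose[OF P(2) homeomorphic_imp_open_map[OF k]]] by (simp add: comp_assoc)
    qed (simp only: p')
    show "card {e \<in> topspace E'. p' e = x} = 2" if "x \<in> topspace B'" for x
    proof -
      obtain y where y: "y \<in> topspace B" "x = k y" using \<open>x \<in> topspace B'\<close> unfolding kim[symmetric] by (elim imageE)
      have "bij_betw h {e \<in> topspace E. p e = y} {e \<in> topspace E'. p' e = x}"
      proof (rule bij_betw_byWitness[where f' = hi])
        show "h ` {e \<in> topspace E. p e = y} \<subseteq> {e \<in> topspace E'. p' e = x}"
          using comm y hi4 by auto
        show "hi ` {e \<in> topspace E'. p' e = x} \<subseteq> {e \<in> topspace E. p e = y}"
          using p' y hi3 kinj pB by (auto simp: inj_on_def)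
      qed (use hi1 hi2 in auto)
      from bij_betw_same_card[OF this] show ?thesis using P(3)[OF y(1)] by simp
    qed
    show "\<exists>V. openin E' V \<and> a \<in> V \<and> inj_on p' V" if a: "a \<in> topspace E'" for a
    proof -
      obtain V where V: "openin E V" "hi a \<in> V" "inj_on p V" using P(4) hi3[OF a] by blast
      have "inj_on p' {e \<in> topspace E'. hi e \<in> V}"
      proof (rule inj_onI)
        fix x y assume "x \<in> {e \<in> topspace E'. hi e \<in> V}" "y \<in> {e \<in> topspace E'. hi e \<in> V}" "p' x = p' y"
        then have "hi x = hi y" "x \<in> topspace E'" "y \<in> topspace E'" using iff V(3) by (auto dest: inj_onD)
        then show "x = y" using hi2 by metis
      qed
      then show ?thesis using pre[OF V(1)] V(2) a by blast
    qed
    show "\<exists>V W. openin E' V \<and> openin E' W \<and> a \<in> V \<and> b \<in> W \<and> disjnt V W"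
      if ab: "a \<in> topspace E'" "b \<in> topspace E'" "a \<noteq> b" "p' a = p' b" for a b
    proof -
      have "hi a \<noteq> hi b" using ab hi2 by metis
      then obtain V W where V: "openin E V" "openin E W" "hi a \<in> V" "hi b \<in> W" "disjnt V W"
        using P(5)[OF hi3[OF ab(1)] hi3[OF ab(2)]] iff ab by metis
      then show ?thesis using pre[OF V(1)] pre[OF V(2)] ab
        by (intro exI[of _ "{e \<in> topspace E'. hi e \<in> V}"] exI[of _ "{e \<in> topspace E'. hi e \<in> W}"])
           (auto simp: disjnt_def)
    qed
  qed
qed

text \<open>Where \<open>q\<close> is injective on \<open>V\<close>, the image of a small open set
  contains \<open>V\<close> intersected with the preimage under \<open>q\<close> of an open set of
  \<open>B\<close>. A lift is thus a homeomorphism as soon as it is bijective, with no inverse to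
  construct.\<close>

lemma open_map_lift:
  assumes p: "open_map E B p" and q: "two_covering E' B q" and f: "continuous_map E E' f"
    and comm: "\<And>e. e \<in> topspace E \<Longrightarrow> q (f e) = p e"
  shows "open_map E E' f"
  unfolding open_map_def
proof (intro allI impI)
  note Q = two_covering_props[OF q]
  fix W assume W: "openin E W"
  show "openin E' (f ` W)"
    unfolding openin_subopen[of E' "f ` W"]
  proof
    fix y assume "y \<in> f ` W"
    then obtain e where e: "e \<in> W" "y = f e" by blast
    have WE: "W \<subseteq> topspace E" using openin_subset[OF W] by blast
    have fE: "\<And>e. e \<in> topspace E \<Longrightarrow> f e \<in> topspace E'" using f by (auto simp: continuous_map_def)
    obtain V where V: "openin E' V" "f e \<in> V" "inj_on q V" using Q(4) fE e WE by blast
    define W' where "W' = W \<inter> {e \<in> topspace E. f e \<in> V}"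
    have W': "openin E W'" using W openin_continuous_map_preimage[OF f V(1)] by (auto simp: W'_def)
    have "openin E' (V \<inter> {a \<in> topspace E'. q a \<in> p ` W'})"
      using V(1) openin_continuous_map_preimage[OF Q(1)] p W' by (simp add: open_map_def openin_Int)
    moreover have "V \<inter> {a \<in> topspace E'. q a \<in> p ` W'} \<subseteq> f ` W"
    proof
      fix a assume a: "a \<in> V \<inter> {a \<in> topspace E'. q a \<in> p ` W'}"
      then obtain w where w: "w \<in> W'" "q a = p w" by blast
      then have "w \<in> W" "f w \<in> V" "q (f w) = q a" using comm by (auto simp: W'_def)
      then show "a \<in> f ` W" using V(3) a by (auto dest: inj_onD)
    qed
    moreover have "y \<in> V \<inter> {a \<in> topspace E'. q a \<in> p ` W'}"
      using e V WE fE comm by (auto simp: W'_def)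
    ultimately show "\<exists>T. openin E' T \<and> y \<in> T \<and> T \<subseteq> f ` W" by blast
  qed
qed

text \<open>Openness of the agreement set comes from local injectivity of \<open>q\<close>, openness
  of its complement from the separation of points in one fibre.\<close>

lemma lifts_agree_open:
  assumes q: "two_covering E' B q" and f: "continuous_map E E' f" and g: "continuous_map E E' g"
    and comm: "\<And>e. e \<in> topspace E \<Longrightarrow> q (f e) = q (g e)"
  shows "openin E {e \<in> topspace E. f e = g e}" and "openin E {e \<in> topspace E. f e \<noteq> g e}"
proof -
  note Q = two_covering_props[OF q]
  have fE: "\<And>e. e \<in> topspace E \<Longrightarrow> f e \<in> topspace E'" using f by (auto simp: continuous_map_def)
  have gE: "\<And>e. e \<in> topspace E \<Longrightarrow> g e \<in> topspace E'" using g by (auto simp: continuous_map_def)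
  have pre: "openin E ({e \<in> topspace E. f e \<in> V} \<inter> {e \<in> topspace E. g e \<in> W})"
    if "openin E' V" "openin E' W" for V W
    using that openin_continuous_map_preimage f g by blast
  show "openin E {e \<in> topspace E. f e = g e}"
    unfolding openin_subopen[of E "{e \<in> topspace E. f e = g e}"]
  proof
    fix e assume e: "e \<in> {e \<in> topspace E. f e = g e}"
    obtain V where V: "openin E' V" "f e \<in> V" "inj_on q V" using Q(4) fE e by blast
    show "\<exists>T. openin E T \<and> e \<in> T \<and> T \<subseteq> {e \<in> topspace E. f e = g e}"
      using pre[OF V(1) V(1)] e V comm
      by (intro exI[of _ "{e \<in> topspace E. f e \<in> V} \<inter> {e \<in> topspace E. g e \<in> V}"]) (auto dest: inj_onD)
  qed
  show "openin E {e \<in> topspace E. f e \<noteq> g e}"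
    unfolding openin_subopen[of E "{e \<in> topspace E. f e \<noteq> g e}"]
  proof
    fix e assume e: "e \<in> {e \<in> topspace E. f e \<noteq> g e}"
    then obtain V W where V: "openin E' V" "openin E' W" "f e \<in> V" "g e \<in> W" "disjnt V W"
      using Q(5)[of "f e" "g e"] fE gE comm by auto
    show "\<exists>T. openin E T \<and> e \<in> T \<and> T \<subseteq> {e \<in> topspace E. f e \<noteq> g e}"
      using pre[OF V(1,2)] e V
      by (intro exI[of _ "{e \<in> topspace E. f e \<in> V} \<inter> {e \<in> topspace E. g e \<in> W}"]) (auto simp: disjnt_def)
  qed
qed

section \<open>Quotient topologies and open quotient maps\<close>

lemma topspace_quotient_top: "topspace (quotient_top T f) = f ` topspace T"
proof -
  have "openin (quotient_top T f) (f ` topspace T)"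
    unfolding openin_quotient_top
    by (metis (no_types, lifting) image_eqI mem_Collect_eq openin_subopen openin_topspace subsetI subset_refl)
  moreover have "W \<subseteq> f ` topspace T" if "openin (quotient_top T f) W" for W
    using that by (simp add: openin_quotient_top)
  ultimately show ?thesis by (meson openin_subset openin_topspace subset_antisym)
qed

lemma continuous_map_quotient_top: "continuous_map T (quotient_top T f) f"
  unfolding continuous_map by (simp add: topspace_quotient_top openin_quotient_top)

lemma continuous_map_from_quotient_top:
  assumes "continuous_map T Y g" and "\<And>x. x \<in> topspace T \<Longrightarrow> h (f x) = g x"
  shows "continuous_map (quotient_top T f) Y h"
proof -
  have "h ` f ` topspace T \<subseteq> topspace Y" using assms by (auto simp: continuous_map_def)
  moreover have "openin (quotient_top T f) {x \<in> f ` topspace T. h x \<in> W}" if "openin Y W" for W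
  proof -
    have "{x \<in> topspace T. f x \<in> {x \<in> f ` topspace T. h x \<in> W}} = {x \<in> topspace T. g x \<in> W}"
      by (auto simp: assms(2)[symmetric])
    then show ?thesis
      using openin_continuous_map_preimage[OF assms(1) that] by (auto simp: openin_quotient_top)
  qed
  ultimately show ?thesis by (simp add: continuous_map topspace_quotient_top)
qed

lemma continuous_map_prod_id:
  assumes "continuous_map X Y f"
  shows "continuous_map (prod_topology X Z) (prod_topology Y Z) (\<lambda>(x, z). (f x, z))"
  unfolding case_prod_unfold
  by (rule continuous_map_pairedI[OF continuous_map_compose[OF continuous_map_fst assms, unfolded comp_def] continuous_map_snd])

text \<open>A product of a quotient map with an identity need not be a quotient map, but open maps
  are stable under such products. With \<open>continuous_map_from_open_quotient\<close> this yields
  continuity of the group action on the Pin extension and on the quotient by an involution.\<close>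

lemma open_map_prod_id:
  assumes "open_map X Y f"
  shows "open_map (prod_topology X Z) (prod_topology Y Z) (\<lambda>(x, z). (f x, z))"
  unfolding open_map_def
proof (intro allI impI)
  fix W assume W: "openin (prod_topology X Z) W"
  show "openin (prod_topology Y Z) ((\<lambda>(x, z). (f x, z)) ` W)"
    unfolding openin_prod_topology_alt
  proof (intro allI impI)
    fix y z assume "(y, z) \<in> (\<lambda>(x, z). (f x, z)) ` W"
    then obtain x where x: "(x, z) \<in> W" "y = f x" by auto
    then obtain U V where UV: "openin X U" "openin Z V" "x \<in> U" "z \<in> V" "U \<times> V \<subseteq> W"
      using W x(1) unfolding openin_prod_topology_alt by meson
    have "f ` U \<times> V \<subseteq> (\<lambda>(x, z). (f x, z)) ` W" using UV(5) by force
    then show "\<exists>U V. openin Y U \<and> openin Z V \<and> y \<in> U \<and> z \<in> V \<and> U \<times> V \<subseteq> (\<lambda>(x, z). (f x, z)) ` W"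
      using UV assms x unfolding open_map_def by (intro exI[of _ "f ` U"] exI[of _ V]) auto
  qed
qed

lemma continuous_map_from_open_quotient:
  assumes f: "open_map X Y f" "f ` topspace X = topspace Y"
    and g: "continuous_map X Z g" and h: "\<And>x. x \<in> topspace X \<Longrightarrow> h (f x) = g x"
  shows "continuous_map Y Z h"
proof -
  have "h ` topspace Y \<subseteq> topspace Z" using g h by (auto simp: continuous_map_def f(2)[symmetric])
  moreover have "openin Y {y \<in> topspace Y. h y \<in> W}" if "openin Z W" for W
  proof -
    have "{y \<in> topspace Y. h y \<in> W} = f ` {x \<in> topspace X. g x \<in> W}"
      by (auto simp: f(2)[symmetric] h)
    then show ?thesis using f(1) openin_continuous_map_preimage[OF g that] by (auto simp: open_map_def)
  qed
  ultimately show ?thesis by (simp add: continuous_map)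
qed

lemma homeomorphic_map_prod_id:
  assumes "homeomorphic_map X Y f"
  shows "homeomorphic_map (prod_topology X Z) (prod_topology Y Z) (\<lambda>(x, z). (f x, z))"
proof -
  obtain g where "homeomorphic_maps X Y f g" using assms homeomorphic_map_maps by blast
  moreover have "homeomorphic_maps Z Z (\<lambda>z. z) (\<lambda>z. z)" by (simp add: homeomorphic_maps_def)
  ultimately have "homeomorphic_maps (prod_topology X Z) (prod_topology Y Z) (\<lambda>(x, z). (f x, z)) (\<lambda>(x, z). (g x, z))"
    unfolding homeomorphic_maps_prod by blast
  then show ?thesis using homeomorphic_map_maps by blast
qed

section \<open>Topological groups and principal bundles\<close>

locale topological_group =
  fixes G :: "'g topology" and mul :: "'g \<Rightarrow> 'g \<Rightarrow> 'g" and e :: 'g and inv :: "'g \<Rightarrow> 'g"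
  assumes e_in: "e \<in> topspace G"
    and inv_in: "a \<in> topspace G \<Longrightarrow> inv a \<in> topspace G"
    and assoc: "mul (mul a b) c = mul a (mul b c)"
    and unit: "mul e a = a" "mul a e = a"
    and inverse: "a \<in> topspace G \<Longrightarrow> mul a (inv a) = e" "a \<in> topspace G \<Longrightarrow> mul (inv a) a = e"
    and continuous_mul: "continuous_map (prod_topology G G) G (\<lambda>(a, b). mul a b)"
begin

lemma mul_in: "a \<in> topspace G \<Longrightarrow> b \<in> topspace G \<Longrightarrow> mul a b \<in> topspace G"
  using continuous_mul by (auto simp: continuous_map_def Pi_iff)

lemma homeomorphic_map_left_mul:
  assumes "a \<in> topspace G" shows "homeomorphic_map G G (mul a)"
proof -
  have "continuous_map G G (mul b)" if "b \<in> topspace G" for b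
  proof -
    have "continuous_map G (prod_topology G G) (\<lambda>x. (b, x))"
      using that by (simp add: continuous_map_pairedI)
    from continuous_map_compose[OF this continuous_mul] show ?thesis by (simp add: comp_def)
  qed
  then have "homeomorphic_maps G G (mul a) (mul (inv a))"
    using assms inv_in by (simp add: homeomorphic_maps_def assoc[symmetric] inverse unit)
  then show ?thesis using homeomorphic_map_maps by blast
qed

end

locale principal = topological_group G mul e inv
  for G :: "'g topology" and mul :: "'g \<Rightarrow> 'g \<Rightarrow> 'g" and e :: 'g and inv :: "'g \<Rightarrow> 'g" +
  fixes B :: "'a topology" and P :: "'p topology" and pr :: "'p \<Rightarrow> 'a" and act :: "'p \<Rightarrow> 'g \<Rightarrow> 'p"
  assumes principal: "principal_bundle G mul e B P pr act"
begin

lemma continuous_pr: "continuous_map P B pr"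
  and continuous_act: "continuous_map (prod_topology P G) P (\<lambda>(p, t). act p t)"
  and act_e: "p \<in> topspace P \<Longrightarrow> act p e = p"
  and pr_act: "p \<in> topspace P \<Longrightarrow> t \<in> topspace G \<Longrightarrow> pr (act p t) = pr p"
  and act_act: "p \<in> topspace P \<Longrightarrow> t \<in> topspace G \<Longrightarrow> r \<in> topspace G \<Longrightarrow> act (act p t) r = act p (mul t r)"
  using principal by (auto simp: principal_bundle_def)

lemma pr_in: "p \<in> topspace P \<Longrightarrow> pr p \<in> topspace B"
  using continuous_pr by (auto simp: continuous_map_def)

lemma act_in: "p \<in> topspace P \<Longrightarrow> t \<in> topspace G \<Longrightarrow> act p t \<in> topspace P"
  using continuous_act by (auto simp: continuous_map_def Pi_iff)

lemma act_inv: "p \<in> topspace P \<Longrightarrow> t \<in> topspace G \<Longrightarrow> act (act p t) (inv t) = p"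
  "p \<in> topspace P \<Longrightarrow> t \<in> topspace G \<Longrightarrow> act (act p (inv t)) t = p"
  by (simp_all add: act_act inv_in inverse act_e)

lemma continuous_act_right: "t \<in> topspace G \<Longrightarrow> continuous_map P P (\<lambda>p. act p t)"
proof -
  assume t: "t \<in> topspace G"
  have "continuous_map P (prod_topology P G) (\<lambda>x. (x, t))"
    using t by (simp add: continuous_map_pairedI)
  from continuous_map_compose[OF this continuous_act] show ?thesis by (simp add: comp_def)
qed

lemma homeomorphic_act_right: "t \<in> topspace G \<Longrightarrow> homeomorphic_map P P (\<lambda>p. act p t)"
proof -
  assume t: "t \<in> topspace G"
  then have "homeomorphic_maps P P (\<lambda>p. act p t) (\<lambda>p. act p (inv t))"
    by (simp add: homeomorphic_maps_def continuous_act_right inv_in act_inv)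
  then show ?thesis using homeomorphic_map_maps by blast
qed

text \<open>The freedom to shrink into \<open>W\<close> later provides trivializations over sets on
  which \<pi> is injective.\<close>

lemma trivialization:
  assumes "x \<in> topspace B" "openin B W" "x \<in> W"
  obtains U \<Phi> where "openin B U" "x \<in> U" "U \<subseteq> W"
    "homeomorphic_map (prod_topology (subtopology B U) G) (subtopology P {p \<in> topspace P. pr p \<in> U}) \<Phi>"
    "\<And>y t. y \<in> U \<Longrightarrow> t \<in> topspace G \<Longrightarrow> \<Phi> (y, t) \<in> topspace P"
    "\<And>y t. y \<in> U \<Longrightarrow> t \<in> topspace G \<Longrightarrow> pr (\<Phi> (y, t)) = y"
    "\<And>y t r. y \<in> U \<Longrightarrow> t \<in> topspace G \<Longrightarrow> r \<in> topspace G \<Longrightarrow> \<Phi> (y, mul t r) = act (\<Phi> (y, t)) r"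
    "\<And>p. p \<in> topspace P \<Longrightarrow> pr p \<in> U \<Longrightarrow> \<exists>t \<in> topspace G. p = \<Phi> (pr p, t)"
    "inj_on \<Phi> (U \<times> topspace G)"
proof -
  obtain U \<Phi> where U: "openin B U" "x \<in> U"
    and h: "homeomorphic_map (prod_topology (subtopology B U) G) (subtopology P {p \<in> topspace P. pr p \<in> U}) \<Phi>"
    and \<Phi>: "\<forall>y \<in> U. \<forall>t \<in> topspace G. pr (\<Phi> (y, t)) = y \<and>
                 (\<forall>r \<in> topspace G. \<Phi> (y, mul t r) = act (\<Phi> (y, t)) r)"
    using principal assms(1) unfolding principal_bundle_def by blast
  define V where "V = U \<inter> W"
  have V: "openin B V" "x \<in> V" "V \<subseteq> W" using U assms by (auto simp: V_def)
  have UB: "U \<subseteq> topspace B" using openin_subset[OF U(1)] by blast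
  have im: "\<Phi> ` (U \<times> topspace G) = {p \<in> topspace P. pr p \<in> U}"
    using homeomorphic_imp_surjective_map[OF h] UB by auto
  have h': "homeomorphic_map (prod_topology (subtopology B V) G) (subtopology P {p \<in> topspace P. pr p \<in> V}) \<Phi>"
  proof -
    have "homeomorphic_map (subtopology (prod_topology (subtopology B U) G) (V \<times> topspace G))
       (subtopology (subtopology P {p \<in> topspace P. pr p \<in> U}) {p \<in> topspace P. pr p \<in> V}) \<Phi>"
    proof (rule homeomorphic_map_subtopologies_alt[OF h])
      fix a assume "a \<in> topspace (prod_topology (subtopology B U) G)"
        "\<Phi> a \<in> topspace (subtopology P {p \<in> topspace P. pr p \<in> U})"
      then show "(\<Phi> a \<in> {p \<in> topspace P. pr p \<in> V}) = (a \<in> V \<times> topspace G)" using \<Phi> by auto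
    qed
    moreover have "subtopology (prod_topology (subtopology B U) G) (V \<times> topspace G) = prod_topology (subtopology B V) G"
      by (simp add: subtopology_Times subtopology_subtopology V_def)
    moreover have "subtopology (subtopology P {p \<in> topspace P. pr p \<in> U}) {p \<in> topspace P. pr p \<in> V} = subtopology P {p \<in> topspace P. pr p \<in> V}"
      unfolding subtopology_subtopology by (rule arg_cong[where f = "subtopology P"]) (auto simp: V_def)
    ultimately show ?thesis by simp
  qed
  show ?thesis
  proof (rule that[of V \<Phi>])
    show "\<And>p. p \<in> topspace P \<Longrightarrow> pr p \<in> V \<Longrightarrow> \<exists>t\<in>topspace G. p = \<Phi> (pr p, t)"
    proof -
      fix p assume p: "p \<in> topspace P" "pr p \<in> V"
      then have "p \<in> \<Phi> ` (U \<times> topspace G)" unfolding im by (simp add: V_def)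
      then obtain y t where yt: "y \<in> U" "t \<in> topspace G" "p = \<Phi> (y, t)" by auto
      then have "y = pr p" using \<Phi> by auto
      then show "\<exists>t\<in>topspace G. p = \<Phi> (pr p, t)" using yt by auto
    qed
    show "\<And>y t. y \<in> V \<Longrightarrow> t \<in> topspace G \<Longrightarrow> \<Phi> (y, t) \<in> topspace P" using im by (auto simp: V_def)
    show "inj_on \<Phi> (V \<times> topspace G)"
      using homeomorphic_imp_injective_map[OF h] UB by (auto simp: V_def inj_on_def)
  qed (use V h' \<Phi> in \<open>auto simp: V_def\<close>)
qed

lemma fibre_ex: "x \<in> topspace B \<Longrightarrow> \<exists>p \<in> topspace P. pr p = x"
  using e_in by (rule_tac trivialization[of x "topspace B"]) (auto intro!: bexI)

text \<open>The definition of a principal bundle asks only for equivariant local trivializations;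
  freeness here, and transitivity on fibres below, are read off from them, since in a trivialization
  the action is multiplication in the group.\<close>

lemma free: "p \<in> topspace P \<Longrightarrow> t \<in> topspace G \<Longrightarrow> act p t = p \<Longrightarrow> t = e"
proof -
  assume p: "p \<in> topspace P" "t \<in> topspace G" "act p t = p"
  obtain U \<Phi> where U: "pr p \<in> U" "\<And>y t r. y \<in> U \<Longrightarrow> t \<in> topspace G \<Longrightarrow> r \<in> topspace G \<Longrightarrow> \<Phi> (y, mul t r) = act (\<Phi> (y, t)) r"
    "\<And>p. p \<in> topspace P \<Longrightarrow> pr p \<in> U \<Longrightarrow> \<exists>t \<in> topspace G. p = \<Phi> (pr p, t)" "inj_on \<Phi> (U \<times> topspace G)"
    by (rule trivialization[of "pr p" "topspace B"]) (use pr_in p in auto)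
  obtain s where s: "s \<in> topspace G" "p = \<Phi> (pr p, s)" using U p by blast
  have "\<Phi> (pr p, mul s t) = \<Phi> (pr p, s)" using U s p by metis
  then have "mul s t = s" using inj_onD[OF U(4), of "(pr p, mul s t)" "(pr p, s)"] s(1) p U(1) mul_in by simp
  then have "mul (inv s) (mul s t) = mul (inv s) s" by simp
  then show "t = e" using s p by (simp add: assoc[symmetric] inverse unit)
qed

lemma transitive:
  "p \<in> topspace P \<Longrightarrow> q \<in> topspace P \<Longrightarrow> pr p = pr q \<Longrightarrow> \<exists>t \<in> topspace G. q = act p t"
proof -
  assume p: "p \<in> topspace P" "q \<in> topspace P" "pr p = pr q"
  obtain U \<Phi> where U: "pr p \<in> U" "\<And>y t r. y \<in> U \<Longrightarrow> t \<in> topspace G \<Longrightarrow> r \<in> topspace G \<Longrightarrow> \<Phi> (y, mul t r) = act (\<Phi> (y, t)) r"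
    "\<And>p. p \<in> topspace P \<Longrightarrow> pr p \<in> U \<Longrightarrow> \<exists>t \<in> topspace G. p = \<Phi> (pr p, t)"
    by (rule trivialization[of "pr p" "topspace B"]) (use pr_in p in auto)
  obtain s where s: "s \<in> topspace G" "p = \<Phi> (pr p, s)" using U p by blast
  obtain r where r: "r \<in> topspace G" "q = \<Phi> (pr p, r)" using U p by metis
  have "act p (mul (inv s) r) = \<Phi> (pr p, mul s (mul (inv s) r))" using U s r mul_in inv_in by metis
  also have "\<dots> = q" using r s by (simp add: assoc[symmetric] inverse unit)
  finally show ?thesis using s r mul_in inv_in by metis
qed

lemma act_cancel:
  "p \<in> topspace P \<Longrightarrow> t \<in> topspace G \<Longrightarrow> r \<in> topspace G \<Longrightarrow> act p t = act p r \<Longrightarrow> t = r"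
proof -
  assume *: "p \<in> topspace P" "t \<in> topspace G" "r \<in> topspace G" "act p t = act p r"
  then have "act p (mul t (inv r)) = p"
    by (metis act_act act_inv(1) inv_in)
  then have "mul t (inv r) = e" using * free mul_in inv_in by blast
  then have "mul (mul t (inv r)) r = r" by (simp add: unit)
  then show "t = r" using * by (simp add: assoc inverse unit)
qed

text \<open>Near a point of the image, the image of \<open>A\<close> contains the preimage of
  \<open>A\<close> under the local section \<open>\<lambda>y. \<Phi> (y, e)\<close>. Invariance
  ensures that this section does meet \<open>A\<close> over the given point: a fibre that meets
  \<open>A\<close> lies in \<open>A\<close>.\<close>

lemma open_image_invariant:
  assumes "openin P A" and inv: "\<And>p t. p \<in> A \<Longrightarrow> t \<in> topspace G \<Longrightarrow> act p t \<in> A"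
  shows "openin B (pr ` A)"
  unfolding openin_subopen[of B "pr ` A"]
proof
  fix x assume "x \<in> pr ` A"
  then obtain p where p: "p \<in> A" "x = pr p" by blast
  have AP: "A \<subseteq> topspace P" using openin_subset[OF assms(1)] by blast
  then have pP: "p \<in> topspace P" using p by blast
  obtain U \<Phi> where U: "openin B U" "pr p \<in> U" 
    "homeomorphic_map (prod_topology (subtopology B U) G) (subtopology P {p \<in> topspace P. pr p \<in> U}) \<Phi>"
    and \<Phi>: "\<And>y t. y \<in> U \<Longrightarrow> t \<in> topspace G \<Longrightarrow> \<Phi> (y, t) \<in> topspace P"
    "\<And>y t. y \<in> U \<Longrightarrow> t \<in> topspace G \<Longrightarrow> pr (\<Phi> (y, t)) = y"
    by (rule trivialization[of "pr p" "topspace B"]) (use pr_in pP in auto)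
  have "continuous_map (subtopology B U) (prod_topology (subtopology B U) G) (\<lambda>y. (y, e))"
    using e_in by (simp add: continuous_map_pairedI)
  then have "continuous_map (subtopology B U) P (\<lambda>y. \<Phi> (y, e))"
    using continuous_map_compose[of "subtopology B U" _ "\<lambda>y. (y, e)" _ \<Phi>] homeomorphic_imp_continuous_map[OF U(3)]
    by (fastforce simp: comp_def continuous_map_in_subtopology)
  then have "openin (subtopology B U) {y \<in> topspace (subtopology B U). \<Phi> (y, e) \<in> A}"
    using assms(1) openin_continuous_map_preimage by blast
  then have o: "openin B {y \<in> topspace (subtopology B U). \<Phi> (y, e) \<in> A}" using U(1) openin_trans_full by blast
  have "\<exists>t \<in> topspace G. \<Phi> (pr p, e) = act p t"
    using transitive[OF pP, of "\<Phi> (pr p, e)"] \<Phi> U e_in by metis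
  then have "x \<in> {y \<in> topspace (subtopology B U). \<Phi> (y, e) \<in> A}"
    using p inv U openin_subset by fastforce
  moreover have "{y \<in> topspace (subtopology B U). \<Phi> (y, e) \<in> A} \<subseteq> pr ` A"
    using \<Phi>(2) e_in by (force simp: image_iff)
  ultimately show "\<exists>T. openin B T \<and> x \<in> T \<and> T \<subseteq> pr ` A" using o by blast
qed

text \<open>The set where two equivariant lifts agree is open and closed, and so is its image in the base.\<close>

lemma equivariant_lifts_agree:
  assumes conn: "connected_space B" and q: "two_covering E F q"
    and f: "continuous_map P E f" and g: "continuous_map P E g"
    and comm: "\<And>p. p \<in> topspace P \<Longrightarrow> q (f p) = q (g p)"
    and inv: "\<And>p t. p \<in> topspace P \<Longrightarrow> t \<in> topspace G \<Longrightarrow> f (act p t) = g (act p t) \<longleftrightarrow> f p = g p"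
  shows "(\<forall>p \<in> topspace P. f p = g p) \<or> (\<forall>p \<in> topspace P. f p \<noteq> g p)"
proof -
  let ?A = "{p \<in> topspace P. f p = g p}" and ?C = "{p \<in> topspace P. f p \<noteq> g p}"
  have "openin B (pr ` ?A)"
    by (rule open_image_invariant[OF lifts_agree_open(1)[OF q f g comm]]) (use inv act_in in auto)
  moreover have "openin B (pr ` ?C)"
    by (rule open_image_invariant[OF lifts_agree_open(2)[OF q f g comm]]) (use inv act_in in auto)
  moreover have "topspace B \<subseteq> pr ` ?A \<union> pr ` ?C" using fibre_ex by blast
  \<comment> \<open>Agreement is constant on orbits, and by transitivity the orbits are whole
    fibres.\<close>
  moreover have "pr ` ?A \<inter> pr ` ?C = {}"
  proof (rule ccontr)
    assume "pr ` ?A \<inter> pr ` ?C \<noteq> {}"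
    then obtain a c where ac: "a \<in> ?A" "c \<in> ?C" "pr a = pr c" by fastforce
    then obtain t where "t \<in> topspace G" "c = act a t" using transitive[of a c] by auto
    then show False using ac inv by auto
  qed
  ultimately have "pr ` ?A = {} \<or> pr ` ?C = {}"
    using conn unfolding connected_space_def by blast
  then show ?thesis by blast
qed

lemma transport_total:
  assumes f: "homeomorphic_map P P' f"
    and pr: "\<And>p. p \<in> topspace P \<Longrightarrow> pr' (f p) = pr p"
    and ac: "\<And>p t. p \<in> topspace P \<Longrightarrow> t \<in> topspace G \<Longrightarrow> act' (f p) t = f (act p t)"
  shows "principal_bundle G mul e B P' pr' act'"
  unfolding principal_bundle_def
proof (intro conjI ballI)
  obtain g where g: "homeomorphic_maps P P' f g" using f homeomorphic_map_maps by blast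
  have gP: "\<And>q. q \<in> topspace P' \<Longrightarrow> g q \<in> topspace P" "\<And>q. q \<in> topspace P' \<Longrightarrow> f (g q) = q"
    and fP: "\<And>p. p \<in> topspace P \<Longrightarrow> f p \<in> topspace P'" "\<And>p. p \<in> topspace P \<Longrightarrow> g (f p) = p"
    and gc: "continuous_map P' P g" and fc: "continuous_map P P' f"
    using g by (auto simp: homeomorphic_maps_def continuous_map_def)
  have pr': "pr' q = pr (g q)" if "q \<in> topspace P'" for q using pr[of "g q"] gP that by simp
  have ac': "act' q t = f (act (g q) t)" if "q \<in> topspace P'" "t \<in> topspace G" for q t
    using ac[of "g q" t] gP that by simp
  show "continuous_map P' B pr'"
    by (rule continuous_map_eq[OF continuous_map_compose[OF gc continuous_pr]]) (simp add: pr')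
  show "continuous_map (prod_topology P' G) P' (\<lambda>(p, t). act' p t)"
  proof (rule continuous_map_eq)
    have "continuous_map (prod_topology P' G) (prod_topology P G) (\<lambda>(p, t). (g p, t))"
      by (rule continuous_map_prod_id[OF gc])
    then show "continuous_map (prod_topology P' G) P' (f \<circ> (\<lambda>(p, t). act p t) \<circ> (\<lambda>(p, t). (g p, t)))"
      using continuous_map_compose[OF _ continuous_map_compose[OF continuous_act fc]] by (simp add: comp_assoc)
  qed (auto simp: ac')
  fix q assume q: "q \<in> topspace P'"
  show "act' q e = q" using q e_in gP act_e by (simp add: ac')
  fix t assume t: "t \<in> topspace G"
  show "pr' (act' q t) = pr' q" using q t gP act_in pr_act by (simp add: ac' pr pr')
  fix r assume r: "r \<in> topspace G"
  show "act' (act' q t) r = act' q (mul t r)"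
    using q t r gP act_in mul_in by (simp add: ac' ac act_act)
next
  fix x assume x: "x \<in> topspace B"
  have fc: "continuous_map P P' f" using f homeomorphic_imp_continuous_map by blast
  have im: "f ` topspace P = topspace P'" using f homeomorphic_imp_surjective_map by blast
  obtain U \<Phi> where U: "openin B U" "x \<in> U"
    and h: "homeomorphic_map (prod_topology (subtopology B U) G) (subtopology P {p \<in> topspace P. pr p \<in> U}) \<Phi>"
    and \<Phi>: "\<And>y t. y \<in> U \<Longrightarrow> t \<in> topspace G \<Longrightarrow> \<Phi> (y, t) \<in> topspace P"
    "\<And>y t. y \<in> U \<Longrightarrow> t \<in> topspace G \<Longrightarrow> pr (\<Phi> (y, t)) = y"
    "\<And>y t r. y \<in> U \<Longrightarrow> t \<in> topspace G \<Longrightarrow> r \<in> topspace G \<Longrightarrow> \<Phi> (y, mul t r) = act (\<Phi> (y, t)) r"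
    by (rule trivialization[of x "topspace B"]) (use x in auto)
  have "homeomorphic_map (subtopology P {p \<in> topspace P. pr p \<in> U}) (subtopology P' {p \<in> topspace P'. pr' p \<in> U}) f"
    by (rule homeomorphic_map_subtopologies_alt[OF f]) (use pr in auto)
  from homeomorphic_map_compose[OF h this]
  show "\<exists>U. openin B U \<and> x \<in> U \<and> (\<exists>\<Phi>. homeomorphic_map (prod_topology (subtopology B U) G)
      (subtopology P' {p \<in> topspace P'. pr' p \<in> U}) \<Phi> \<and>
      (\<forall>y\<in>U. \<forall>t\<in>topspace G. pr' (\<Phi> (y, t)) = y \<and> (\<forall>r\<in>topspace G. \<Phi> (y, mul t r) = act' (\<Phi> (y, t)) r)))"
    using U \<Phi> pr ac by (intro exI[of _ U] conjI exI[of _ "f \<circ> \<Phi>"]) auto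
qed

text \<open>Accounts for the pull-back along an isometry, where total space and action stay the same
  and only the projection is followed by a homeomorphism of the base.\<close>

lemma transport_base:
  assumes k: "homeomorphic_map B B' k"
    and pr': "\<And>p. p \<in> topspace P \<Longrightarrow> pr' p = k (pr p)"
  shows "principal_bundle G mul e B' P pr' act"
  unfolding principal_bundle_def
proof (intro conjI ballI)
  show "continuous_map P B' pr'"
    by (rule continuous_map_eq[OF continuous_map_compose[OF continuous_pr homeomorphic_imp_continuous_map[OF k]]])
       (simp add: pr')
  fix p assume p: "p \<in> topspace P"
  fix t assume t: "t \<in> topspace G"
  show "pr' (act p t) = pr' p" using p t by (simp add: pr' act_in pr_act)
next
  fix x assume x: "x \<in> topspace B'"
  obtain g where g: "homeomorphic_maps B B' k g" using k homeomorphic_map_maps by blast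
  have gB: "\<And>q. q \<in> topspace B' \<Longrightarrow> g q \<in> topspace B" "\<And>q. q \<in> topspace B' \<Longrightarrow> k (g q) = q"
    and kB: "\<And>p. p \<in> topspace B \<Longrightarrow> k p \<in> topspace B'" "\<And>p. p \<in> topspace B \<Longrightarrow> g (k p) = p"
    and gc: "homeomorphic_map B' B g"
    using g homeomorphic_maps_map[of B B' k g] by (auto simp: homeomorphic_maps_def continuous_map_def)
  obtain U \<Phi> where U: "openin B U" "g x \<in> U"
    and h: "homeomorphic_map (prod_topology (subtopology B U) G) (subtopology P {p \<in> topspace P. pr p \<in> U}) \<Phi>"
    and \<Phi>: "\<And>y t. y \<in> U \<Longrightarrow> t \<in> topspace G \<Longrightarrow> \<Phi> (y, t) \<in> topspace P"
    "\<And>y t. y \<in> U \<Longrightarrow> t \<in> topspace G \<Longrightarrow> pr (\<Phi> (y, t)) = y"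
    "\<And>y t r. y \<in> U \<Longrightarrow> t \<in> topspace G \<Longrightarrow> r \<in> topspace G \<Longrightarrow> \<Phi> (y, mul t r) = act (\<Phi> (y, t)) r"
    by (rule trivialization[of "g x" "topspace B"]) (use x gB in auto)
  define U' where "U' = {y \<in> topspace B'. g y \<in> U}"
  have U': "openin B' U'" "x \<in> U'"
    using openin_continuous_map_preimage[OF homeomorphic_imp_continuous_map[OF gc] U(1)] x U by (auto simp: U'_def)
  have UB: "U \<subseteq> topspace B" using openin_subset[OF U(1)] by blast
  have "homeomorphic_map (subtopology B' U') (subtopology B U) g"
    by (rule homeomorphic_map_subtopologies_alt[OF gc]) (auto simp: U'_def)
  from homeomorphic_map_compose[OF homeomorphic_map_prod_id[OF this] h]
  have "homeomorphic_map (prod_topology (subtopology B' U') G) (subtopology P {p \<in> topspace P. pr p \<in> U}) (\<Phi> \<circ> (\<lambda>(x, z). (g x, z)))" .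
  moreover have "{p \<in> topspace P. pr p \<in> U} = {p \<in> topspace P. pr' p \<in> U'}"
    using pr' UB kB pr_in by (auto simp: U'_def)
  moreover have "pr' ((\<Phi> \<circ> (\<lambda>(x, z). (g x, z))) (y, t)) = y" if "y \<in> U'" "t \<in> topspace G" for y t
    using that \<Phi> pr' gB by (auto simp: U'_def)
  moreover have "(\<Phi> \<circ> (\<lambda>(x, z). (g x, z))) (y, mul t r) = act ((\<Phi> \<circ> (\<lambda>(x, z). (g x, z))) (y, t)) r"
    if "y \<in> U'" "t \<in> topspace G" "r \<in> topspace G" for y t r
    using that \<Phi> by (auto simp: U'_def)
  ultimately show "\<exists>U. openin B' U \<and> x \<in> U \<and> (\<exists>\<Phi>. homeomorphic_map (prod_topology (subtopology B' U) G)
      (subtopology P {p \<in> topspace P. pr' p \<in> U}) \<Phi> \<and>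
      (\<forall>y\<in>U. \<forall>t\<in>topspace G. pr' (\<Phi> (y, t)) = y \<and> (\<forall>r\<in>topspace G. \<Phi> (y, mul t r) = act (\<Phi> (y, t)) r)))"
    using U' by (intro exI[of _ U'] conjI exI[of _ "\<Phi> \<circ> (\<lambda>(x, z). (g x, z))"]) auto
qed (use continuous_act act_e act_act in auto)

end

section \<open>Pin and Spin groups\<close>

lemma cl_mult_linear:
  "cl_mult \<kappa> (a + b) c = cl_mult \<kappa> a c + cl_mult \<kappa> b c"
  "cl_mult \<kappa> c (a + b) = cl_mult \<kappa> c a + cl_mult \<kappa> c b"
  "cl_mult \<kappa> (x *\<^sub>R a) c = x *\<^sub>R cl_mult \<kappa> a c"
  "cl_mult \<kappa> c (x *\<^sub>R a) = x *\<^sub>R cl_mult \<kappa> c a"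
  "cl_mult \<kappa> (- a) c = - cl_mult \<kappa> a c"
  "cl_mult \<kappa> c (- a) = - cl_mult \<kappa> c a"
  "cl_mult \<kappa> (a - b) c = cl_mult \<kappa> a c - cl_mult \<kappa> b c"
proof -
  have "bounded_bilinear (cl_mult \<kappa>)" using cl_mult_bilinear bilinear_conv_bounded_bilinear by blast
  note b = bounded_bilinear.add_left[OF this] bounded_bilinear.add_right[OF this] bounded_bilinear.scaleR_left[OF this]
    bounded_bilinear.scaleR_right[OF this] bounded_bilinear.minus_left[OF this] bounded_bilinear.minus_right[OF this]
    bounded_bilinear.diff_left[OF this]
  show "cl_mult \<kappa> (a + b) c = cl_mult \<kappa> a c + cl_mult \<kappa> b c"
    "cl_mult \<kappa> c (a + b) = cl_mult \<kappa> c a + cl_mult \<kappa> c b"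
    "cl_mult \<kappa> (x *\<^sub>R a) c = x *\<^sub>R cl_mult \<kappa> a c"
    "cl_mult \<kappa> c (x *\<^sub>R a) = x *\<^sub>R cl_mult \<kappa> c a"
    "cl_mult \<kappa> (- a) c = - cl_mult \<kappa> a c"
    "cl_mult \<kappa> c (- a) = - cl_mult \<kappa> c a"
    "cl_mult \<kappa> (a - b) c = cl_mult \<kappa> a c - cl_mult \<kappa> b c"
    by (rule b)+
qed

lemma axis_uminus: "axis S (- x) = - axis S (x::real)"
  by (simp add: axis_def vec_eq_iff)

lemma cl_vec_nth: "cl_vec v $ {i} = v $ i"
proof -
  have "cl_vec v $ {i} = (\<Sum>j\<in>UNIV. if j = i then v $ i else 0)"
    unfolding cl_vec_def sum_component by (rule sum.cong) (auto simp: axis_def)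
  then show ?thesis by simp
qed

lemma cl_vec_linear:
  fixes v w :: "real^'a::{finite,linorder}"
  shows "cl_vec (v + w) = cl_vec v + cl_vec w"
  "cl_vec (x *\<^sub>R v) = x *\<^sub>R cl_vec v"
  "cl_vec (v - w) = cl_vec v - cl_vec w"
proof -
  show a: "cl_vec (v + w) = cl_vec v + cl_vec w" for v w :: "(real, 'a) vec" by (simp add: cl_vec_def cl_axis_add sum.distrib)
  show s: "cl_vec (x *\<^sub>R v) = x *\<^sub>R cl_vec v" for x and v :: "(real, 'a) vec" by (simp add: cl_vec_def cl_axis_scale scaleR_sum_right)
  show "cl_vec (v - w) = cl_vec v - cl_vec w"
    using a[of v "(- 1) *\<^sub>R w"] s[of "- 1" w] by simp
qed

lemma cl_vec_inject: "cl_vec v = cl_vec w \<longleftrightarrow> v = w"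
  by (metis cl_vec_nth vec_eq_iff)

lemma cl_vec_square: "cl_mult \<kappa> (cl_vec v) (cl_vec v) = (\<kappa> * (v \<bullet> v)) *\<^sub>R cl_one"
  using cl_vec_anticommute[of \<kappa> v v]
  by (simp add: vec_eq_iff mult.assoc flip: mult_2)

lemma cl_grade_linear:
  "cl_grade (a + b) = cl_grade a + cl_grade b" "cl_grade (x *\<^sub>R a) = x *\<^sub>R cl_grade a"
  "cl_grade (- a) = - cl_grade a" "cl_grade (sum f A) = (\<Sum>i\<in>A. cl_grade (f i))"
  "cl_grade (cl_grade a) = a"
  by (simp_all add: cl_grade_def vec_eq_iff algebra_simps sum_distrib_left)

lemma cl_grade_axis: "cl_grade (axis S x) = axis S ((- 1) ^ card S * x)"
  by (simp add: cl_grade_def vec_eq_iff axis_def)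

text \<open>The cardinality of a symmetric difference is additive modulo 2; the sign rule is
  \<open>prod_sym_diff\<close> for the constant weight -1.\<close>

lemma cl_grade_mult: "cl_grade (cl_mult \<kappa> a (b :: 'a::{finite,linorder} cliff)) = cl_mult \<kappa> (cl_grade a) (cl_grade b)"
proof -
  have p: "(- 1) ^ card (sym_diff S T) = (- 1) ^ card S * (- 1 :: real) ^ card T" for S T :: "'a set"
    using prod_sym_diff[of "\<lambda>_. - 1 :: real" S T] by (simp only: prod_constant)
  have "cl_grade (cl_mult \<kappa> (\<Sum>S\<in>UNIV. axis S (a $ S)) (\<Sum>S\<in>UNIV. axis S (b $ S))) =
     cl_mult \<kappa> (cl_grade (\<Sum>S\<in>UNIV. axis S (a $ S))) (cl_grade (\<Sum>S\<in>UNIV. axis S (b $ S)))"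
    by (simp add: cl_mult_sum cl_grade_linear cl_grade_axis cl_mult_axis p mult_ac)
  then show ?thesis by (simp only: cl_expand[symmetric])
qed

lemma cl_grade_one: "cl_grade cl_one = cl_one"
  by (simp add: cl_one_def cl_grade_axis)

lemma cl_grade_vec: "cl_grade (cl_vec v) = - cl_vec v"
  by (simp add: cl_vec_def cl_grade_linear cl_grade_axis axis_uminus sum_negf)

lemma cl_one_neq: "cl_one \<noteq> (0 :: 'm::{finite,linorder} cliff)" "cl_one \<noteq> (- cl_one :: 'm::{finite,linorder} cliff)"
  by (auto simp: cl_one_def vec_eq_iff axis_def)

definition hyperplane_reflection :: "real^'m::finite \<Rightarrow> 'm square_matrix" where
  "hyperplane_reflection v = matrix (\<lambda>x. x - (2 * (v \<bullet> x)) *\<^sub>R v)"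

lemma hyperplane_reflection_mult: "hyperplane_reflection v *v x = x - (2 * (v \<bullet> x)) *\<^sub>R v"
  unfolding hyperplane_reflection_def
proof -
  have "linear (\<lambda>x. x - (2 * (v \<bullet> x)) *\<^sub>R v)" by (auto intro!: linearI simp: algebra_simps inner_simps)
  then show "matrix (\<lambda>x. x - (2 * (v \<bullet> x)) *\<^sub>R v) *v x = x - (2 * (v \<bullet> x)) *\<^sub>R v"
    by simp
qed

lemma orthogonal_hyperplane_reflection: "norm v = 1 \<Longrightarrow> orthogonal_matrix (hyperplane_reflection v)"
proof -
  assume v: "norm v = 1"
  have "orthogonal_transformation (\<lambda>x. x - (2 * (v \<bullet> x)) *\<^sub>R v)"
    unfolding orthogonal_transformation_def
  proof (intro conjI allI)
    show "linear (\<lambda>x. x - (2 * (v \<bullet> x)) *\<^sub>R v)" by (auto intro!: linearI simp: algebra_simps inner_simps)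
    show "(x - (2 * (v \<bullet> x)) *\<^sub>R v) \<bullet> (y - (2 * (v \<bullet> y)) *\<^sub>R v) = x \<bullet> y" for x y
      using v by (simp add: inner_simps dot_square_norm inner_commute algebra_simps)
  qed
  then show ?thesis unfolding hyperplane_reflection_def orthogonal_transformation_matrix by blast
qed

text \<open>An orthogonal map that carries a basis vector to \<open>v\<close> conjugates the two
  reflections, and the reflection in a coordinate hyperplane is diagonal with a single entry
  -1.\<close>

lemma det_hyperplane_reflection: "norm v = 1 \<Longrightarrow> det (hyperplane_reflection (v :: real^'m::finite)) = - 1"
proof -
  assume v: "norm v = 1"
  obtain k :: 'm where True by blast
  let ?e = "axis k 1 :: real^'m"
  obtain f where f: "orthogonal_transformation f" "f ?e = v"
    using orthogonal_transformation_exists_1[of ?e v] v by auto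
  let ?Q = "matrix f"
  have Q: "?Q *v x = f x" for x using f by (simp add: matrix_works orthogonal_transformation_linear)
  have "hyperplane_reflection v ** ?Q = ?Q ** hyperplane_reflection ?e"
  proof (subst matrix_eq, intro allI)
    fix x
    have "v \<bullet> f x = ?e \<bullet> x" using f unfolding orthogonal_transformation_def by metis
    moreover have "f (x - c *\<^sub>R ?e) = f x - c *\<^sub>R v" for c
      using f by (simp add: linear_diff linear_scale orthogonal_transformation_linear)
    ultimately show "(hyperplane_reflection v ** ?Q) *v x = (?Q ** hyperplane_reflection ?e) *v x"
      by (simp add: matrix_vector_mul_assoc[symmetric] hyperplane_reflection_mult Q)
  qed
  then have "det (hyperplane_reflection v) * det ?Q = det ?Q * det (hyperplane_reflection ?e)"
    by (metis det_mul)
  moreover have "det ?Q \<noteq> 0"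
    using f orthogonal_transformation_matrix det_orthogonal_matrix by fastforce
  moreover have "det (hyperplane_reflection ?e) = - 1"
  proof -
    have n: "hyperplane_reflection ?e $ i $ j = (if i = j then if i = k then - 1 else 1 else 0)" for i j
    proof -
      have "hyperplane_reflection ?e $ i $ j = (hyperplane_reflection ?e *v axis j 1) $ i"
        by (simp add: matrix_vector_mult_basis column_def)
      then show ?thesis by (simp only: hyperplane_reflection_mult, simp add: inner_axis_axis, simp add: axis_def)
    qed
    have "det (hyperplane_reflection ?e) = (\<Prod>i\<in>UNIV. if i = k then - 1 else 1)"
      by (subst det_diagonal) (simp_all add: n)
    then show ?thesis by simp
  qed
  ultimately show ?thesis using mult_right_cancel[of "det ?Q" "det (hyperplane_reflection v)" "- 1"] by simp
qed

section \<open>The groups Pin and Spin and their projection to the orthogonal group\<close>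

locale clifford =
  fixes \<kappa> :: real
  assumes sign: "\<kappa> = 1 \<or> \<kappa> = - 1"
begin

lemma Pin_mult: "s \<in> Pin \<kappa> \<Longrightarrow> t \<in> Pin \<kappa> \<Longrightarrow> cl_mult \<kappa> s t \<in> Pin \<kappa>"
  by (induction rule: Pin.induct) (simp_all add: cl_mult_one cl_mult_assoc[OF sign] Pin.mult)

lemma Pin_vec: "norm v = 1 \<Longrightarrow> cl_vec v \<in> Pin \<kappa>"
  using Pin.mult[OF Pin.one] by (simp add: cl_mult_one)

lemma Pin_inverse_ex:
  "t \<in> Pin \<kappa> \<Longrightarrow> \<exists>s \<in> Pin \<kappa>. cl_mult \<kappa> t s = cl_one \<and> cl_mult \<kappa> s t = cl_one"
proof (induction rule: Pin.induct)
  case one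
  then show ?case by (auto intro!: bexI[of _ cl_one] simp: cl_mult_one Pin.one)
next
  case (mult t v)
  then obtain s where s: "s \<in> Pin \<kappa>" "cl_mult \<kappa> t s = cl_one" "cl_mult \<kappa> s t = cl_one" by blast
  have k: "\<kappa> * \<kappa> = 1" "\<bar>\<kappa>\<bar> = 1" using sign by auto
  \<comment> \<open>A unit vector squares to \<kappa>, so its inverse is
    \<open>\<kappa> *\<^sub>R v\<close>, again a unit vector and hence in Pin.\<close>
  have v: "cl_mult \<kappa> (cl_vec v) (cl_vec (\<kappa> *\<^sub>R v)) = cl_one" "cl_mult \<kappa> (cl_vec (\<kappa> *\<^sub>R v)) (cl_vec v) = cl_one"
    using mult k by (simp_all add: cl_vec_linear cl_mult_linear cl_vec_square dot_square_norm)
  have w: "cl_mult \<kappa> (cl_vec v) (cl_mult \<kappa> (cl_vec (\<kappa> *\<^sub>R v)) a) = a"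
    "cl_mult \<kappa> (cl_vec (\<kappa> *\<^sub>R v)) (cl_mult \<kappa> (cl_vec v) a) = a"
    "cl_mult \<kappa> t (cl_mult \<kappa> s a) = a" "cl_mult \<kappa> s (cl_mult \<kappa> t a) = a" for a
    using v s by (simp_all add: cl_mult_assoc[OF sign, symmetric] cl_mult_one)
  have "cl_mult \<kappa> s (cl_vec (\<kappa> *\<^sub>R v)) \<in> Pin \<kappa>"
    using s mult k by (intro Pin_mult Pin_vec) simp_all
  moreover have "cl_mult \<kappa> (cl_mult \<kappa> (cl_vec v) t) (cl_mult \<kappa> s (cl_vec (\<kappa> *\<^sub>R v))) = cl_one"
    using v w by (simp add: cl_mult_assoc[OF sign])
  moreover have "cl_mult \<kappa> (cl_mult \<kappa> s (cl_vec (\<kappa> *\<^sub>R v))) (cl_mult \<kappa> (cl_vec v) t) = cl_one"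
    using s w by (simp add: cl_mult_assoc[OF sign])
  ultimately show ?case by blast
qed

definition pin_inv :: "'m::{finite,linorder} cliff \<Rightarrow> 'm cliff" where
  "pin_inv t = (SOME s. s \<in> Pin \<kappa> \<and> cl_mult \<kappa> t s = cl_one \<and> cl_mult \<kappa> s t = cl_one)"

lemma pin_inv:
  assumes "t \<in> Pin \<kappa>"
  shows "pin_inv t \<in> Pin \<kappa>" "cl_mult \<kappa> t (pin_inv t) = cl_one" "cl_mult \<kappa> (pin_inv t) t = cl_one"
  using someI_ex[OF Pin_inverse_ex[OF assms, unfolded Bex_def]] by (simp_all add: pin_inv_def)

lemma Pin_parity: "t \<in> Pin \<kappa> \<Longrightarrow> cl_grade t = t \<or> cl_grade t = - t"
  by (induction rule: Pin.induct)
    (auto simp: cl_grade_one cl_grade_mult cl_grade_vec cl_mult_linear)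

lemma Pin_nonzero: "t \<in> Pin \<kappa> \<Longrightarrow> t \<noteq> 0"
  using pin_inv(2)[of t] cl_one_neq(1) bilinear_lzero[OF cl_mult_bilinear] by metis

lemma Spin_Pin: "t \<in> Spin \<kappa> \<Longrightarrow> t \<in> Pin \<kappa>"
  by (simp add: Spin_def)

lemma Spin_subset: "Spin \<kappa> \<subseteq> Pin \<kappa>"
  by (auto simp: Spin_def)

lemma Pin_odd: "t \<in> Pin \<kappa> \<Longrightarrow> t \<notin> Spin \<kappa> \<longleftrightarrow> cl_grade t = - t"
proof -
  assume t: "t \<in> Pin \<kappa>"
  have "t \<noteq> - t" using Pin_nonzero[OF t] by (simp add: vec_eq_iff)
  then show ?thesis using t Pin_parity[OF t] by (auto simp: Spin_def)
qed

text \<open>Parity is multiplicative, and an element of Pin cannot be even and odd at once because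
  it is nonzero. So Spin is the kernel of a homomorphism to a group of two elements.\<close>

lemma Spin_mult_iff:
  assumes "s \<in> Pin \<kappa>" "t \<in> Pin \<kappa>"
  shows "cl_mult \<kappa> s t \<in> Spin \<kappa> \<longleftrightarrow> (s \<in> Spin \<kappa> \<longleftrightarrow> t \<in> Spin \<kappa>)"
proof -
  have st: "cl_mult \<kappa> s t \<in> Pin \<kappa>" using assms by (rule Pin_mult)
  have g: "cl_grade t = (if t \<in> Spin \<kappa> then t else - t)" if "t \<in> Pin \<kappa>" for t
    using Pin_odd[OF that] that by (auto simp: Spin_def)
  have "cl_grade (cl_mult \<kappa> s t) = (if s \<in> Spin \<kappa> \<longleftrightarrow> t \<in> Spin \<kappa> then cl_mult \<kappa> s t else - cl_mult \<kappa> s t)"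
    unfolding cl_grade_mult g[OF assms(1)] g[OF assms(2)] by (simp add: cl_mult_linear)
  moreover have "cl_mult \<kappa> s t \<noteq> - cl_mult \<kappa> s t" using Pin_nonzero[OF st] by (simp add: vec_eq_iff)
  ultimately show ?thesis using st Pin_odd[OF st] by (auto simp: Spin_def split: if_splits)
qed

lemma Spin_one: "cl_one \<in> Spin \<kappa>"
  by (simp add: Spin_def Pin.one cl_grade_one)

lemma pin_inv_Spin_iff: "t \<in> Pin \<kappa> \<Longrightarrow> pin_inv t \<in> Spin \<kappa> \<longleftrightarrow> t \<in> Spin \<kappa>"
  using Spin_mult_iff[of t "pin_inv t"] pin_inv[of t] Spin_one by auto

lemma Pin_odd_ex: "\<exists>t \<in> Pin \<kappa>. t \<notin> (Spin \<kappa> :: 'm::{finite,linorder} cliff set)"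
proof -
  obtain i :: 'm where True by blast
  have "cl_vec (axis i 1) \<in> (Pin \<kappa> :: 'm cliff set)" by (rule Pin_vec) simp
  then show ?thesis using Pin_odd cl_grade_vec by blast
qed

lemma continuous_cl_mult: "continuous_on A f \<Longrightarrow> continuous_on A g \<Longrightarrow> continuous_on A (\<lambda>x. cl_mult \<kappa> (f x) (g x))"
  using cl_mult_bilinear bilinear_conv_bounded_bilinear bounded_bilinear.continuous_on by blast

lemma topological_group_Pin: "topological_group (cl_top (Pin \<kappa>)) (cl_mult \<kappa>) cl_one pin_inv"
proof
  show "continuous_map (prod_topology (cl_top (Pin \<kappa>)) (cl_top (Pin \<kappa>))) (cl_top (Pin \<kappa>)) (\<lambda>(a, b). cl_mult \<kappa> a b)"
    by (auto simp: cl_top_def case_prod_unfold Pin_mult intro!: continuous_cl_mult continuous_on_fst continuous_on_snd)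
qed (auto simp: cl_top_def Pin.one pin_inv cl_mult_assoc[OF sign] cl_mult_one)

lemma topological_group_Spin: "topological_group (cl_top (Spin \<kappa>)) (cl_mult \<kappa>) cl_one pin_inv"
proof
  show "continuous_map (prod_topology (cl_top (Spin \<kappa>)) (cl_top (Spin \<kappa>))) (cl_top (Spin \<kappa>)) (\<lambda>(a, b). cl_mult \<kappa> a b)"
    by (auto simp: cl_top_def case_prod_unfold Spin_mult_iff Spin_Pin intro!: continuous_cl_mult continuous_on_fst continuous_on_snd)
qed (auto simp: cl_top_def Spin_one pin_inv Spin_Pin pin_inv_Spin_iff cl_mult_assoc[OF sign] cl_mult_one)

lemma topspace_cl_top: "topspace (cl_top G) = G"
  by (simp add: cl_top_def)

text \<open>The even and the odd elements of Pin are each cut out by a closed linear condition, and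
  they are complementary to each other.\<close>

lemma openin_Spin:
  "openin (cl_top (Pin \<kappa>)) (Spin \<kappa> :: 'a::{finite,linorder} cliff set)"
  "openin (cl_top (Pin \<kappa>)) (Pin \<kappa> - Spin \<kappa> :: 'a cliff set)"
proof -
  have "closed {t :: 'a cliff. cl_grade t = t}" "closed {t :: 'a cliff. cl_grade t = - t}"
    unfolding cl_grade_def by (intro closed_Collect_eq continuous_intros)+
  then have "closedin (cl_top (Pin \<kappa>)) (Pin \<kappa> \<inter> {t :: 'a cliff. cl_grade t = t})"
     "closedin (cl_top (Pin \<kappa>)) (Pin \<kappa> \<inter> {t :: 'a cliff. cl_grade t = - t})"
    unfolding cl_top_def by (auto intro: closedin_closed_Int)
  then have c: "closedin (cl_top (Pin \<kappa>)) {t \<in> Pin \<kappa> :: 'a cliff set. cl_grade t = t}"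
     "closedin (cl_top (Pin \<kappa>)) {t \<in> Pin \<kappa> :: 'a cliff set. cl_grade t = - t}"
    by (simp_all add: Int_def)
  have "{t \<in> Pin \<kappa>. cl_grade t = t} = (Spin \<kappa> :: 'a cliff set)" "{t \<in> Pin \<kappa>. cl_grade t = - t} = (Pin \<kappa> - Spin \<kappa> :: 'a cliff set)"
    using Pin_odd by (auto simp: Spin_def)
  with c show "openin (cl_top (Pin \<kappa>)) (Spin \<kappa> :: 'a cliff set)" "openin (cl_top (Pin \<kappa>)) (Pin \<kappa> - Spin \<kappa> :: 'a cliff set)"
    using Spin_subset[where 'a = 'a] by (simp_all add: closedin_def topspace_cl_top double_diff)
qed

text \<open>For distinct basis vectors a, b the product (ab)(ab) equals -(aa)(bb) =
  -\<kappa>\<kappa> = -1 for both signs \<kappa>; the dimension bound provides the two distinct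
  indices.\<close>

lemma minus_one_Spin:
  assumes "CARD('m) \<ge> 2"
  shows "- cl_one \<in> (Spin \<kappa> :: 'm::{finite,linorder} cliff set)"
proof -
  obtain i j :: 'm where ij: "i \<noteq> j"
    using assms by (metis card_2_iff' ex_card iso_tuple_UNIV_I)
  let ?a = "cl_vec (axis i 1) :: 'm cliff" and ?b = "cl_vec (axis j 1) :: 'm cliff"
  have k: "\<kappa> * \<kappa> = 1" using sign by auto
  have ab: "cl_mult \<kappa> ?b ?a = - cl_mult \<kappa> ?a ?b"
    using cl_vec_anticommute[of \<kappa> "axis i 1" "axis j 1"] ij by (simp add: inner_axis_axis eq_neg_iff_add_eq_0 add.commute)
  have "cl_mult \<kappa> ?a (cl_mult \<kappa> ?b (cl_mult \<kappa> ?a ?b)) = cl_mult \<kappa> ?a (cl_mult \<kappa> (cl_mult \<kappa> ?b ?a) ?b)"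
    by (simp add: cl_mult_assoc[OF sign])
  also have "\<dots> = - cl_mult \<kappa> (cl_mult \<kappa> ?a ?a) (cl_mult \<kappa> ?b ?b)"
    by (simp add: ab cl_mult_linear cl_mult_assoc[OF sign])
  also have "\<dots> = - cl_one" using k by (simp add: cl_vec_square cl_mult_linear cl_mult_one inner_axis_axis)
  finally have "- cl_one \<in> (Pin \<kappa> :: 'm cliff set)"
    using Pin_mult Pin_vec by (metis norm_axis_1)
  then show ?thesis by (simp add: Spin_def cl_grade_linear cl_grade_one)
qed

text \<open>Resolves the definite description in \<open>pin_proj\<close>: \<open>t\<close> cancels
  on the right by its inverse, and \<open>cl_vec\<close> is injective.\<close>

lemma pin_proj_unique:
  assumes t: "t \<in> Pin \<kappa>" and A: "\<And>w. cl_mult \<kappa> (cl_grade t) (cl_vec w) = cl_mult \<kappa> (cl_vec (A *v w)) t"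
  shows "pin_proj \<kappa> t = A"
  unfolding pin_proj_def
proof (rule the_equality)
  fix C assume C: "\<forall>w. cl_mult \<kappa> (cl_grade t) (cl_vec w) = cl_mult \<kappa> (cl_vec (C *v w)) t"
  have "C *v w = A *v w" for w
  proof -
    have "cl_mult \<kappa> (cl_mult \<kappa> (cl_vec (C *v w)) t) (pin_inv t) = cl_mult \<kappa> (cl_mult \<kappa> (cl_vec (A *v w)) t) (pin_inv t)"
      using A C by metis
    then show ?thesis using pin_inv[OF t] by (simp add: cl_mult_assoc[OF sign] cl_mult_one cl_vec_inject)
  qed
  then show "C = A" by (simp add: matrix_eq)
qed (intro allI A)

text \<open>One more unit vector composes with its reflection, because v x = - r(x) v, where r is
  the reflection in the hyperplane orthogonal to \<open>v\<close>; the minus sign is absorbed by the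
  grading.\<close>

lemma reflect_step:
  assumes v: "norm v = 1" and A: "\<And>w. cl_mult \<kappa> (cl_grade t) (cl_vec w) = cl_mult \<kappa> (cl_vec (A *v w)) t"
  shows "cl_mult \<kappa> (cl_grade (cl_mult \<kappa> (cl_vec v) t)) (cl_vec w) =
    cl_mult \<kappa> (cl_vec ((hyperplane_reflection v ** A) *v w)) (cl_mult \<kappa> (cl_vec v) t)"
proof -
  have k: "\<kappa> * \<kappa> = 1" using sign by auto
  let ?x = "A *v w"
  have "cl_mult \<kappa> (cl_grade (cl_mult \<kappa> (cl_vec v) t)) (cl_vec w) = - cl_mult \<kappa> (cl_mult \<kappa> (cl_vec v) (cl_vec ?x)) t"
    by (simp add: cl_grade_mult cl_grade_vec cl_mult_linear cl_mult_assoc[OF sign] A)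
  also have "cl_mult \<kappa> (cl_vec v) (cl_vec ?x) = (2 * \<kappa> * (v \<bullet> ?x)) *\<^sub>R cl_one - cl_mult \<kappa> (cl_vec ?x) (cl_vec v)"
    using cl_vec_anticommute[of \<kappa> v ?x] by (simp add: algebra_simps)
  \<comment> \<open>The scalar \<kappa> is rewritten as the square of \<open>v\<close>, so that
    \<open>v\<close> can be factored out on the right.\<close>
  also have "\<dots> = (2 * (v \<bullet> ?x)) *\<^sub>R cl_mult \<kappa> (cl_vec v) (cl_vec v) - cl_mult \<kappa> (cl_vec ?x) (cl_vec v)"
    using v by (simp add: cl_vec_square dot_square_norm)
  also have "\<dots> = - cl_mult \<kappa> (cl_vec (?x - (2 * (v \<bullet> ?x)) *\<^sub>R v)) (cl_vec v)"
    by (simp add: cl_vec_linear cl_mult_linear)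
  finally show ?thesis
    by (simp add: matrix_vector_mul_assoc[symmetric] hyperplane_reflection_mult cl_mult_linear cl_mult_assoc[OF sign])
qed

lemma pin_proj_props:
  assumes "t \<in> Pin \<kappa>"
  shows "cl_mult \<kappa> (cl_grade t) (cl_vec w) = cl_mult \<kappa> (cl_vec (pin_proj \<kappa> t *v w)) t"
    and "orthogonal_matrix (pin_proj \<kappa> t)"
    and "t \<in> Spin \<kappa> \<longleftrightarrow> det (pin_proj \<kappa> t) > 0"
proof -
  \<comment> \<open>Each further unit vector flips both the parity and the sign of the determinant.
    The conjunct \<open>det A \<noteq> 0\<close> strengthens the induction: only then does a
    determinant that is not positive become positive under the flip.\<close>
  have "\<exists>A. (\<forall>w. cl_mult \<kappa> (cl_grade t) (cl_vec w) = cl_mult \<kappa> (cl_vec (A *v w)) t) \<and> orthogonal_matrix A \<and>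
      (t \<in> Spin \<kappa> \<longleftrightarrow> det A > 0) \<and> det A \<noteq> 0"
    using assms
  proof (induction rule: Pin.induct)
    case one
    then show ?case
      by (auto intro!: exI[of _ "mat 1"] simp: cl_grade_one cl_mult_one Spin_one orthogonal_matrix_id)
  next
    case (mult t v)
    then obtain A where A: "\<And>w. cl_mult \<kappa> (cl_grade t) (cl_vec w) = cl_mult \<kappa> (cl_vec (A *v w)) t"
      "orthogonal_matrix A" "t \<in> Spin \<kappa> \<longleftrightarrow> det A > 0" "det A \<noteq> 0" by blast
    have "cl_vec v \<notin> Spin \<kappa>" using Pin_odd[OF Pin_vec] mult cl_grade_vec by blast
    then have "cl_mult \<kappa> (cl_vec v) t \<in> Spin \<kappa> \<longleftrightarrow> t \<notin> Spin \<kappa>"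
      using Spin_mult_iff[OF Pin_vec] mult by blast
    then show ?case
      using reflect_step[OF mult.hyps(2) A(1)] A orthogonal_hyperplane_reflection[OF mult.hyps(2)] det_hyperplane_reflection[OF mult.hyps(2)]
      by (intro exI[of _ "hyperplane_reflection v ** A"]) (auto simp: det_mul orthogonal_matrix_mul)
  qed
  then obtain A where A: "\<And>w. cl_mult \<kappa> (cl_grade t) (cl_vec w) = cl_mult \<kappa> (cl_vec (A *v w)) t"
      "orthogonal_matrix A" "t \<in> Spin \<kappa> \<longleftrightarrow> det A > 0" by blast
  have "pin_proj \<kappa> t = A" by (rule pin_proj_unique[OF assms A(1)])
  then show "cl_mult \<kappa> (cl_grade t) (cl_vec w) = cl_mult \<kappa> (cl_vec (pin_proj \<kappa> t *v w)) t"
    "orthogonal_matrix (pin_proj \<kappa> t)" "t \<in> Spin \<kappa> \<longleftrightarrow> det (pin_proj \<kappa> t) > 0"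
    using A by auto
qed

lemma pin_proj_mult:
  "s \<in> Pin \<kappa> \<Longrightarrow> t \<in> Pin \<kappa> \<Longrightarrow> pin_proj \<kappa> (cl_mult \<kappa> s t) = pin_proj \<kappa> s ** pin_proj \<kappa> t"
proof (rule pin_proj_unique)
  assume s: "s \<in> Pin \<kappa>" and t: "t \<in> Pin \<kappa>"
  show "cl_mult \<kappa> s t \<in> Pin \<kappa>" using s t by (rule Pin_mult)
  fix w
  have "cl_mult \<kappa> (cl_grade (cl_mult \<kappa> s t)) (cl_vec w) = cl_mult \<kappa> (cl_mult \<kappa> (cl_grade s) (cl_vec (pin_proj \<kappa> t *v w))) t"
    by (simp only: cl_grade_mult cl_mult_assoc[OF sign] pin_proj_props(1)[OF t])
  then show "cl_mult \<kappa> (cl_grade (cl_mult \<kappa> s t)) (cl_vec w) =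
      cl_mult \<kappa> (cl_vec ((pin_proj \<kappa> s ** pin_proj \<kappa> t) *v w)) (cl_mult \<kappa> s t)"
    by (simp only: cl_mult_assoc[OF sign] pin_proj_props(1)[OF s] matrix_vector_mul_assoc)
qed

lemma pin_proj_one: "pin_proj \<kappa> cl_one = mat 1"
  by (rule pin_proj_unique) (simp_all add: Pin.one cl_grade_one cl_mult_one)

lemma pin_proj_minus_one:
  "- cl_one \<in> (Pin \<kappa> :: 'a::{finite,linorder} cliff set) \<Longrightarrow> pin_proj \<kappa> (- cl_one :: 'a cliff) = mat 1"
  by (rule pin_proj_unique) (simp_all add: cl_grade_one cl_grade_linear cl_mult_linear cl_mult_one)

end

section \<open>The volume element and chirality\<close>

lemma sum_card_less: "2 * (\<Sum>i\<in>UNIV. card {j. j < (i::'m)}) + CARD('m) = CARD('m) * CARD('m::{finite,linorder})"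
proof -
  let ?L = "SIGMA i:UNIV. {j::'m. j < i}"
  have L: "card ?L = (\<Sum>i\<in>UNIV. card {j::'m. j < i})" by (simp add: card_SigmaI)
  \<comment> \<open>The square splits into the pairs on one side of the diagonal, their mirror
    images and the diagonal.\<close>
  have U: "(UNIV :: ('m \<times> 'm) set) = (?L \<union> prod.swap ` ?L) \<union> range (\<lambda>i. (i, i))"
  proof -
    have "(i, j) \<in> (?L \<union> prod.swap ` ?L) \<union> range (\<lambda>i. (i, i))" for i j
      by (cases i j rule: linorder_cases) (auto simp: image_iff)
    then show ?thesis by auto
  qed
  have "card ((?L \<union> prod.swap ` ?L) \<union> range (\<lambda>i. (i, i))) = card (?L \<union> prod.swap ` ?L) + card (range (\<lambda>i::'m. (i, i)))"
    by (rule card_Un_disjoint) auto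
  also have "card (?L \<union> prod.swap ` ?L) = card ?L + card (prod.swap ` ?L)"
    by (rule card_Un_disjoint) auto
  also have "card (prod.swap ` ?L) = card ?L" by (rule card_image) simp
  also have "card (range (\<lambda>i::'m. (i, i))) = CARD('m)" by (rule card_image) (simp add: inj_on_def)
  finally show ?thesis using L by (simp add: U[symmetric] card_cartesian_product flip: UNIV_Times_UNIV)
qed

locale spinor_module = clifford \<kappa> for \<kappa> :: real +
  fixes n :: nat and \<rho> :: "'m::{finite,linorder} cliff \<Rightarrow> complex^'k::finite^'k"
  assumes dim: "CARD('m) = 2 * n" and rep: "clifford_module \<kappa> \<rho>"
begin

lemma rep_one: "\<rho> cl_one = mat 1" and rep_mult: "\<rho> (cl_mult \<kappa> a b) = \<rho> a ** \<rho> b"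
  and rep_linear: "linear \<rho>"
  using rep by (auto simp: clifford_module_def)

lemma rep_minus: "\<rho> (- a) = - \<rho> a"
  by (rule linear_neg[OF rep_linear])

lemma rep_inv: "t \<in> Pin \<kappa> \<Longrightarrow> \<rho> (pin_inv t) *v (\<rho> t *v z) = z" "t \<in> Pin \<kappa> \<Longrightarrow> \<rho> t *v (\<rho> (pin_inv t) *v z) = z"
  by (simp_all add: matrix_vector_mul_assoc pin_inv rep_one flip: rep_mult)

text \<open>Sorting the product of the 2n basis vectors with itself costs n(2n-1) transpositions, a
  number of the same parity as n, and \<kappa> occurs 2n times. The factor i^n in
  \<open>chirality\<close> compensates this sign, so that chirality squares to the identity for
  either \<kappa>.\<close>

lemma volume_square: "cl_mult \<kappa> (axis UNIV 1) (axis UNIV 1 :: 'm cliff) = (- 1) ^ n *\<^sub>R cl_one"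
proof -
  have "(\<Prod>j\<in>UNIV. if j < i then - 1 else if j = i then \<kappa> else 1) = \<kappa> * (- 1) ^ card {j::'m. j < i}" for i
  proof -
    have "(\<Prod>j\<in>UNIV. if j < i then - 1 else if j = i then \<kappa> else 1) =
      (\<Prod>j\<in>UNIV. (if j = i then \<kappa> else 1) * (if j < i then - 1 else 1))"
      by (rule prod.cong) auto
    also have "\<dots> = \<kappa> * (\<Prod>j\<in>UNIV. if j < i then - 1 else 1)" by (simp add: prod.distrib)
    also have "(\<Prod>j\<in>UNIV. if j < i then - 1 else 1 :: real) = (- 1) ^ card {j. j < i}"
      by (simp add: prod.If_cases)
    finally show ?thesis .
  qed
  then have "cl_sign \<kappa> UNIV (UNIV :: 'm set) = \<kappa> ^ CARD('m) * (- 1) ^ (\<Sum>i\<in>UNIV. card {j::'m. j < i})"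
    by (simp add: cl_sign_def prod.distrib power_sum)
  moreover have "\<kappa> ^ CARD('m) = 1" using sign by (auto simp: dim)
  moreover have "(- 1 :: real) ^ (\<Sum>i\<in>UNIV. card {j::'m. j < i}) = (- 1) ^ n"
  proof -
    define N where "N = (\<Sum>i\<in>UNIV. card {j::'m. j < i})"
    have "2 * N + 2 * n = 2 * n * (2 * n)" using sum_card_less[where 'm = 'm] unfolding N_def[symmetric] dim .
    then have "N + n = 2 * (n * n)" by simp
    then have "even (N + n)" by simp
    then have "even N \<longleftrightarrow> even n" by simp
    then show ?thesis unfolding N_def[symmetric] by (simp add: minus_one_power_iff)
  qed
  ultimately show ?thesis by (simp add: cl_mult_axis cl_one_def, simp add: vec_eq_iff axis_def)
qed

text \<open>A basis vector anticommutes with the 2n-1 other factors of the volume element and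
  commutes with itself, an odd number of sign changes in all. The two orderings are compared through
  the product of their signs, in which \<kappa> squares away.\<close>

lemma volume_vec: "cl_mult \<kappa> (axis UNIV 1) (cl_vec v) = - cl_mult \<kappa> (cl_vec v) (axis UNIV (1::real) :: 'm cliff)"
proof -
  have "cl_sign \<kappa> UNIV {i} = - cl_sign \<kappa> {i} UNIV" for i :: 'm
  proof -
    let ?f = "\<lambda>j. (if i < j then - 1 else if i = j then \<kappa> else 1)" and ?g = "\<lambda>j. (if j < i then - 1 else if j = i then \<kappa> else 1)"
    have fg: "?f j * ?g j = (if j = i then 1 else - 1)" for j using sign by auto
    have "cl_sign \<kappa> UNIV {i} * cl_sign \<kappa> {i} UNIV = (\<Prod>j\<in>UNIV. ?f j * ?g j)"
      by (simp add: cl_sign_def prod.distrib)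
    also have "\<dots> = (\<Prod>j\<in>UNIV. if j = i then 1 else - 1)" by (simp only: fg)
    also have "\<dots> = (- 1) ^ (CARD('m) - 1)"
      by (simp add: prod.If_cases Compl_eq_Diff_UNIV card_Diff_singleton)
    also have "\<dots> = - 1"
    proof -
      have "odd (CARD('m) - 1)" using dim finite_UNIV_card_ge_0[where 'a = 'm] by (cases n) auto
      then show ?thesis by simp
    qed
    finally have p: "cl_sign \<kappa> UNIV {i} * cl_sign \<kappa> {i} UNIV = - 1" .
    have "cl_sign \<kappa> {i} UNIV * cl_sign \<kappa> {i} UNIV = 1"
    proof -
      have gg: "?g j * ?g j = 1" for j using sign by auto
      have "cl_sign \<kappa> {i} UNIV * cl_sign \<kappa> {i} UNIV = (\<Prod>j\<in>UNIV. ?g j * ?g j)"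
        by (simp add: cl_sign_def prod.distrib)
      then show ?thesis by (simp only: gg) simp
    qed
    with p show ?thesis by (metis mult_minus_left mult_cancel_right zero_neq_neg_one mult_zero_right)
  qed
  moreover have "sym_diff UNIV {i} = sym_diff {i} UNIV" for i :: 'm by blast
  ultimately show ?thesis
    unfolding cl_vec_def by (simp add: cl_mult_sum cl_mult_axis axis_uminus sum_negf)
qed

lemma volume_Pin: "t \<in> Pin \<kappa> \<Longrightarrow> cl_mult \<kappa> (axis UNIV 1) t = cl_mult \<kappa> (cl_grade t) (axis UNIV (1::real) :: 'm cliff)"
proof (induction rule: Pin.induct)
  case one
  then show ?case by (simp add: cl_grade_one cl_mult_one)
next
  case (mult t v)
  have "cl_mult \<kappa> (axis UNIV 1) (cl_mult \<kappa> (cl_vec v) t) = cl_mult \<kappa> (cl_mult \<kappa> (axis UNIV 1) (cl_vec v)) t"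
    by (simp add: cl_mult_assoc[OF sign])
  also have "\<dots> = - cl_mult \<kappa> (cl_vec v) (cl_mult \<kappa> (axis UNIV 1) t)"
    by (simp add: volume_vec cl_mult_linear cl_mult_assoc[OF sign])
  finally show ?case by (simp add: mult cl_grade_mult cl_grade_vec cl_mult_linear cl_mult_assoc[OF sign])
qed

lemma chirality_linear:
  "chirality \<rho> (z + w) = chirality \<rho> z + chirality \<rho> w" "chirality \<rho> (c *\<^sub>R z) = c *\<^sub>R chirality \<rho> z"
  "chirality \<rho> (- z) = - chirality \<rho> z"
proof -
  have s: "A *v (c *\<^sub>R z) = c *\<^sub>R (A *v z)" for A :: "complex^'k^'k" and c z
    by (simp add: vec_eq_iff matrix_vector_mult_def scaleR_sum_right)
  have t: "a *s (c *\<^sub>R z) = c *\<^sub>R (a *s z)" for a :: complex and c and z :: "complex^'k"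
    by (simp add: vec_eq_iff)
  show "chirality \<rho> (z + w) = chirality \<rho> z + chirality \<rho> w"
    by (simp add: chirality_def matrix_vector_right_distrib vector_add_ldistrib)
  show sc: "chirality \<rho> (c *\<^sub>R z) = c *\<^sub>R chirality \<rho> z" for c z by (simp add: chirality_def s t)
  show "chirality \<rho> (- z) = - chirality \<rho> z" using sc[of "- 1"] by simp
qed

lemma chirality_chirality: "chirality \<rho> (chirality \<rho> z) = z"
proof -
  have "chirality \<rho> (chirality \<rho> z) = (\<i> ^ n * \<i> ^ n) *s ((\<rho> (axis UNIV 1) ** \<rho> (axis UNIV 1)) *v z)"
    by (simp add: chirality_def dim vector_scalar_commute[symmetric] matrix_vector_mul_assoc vector_smult_assoc)
  also have "\<rho> (axis UNIV 1) ** \<rho> (axis UNIV 1) = (- 1) ^ n *\<^sub>R mat 1"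
    by (simp add: volume_square linear_scale[OF rep_linear] rep_one flip: rep_mult)
  also have "\<i> ^ n * \<i> ^ n = (- 1 :: complex) ^ n"
    by (simp flip: power_mult_distrib)
  finally show ?thesis
    by (cases "even n") (simp_all add: vec_eq_iff matrix_vector_mult_def mat_def if_distrib if_distribR sum_negf cong: if_cong)
qed

lemma chirality_Pin:
  assumes "t \<in> Pin \<kappa>"
  shows "chirality \<rho> (\<rho> t *v z) = (if t \<in> Spin \<kappa> then 1 else - 1) *\<^sub>R (\<rho> t *v chirality \<rho> z)"
proof -
  have "chirality \<rho> (\<rho> t *v z) = \<rho> (cl_grade t) *v chirality \<rho> z"
    by (simp add: chirality_def vector_scalar_commute[symmetric] matrix_vector_mul_assoc volume_Pin[OF assms] flip: rep_mult)
  moreover have "cl_grade t = (if t \<in> Spin \<kappa> then t else - t)"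
    using Pin_odd[OF assms] by (auto simp: Spin_def)
  ultimately show ?thesis
    by (simp add: rep_minus matrix_vector_mult_def vec_eq_iff sum_negf)
qed

end

section \<open>Tangent spaces and frames\<close>

lemma smooth_on_deriv:
  assumes "smooth_on S f"
  shows "x \<in> S \<Longrightarrow> f differentiable (at x)"
    and "continuous_on S (\<lambda>x. frechet_derivative f (at x) v)"
proof -
  have "ck_on (Suc 0) S f" using assms smooth_on_def by blast
  then show "x \<in> S \<Longrightarrow> f differentiable (at x)" "continuous_on S (\<lambda>x. frechet_derivative f (at x) v)" by auto
qed

locale manifold =
  fixes M :: "('a, 'm::finite, 'z) mfd_scheme"
  assumes smooth_manifold: "smooth_manifold M"
begin

lemma
  assumes "c \<in> atlas M"
  shows chart_openin: "openin (mtop M) (fst c)"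
    and chart_image_open: "open (snd c ` fst c)"
    and chart_homeo: "homeomorphic_map (subtopology (mtop M) (fst c)) (top_of_set (snd c ` fst c)) (snd c)"
  using smooth_manifold assms unfolding smooth_manifold_def by auto

lemma chart_subset: "c \<in> atlas M \<Longrightarrow> fst c \<subseteq> topspace (mtop M)"
  by (rule openin_subset[OF chart_openin])

lemma charts_at_topspace: "c \<in> charts_at M x \<Longrightarrow> x \<in> topspace (mtop M)"
  using chart_subset unfolding charts_at_def by blast

lemma charts_atD: "c \<in> charts_at M x \<Longrightarrow> c \<in> atlas M" "c \<in> charts_at M x \<Longrightarrow> x \<in> fst c"
  by (auto simp: charts_at_def)

lemma charts_at_ex: "x \<in> topspace (mtop M) \<Longrightarrow> \<exists>c. c \<in> charts_at M x"
proof -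
  assume "x \<in> topspace (mtop M)"
  then have "x \<in> (\<Union>c \<in> atlas M. fst c)" using smooth_manifold unfolding smooth_manifold_def by simp
  then show ?thesis unfolding charts_at_def by blast
qed

lemma chart_inj: "c \<in> atlas M \<Longrightarrow> inj_on (snd c) (fst c)"
  using homeomorphic_imp_injective_map[OF chart_homeo] chart_subset by (simp add: inf.absorb2)

lemma inv_chart: "c \<in> atlas M \<Longrightarrow> y \<in> fst c \<Longrightarrow> inv_chart c (snd c y) = y"
  unfolding inv_chart_def by (rule inv_into_f_f[OF chart_inj])

lemma chart_open: "c \<in> atlas M \<Longrightarrow> openin (mtop M) W \<Longrightarrow> open (snd c ` (fst c \<inter> W))"
proof -
  assume c: "c \<in> atlas M" and W: "openin (mtop M) W"
  have "openin (subtopology (mtop M) (fst c)) (fst c \<inter> W)" using W by (rule openin_subtopology_Int2)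
  then have "openin (top_of_set (snd c ` fst c)) (snd c ` (fst c \<inter> W))"
    using homeomorphic_imp_open_map[OF chart_homeo[OF c]] unfolding open_map_def by auto
  then show ?thesis using chart_image_open[OF c] openin_open_eq by blast
qed

lemma chart_continuous: "c \<in> atlas M \<Longrightarrow> continuous_map (subtopology (mtop M) (fst c)) euclidean (snd c)"
  using homeomorphic_imp_continuous_map[OF chart_homeo] continuous_map_in_subtopology by blast

end

text \<open>Pointwise, because differentiability of \<tau> is obtained from expressions valid only
  near a point. Continuity near \<open>x\<close> is included so that the points sent into a given
  chart domain form an open set, on which chart expressions can be composed.\<close>

definition mdiff ::
  "('a, 'm::finite, 'z) mfd_scheme \<Rightarrow> ('b, 'm, 'w) mfd_scheme \<Rightarrow> ('a \<Rightarrow> 'b) \<Rightarrow> 'a \<Rightarrow> bool" where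
  "mdiff M N f x \<longleftrightarrow>
     (\<exists>U. openin (mtop M) U \<and> x \<in> U \<and> continuous_map (subtopology (mtop M) U) (mtop N) f) \<and>
     (\<forall>c \<in> charts_at M x. \<forall>d \<in> charts_at N (f x). (snd d \<circ> f \<circ> inv_chart c) differentiable (at (snd c x)))"

abbreviation jac ::
  "('a \<Rightarrow> 'b) \<Rightarrow> 'a \<Rightarrow> ('a, 'm::finite) chart \<Rightarrow> ('b, 'm) chart \<Rightarrow> real^'m \<Rightarrow> real^'m" where
  "jac f x c d \<equiv> frechet_derivative (snd d \<circ> f \<circ> inv_chart c) (at (snd c x))"

lemma mdiff_topspace: "mdiff M N f x \<Longrightarrow> x \<in> topspace (mtop M) \<and> f x \<in> topspace (mtop N)"
proof -
  assume "mdiff M N f x"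
  then obtain U where U: "openin (mtop M) U" "x \<in> U" "continuous_map (subtopology (mtop M) U) (mtop N) f"
    unfolding mdiff_def by blast
  then show ?thesis using openin_subset[OF U(1)] continuous_map_image_subset_topspace[OF U(3)] by auto
qed

lemma mdiff_deriv:
  "mdiff M N f x \<Longrightarrow> c \<in> charts_at M x \<Longrightarrow> d \<in> charts_at N (f x) \<Longrightarrow>
    ((snd d \<circ> f \<circ> inv_chart c) has_derivative jac f x c d) (at (snd c x))"
  unfolding mdiff_def using frechet_derivative_works by blast

lemma (in manifold) mdiff_smooth_map:
  assumes "openin (mtop M) U" "x \<in> U" "smooth_map_on M N U f"
  shows "mdiff M N f x"
  unfolding mdiff_def
proof (intro conjI ballI)
  show "\<exists>U. openin (mtop M) U \<and> x \<in> U \<and> continuous_map (subtopology (mtop M) U) (mtop N) f"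
    using assms unfolding smooth_map_on_def by blast
  fix c d assume "c \<in> charts_at M x" "d \<in> charts_at N (f x)"
  then have "smooth_on (snd c ` (U \<inter> fst c \<inter> f -` fst d)) (snd d \<circ> f \<circ> inv_chart c)"
    "snd c x \<in> snd c ` (U \<inter> fst c \<inter> f -` fst d)"
    using assms unfolding smooth_map_on_def charts_at_def by auto
  then show "(snd d \<circ> f \<circ> inv_chart c) differentiable (at (snd c x))" by (rule smooth_on_deriv(1))
qed

lemma (in manifold) mdiff_ident: "x \<in> topspace (mtop M) \<Longrightarrow> mdiff M M (\<lambda>x. x) x"
  unfolding mdiff_def
proof (intro conjI ballI)
  assume "x \<in> topspace (mtop M)"
  then show "\<exists>U. openin (mtop M) U \<and> x \<in> U \<and> continuous_map (subtopology (mtop M) U) (mtop M) (\<lambda>x. x)"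
    by (intro exI[of _ "topspace (mtop M)"]) simp
  fix c d assume "c \<in> charts_at M x" "d \<in> charts_at M x"
  then have "smooth_on (snd c ` (fst c \<inter> fst d)) (snd d \<circ> inv_chart c)"
    "snd c x \<in> snd c ` (fst c \<inter> fst d)"
    using smooth_manifold unfolding smooth_manifold_def charts_at_def by auto
  moreover have "snd d \<circ> (\<lambda>x. x) \<circ> inv_chart c = snd d \<circ> inv_chart c" by (simp add: comp_def)
  ultimately show "(snd d \<circ> (\<lambda>x. x) \<circ> inv_chart c) differentiable (at (snd c x))"
    using smooth_on_deriv(1) by metis
qed

lemma (in manifold) openin_preimage:
  assumes "openin (mtop M) U" "continuous_map (subtopology (mtop M) U) T f" "openin T V"
  shows "openin (mtop M) {z \<in> U. f z \<in> V}"
proof -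
  have "openin (subtopology (mtop M) U) {z \<in> topspace (subtopology (mtop M) U). f z \<in> V}"
    using assms(2,3) by (rule openin_continuous_map_preimage)
  then have "openin (mtop M) {z \<in> topspace (subtopology (mtop M) U). f z \<in> V}"
    using assms(1) by (rule openin_trans_full)
  moreover have "{z \<in> topspace (subtopology (mtop M) U). f z \<in> V} = {z \<in> U. f z \<in> V}"
    using openin_subset[OF assms(1)] by auto
  ultimately show ?thesis by simp
qed

text \<open>The chart expressions of \<open>g\<close> and \<open>f\<close> compose to that of
  \<open>g \<circ> f\<close> only at points that \<open>f\<close> sends into the domain of
  \<open>d\<close>. These form a neighbourhood of \<open>x\<close>, which is all that the derivative
  sees.\<close>

lemma mdiff_chain:
  assumes M: "manifold M" and N: "manifold N" and f: "mdiff M N f x" and g: "mdiff N Q g (f x)"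
    and c: "c \<in> charts_at M x" and d: "d \<in> charts_at N (f x)" and b: "b \<in> charts_at Q (g (f x))"
  shows "((snd b \<circ> (g \<circ> f) \<circ> inv_chart c) has_derivative jac g (f x) d b \<circ> jac f x c d) (at (snd c x))"
proof -
  interpret M: manifold M by fact
  interpret N: manifold N by fact
  have cM: "c \<in> atlas M" "x \<in> fst c" and dN: "d \<in> atlas N" "f x \<in> fst d"
    using c d by (auto simp: charts_at_def)
  obtain U where U: "openin (mtop M) U" "x \<in> U" "continuous_map (subtopology (mtop M) U) (mtop N) f"
    using f unfolding mdiff_def by blast
  define W where "W = {z \<in> U. f z \<in> fst d}"
  have W: "openin (mtop M) W" unfolding W_def
    by (rule M.openin_preimage[OF U(1,3) N.chart_openin[OF dN(1)]])
  have "((snd b \<circ> g \<circ> inv_chart d) \<circ> (snd d \<circ> f \<circ> inv_chart c) has_derivative jac g (f x) d b \<circ> jac f x c d) (at (snd c x))"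
  proof (rule diff_chain_at)
    show "((snd d \<circ> f \<circ> inv_chart c) has_derivative jac f x c d) (at (snd c x))"
      by (rule mdiff_deriv[OF f c d])
    have "(snd d \<circ> f \<circ> inv_chart c) (snd c x) = snd d (f x)" using M.inv_chart[OF cM] by simp
    then show "((snd b \<circ> g \<circ> inv_chart d) has_derivative jac g (f x) d b) (at ((snd d \<circ> f \<circ> inv_chart c) (snd c x)))"
      using mdiff_deriv[OF g d b] by simp
  qed
  then show ?thesis
  proof (rule has_derivative_transform_within_open)
    show "open (snd c ` (fst c \<inter> W))" by (rule M.chart_open[OF cM(1) W])
    show "snd c x \<in> snd c ` (fst c \<inter> W)" using cM dN U(2) by (auto simp: W_def)
    fix y assume "y \<in> snd c ` (fst c \<inter> W)"
    then obtain z where z: "z \<in> fst c" "z \<in> W" "y = snd c z" by blast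
    then show "((snd b \<circ> g \<circ> inv_chart d) \<circ> (snd d \<circ> f \<circ> inv_chart c)) y = (snd b \<circ> (g \<circ> f) \<circ> inv_chart c) y"
      using M.inv_chart[OF cM(1)] N.inv_chart[OF dN(1)] by (simp add: W_def)
  qed
qed

lemma mdiff_compose:
  assumes M: "manifold M" and N: "manifold N" and f: "mdiff M N f x" and g: "mdiff N Q g (f x)"
  shows "mdiff M Q (g \<circ> f) x"
  unfolding mdiff_def
proof (intro conjI ballI)
  interpret M: manifold M by fact
  interpret N: manifold N by fact
  obtain U where U: "openin (mtop M) U" "x \<in> U" "continuous_map (subtopology (mtop M) U) (mtop N) f"
    using f unfolding mdiff_def by blast
  obtain V where V: "openin (mtop N) V" "f x \<in> V" "continuous_map (subtopology (mtop N) V) (mtop Q) g"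
    using g unfolding mdiff_def by blast
  have W: "openin (mtop M) {z \<in> U. f z \<in> V}" by (rule M.openin_preimage[OF U(1,3) V(1)])
  have "continuous_map (subtopology (mtop M) {z \<in> U. f z \<in> V}) (subtopology (mtop N) V) f"
    using continuous_map_from_subtopology_mono[OF U(3), of "{z \<in> U. f z \<in> V}"]
    by (auto simp: continuous_map_in_subtopology)
  from continuous_map_compose[OF this V(3)]
  show "\<exists>U. openin (mtop M) U \<and> x \<in> U \<and> continuous_map (subtopology (mtop M) U) (mtop Q) (g \<circ> f)"
    using W U V by (intro exI[of _ "{z \<in> U. f z \<in> V}"]) auto
  fix c b assume c: "c \<in> charts_at M x" and b: "b \<in> charts_at Q ((g \<circ> f) x)"
  obtain d where d: "d \<in> charts_at N (f x)" using N.charts_at_ex mdiff_topspace[OF f] by blast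
  show "(snd b \<circ> (g \<circ> f) \<circ> inv_chart c) differentiable (at (snd c x))"
    using differentiableI[OF mdiff_chain[OF M N f g c d]] b by (simp del: split_paired_All)
qed

lemma jac_compose:
  assumes "manifold M" "manifold N" "mdiff M N f x" "mdiff N Q g (f x)"
    "c \<in> charts_at M x" "d \<in> charts_at N (f x)" "b \<in> charts_at Q (g (f x))"
  shows "jac (g \<circ> f) x c b = jac g (f x) d b \<circ> jac f x c d"
  using frechet_derivative_at[OF mdiff_chain[OF assms]] by simp

text \<open>The transition rule is rephrased with the Jacobian of the identity map, so that
  independence of charts becomes an instance of the chain rule \<open>jac_compose\<close>.\<close>

lemma tangent_space_alt:
  "v \<in> tangent_space M x \<longleftrightarrow> (\<forall>c. c \<notin> charts_at M x \<longrightarrow> v c = 0) \<and>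
     (\<forall>c \<in> charts_at M x. \<forall>d \<in> charts_at M x. v d = jac (\<lambda>x. x) x c d (v c))"
  unfolding tangent_space_def by (simp add: comp_def)

lemma tangent_space_jac:
  "v \<in> tangent_space M x \<Longrightarrow> c \<in> charts_at M x \<Longrightarrow> d \<in> charts_at M x \<Longrightarrow> jac (\<lambda>x. x) x c d (v c) = v d"
  unfolding tangent_space_alt by (metis (no_types, lifting))

lemma tangent_space_outside: "v \<in> tangent_space M x \<Longrightarrow> c \<notin> charts_at M x \<Longrightarrow> v c = 0"
  unfolding tangent_space_alt by blast

text \<open>The definition picks a chart arbitrarily; composing with the identity of
  \<open>M\<close> in the chain rule moves the result to any chart \<open>c\<close>.\<close>

lemma tangent_map_eq:
  assumes M: "manifold M" and f: "mdiff M N f x" and v: "v \<in> tangent_space M x"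
    and c: "c \<in> charts_at M x" and d: "d \<in> charts_at N (f x)"
  shows "tangent_map M N f x v d = jac f x c d (v c)"
proof -
  interpret M: manifold M by fact
  define c' where "c' = (SOME c. c \<in> charts_at M x)"
  have c': "c' \<in> charts_at M x" unfolding c'_def using c by (rule someI)
  have "jac f x c' d = jac f x c d \<circ> jac (\<lambda>x. x) x c' c"
    using jac_compose[where f = "\<lambda>x. x" and g = f and x = x and M = M and N = M and Q = N and c = c' and d = c and b = d]
      M M.mdiff_ident mdiff_topspace[OF f] f c' c d by (simp add: comp_def)
  then have "jac f x c' d (v c') = jac f x c d (v c)" using tangent_space_jac[OF v c' c] by simp
  then show ?thesis using d by (simp add: tangent_map_def Let_def c'_def[symmetric])
qed

lemma tangent_map_outside: "d \<notin> charts_at N (f x) \<Longrightarrow> tangent_map M N f x v d = 0"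
  by (simp add: tangent_map_def Let_def)

lemma tangent_map_in:
  assumes M: "manifold M" and N: "manifold N" and f: "mdiff M N f x" and v: "v \<in> tangent_space M x"
  shows "tangent_map M N f x v \<in> tangent_space N (f x)"
  unfolding tangent_space_alt
proof (intro conjI allI impI ballI)
  interpret M: manifold M by fact
  interpret N: manifold N by fact
  fix d d' assume d: "d \<in> charts_at N (f x)" "d' \<in> charts_at N (f x)"
  obtain c where c: "c \<in> charts_at M x" using M.charts_at_ex mdiff_topspace[OF f] by blast
  have "jac f x c d' = jac (\<lambda>x. x) (f x) d d' \<circ> jac f x c d"
    using jac_compose[where f = f and g = "\<lambda>x. x" and x = x and M = M and N = N and Q = N and c = c and d = d and b = d']
      M N N.mdiff_ident mdiff_topspace[OF f] f c d by (simp add: comp_def)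
  then show "tangent_map M N f x v d' = jac (\<lambda>x. x) (f x) d d' (tangent_map M N f x v d)"
    by (simp add: tangent_map_eq[OF M f v c] d)
qed (rule tangent_map_outside)

lemma tangent_map_compose:
  assumes M: "manifold M" and N: "manifold N" and f: "mdiff M N f x" and g: "mdiff N Q g (f x)"
    and v: "v \<in> tangent_space M x"
  shows "tangent_map M Q (g \<circ> f) x v = tangent_map N Q g (f x) (tangent_map M N f x v)"
proof
  interpret M: manifold M by fact
  interpret N: manifold N by fact
  fix b
  obtain c where c: "c \<in> charts_at M x" using M.charts_at_ex mdiff_topspace[OF f] by blast
  obtain d where d: "d \<in> charts_at N (f x)" using N.charts_at_ex mdiff_topspace[OF f] by blast
  show "tangent_map M Q (g \<circ> f) x v b = tangent_map N Q g (f x) (tangent_map M N f x v) b"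
  proof (cases "b \<in> charts_at Q (g (f x))")
    case True
    show ?thesis
      using tangent_map_eq[OF M mdiff_compose[OF M N f g] v c, of b]
        tangent_map_eq[OF N g tangent_map_in[OF M N f v] d True] tangent_map_eq[OF M f v c d]
        jac_compose[OF M N f g c d True] True by simp
  qed (simp add: tangent_map_outside)
qed

lemma tangent_map_ident:
  assumes M: "manifold M" and x: "x \<in> topspace (mtop M)" and v: "v \<in> tangent_space M x"
  shows "tangent_map M M (\<lambda>x. x) x v = v"
proof
  interpret M: manifold M by fact
  fix d
  obtain c where c: "c \<in> charts_at M x" using M.charts_at_ex x by blast
  show "tangent_map M M (\<lambda>x. x) x v d = v d"
  proof (cases "d \<in> charts_at M x")
    case True
    then show ?thesis
      using tangent_map_eq[OF M M.mdiff_ident[OF x] v c, of d] tangent_space_jac[OF v c] by simp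
  next
    case False
    then show ?thesis using tangent_space_outside[OF v] by (simp add: tangent_map_outside)
  qed
qed

text \<open>Derivatives are local. This is applied to identities such as \<tau> = g \<circ> \<pi>
  that hold only near a point.\<close>

lemma mdiff_cong:
  assumes M: "manifold M" and f: "mdiff M N f x" and W: "openin (mtop M) W" "x \<in> W"
    and eq: "\<And>y. y \<in> W \<Longrightarrow> f y = g y"
  shows "mdiff M N g x" and "tangent_map M N f x v = tangent_map M N g x v"
proof -
  interpret M: manifold M by fact
  have d: "((snd d \<circ> g \<circ> inv_chart c) has_derivative jac f x c d) (at (snd c x))"
    if c: "c \<in> charts_at M x" and d: "d \<in> charts_at N (f x)" for c d
  proof (rule has_derivative_transform_within_open[OF mdiff_deriv[OF f c d]])
    show "open (snd c ` (fst c \<inter> W))" by (rule M.chart_open[OF M.charts_atD(1)[OF c] W(1)])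
    show "snd c x \<in> snd c ` (fst c \<inter> W)" using M.charts_atD(2)[OF c] W by blast
    fix y assume "y \<in> snd c ` (fst c \<inter> W)"
    then show "(snd d \<circ> f \<circ> inv_chart c) y = (snd d \<circ> g \<circ> inv_chart c) y"
      using M.inv_chart[OF M.charts_atD(1)[OF c]] eq by auto
  qed
  have fg: "g x = f x" using eq W by simp
  have j: "jac g x c d = jac f x c d" if "c \<in> charts_at M x" "d \<in> charts_at N (f x)" for c d
    using frechet_derivative_at[OF d[OF that]] by simp
  show "mdiff M N g x"
    unfolding mdiff_def
  proof (intro conjI ballI)
    obtain U where U: "openin (mtop M) U" "x \<in> U" "continuous_map (subtopology (mtop M) U) (mtop N) f"
      using f unfolding mdiff_def by blast
    have "continuous_map (subtopology (mtop M) (U \<inter> W)) (mtop N) g"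
      by (rule continuous_map_eq[OF continuous_map_from_subtopology_mono[OF U(3)]]) (use eq in auto)
    then show "\<exists>U. openin (mtop M) U \<and> x \<in> U \<and> continuous_map (subtopology (mtop M) U) (mtop N) g"
      using U W by (intro exI[of _ "U \<inter> W"]) auto
    fix c b assume "c \<in> charts_at M x" "b \<in> charts_at N (g x)"
    then show "(snd b \<circ> g \<circ> inv_chart c) differentiable (at (snd c x))"
      using d differentiableI fg by metis
  qed
  show "tangent_map M N f x v = tangent_map M N g x v"
  proof
    fix b
    obtain c0 where c0: "c0 \<in> charts_at M x" using M.charts_at_ex mdiff_topspace[OF f] by blast
    have c: "(SOME c. c \<in> charts_at M x) \<in> charts_at M x" using c0 by (rule someI)
    show "tangent_map M N f x v b = tangent_map M N g x v b"
      by (simp add: tangent_map_def Let_def fg j[OF c])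
  qed
qed

lemma tangent_map_sum:
  assumes M: "manifold M" and f: "mdiff M N f x" and S: "finite S"
  shows "tangent_map M N f x (\<lambda>c. \<Sum>j\<in>S. a j *\<^sub>R v j c) = (\<lambda>d. \<Sum>j\<in>S. a j *\<^sub>R tangent_map M N f x (v j) d)"
proof
  interpret M: manifold M by fact
  fix d
  obtain c0 where c0: "c0 \<in> charts_at M x" using M.charts_at_ex mdiff_topspace[OF f] by blast
  have c: "(SOME c. c \<in> charts_at M x) \<in> charts_at M x" using c0 by (rule someI)
  show "tangent_map M N f x (\<lambda>c. \<Sum>j\<in>S. a j *\<^sub>R v j c) d = (\<Sum>j\<in>S. a j *\<^sub>R tangent_map M N f x (v j) d)"
  proof (cases "d \<in> charts_at N (f x)")
    case True
    have "linear (jac f x (SOME c. c \<in> charts_at M x) d)"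
      using has_derivative_linear[OF mdiff_deriv[OF f c True]] .
    then show ?thesis using True by (simp add: tangent_map_def Let_def linear_sum linear_scale)
  qed (simp add: tangent_map_outside)
qed

lemma tangent_space_sum:
  assumes M: "manifold M" and x: "x \<in> topspace (mtop M)"
    and v: "\<And>j. j \<in> S \<Longrightarrow> v j \<in> tangent_space M x"
  shows "(\<lambda>c. \<Sum>j\<in>S. a j *\<^sub>R v j c) \<in> tangent_space M x"
  unfolding tangent_space_alt
proof (intro conjI allI impI ballI)
  interpret M: manifold M by fact
  fix c show "c \<notin> charts_at M x \<Longrightarrow> (\<Sum>j\<in>S. a j *\<^sub>R v j c) = 0"
    using tangent_space_outside[OF v] by simp
next
  interpret M: manifold M by fact
  fix c d assume cd: "c \<in> charts_at M x" "d \<in> charts_at M x"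
  have "linear (jac (\<lambda>x. x) x c d)"
    using has_derivative_linear[OF mdiff_deriv[OF M.mdiff_ident[OF x] cd]] .
  then show "(\<Sum>j\<in>S. a j *\<^sub>R v j d) = jac (\<lambda>x. x) x c d (\<Sum>j\<in>S. a j *\<^sub>R v j c)"
    using tangent_space_jac[OF v cd] by (simp add: linear_sum linear_scale)
qed

lemma tangent_space_eqI:
  assumes "v \<in> tangent_space M x" "w \<in> tangent_space M x" "c \<in> charts_at M x" "v c = w c"
  shows "v = w"
proof
  fix d
  show "v d = w d"
  proof (cases "d \<in> charts_at M x")
    case True
    then show ?thesis using tangent_space_jac[OF assms(1,3) True] tangent_space_jac[OF assms(2,3) True] assms(4) by metis
  next
    case False
    then show ?thesis using tangent_space_outside[OF assms(1) False] tangent_space_outside[OF assms(2) False] by simp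
  qed
qed

lemma coord_vector:
  assumes M: "manifold M" and c: "c \<in> charts_at M x"
  shows "coord_vector M c x a \<in> tangent_space M x" "coord_vector M c x a c = a"
proof -
  interpret M: manifold M by fact
  have x: "x \<in> topspace (mtop M)" by (rule M.charts_at_topspace[OF c])
  have e: "coord_vector M c x a d = jac (\<lambda>x. x) x c d a" if "d \<in> charts_at M x" for d
    using that by (simp add: coord_vector_def comp_def)
  show "coord_vector M c x a \<in> tangent_space M x"
    unfolding tangent_space_alt
  proof (intro conjI allI impI ballI)
    fix d show "d \<notin> charts_at M x \<Longrightarrow> coord_vector M c x a d = 0" by (simp add: coord_vector_def)
  next
    fix d d' assume d: "d \<in> charts_at M x" "d' \<in> charts_at M x"
    have "jac (\<lambda>x. x) x c d' = jac (\<lambda>x. x) x d d' \<circ> jac (\<lambda>x. x) x c d"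
      using jac_compose[where f = "\<lambda>x. x" and g = "\<lambda>x. x" and x = x and M = M and N = M and Q = M and c = c and d = d and b = d']
      M M.mdiff_ident x c d by (simp add: comp_def)
    then show "coord_vector M c x a d' = jac (\<lambda>x. x) x d d' (coord_vector M c x a d)"
      using e[OF d(1)] e[OF d(2)] by simp
  qed
  have "((snd c \<circ> (\<lambda>x. x) \<circ> inv_chart c) has_derivative id) (at (snd c x))"
  proof (rule has_derivative_transform_within_open[OF has_derivative_id])
    show "open (snd c ` fst c)" using M.chart_image_open M.charts_atD[OF c] by blast
    show "snd c x \<in> snd c ` fst c" using M.charts_atD[OF c] by blast
    fix y assume "y \<in> snd c ` fst c"
    then show "id y = (snd c \<circ> (\<lambda>x. x) \<circ> inv_chart c) y" using M.inv_chart[OF M.charts_atD(1)[OF c]] by auto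
  qed
  then have "jac (\<lambda>x. x) x c c = id" using frechet_derivative_at by metis
  then show "coord_vector M c x a c = a" using e[OF c] by simp
qed

section \<open>Frames, their matrices and their images under tangent maps\<close>

lemma frame_mult_simps: "fst (frame_mult e A) = fst e" "snd (frame_mult e A) = (\<lambda>i c. \<Sum>j\<in>UNIV. A $ j $ i *\<^sub>R snd e j c)"
  by (simp_all add: frame_mult_def)

lemma frame_mult_mult: "frame_mult (frame_mult e A) B = frame_mult e (A ** B)"
proof (rule prod_eqI)
  show "snd (frame_mult (frame_mult e A) B) = snd (frame_mult e (A ** B))"
  proof (intro ext)
    fix i c
    have "(\<Sum>k\<in>UNIV. B $ k $ i *\<^sub>R (\<Sum>j\<in>UNIV. A $ j $ k *\<^sub>R snd e j c))
        = (\<Sum>k\<in>UNIV. \<Sum>j\<in>UNIV. (A $ j $ k * B $ k $ i) *\<^sub>R snd e j c)"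
      by (simp add: scaleR_sum_right mult.commute)
    also have "\<dots> = (\<Sum>j\<in>UNIV. \<Sum>k\<in>UNIV. (A $ j $ k * B $ k $ i) *\<^sub>R snd e j c)" by (rule sum.swap)
    finally show "snd (frame_mult (frame_mult e A) B) i c = snd (frame_mult e (A ** B)) i c"
      by (simp add: frame_mult_simps matrix_matrix_mult_def scaleR_sum_left)
  qed
qed (simp add: frame_mult_simps)

lemma frame_mult_one: "frame_mult e (mat 1) = e"
proof (rule prod_eqI)
  have "(\<Sum>j\<in>UNIV. (mat 1 :: real^'b^'b) $ j $ i *\<^sub>R snd e j c) = snd e i c" for i c
    by (simp add: mat_def if_distrib[of "\<lambda>x. x *\<^sub>R _"] cong: if_cong)
  then show "snd (frame_mult e (mat 1)) = snd e" by (simp add: frame_mult_simps)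
qed (simp add: frame_mult_simps)

lemma frame_matrix_mult: "frame_matrix c (frame_mult e A) = frame_matrix c e ** A"
proof -
  have "(\<Sum>k\<in>UNIV. A $ k $ j *\<^sub>R snd e k c) $ i = (\<Sum>k\<in>UNIV. snd e k c $ i * A $ k $ j)" for i j
    by (simp add: sum_component mult.commute)
  then show ?thesis
    by (simp only: frame_matrix_def frame_mult_simps matrix_matrix_mult_def vec_eq_iff vec_lambda_beta simp_thms)
qed

text \<open>No linear independence is asked, so that \<open>frame_mult\<close> and
  \<open>frame_map\<close> stay inside for arbitrary matrices and differentiable maps; linear and
  orthonormal frames are carved out afterwards.\<close>

definition tangent_frames :: "('a, 'm::finite, 'z) mfd_scheme \<Rightarrow> ('a, 'm) frame set" where
  "tangent_frames M = {e. fst e \<in> topspace (mtop M) \<and> (\<forall>i. snd e i \<in> tangent_space M (fst e))}"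

lemma frame_eqI:
  assumes "e \<in> tangent_frames M" "e' \<in> tangent_frames M" "fst e = fst e'" "c \<in> charts_at M (fst e)"
    "frame_matrix c e = frame_matrix c e'"
  shows "e = e'"
proof (rule prod_eqI)
  have "snd e i = snd e' i" for i
  proof (rule tangent_space_eqI[of _ M "fst e" _ c])
    show "snd e i c = snd e' i c"
    proof (rule vec_eq_iff[THEN iffD2, rule_format])
      fix k
      have "frame_matrix c e $ k $ i = frame_matrix c e' $ k $ i" using assms(5) by simp
      then show "snd e i c $ k = snd e' i c $ k" by (simp add: frame_matrix_def)
    qed
  qed (use assms in \<open>auto simp: tangent_frames_def\<close>)
  then show "snd e = snd e'" by blast
qed fact

lemma frame_mult_tangent:
  "manifold M \<Longrightarrow> e \<in> tangent_frames M \<Longrightarrow> frame_mult e A \<in> tangent_frames M"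
  unfolding tangent_frames_def mem_Collect_eq frame_mult_simps
  by (intro conjI allI tangent_space_sum) simp_all

lemma frame_map_simps: "fst (frame_map M N f e) = f (fst e)" "snd (frame_map M N f e) = (\<lambda>i. tangent_map M N f (fst e) (snd e i))"
  by (simp_all add: frame_map_def)

lemma frame_map_tangent:
  "manifold M \<Longrightarrow> manifold N \<Longrightarrow> mdiff M N f (fst e) \<Longrightarrow> e \<in> tangent_frames M \<Longrightarrow> frame_map M N f e \<in> tangent_frames N"
  unfolding tangent_frames_def mem_Collect_eq frame_map_simps
  by (intro conjI allI tangent_map_in mdiff_topspace[THEN conjunct2]) simp_all

lemma frame_map_mult:
  assumes "manifold M" "mdiff M N f (fst e)"
  shows "frame_map M N f (frame_mult e A) = frame_mult (frame_map M N f e) A"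
  unfolding frame_map_def frame_mult_def by (simp add: tangent_map_sum[OF assms])

lemma frame_map_compose:
  assumes "manifold M" "manifold N" "mdiff M N f (fst e)" "mdiff N Q g (f (fst e))" "e \<in> tangent_frames M"
  shows "frame_map M Q (g \<circ> f) e = frame_map N Q g (frame_map M N f e)"
  using tangent_map_compose[OF assms(1-4)] assms(5) by (simp add: frame_map_def tangent_frames_def)

lemma frame_map_ident: "manifold M \<Longrightarrow> e \<in> tangent_frames M \<Longrightarrow> frame_map M M (\<lambda>x. x) e = e"
  by (rule prod_eqI) (simp_all add: frame_map_def tangent_frames_def tangent_map_ident)

lemma frame_map_cong:
  assumes "manifold M" "mdiff M N f (fst e)" "openin (mtop M) W" "fst e \<in> W" "\<And>y. y \<in> W \<Longrightarrow> f y = g y"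
  shows "frame_map M N f e = frame_map M N g e"
  using mdiff_cong(2)[OF assms] assms(4,5) by (simp add: frame_map_def)

lemma frame_matrix_map:
  assumes "manifold M" "mdiff M N f (fst e)" "e \<in> tangent_frames M" "c \<in> charts_at M (fst e)" "d \<in> charts_at N (f (fst e))"
  shows "frame_matrix d (frame_map M N f e) = matrix (jac f (fst e) c d) ** frame_matrix c e"
proof -
  have "linear (jac f (fst e) c d)" using has_derivative_linear[OF mdiff_deriv[OF assms(2,4,5)]] .
  from matrix_vector_mul(2)[OF this] have "jac f (fst e) c d v = matrix (jac f (fst e) c d) *v v" for v by metis
  then have "jac f (fst e) c d v $ i = (\<Sum>k\<in>UNIV. matrix (jac f (fst e) c d) $ i $ k * v $ k)" for v i
    by (simp only: matrix_vector_mult_def vec_lambda_beta)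
  then show ?thesis
    using tangent_map_eq[OF assms(1,2) _ assms(4,5)] assms(3) unfolding vec_eq_iff
    by (simp add: frame_matrix_def frame_map_simps matrix_matrix_mult_def tangent_frames_def)
qed

definition coord_frame :: "('a, 'm::finite, 'z) mfd_scheme \<Rightarrow> ('a, 'm) chart \<Rightarrow> 'a \<Rightarrow> ('a, 'm) frame" where
  "coord_frame M c x = (x, \<lambda>i. coord_vector M c x (axis i 1))"

lemma coord_frame:
  assumes M: "manifold M" and c: "c \<in> charts_at M x"
  shows "coord_frame M c x \<in> tangent_frames M" "frame_matrix c (coord_frame M c x) = mat 1" "fst (coord_frame M c x) = x"
proof -
  interpret M: manifold M by fact
  show "coord_frame M c x \<in> tangent_frames M"
    using coord_vector[OF M c] M.charts_at_topspace[OF c] by (simp add: coord_frame_def tangent_frames_def)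
  show "frame_matrix c (coord_frame M c x) = mat 1"
    by (simp add: coord_frame_def frame_matrix_def coord_vector[OF M c] vec_eq_iff mat_def axis_def)
qed (simp add: coord_frame_def)

lemma frame_coord:
  assumes M: "manifold M" and e: "e \<in> tangent_frames M" and c: "c \<in> charts_at M (fst e)"
  shows "e = frame_mult (coord_frame M c (fst e)) (frame_matrix c e)"
  by (rule frame_eqI[OF e frame_mult_tangent[OF M coord_frame(1)[OF M c]] _ c])
    (simp_all add: frame_mult_simps frame_matrix_mult coord_frame[OF M c])

lemma linear_frames_alt: "linear_frames M = {e \<in> tangent_frames M. \<forall>c \<in> charts_at M (fst e). det (frame_matrix c e) \<noteq> 0}"
  by (auto simp: linear_frames_def tangent_frames_def)

text \<open>A nonzero determinant in one chart implies the same in all charts: the matrices of a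
  frame in two charts differ by the matrix of a coordinate frame, and determinants are
  multiplicative.\<close>

lemma linear_frames_iff:
  assumes M: "manifold M" and c: "c \<in> charts_at M (fst e)"
  shows "e \<in> linear_frames M \<longleftrightarrow> e \<in> tangent_frames M \<and> det (frame_matrix c e) \<noteq> 0"
proof -
  have "det (frame_matrix d e) \<noteq> 0" if e: "e \<in> tangent_frames M" "det (frame_matrix c e) \<noteq> 0" "d \<in> charts_at M (fst e)" for d
  proof -
    have "frame_matrix c e = frame_matrix c (coord_frame M d (fst e)) ** frame_matrix d e"
      using frame_coord[OF M e(1,3)] frame_matrix_mult by metis
    then show ?thesis using e(2) by (metis det_mul mult_zero_right)
  qed
  then show ?thesis using c by (auto simp: linear_frames_alt)
qed

lemma coord_frame_linear: "manifold M \<Longrightarrow> c \<in> charts_at M x \<Longrightarrow> coord_frame M c x \<in> linear_frames M"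
  using linear_frames_iff[of M c "coord_frame M c x"] coord_frame[of M c x] by simp

lemma frame_mult_linear_iff:
  assumes M: "manifold M" and e: "e \<in> linear_frames M"
  shows "frame_mult e A \<in> linear_frames M \<longleftrightarrow> det A \<noteq> 0"
proof -
  interpret M: manifold M by fact
  have et: "e \<in> tangent_frames M" using e by (simp add: linear_frames_alt)
  then obtain c where c: "c \<in> charts_at M (fst e)" using M.charts_at_ex unfolding tangent_frames_def by blast
  show ?thesis
    using linear_frames_iff[OF M, of c "frame_mult e A"] linear_frames_iff[OF M c] frame_mult_tangent[OF M et] c e
    by (simp add: frame_mult_simps frame_matrix_mult det_mul)
qed

lemma linear_frames_transitive:
  assumes M: "manifold M" and e: "e \<in> linear_frames M" "e' \<in> linear_frames M" "fst e = fst e'"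
  shows "\<exists>A. det A \<noteq> 0 \<and> e' = frame_mult e A"
proof -
  interpret M: manifold M by fact
  have et: "e \<in> tangent_frames M" "e' \<in> tangent_frames M" using e by (simp_all add: linear_frames_alt)
  then obtain c where c: "c \<in> charts_at M (fst e)" using M.charts_at_ex unfolding tangent_frames_def by blast
  have d: "det (frame_matrix c e) \<noteq> 0" "det (frame_matrix c e') \<noteq> 0"
    using linear_frames_iff[OF M c] linear_frames_iff[OF M, of c e'] c e by auto
  then obtain B where B: "frame_matrix c e ** B = mat 1" using invertible_det_nz invertible_def by blast
  define A where "A = B ** frame_matrix c e'"
  have "frame_matrix c e' = frame_matrix c (frame_mult e A)"
    by (simp add: frame_matrix_mult A_def matrix_mul_assoc B)
  then have "e' = frame_mult e A"
    using frame_eqI[OF et(2) frame_mult_tangent[OF M et(1)]] c e(3) by (simp add: frame_mult_simps)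
  moreover have "det A \<noteq> 0"
    using calculation frame_mult_linear_iff[OF M e(1)] e(2) by blast
  ultimately show ?thesis by blast
qed

section \<open>Orthonormal frame bundles\<close>

locale riemannian =
  fixes M :: "('a, 'm::finite, 'z) mfd_scheme"
  assumes riemannian_manifold: "riemannian_manifold M"
begin

sublocale manifold
  using riemannian_manifold by unfold_locales (simp add: riemannian_manifold_def)

lemma manifold: "manifold M" ..

lemma
  assumes "x \<in> topspace (mtop M)" "v \<in> tangent_space M x"
  shows metric_pos: "v \<noteq> (\<lambda>_. 0) \<Longrightarrow> metric M x v v > 0"
    and metric_sym: "w \<in> tangent_space M x \<Longrightarrow> metric M x v w = metric M x w v"
    and metric_linear: "w \<in> tangent_space M x \<Longrightarrow> z \<in> tangent_space M x \<Longrightarrow>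
       metric M x (\<lambda>c. a *\<^sub>R v c + b *\<^sub>R w c) z = a * metric M x v z + b * metric M x w z"
proof -
  have "\<forall>x \<in> topspace (mtop M).
        (\<forall>v \<in> tangent_space M x. (v \<noteq> (\<lambda>_. 0) \<longrightarrow> metric M x v v > 0) \<and>
           (\<forall>w \<in> tangent_space M x. metric M x v w = metric M x w v \<and>
              (\<forall>z \<in> tangent_space M x. \<forall>a b.
                 metric M x (\<lambda>c. a *\<^sub>R v c + b *\<^sub>R w c) z = a * metric M x v z + b * metric M x w z)))"
    using riemannian_manifold unfolding riemannian_manifold_def by (elim conjE)
  note R = bspec[OF bspec[OF this assms(1)] assms(2)]
  show "v \<noteq> (\<lambda>_. 0) \<Longrightarrow> metric M x v v > 0" by (rule mp[OF conjunct1[OF R]])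
  show "w \<in> tangent_space M x \<Longrightarrow> metric M x v w = metric M x w v"
    by (rule conjunct1[OF bspec[OF conjunct2[OF R]]])
  show "w \<in> tangent_space M x \<Longrightarrow> z \<in> tangent_space M x \<Longrightarrow>
       metric M x (\<lambda>c. a *\<^sub>R v c + b *\<^sub>R w c) z = a * metric M x v z + b * metric M x w z"
    by (rule spec[OF spec[OF bspec[OF conjunct2[OF bspec[OF conjunct2[OF R]]]]]])
qed

lemma metric_sum:
  assumes x: "x \<in> topspace (mtop M)" and z: "z \<in> tangent_space M x" and S: "finite S"
    and v: "\<And>j. j \<in> S \<Longrightarrow> v j \<in> tangent_space M x"
  shows "metric M x (\<lambda>c. \<Sum>j\<in>S. a j *\<^sub>R v j c) z = (\<Sum>j\<in>S. a j * metric M x (v j) z)"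
  using S v
proof (induction S)
  case empty
  show ?case using metric_linear[OF x z z z, of 0 0] by simp
next
  case (insert k S)
  have "(\<lambda>c. \<Sum>j\<in>S. a j *\<^sub>R v j c) \<in> tangent_space M x"
    using insert by (intro tangent_space_sum[OF manifold x]) simp
  then have "metric M x (\<lambda>c. a k *\<^sub>R v k c + 1 *\<^sub>R (\<Sum>j\<in>S. a j *\<^sub>R v j c)) z =
     a k * metric M x (v k) z + 1 * metric M x (\<lambda>c. \<Sum>j\<in>S. a j *\<^sub>R v j c) z"
    using insert by (intro metric_linear[OF x _ _ z]) simp_all
  then show ?case using insert by simp
qed

lemma orthonormal_frames_alt:
  "orthonormal_frames M = {e \<in> tangent_frames M. \<forall>i j. metric M (fst e) (snd e i) (snd e j) = (if i = j then 1 else 0)}"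
  by (auto simp: orthonormal_frames_def tangent_frames_def)

lemma orthonormalD:
  assumes "e \<in> orthonormal_frames M"
  shows "e \<in> tangent_frames M" "fst e \<in> topspace (mtop M)" "snd e i \<in> tangent_space M (fst e)"
    "metric M (fst e) (snd e i) (snd e j) = (if i = j then 1 else 0)"
  using assms by (auto simp: orthonormal_frames_alt tangent_frames_def)

lemma frame_mult_orthonormal:
  assumes e: "e \<in> orthonormal_frames M" and A: "orthogonal_matrix A"
  shows "frame_mult e A \<in> orthonormal_frames M"
  unfolding orthonormal_frames_alt
proof (intro CollectI conjI allI)
  note E = orthonormalD[OF e]
  show "frame_mult e A \<in> tangent_frames M" by (rule frame_mult_tangent[OF manifold E(1)])
  let ?v = "\<lambda>i c. \<Sum>j\<in>UNIV. A $ j $ i *\<^sub>R snd e j c"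
  have v: "?v i \<in> tangent_space M (fst e)" for i by (intro tangent_space_sum[OF manifold E(2)] E(3))
  have 1: "metric M (fst e) (snd e j) (?v k) = A $ j $ k" for j k
  proof -
    have "metric M (fst e) (snd e j) (?v k) = metric M (fst e) (?v k) (snd e j)"
      by (rule metric_sym[OF E(2,3) v])
    also have "\<dots> = (\<Sum>l\<in>UNIV. A $ l $ k * metric M (fst e) (snd e l) (snd e j))"
      by (rule metric_sum[OF E(2,3)]) (simp_all add: E(3))
    also have "\<dots> = A $ j $ k" by (simp add: E(4) if_distrib cong: if_cong)
    finally show ?thesis .
  qed
  fix i k
  have "metric M (fst e) (?v i) (?v k) = (\<Sum>j\<in>UNIV. A $ j $ i * metric M (fst e) (snd e j) (?v k))"
    by (rule metric_sum[OF E(2) v]) (simp_all add: E(3))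
  also have "\<dots> = (transpose A ** A) $ i $ k"
    by (simp add: 1 matrix_matrix_mult_def transpose_def)
  also have "\<dots> = (if i = k then 1 else 0)"
    using A by (simp add: orthogonal_matrix mat_def)
  finally show "metric M (fst (frame_mult e A)) (snd (frame_mult e A) i) (snd (frame_mult e A) k) = (if i = k then 1 else 0)"
    by (simp add: frame_mult_simps)
qed

text \<open>A vector in the kernel of the frame matrix is a linear relation among the frame vectors,
  and pairing this relation with each frame vector makes its coefficients vanish.\<close>

lemma orthonormal_linear: "orthonormal_frames M \<subseteq> linear_frames M"
proof
  fix e assume e: "e \<in> orthonormal_frames M"
  note E = orthonormalD[OF e]
  obtain c where c: "c \<in> charts_at M (fst e)" using charts_at_ex E(2) by blast
  have "det (frame_matrix c e) \<noteq> 0"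
  proof
    assume "det (frame_matrix c e) = 0"
    then obtain y where y: "y \<noteq> 0" "frame_matrix c e *v y = 0"
      using invertible_det_nz[of "frame_matrix c e"] matrix_left_invertible_ker invertible_left_inverse by blast
    let ?w = "\<lambda>d. \<Sum>j\<in>UNIV. y $ j *\<^sub>R snd e j d"
    have w: "?w \<in> tangent_space M (fst e)" by (intro tangent_space_sum[OF manifold E(2)] E(3))
    have "?w c $ i = (frame_matrix c e *v y) $ i" for i
      by (simp add: matrix_vector_mult_def frame_matrix_def mult.commute)
    then have wc: "?w c = 0" using y(2) by (simp add: vec_eq_iff)
    have z: "(\<lambda>d. 0 *\<^sub>R snd e undefined d) = (\<lambda>_. 0)" by simp
    have "(\<lambda>d. \<Sum>j\<in>{undefined}. 0 *\<^sub>R snd e j d) \<in> tangent_space M (fst e)"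
      by (intro tangent_space_sum[OF manifold E(2)] E(3))
    then have w0: "(\<lambda>_. 0) \<in> tangent_space M (fst e)" by simp
    have "?w = (\<lambda>_. 0)"
      by (rule tangent_space_eqI[OF w w0 c wc])
    then have "metric M (fst e) ?w (snd e i) = metric M (fst e) (\<lambda>_. 0) (snd e i)" for i by simp
    moreover have "metric M (fst e) ?w (snd e i) = y $ i" for i
      by (subst metric_sum[OF E(2,3)]) (simp_all add: E(3,4) if_distrib cong: if_cong)
    moreover have "metric M (fst e) (\<lambda>_. 0) (snd e i) = 0" for i
      using metric_linear[OF E(2,3,3,3), of 0 undefined 0 undefined i] by simp
    ultimately show False using y(1) by (simp add: vec_eq_iff)
  qed
  then show "e \<in> linear_frames M" using linear_frames_iff[OF manifold c] E(1) by blast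
qed

lemma topspace_frame_bundle: "topspace (frame_bundle M) = orthonormal_frames M"
proof
  show "topspace (frame_bundle M) \<subseteq> orthonormal_frames M"
    unfolding frame_bundle_def topology_generated_by_topspace by blast
  show "orthonormal_frames M \<subseteq> topspace (frame_bundle M)"
  proof
    fix e assume e: "e \<in> orthonormal_frames M"
    obtain c where c: "c \<in> charts_at M (fst e)" using charts_at_ex orthonormalD(2)[OF e] by blast
    let ?V = "topspace (mtop M) \<times> (UNIV :: (real^'m^'m) set)"
    have "openin (prod_topology (mtop M) euclidean) ?V" by (simp add: openin_prod_Times_iff)
    then have "{e \<in> orthonormal_frames M. fst e \<in> fst c \<and> (fst e, frame_matrix c e) \<in> ?V} \<in>
      {{e \<in> orthonormal_frames M. fst e \<in> fst c \<and> (fst e, frame_matrix c e) \<in> V} | c V.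
        c \<in> atlas M \<and> openin (prod_topology (mtop M) (euclidean :: (real^'m^'m) topology)) V}"
      using charts_atD(1)[OF c] by blast
    moreover have "e \<in> {e \<in> orthonormal_frames M. fst e \<in> fst c \<and> (fst e, frame_matrix c e) \<in> ?V}"
      using e charts_atD(2)[OF c] orthonormalD(2)[OF e] by simp
    ultimately show "e \<in> topspace (frame_bundle M)"
      unfolding frame_bundle_def topology_generated_by_topspace by (rule UnionI)
  qed
qed

lemma openin_frame_bundle_basic:
  assumes "c \<in> atlas M" "openin (prod_topology (mtop M) euclidean) V"
  shows "openin (frame_bundle M) {e \<in> orthonormal_frames M. fst e \<in> fst c \<and> (fst e, frame_matrix c e) \<in> V}"
  unfolding frame_bundle_def by (rule topology_generated_by_Basis) (use assms in blast)

lemma continuous_frame_fst: "continuous_map (frame_bundle M) (mtop M) fst"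
  unfolding continuous_map
proof (intro conjI allI impI)
  show "fst ` topspace (frame_bundle M) \<subseteq> topspace (mtop M)"
    unfolding topspace_frame_bundle using orthonormalD(2) by blast
  fix W assume W: "openin (mtop M) W"
  have o: "openin (prod_topology (mtop M) euclidean) (W \<times> (UNIV :: (real^'m^'m) set))"
    using W by (simp add: openin_prod_Times_iff)
  have "{e \<in> topspace (frame_bundle M). fst e \<in> W} =
     (\<Union>c\<in>atlas M. {e \<in> orthonormal_frames M. fst e \<in> fst c \<and> (fst e, frame_matrix c e) \<in> W \<times> UNIV})"
    (is "?l = ?r")
  proof
    show "?r \<subseteq> ?l" by (auto simp: topspace_frame_bundle)
    show "?l \<subseteq> ?r"
    proof
      fix e assume e: "e \<in> ?l"
      then obtain c where "c \<in> charts_at M (fst e)"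
        using charts_at_ex[of "fst e"] orthonormalD(2)[of e] by (auto simp: topspace_frame_bundle simp del: split_paired_Ex)
      then show "e \<in> ?r" using e charts_atD[of c "fst e"] by (intro UN_I[of c]) (auto simp: topspace_frame_bundle)
    qed
  qed
  moreover have "openin (frame_bundle M) ?r"
  proof (rule openin_Union)
    fix S assume "S \<in> (\<lambda>c. {e \<in> orthonormal_frames M. fst e \<in> fst c \<and> (fst e, frame_matrix c e) \<in> W \<times> UNIV}) ` atlas M"
    then show "openin (frame_bundle M) S" using openin_frame_bundle_basic[OF _ o] by (elim imageE) simp
  qed
  ultimately show "openin (frame_bundle M) ?l" by simp
qed

lemma continuous_frame_matrix:
  assumes c: "c \<in> atlas M"
  shows "continuous_map (subtopology (frame_bundle M) {e. fst e \<in> fst c}) euclidean (frame_matrix c)"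
  unfolding continuous_map
proof (intro conjI allI impI)
  fix W :: "(real^'m^'m) set" assume W: "openin euclidean W"
  have "openin (prod_topology (mtop M) euclidean) (topspace (mtop M) \<times> W)"
    using W by (simp add: openin_prod_Times_iff)
  from openin_frame_bundle_basic[OF c this]
  have "openin (subtopology (frame_bundle M) {e. fst e \<in> fst c})
    ({e \<in> orthonormal_frames M. fst e \<in> fst c \<and> (fst e, frame_matrix c e) \<in> topspace (mtop M) \<times> W} \<inter> {e. fst e \<in> fst c})"
    by (rule openin_subtopology_Int)
  moreover have "{e \<in> orthonormal_frames M. fst e \<in> fst c \<and> (fst e, frame_matrix c e) \<in> topspace (mtop M) \<times> W} \<inter> {e. fst e \<in> fst c} =
    {e \<in> topspace (subtopology (frame_bundle M) {e. fst e \<in> fst c}). frame_matrix c e \<in> W}"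
    using orthonormalD(2) by (auto simp: topspace_frame_bundle)
  ultimately show "openin (subtopology (frame_bundle M) {e. fst e \<in> fst c})
    {e \<in> topspace (subtopology (frame_bundle M) {e. fst e \<in> fst c}). frame_matrix c e \<in> W}" by simp
qed simp

lemma openin_frames_over:
  assumes "openin (mtop M) U" shows "openin (frame_bundle M) {e \<in> orthonormal_frames M. fst e \<in> U}"
  using openin_continuous_map_preimage[OF continuous_frame_fst assms] by (simp add: topspace_frame_bundle)

lemma subtopology_frames_over:
  "subtopology (frame_bundle M) {e. fst e \<in> U} = subtopology (frame_bundle M) {e \<in> orthonormal_frames M. fst e \<in> U}"
  using subtopology_restrict[of "frame_bundle M" "{e. fst e \<in> U}"] by (simp add: topspace_frame_bundle Int_def)

lemma continuous_map_into_frame_bundle: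
  assumes on: "\<And>t. t \<in> topspace T \<Longrightarrow> f t \<in> orthonormal_frames M"
    and base: "continuous_map T (mtop M) (\<lambda>t. fst (f t))"
    and mat: "\<And>c. c \<in> atlas M \<Longrightarrow>
      continuous_map (subtopology T {t \<in> topspace T. fst (f t) \<in> fst c}) euclidean (\<lambda>t. frame_matrix c (f t))"
  shows "continuous_map T (frame_bundle M) f"
  unfolding frame_bundle_def
proof (rule continuous_on_generated_topo)
  have "topspace (frame_bundle M) = \<Union> {{e \<in> orthonormal_frames M. fst e \<in> fst c \<and> (fst e, frame_matrix c e) \<in> V} | c V.
        c \<in> atlas M \<and> openin (prod_topology (mtop M) (euclidean :: (real^'m^'m) topology)) V}"
    unfolding frame_bundle_def topology_generated_by_topspace ..
  moreover have "f ` topspace T \<subseteq> topspace (frame_bundle M)" using on by (auto simp: topspace_frame_bundle)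
  ultimately show "f ` topspace T \<subseteq> \<Union> {{e \<in> orthonormal_frames M. fst e \<in> fst c \<and> (fst e, frame_matrix c e) \<in> V} | c V.
        c \<in> atlas M \<and> openin (prod_topology (mtop M) (euclidean :: (real^'m^'m) topology)) V}"
    by simp
  fix U
  assume "U \<in> {{e \<in> orthonormal_frames M. fst e \<in> fst c \<and> (fst e, frame_matrix c e) \<in> V} | c V.
        c \<in> atlas M \<and> openin (prod_topology (mtop M) (euclidean :: (real^'m^'m) topology)) V}"
  then obtain c V where U: "U = {e \<in> orthonormal_frames M. fst e \<in> fst c \<and> (fst e, frame_matrix c e) \<in> V}"
    and c: "c \<in> atlas M" and V: "openin (prod_topology (mtop M) (euclidean :: (real^'m^'m) topology)) V" by blast
  let ?S = "{t \<in> topspace T. fst (f t) \<in> fst c}"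
  have oS: "openin T ?S" by (rule openin_continuous_map_preimage[OF base chart_openin[OF c]])
  have "continuous_map (subtopology T ?S) (prod_topology (mtop M) euclidean) (\<lambda>t. (fst (f t), frame_matrix c (f t)))"
    by (rule continuous_map_pairedI[OF continuous_map_from_subtopology[OF base] mat[OF c]])
  from openin_continuous_map_preimage[OF this V]
  have "openin T {t \<in> topspace (subtopology T ?S). (fst (f t), frame_matrix c (f t)) \<in> V}"
    using oS by (rule openin_trans_full)
  moreover have "{t \<in> topspace (subtopology T ?S). (fst (f t), frame_matrix c (f t)) \<in> V} = f -` U \<inter> topspace T"
    using on by (auto simp: U)
  ultimately show "openin T (f -` U \<inter> topspace T)" by simp
qed

lemma continuous_map_matrix_mult:
  fixes A :: "'t \<Rightarrow> real^'n::finite^'m" and B :: "'t \<Rightarrow> real^'l::finite^'n"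
  assumes "continuous_map T euclidean A" "continuous_map T euclidean B"
  shows "continuous_map T euclidean (\<lambda>t. A t ** B t)"
proof -
  have "continuous_map T (prod_topology euclidean euclidean) (\<lambda>t. (A t, B t))"
    by (rule continuous_map_pairedI[OF assms])
  moreover have "continuous_map (prod_topology euclidean euclidean) euclidean
     (\<lambda>p :: (real^'n^'m) \<times> (real^'l^'n). fst p ** snd p)"
    by (auto simp: matrix_matrix_mult_def intro!: continuous_intros continuous_on_vec_lambda)
  ultimately have "continuous_map T euclidean ((\<lambda>p. fst p ** snd p) \<circ> (\<lambda>t. (A t, B t)))"
    by (rule continuous_map_compose)
  then show ?thesis by (simp add: comp_def)
qed

lemma continuous_frame_mult:
  assumes A: "orthogonal_matrix A"
  shows "continuous_map (frame_bundle M) (frame_bundle M) (\<lambda>e. frame_mult e A)"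
proof (rule continuous_map_into_frame_bundle)
  show "frame_mult t A \<in> orthonormal_frames M" if "t \<in> topspace (frame_bundle M)" for t
    using that frame_mult_orthonormal[OF _ A] by (simp add: topspace_frame_bundle)
  show "continuous_map (frame_bundle M) (mtop M) (\<lambda>t. fst (frame_mult t A))"
    by (simp add: frame_mult_simps continuous_frame_fst)
  fix c assume c: "c \<in> atlas M"
  have "continuous_map (subtopology (frame_bundle M) {e. fst e \<in> fst c}) euclidean (\<lambda>t. frame_matrix c (frame_mult t A))"
    unfolding frame_matrix_mult by (intro continuous_map_matrix_mult continuous_frame_matrix c) simp
  then show "continuous_map (subtopology (frame_bundle M) {t \<in> topspace (frame_bundle M). fst (frame_mult t A) \<in> fst c}) euclidean
     (\<lambda>t. frame_matrix c (frame_mult t A))"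
    by (rule continuous_map_from_subtopology_mono) (auto simp: frame_mult_simps)
qed

lemma homeomorphic_frame_mult:
  assumes A: "orthogonal_matrix A"
  shows "homeomorphic_map (frame_bundle M) (frame_bundle M) (\<lambda>e. frame_mult e A)"
proof -
  have T: "orthogonal_matrix (transpose A)" "A ** transpose A = mat 1" "transpose A ** A = mat 1"
    using A by (simp_all add: orthogonal_matrix_def)
  have "homeomorphic_maps (frame_bundle M) (frame_bundle M) (\<lambda>e. frame_mult e A) (\<lambda>e. frame_mult e (transpose A))"
    unfolding homeomorphic_maps_def
    by (simp add: continuous_frame_mult A T frame_mult_mult frame_mult_one)
  then show ?thesis using homeomorphic_map_maps by blast
qed

end

text \<open>In charts the matrix of the image frame is the Jacobian times the matrix of the frame,
  and the Jacobian depends continuously on the base point because a smooth map has continuous first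
  derivatives.\<close>

lemma continuous_frame_map:
  fixes M :: "('a, 'm::finite, 'z) mfd_scheme" and N :: "('b, 'm, 'w) mfd_scheme"
  assumes M: "riemannian M" and N: "riemannian N" and U: "openin (mtop M) U" and f: "smooth_map_on M N U f"
    and on: "\<And>e. e \<in> orthonormal_frames M \<Longrightarrow> fst e \<in> U \<Longrightarrow> frame_map M N f e \<in> orthonormal_frames N"
  shows "continuous_map (subtopology (frame_bundle M) {e. fst e \<in> U}) (frame_bundle N) (frame_map M N f)"
proof -
  interpret M: riemannian M by fact
  interpret N: riemannian N by fact
  let ?T = "subtopology (frame_bundle M) {e. fst e \<in> U}"
  have topT: "topspace ?T = {e \<in> orthonormal_frames M. fst e \<in> U}" by (auto simp: M.topspace_frame_bundle)
  have fc: "continuous_map (subtopology (mtop M) U) (mtop N) f" using f by (simp add: smooth_map_on_def)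
  have fstU: "continuous_map ?T (subtopology (mtop M) U) fst"
    using M.continuous_frame_fst by (auto simp: continuous_map_in_subtopology continuous_map_from_subtopology)
  show ?thesis
  proof (rule N.continuous_map_into_frame_bundle)
    show "frame_map M N f t \<in> orthonormal_frames N" if "t \<in> topspace ?T" for t using that on by (simp add: M.topspace_frame_bundle)
    show "continuous_map ?T (mtop N) (\<lambda>t. fst (frame_map M N f t))"
      using continuous_map_compose[OF fstU fc] by (simp add: frame_map_simps comp_def)
    fix d assume d: "d \<in> atlas N"
    let ?S = "{t \<in> topspace ?T. fst (frame_map M N f t) \<in> fst d}"
    show "continuous_map (subtopology ?T ?S) euclidean (\<lambda>t. frame_matrix d (frame_map M N f t))"
    proof (rule continuous_map_local)
      fix e assume "e \<in> topspace (subtopology ?T ?S)"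
      then have e: "e \<in> orthonormal_frames M" "fst e \<in> U" "f (fst e) \<in> fst d" by (auto simp: M.topspace_frame_bundle frame_map_simps)
      obtain c where c: "c \<in> charts_at M (fst e)" using M.charts_at_ex M.orthonormalD(2)[OF e(1)] by blast
      note cM = M.charts_atD[OF c]
      let ?W = "U \<inter> fst c \<inter> f -` fst d" and ?F = "snd d \<circ> f \<circ> inv_chart c"
      let ?R = "subtopology (subtopology ?T ?S) {e. fst e \<in> fst c}"
      have tR: "topspace ?R = {e \<in> orthonormal_frames M. fst e \<in> ?W}" by (auto simp: M.topspace_frame_bundle frame_map_simps)
      have sm: "smooth_on (snd c ` ?W) ?F" using f cM d by (simp add: smooth_map_on_def)
      have J: "continuous_on (snd c ` ?W) (\<lambda>z. matrix (frechet_derivative ?F (at z)))"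
        unfolding matrix_def
        by (intro continuous_on_vec_lambda continuous_on_component smooth_on_deriv(2)[OF sm])
      have "continuous_map ?R (subtopology (mtop M) (fst c)) fst"
        using M.continuous_frame_fst by (auto simp: continuous_map_in_subtopology continuous_map_from_subtopology)
      from continuous_map_compose[OF this M.chart_continuous[OF cM(1)]]
      have "continuous_map ?R (top_of_set (snd c ` ?W)) (snd c \<circ> fst)"
        using tR by (auto simp: continuous_map_in_subtopology)
      from continuous_map_compose[OF this, of euclidean "\<lambda>z. matrix (frechet_derivative ?F (at z))"] J
      have "continuous_map ?R euclidean (\<lambda>t. matrix (jac f (fst t) c d))"
        by (simp add: comp_def)
      moreover have "continuous_map ?R euclidean (frame_matrix c)"
      proof -
        have "?R = subtopology (subtopology (frame_bundle M) {e. fst e \<in> fst c}) ({e. fst e \<in> U} \<inter> ?S)"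
          by (simp add: subtopology_subtopology Int_ac)
        then show ?thesis using continuous_map_from_subtopology[OF M.continuous_frame_matrix[OF cM(1)]] by simp
      qed
      ultimately have "continuous_map ?R euclidean (\<lambda>t. matrix (jac f (fst t) c d) ** frame_matrix c t)"
        by (rule M.continuous_map_matrix_mult)
      then have "continuous_map ?R euclidean (\<lambda>t. frame_matrix d (frame_map M N f t))"
      proof (rule continuous_map_eq)
        fix t assume "t \<in> topspace ?R"
        then have t: "t \<in> orthonormal_frames M" "fst t \<in> U" "fst t \<in> fst c" "f (fst t) \<in> fst d" using tR by auto
        show "matrix (jac f (fst t) c d) ** frame_matrix c t = frame_matrix d (frame_map M N f t)"
          by (rule frame_matrix_map[symmetric, OF M.manifold M.mdiff_smooth_map[OF U t(2) f] M.orthonormalD(1)[OF t(1)]])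
            (use t cM d in \<open>simp_all add: charts_at_def\<close>)
      qed
      moreover have "openin (subtopology ?T ?S) (topspace (subtopology ?T ?S) \<inter> {e. fst e \<in> fst c})"
      proof -
        have "continuous_map (subtopology ?T ?S) (mtop M) fst"
          by (intro continuous_map_from_subtopology M.continuous_frame_fst)
        from openin_continuous_map_preimage[OF this M.chart_openin[OF cM(1)]]
        show ?thesis by (simp add: Int_def)
      qed
      moreover have "subtopology (subtopology ?T ?S) (topspace (subtopology ?T ?S) \<inter> {e. fst e \<in> fst c}) = ?R"
        by (rule subtopology_restrict)
      moreover have "e \<in> topspace (subtopology ?T ?S) \<inter> {e. fst e \<in> fst c}"
        using e cM by (simp add: M.topspace_frame_bundle frame_map_simps)
      ultimately show "\<exists>U. openin (subtopology ?T ?S) U \<and> e \<in> U \<and>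
         continuous_map (subtopology (subtopology ?T ?S) U) euclidean (\<lambda>t. frame_matrix d (frame_map M N f t))"
        by (intro exI[of _ "topspace (subtopology ?T ?S) \<inter> {e. fst e \<in> fst c}"] conjI) (simp_all only:)
    qed
  qed
qed

section \<open>Orientations and the orientable double cover\<close>

lemma (in manifold) manifold: "manifold M" ..

context manifold
begin

lemma orientation_iff:
  assumes u: "orientation M u" and e0: "e0 \<in> u" and A: "det A \<noteq> 0"
  shows "frame_mult e0 A \<in> u \<longleftrightarrow> det A > 0"
  using u e0 A unfolding orientation_def by (elim conjE) (drule bspec, assumption, simp)

lemma orientationD:
  assumes u: "orientation M u"
  shows "u \<subseteq> linear_frames M" and "x \<in> topspace (mtop M) \<Longrightarrow> \<exists>e \<in> u. fst e = x"
    and "c \<in> atlas M \<Longrightarrow> openin (mtop M) {x \<in> fst c. coord_frame M c x \<in> u}"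
    and "c \<in> atlas M \<Longrightarrow> openin (mtop M) {x \<in> fst c. coord_frame M c x \<notin> u}"
  using u unfolding orientation_def coord_frame_def by (elim conjE; simp)+

lemma linear_frame_topspace: "e \<in> linear_frames M \<Longrightarrow> fst e \<in> topspace (mtop M)"
  unfolding linear_frames_def by simp

text \<open>A frame outside \<open>u\<close> is a frame of \<open>u\<close> multiplied by a matrix
  of negative determinant, so both sign rules reduce to the one for \<open>u\<close> by
  multiplicativity of determinants.\<close>

lemma opposite_iff:
  assumes u: "orientation M u" and e0: "e0 \<in> opposite_orientation M u" and A: "det A \<noteq> 0"
  shows "frame_mult e0 A \<in> opposite_orientation M u \<longleftrightarrow> det A > 0"
proof -
  have l: "e0 \<in> linear_frames M" "e0 \<notin> u" using e0 by (simp_all add: opposite_orientation_def)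
  obtain e where e: "e \<in> u" "fst e = fst e0" using orientationD(2)[OF u linear_frame_topspace[OF l(1)]] by blast
  then obtain B where B: "det B \<noteq> 0" "e0 = frame_mult e B"
    using linear_frames_transitive[OF manifold _ l(1)] orientationD(1)[OF u] by blast
  then have "det B < 0" using orientation_iff[OF u e(1) B(1)] l(2) by auto
  have "frame_mult e0 A \<in> u \<longleftrightarrow> det (B ** A) > 0"
    using orientation_iff[OF u e(1), of "B ** A"] A B by (simp add: det_mul frame_mult_mult)
  also have "\<dots> \<longleftrightarrow> \<not> det A > 0" using \<open>det B < 0\<close> A by (auto simp: det_mul zero_less_mult_iff)
  finally show ?thesis using frame_mult_linear_iff[OF manifold l(1)] A by (auto simp: opposite_orientation_def)
qed

lemma orientation_opposite:
  assumes u: "orientation M u"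
  shows "orientation M (opposite_orientation M u)"
  unfolding orientation_def coord_frame_def[symmetric]
proof (intro conjI ballI allI impI)
  show "opposite_orientation M u \<subseteq> linear_frames M" by (auto simp: opposite_orientation_def)
  fix x assume x: "x \<in> topspace (mtop M)"
  obtain e where e: "e \<in> u" "fst e = x" using orientationD(2)[OF u x] by blast
  obtain k :: 'm where True by blast
  let ?R = "hyperplane_reflection (axis k 1 :: real^'m)"
  have R: "det ?R = - 1" by (rule det_hyperplane_reflection) simp
  then have "frame_mult e ?R \<in> opposite_orientation M u"
    using frame_mult_linear_iff[OF manifold, of e ?R] orientation_iff[OF u e(1), of ?R] orientationD(1)[OF u] e(1)
    by (auto simp: opposite_orientation_def)
  then show "\<exists>e \<in> opposite_orientation M u. fst e = x" using e(2) by (intro bexI[of _ "frame_mult e ?R"]) (simp_all add: frame_mult_simps)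
next
  fix e and A :: "real^'m^'m" assume "e \<in> opposite_orientation M u" "det A \<noteq> 0"
  then show "frame_mult e A \<in> opposite_orientation M u \<longleftrightarrow> 0 < det A" by (rule opposite_iff[OF u])
next
  fix c assume c: "c \<in> atlas M"
  have "coord_frame M c x \<in> linear_frames M" if "x \<in> fst c" for x
    using coord_frame_linear[OF manifold] c that by (simp add: charts_at_def)
  then have "{x \<in> fst c. coord_frame M c x \<in> opposite_orientation M u} = {x \<in> fst c. coord_frame M c x \<notin> u}"
    "{x \<in> fst c. coord_frame M c x \<notin> opposite_orientation M u} = {x \<in> fst c. coord_frame M c x \<in> u}"
    by (auto simp: opposite_orientation_def)
  then show "openin (mtop M) {x \<in> fst c. coord_frame M c x \<in> opposite_orientation M u}"
    "openin (mtop M) {x \<in> fst c. coord_frame M c x \<notin> opposite_orientation M u}"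
    using orientationD(3,4)[OF u c] by simp_all
qed

lemma opposite_opposite: "orientation M u \<Longrightarrow> opposite_orientation M (opposite_orientation M u) = u"
  using orientationD(1)[of u] by (auto simp: opposite_orientation_def)

end

context riemannian
begin

text \<open>In a chart, membership in \<open>u\<close> is decided by two locally constant data:
  whether the coordinate frame lies in \<open>u\<close>, and the sign of the determinant of the
  frame matrix. Each admissible combination is a basic open set.\<close>

lemma openin_oriented_frames:
  assumes u: "orientation M u"
  shows "openin (frame_bundle M) (orthonormal_frames M \<inter> u)"
  unfolding openin_subopen[of "frame_bundle M" "orthonormal_frames M \<inter> u"]
proof
  fix e assume e: "e \<in> orthonormal_frames M \<inter> u"
  then obtain c where c: "c \<in> charts_at M (fst e)" using charts_at_ex orthonormalD(2) by blast
  note ca = charts_atD[OF c]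
  have d0: "det (frame_matrix c f) \<noteq> 0" and fc: "f = frame_mult (coord_frame M c (fst f)) (frame_matrix c f)"
    and cl: "coord_frame M c (fst f) \<in> linear_frames M"
    if "f \<in> orthonormal_frames M" "fst f \<in> fst c" for f
  proof -
    have cf: "c \<in> charts_at M (fst f)" using ca that by (simp add: charts_at_def)
    show "det (frame_matrix c f) \<noteq> 0" using orthonormal_linear that linear_frames_iff[OF manifold cf] by blast
    show "f = frame_mult (coord_frame M c (fst f)) (frame_matrix c f)"
      by (rule frame_coord[OF manifold orthonormalD(1)[OF that(1)] cf])
    show "coord_frame M c (fst f) \<in> linear_frames M" by (rule coord_frame_linear[OF manifold cf])
  qed
  have cont: "continuous_on UNIV (det :: real^'m^'m \<Rightarrow> real)"
    unfolding det_def by (intro continuous_intros)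
  then have o: "open {A :: real^'m^'m. det A > 0}" "open {A :: real^'m^'m. det A < 0}"
    by (auto intro!: open_Collect_less continuous_intros)
  show "\<exists>T. openin (frame_bundle M) T \<and> e \<in> T \<and> T \<subseteq> orthonormal_frames M \<inter> u"
  proof (cases "coord_frame M c (fst e) \<in> u")
    case True
    let ?V = "{x \<in> fst c. coord_frame M c x \<in> u} \<times> {A :: real^'m^'m. det A > 0}"
    have "openin (prod_topology (mtop M) euclidean) ?V"
      using orientationD(3)[OF u ca(1)] o by (simp add: openin_prod_Times_iff)
    from openin_frame_bundle_basic[OF ca(1) this]
    have "openin (frame_bundle M) {e \<in> orthonormal_frames M. fst e \<in> fst c \<and> (fst e, frame_matrix c e) \<in> ?V}" .
    moreover have "e \<in> {e \<in> orthonormal_frames M. fst e \<in> fst c \<and> (fst e, frame_matrix c e) \<in> ?V}"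
    proof -
      have eo: "e \<in> orthonormal_frames M" using e by blast
      have "det (frame_matrix c e) > 0"
        using orientation_iff[OF u True d0[OF eo ca(2)]] fc[OF eo ca(2)] e by simp
      then show ?thesis using eo ca(2) True by simp
    qed
    moreover have "{e \<in> orthonormal_frames M. fst e \<in> fst c \<and> (fst e, frame_matrix c e) \<in> ?V} \<subseteq> orthonormal_frames M \<inter> u"
    proof
      fix f assume "f \<in> {e \<in> orthonormal_frames M. fst e \<in> fst c \<and> (fst e, frame_matrix c e) \<in> ?V}"
      then have f: "f \<in> orthonormal_frames M" "fst f \<in> fst c" "coord_frame M c (fst f) \<in> u" "det (frame_matrix c f) > 0" by auto
      then show "f \<in> orthonormal_frames M \<inter> u" using orientation_iff[OF u f(3) d0[OF f(1,2)]] fc[OF f(1,2)] by simp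
    qed
    ultimately show ?thesis by blast
  next
    case False
    let ?u = "opposite_orientation M u"
    let ?V = "{x \<in> fst c. coord_frame M c x \<notin> u} \<times> {A :: real^'m^'m. det A < 0}"
    have n: "f \<in> u \<longleftrightarrow> det (frame_matrix c f) < 0"
      if f: "f \<in> orthonormal_frames M" "fst f \<in> fst c" "coord_frame M c (fst f) \<notin> u" for f
    proof -
      have "coord_frame M c (fst f) \<in> ?u" using cl[OF f(1,2)] f(3) by (simp add: opposite_orientation_def)
      from opposite_iff[OF u this d0[OF f(1,2)]] have "f \<in> ?u \<longleftrightarrow> det (frame_matrix c f) > 0" using fc[OF f(1,2)] by simp
      then show ?thesis using d0[OF f(1,2)] orthonormal_linear f(1) by (auto simp: opposite_orientation_def)
    qed
    have "openin (prod_topology (mtop M) euclidean) ?V"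
      using orientationD(4)[OF u ca(1)] o by (simp add: openin_prod_Times_iff)
    from openin_frame_bundle_basic[OF ca(1) this]
    have "openin (frame_bundle M) {e \<in> orthonormal_frames M. fst e \<in> fst c \<and> (fst e, frame_matrix c e) \<in> ?V}" .
    moreover have "e \<in> {e \<in> orthonormal_frames M. fst e \<in> fst c \<and> (fst e, frame_matrix c e) \<in> ?V}"
      using e ca False n[of e] by auto
    moreover have "{e \<in> orthonormal_frames M. fst e \<in> fst c \<and> (fst e, frame_matrix c e) \<in> ?V} \<subseteq> orthonormal_frames M \<inter> u"
      using n by auto
    ultimately show ?thesis by blast
  qed
qed

lemma oriented_mult_iff:
  assumes u: "orientation M u" and e: "e \<in> orthonormal_frames M" and A: "det A \<noteq> 0"
  shows "frame_mult e A \<in> u \<longleftrightarrow> (e \<in> u \<longleftrightarrow> det A > 0)"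
proof (cases "e \<in> u")
  case True
  then show ?thesis using orientation_iff[OF u True A] by simp
next
  case False
  have l: "e \<in> linear_frames M" using e orthonormal_linear by blast
  then have "e \<in> opposite_orientation M u" using False by (simp add: opposite_orientation_def)
  from opposite_iff[OF u this A] show ?thesis
    using False frame_mult_linear_iff[OF manifold l] A by (auto simp: opposite_orientation_def)
qed

lemma opposite_orthonormal_iff: "e \<in> orthonormal_frames M \<Longrightarrow> e \<in> opposite_orientation M u \<longleftrightarrow> e \<notin> u"
  using orthonormal_linear by (auto simp: opposite_orientation_def)

end

section \<open>The orientable double cover and its frame bundle\<close>

locale double_cover = X: riemannian X + Y: riemannian Y
  for X :: "('x, 'm::finite) mfd" and Y :: "('y, 'm) mfd" +
  fixes \<pi> :: "'y \<Rightarrow> 'x" and \<tau> :: "'y \<Rightarrow> 'y"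
  assumes cover: "orientable_double_cover Y X \<pi> \<tau>"
begin

lemma two_covering_pi: "two_covering (mtop Y) (mtop X) \<pi>"
  and local_diffeo_pi: "local_diffeo Y X \<pi>"
  and connected: "connected_space (mtop Y)"
  using cover unfolding orientable_double_cover_def by auto

lemma
  assumes "x \<in> topspace (mtop Y)"
  shows tau_in: "\<tau> x \<in> topspace (mtop Y)" and tau_neq: "\<tau> x \<noteq> x" and pi_tau: "\<pi> (\<tau> x) = \<pi> x"
  using cover assms unfolding orientable_double_cover_def by auto

lemma metric_pi:
  assumes "x \<in> topspace (mtop Y)" "v \<in> tangent_space Y x" "w \<in> tangent_space Y x"
  shows "metric X (\<pi> x) (tangent_map Y X \<pi> x v) (tangent_map Y X \<pi> x w) = metric Y x v w"
proof -
  have "\<forall>x \<in> topspace (mtop Y). \<forall>v \<in> tangent_space Y x. \<forall>w \<in> tangent_space Y x.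
        metric Y x v w = metric X (\<pi> x) (tangent_map Y X \<pi> x v) (tangent_map Y X \<pi> x w)"
    using cover unfolding orientable_double_cover_def by (elim conjE)
  from bspec[OF bspec[OF bspec[OF this assms(1)] assms(2)] assms(3)] show ?thesis by simp
qed

lemma pi_in: "x \<in> topspace (mtop Y) \<Longrightarrow> \<pi> x \<in> topspace (mtop X)"
  using two_covering_props(1)[OF two_covering_pi] by (auto simp: continuous_map_def)

lemma fibre: "x \<in> topspace (mtop Y) \<Longrightarrow> y \<in> topspace (mtop Y) \<Longrightarrow> \<pi> y = \<pi> x \<Longrightarrow> y = x \<or> y = \<tau> x"
proof -
  assume x: "x \<in> topspace (mtop Y)" and y: "y \<in> topspace (mtop Y)" "\<pi> y = \<pi> x"
  obtain a b where ab: "{e \<in> topspace (mtop Y). \<pi> e = \<pi> x} = {a, b}"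
    using two_covering_props(3)[OF two_covering_pi pi_in[OF x]] by (meson card_2_iff)
  have "x \<in> {a, b}" "\<tau> x \<in> {a, b}" "y \<in> {a, b}"
    using x y tau_in[OF x] pi_tau[OF x] unfolding ab[symmetric] by auto
  then show ?thesis using tau_neq[OF x] by auto
qed

lemma tau_tau: "x \<in> topspace (mtop Y) \<Longrightarrow> \<tau> (\<tau> x) = x"
  using fibre[of x "\<tau> (\<tau> x)"] tau_in tau_neq pi_tau by metis

text \<open>The definition of the cover describes \<tau> only pointwise. Continuity follows because
  \<tau> y is the other point over \<pi> y: for y near x, a point over \<pi> y inside a
  neighbourhood of \<tau> x disjoint from that of x must be \<tau> y.\<close>

lemma continuous_tau: "continuous_map (mtop Y) (mtop Y) \<tau>"
  unfolding continuous_map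
proof (intro conjI allI impI)
  note P = two_covering_props[OF two_covering_pi]
  show "\<tau> ` topspace (mtop Y) \<subseteq> topspace (mtop Y)" using tau_in by blast
  fix W assume W: "openin (mtop Y) W"
  show "openin (mtop Y) {x \<in> topspace (mtop Y). \<tau> x \<in> W}"
    unfolding openin_subopen[of "mtop Y" "{x \<in> topspace (mtop Y). \<tau> x \<in> W}"]
  proof
    fix x assume "x \<in> {x \<in> topspace (mtop Y). \<tau> x \<in> W}"
    then have x: "x \<in> topspace (mtop Y)" "\<tau> x \<in> W" by auto
    obtain U V where UV: "openin (mtop Y) U" "openin (mtop Y) V" "x \<in> U" "\<tau> x \<in> V" "disjnt U V"
      using P(5)[OF x(1) tau_in[OF x(1)]] tau_neq[OF x(1)] pi_tau[OF x(1)] by metis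
    let ?N = "U \<inter> {y \<in> topspace (mtop Y). \<pi> y \<in> \<pi> ` (V \<inter> W)}"
    have VW: "openin (mtop Y) (V \<inter> W)" using UV W by blast
    then have "openin (mtop X) (\<pi> ` (V \<inter> W))" using P(2) unfolding open_map_def by blast
    then have N: "openin (mtop Y) ?N" using openin_continuous_map_preimage[OF P(1)] UV(1) openin_Int by blast
    have "\<pi> x \<in> \<pi> ` (V \<inter> W)" using UV(4) x(2) pi_tau[OF x(1)] by (metis IntI image_eqI)
    then have "x \<in> ?N" using UV(3) x(1) by simp
    moreover have "?N \<subseteq> {x \<in> topspace (mtop Y). \<tau> x \<in> W}"
    proof
      fix y assume "y \<in> ?N"
      then obtain w where w: "y \<in> U" "y \<in> topspace (mtop Y)" "w \<in> V" "w \<in> W" "\<pi> w = \<pi> y" by auto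
      then have "w = y \<or> w = \<tau> y" using fibre[of y w] openin_subset[OF W] by blast
      moreover have "w \<noteq> y" using w UV(5) by (auto simp: disjnt_def)
      ultimately show "y \<in> {x \<in> topspace (mtop Y). \<tau> x \<in> W}" using w by simp
    qed
    ultimately show "\<exists>T. openin (mtop Y) T \<and> x \<in> T \<and> T \<subseteq> {x \<in> topspace (mtop Y). \<tau> x \<in> W}" using N by blast
  qed
qed

lemma homeomorphic_tau: "homeomorphic_map (mtop Y) (mtop Y) \<tau>"
  by (rule homeomorphic_map_involution[OF continuous_tau]) (rule tau_tau)

lemma local_inverse:
  assumes x: "x \<in> topspace (mtop Y)"
  obtains U g where "openin (mtop Y) U" "x \<in> U" "openin (mtop X) (\<pi> ` U)" "inj_on \<pi> U"
    "smooth_map_on Y X U \<pi>" "smooth_map_on X Y (\<pi> ` U) g" "\<forall>y\<in>U. g (\<pi> y) = y"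
proof -
  obtain U where U: "openin (mtop Y) U" "x \<in> U" "openin (mtop X) (\<pi> ` U)" "inj_on \<pi> U"
    "smooth_map_on Y X U \<pi>" "smooth_map_on X Y (\<pi> ` U) (inv_into U \<pi>)"
    using local_diffeo_pi x unfolding local_diffeo_def by blast
  show ?thesis
    using inv_into_f_f[OF U(4)] by (intro that[OF U]) simp
qed

lemma mdiff_pi: "x \<in> topspace (mtop Y) \<Longrightarrow> mdiff Y X \<pi> x"
  by (rule local_inverse[of x]) (auto intro: Y.mdiff_smooth_map)

lemma mdiff_local_inverse:
  assumes "openin (mtop X) (\<pi> ` U)" "smooth_map_on X Y (\<pi> ` U) g" "y \<in> U"
  shows "mdiff X Y g (\<pi> y)"
  by (rule X.mdiff_smooth_map[OF assms(1) _ assms(2)]) (use assms(3) in blast)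

text \<open>Near \<open>x\<close> the involution equals \<open>g \<circ> \<pi>\<close>, where
  \<open>g\<close> is the local inverse of \<pi> at \<tau> x.\<close>

lemma mdiff_tau:
  assumes x: "x \<in> topspace (mtop Y)" shows "mdiff Y Y \<tau> x"
proof -
  obtain U g where U: "openin (mtop Y) U" "\<tau> x \<in> U" "openin (mtop X) (\<pi> ` U)" "inj_on \<pi> U"
    "smooth_map_on Y X U \<pi>" "smooth_map_on X Y (\<pi> ` U) g" "\<forall>y\<in>U. g (\<pi> y) = y"
    by (rule local_inverse[OF tau_in[OF x]])
  have "mdiff X Y g (\<pi> x)" using mdiff_local_inverse[OF U(3,6,2)] pi_tau[OF x] by simp
  from mdiff_compose[OF Y.manifold X.manifold mdiff_pi[OF x] this] have m: "mdiff Y Y (g \<circ> \<pi>) x" .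
  have o: "openin (mtop Y) {y \<in> topspace (mtop Y). \<tau> y \<in> U}"
    by (rule openin_continuous_map_preimage[OF continuous_tau U(1)])
  show ?thesis
  proof (rule mdiff_cong(1)[OF Y.manifold m o])
    show "x \<in> {y \<in> topspace (mtop Y). \<tau> y \<in> U}" using x U(2) by simp
    fix y assume "y \<in> {y \<in> topspace (mtop Y). \<tau> y \<in> U}"
    then have "g (\<pi> (\<tau> y)) = \<tau> y" "\<pi> (\<tau> y) = \<pi> y" using U(7) pi_tau by auto
    then show "(g \<circ> \<pi>) y = \<tau> y" by simp
  qed
qed

abbreviation "d\<pi> \<equiv> frame_map Y X \<pi>"
abbreviation "d\<tau> \<equiv> frame_map Y Y \<tau>"

lemma fst_dpi: "fst (d\<pi> e) = \<pi> (fst e)" and fst_dtau: "fst (d\<tau> e) = \<tau> (fst e)"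
  by (simp_all add: frame_map_simps)

lemma frame_map_local_inverse:
  assumes U: "openin (mtop Y) U" "openin (mtop X) (\<pi> ` U)"
    "smooth_map_on Y X U \<pi>" "smooth_map_on X Y (\<pi> ` U) g" "\<forall>y\<in>U. g (\<pi> y) = y"
  shows "e \<in> tangent_frames Y \<Longrightarrow> fst e \<in> U \<Longrightarrow> frame_map X Y g (d\<pi> e) = e"
    and "e' \<in> tangent_frames X \<Longrightarrow> fst e' \<in> \<pi> ` U \<Longrightarrow> d\<pi> (frame_map X Y g e') = e'"
proof -
  have UY: "U \<subseteq> topspace (mtop Y)" by (rule openin_subset[OF U(1)])
  show "frame_map X Y g (d\<pi> e) = e" if e: "e \<in> tangent_frames Y" "fst e \<in> U"
  proof -
    have ey: "fst e \<in> topspace (mtop Y)" using UY e by blast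
    have mg: "mdiff X Y g (\<pi> (fst e))" by (rule mdiff_local_inverse[OF U(2,4) e(2)])
    have "frame_map X Y g (d\<pi> e) = frame_map Y Y (g \<circ> \<pi>) e"
      by (rule frame_map_compose[symmetric, OF Y.manifold X.manifold mdiff_pi[OF ey] mg e(1)])
    also have "\<dots> = frame_map Y Y (\<lambda>x. x) e"
      by (rule frame_map_cong[OF Y.manifold mdiff_compose[OF Y.manifold X.manifold mdiff_pi[OF ey] mg] U(1) e(2)])
        (simp add: U(5))
    also have "\<dots> = e" by (rule frame_map_ident[OF Y.manifold e(1)])
    finally show ?thesis .
  qed
  show "d\<pi> (frame_map X Y g e') = e'" if e: "e' \<in> tangent_frames X" "fst e' \<in> \<pi> ` U"
  proof -
    obtain y where y: "y \<in> U" "fst e' = \<pi> y" using e(2) by blast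
    have mg: "mdiff X Y g (fst e')" using mdiff_local_inverse[OF U(2,4) y(1)] y(2) by simp
    have gy: "g (fst e') = y" using bspec[OF U(5) y(1)] y(2) by simp
    have mp: "mdiff Y X \<pi> (g (fst e'))" using mdiff_pi UY y(1) by (auto simp: gy)
    have "d\<pi> (frame_map X Y g e') = frame_map X X (\<pi> \<circ> g) e'"
      by (rule frame_map_compose[symmetric, OF X.manifold Y.manifold mg mp e(1)])
    also have "\<dots> = frame_map X X (\<lambda>x. x) e'"
      by (rule frame_map_cong[OF X.manifold mdiff_compose[OF X.manifold Y.manifold mg mp] U(2) e(2)])
        (use U(5) in auto)
    also have "\<dots> = e'" by (rule frame_map_ident[OF X.manifold e(1)])
    finally show ?thesis .
  qed
qed

text \<open>The metric of the cover is pulled back along \<pi>, so a frame and its image have the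
  same Gram matrix.\<close>

lemma dpi_orthonormal_iff:
  assumes e: "e \<in> tangent_frames Y"
  shows "d\<pi> e \<in> orthonormal_frames X \<longleftrightarrow> e \<in> orthonormal_frames Y"
proof -
  have y: "fst e \<in> topspace (mtop Y)" "\<And>i. snd e i \<in> tangent_space Y (fst e)" using e by (auto simp: tangent_frames_def)
  have "d\<pi> e \<in> tangent_frames X" by (rule frame_map_tangent[OF Y.manifold X.manifold mdiff_pi[OF y(1)] e])
  then show ?thesis
    using e by (simp add: X.orthonormal_frames_alt Y.orthonormal_frames_alt frame_map_simps metric_pi[OF y(1) y(2) y(2)])
qed

lemma dpi_in: "e \<in> orthonormal_frames Y \<Longrightarrow> d\<pi> e \<in> orthonormal_frames X"
  using dpi_orthonormal_iff[OF Y.orthonormalD(1)] by blast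

text \<open>Together with \<open>dpi_surj\<close>, this identifies the frame bundle of the cover
  with the pull-back along \<pi> of the frame bundle of \<open>X\<close>.\<close>

lemma dpi_inject:
  assumes "e \<in> orthonormal_frames Y" "e' \<in> orthonormal_frames Y" "fst e = fst e'" "d\<pi> e = d\<pi> e'"
  shows "e = e'"
proof -
  obtain U g where U: "openin (mtop Y) U" "fst e \<in> U" "openin (mtop X) (\<pi> ` U)" "inj_on \<pi> U"
    "smooth_map_on Y X U \<pi>" "smooth_map_on X Y (\<pi> ` U) g" "\<forall>y\<in>U. g (\<pi> y) = y"
    by (rule local_inverse[OF Y.orthonormalD(2)[OF assms(1)]])
  note f = frame_map_local_inverse(1)[OF U(1,3,5,6,7)]
  have "e = frame_map X Y g (d\<pi> e)" using f[OF Y.orthonormalD(1)[OF assms(1)] U(2)] by simp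
  also have "\<dots> = e'" using f[OF Y.orthonormalD(1)[OF assms(2)]] U(2) assms(3,4) by simp
  finally show ?thesis .
qed

lemma dpi_surj:
  assumes e: "e' \<in> orthonormal_frames X" and y: "y \<in> topspace (mtop Y)" "\<pi> y = fst e'"
  shows "\<exists>e \<in> orthonormal_frames Y. fst e = y \<and> d\<pi> e = e'"
proof -
  obtain U g where U: "openin (mtop Y) U" "y \<in> U" "openin (mtop X) (\<pi> ` U)" "inj_on \<pi> U"
    "smooth_map_on Y X U \<pi>" "smooth_map_on X Y (\<pi> ` U) g" "\<forall>y\<in>U. g (\<pi> y) = y"
    by (rule local_inverse[OF y(1)])
  have yU: "fst e' \<in> \<pi> ` U" using U(2) y(2) by (metis image_eqI)
  have mg: "mdiff X Y g (fst e')" using mdiff_local_inverse[OF U(3,6,2)] y(2) by simp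
  have t: "frame_map X Y g e' \<in> tangent_frames Y"
    by (rule frame_map_tangent[OF X.manifold Y.manifold mg X.orthonormalD(1)[OF e]])
  have d: "d\<pi> (frame_map X Y g e') = e'"
    by (rule frame_map_local_inverse(2)[OF U(1,3,5,6,7) X.orthonormalD(1)[OF e] yU])
  then have "frame_map X Y g e' \<in> orthonormal_frames Y" using dpi_orthonormal_iff[OF t] e by simp
  moreover have "fst (frame_map X Y g e') = y" using bspec[OF U(7) U(2)] y(2) by (simp add: frame_map_simps)
  ultimately show ?thesis using d by blast
qed

text \<open>Over a small open set the inverse of \<open>d\<pi>\<close> is the frame map of the local
  inverse of \<pi>; restricting to the part over \<open>W\<close> keeps both homeomorphisms.\<close>

lemma dpi_local_homeo:
  assumes x: "x \<in> topspace (mtop Y)" and W: "openin (mtop Y) W" "x \<in> W"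
  obtains U where "openin (mtop Y) U" "x \<in> U" "U \<subseteq> W" "inj_on \<pi> U" "openin (mtop X) (\<pi> ` U)"
    "homeomorphic_map (subtopology (mtop Y) U) (subtopology (mtop X) (\<pi> ` U)) \<pi>"
    "homeomorphic_map (subtopology (frame_bundle Y) {e. fst e \<in> U}) (subtopology (frame_bundle X) {e. fst e \<in> \<pi> ` U}) d\<pi>"
proof -
  obtain V g where V: "openin (mtop Y) V" "x \<in> V" "openin (mtop X) (\<pi> ` V)" "inj_on \<pi> V"
    "smooth_map_on Y X V \<pi>" "smooth_map_on X Y (\<pi> ` V) g" "\<forall>y\<in>V. g (\<pi> y) = y"
    by (rule local_inverse[OF x])
  have VY: "V \<subseteq> topspace (mtop Y)" by (rule openin_subset[OF V(1)])
  have gon: "frame_map X Y g e' \<in> orthonormal_frames Y" if e: "e' \<in> orthonormal_frames X" "fst e' \<in> \<pi> ` V" for e'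
  proof -
    obtain y where y: "y \<in> V" "fst e' = \<pi> y" using e(2) by blast
    have "mdiff X Y g (fst e')" using mdiff_local_inverse[OF V(3,6) y(1)] y(2) by simp
    then have t: "frame_map X Y g e' \<in> tangent_frames Y"
      by (rule frame_map_tangent[OF X.manifold Y.manifold _ X.orthonormalD(1)[OF e(1)]])
    show ?thesis
      using dpi_orthonormal_iff[OF t] frame_map_local_inverse(2)[OF V(1,3,5,6,7) X.orthonormalD(1)[OF e(1)] e(2)] e(1) by simp
  qed
  have c1: "continuous_map (subtopology (frame_bundle Y) {e. fst e \<in> V}) (frame_bundle X) d\<pi>"
    by (rule continuous_frame_map[OF Y.riemannian_axioms X.riemannian_axioms V(1,5)]) (rule dpi_in)
  have c2: "continuous_map (subtopology (frame_bundle X) {e. fst e \<in> \<pi> ` V}) (frame_bundle Y) (frame_map X Y g)"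
    by (rule continuous_frame_map[OF X.riemannian_axioms Y.riemannian_axioms V(3,6)]) (rule gon)
  have h: "homeomorphic_maps (subtopology (frame_bundle Y) {e. fst e \<in> V}) (subtopology (frame_bundle X) {e. fst e \<in> \<pi> ` V}) d\<pi> (frame_map X Y g)"
    unfolding homeomorphic_maps_def
  proof (intro conjI ballI)
    show "continuous_map (subtopology (frame_bundle Y) {e. fst e \<in> V}) (subtopology (frame_bundle X) {e. fst e \<in> \<pi> ` V}) d\<pi>"
      using c1 by (auto simp: continuous_map_in_subtopology fst_dpi)
    show "continuous_map (subtopology (frame_bundle X) {e. fst e \<in> \<pi> ` V}) (subtopology (frame_bundle Y) {e. fst e \<in> V}) (frame_map X Y g)"
      using c2 V(7) by (auto simp: continuous_map_in_subtopology frame_map_simps)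
  next
    fix e assume "e \<in> topspace (subtopology (frame_bundle Y) {e. fst e \<in> V})"
    then have "e \<in> orthonormal_frames Y" "fst e \<in> V" by (auto simp: Y.topspace_frame_bundle)
    then show "frame_map X Y g (d\<pi> e) = e"
      using frame_map_local_inverse(1)[OF V(1,3,5,6,7)] Y.orthonormalD(1) by blast
  next
    fix e assume "e \<in> topspace (subtopology (frame_bundle X) {e. fst e \<in> \<pi> ` V})"
    then have "e \<in> orthonormal_frames X" "fst e \<in> \<pi> ` V" by (auto simp: X.topspace_frame_bundle)
    then show "d\<pi> (frame_map X Y g e) = e"
      using frame_map_local_inverse(2)[OF V(1,3,5,6,7)] X.orthonormalD(1) by blast
  qed
  define U where "U = V \<inter> W"
  have U: "openin (mtop Y) U" "x \<in> U" "U \<subseteq> W" "inj_on \<pi> U" "U \<subseteq> V"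
    using V W by (auto simp: U_def inj_on_def)
  have pU: "openin (mtop X) (\<pi> ` U)"
    using two_covering_props(2)[OF two_covering_pi] U(1) unfolding open_map_def by blast
  have iff: "\<pi> y \<in> \<pi> ` U \<longleftrightarrow> y \<in> U" if "y \<in> V" for y
    using that V(4) U(5) by (auto dest: inj_onD)
  have hm: "homeomorphic_map (mtop Y) (mtop Y) id" by simp
  have "homeomorphic_map (subtopology (subtopology (frame_bundle Y) {e. fst e \<in> V}) {e. fst e \<in> U})
    (subtopology (subtopology (frame_bundle X) {e. fst e \<in> \<pi> ` V}) {e. fst e \<in> \<pi> ` U}) d\<pi>"
    by (rule homeomorphic_map_subtopologies_alt[OF homeomorphic_maps_imp_map[OF h]]) (use iff in \<open>auto simp: fst_dpi\<close>)
  moreover have "{e. fst e \<in> V} \<inter> {e. fst e \<in> U} = {e :: ('y, 'm) frame. fst e \<in> U}"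
    "{e. fst e \<in> \<pi> ` V} \<inter> {e. fst e \<in> \<pi> ` U} = {e :: ('x, 'm) frame. fst e \<in> \<pi> ` U}" using U(5) by auto
  ultimately have hF: "homeomorphic_map (subtopology (frame_bundle Y) {e. fst e \<in> U}) (subtopology (frame_bundle X) {e. fst e \<in> \<pi> ` U}) d\<pi>"
    by (simp only: subtopology_subtopology)
  have hU: "homeomorphic_map (subtopology (mtop Y) U) (subtopology (mtop X) (\<pi> ` U)) \<pi>"
  proof (rule bijective_open_imp_homeomorphic_map)
    note P = two_covering_props[OF two_covering_pi]
    show "continuous_map (subtopology (mtop Y) U) (subtopology (mtop X) (\<pi> ` U)) \<pi>"
      using P(1) by (auto simp: continuous_map_in_subtopology continuous_map_from_subtopology)
    show "open_map (subtopology (mtop Y) U) (subtopology (mtop X) (\<pi> ` U)) \<pi>"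
      by (rule open_map_into_subtopology[OF open_map_from_subtopology[OF P(2) U(1)]]) auto
    show "\<pi> ` topspace (subtopology (mtop Y) U) = topspace (subtopology (mtop X) (\<pi> ` U))"
      using openin_subset[OF U(1)] pi_in by auto
    show "inj_on \<pi> (topspace (subtopology (mtop Y) U))" using U(4) by (auto simp: inj_on_def)
  qed
  show ?thesis by (rule that[OF U(1-4) pU hU hF])
qed

lemma dpi_dtau:
  assumes e: "e \<in> orthonormal_frames Y" shows "d\<pi> (d\<tau> e) = d\<pi> e"
proof -
  note y = Y.orthonormalD(1,2)[OF e]
  have "d\<pi> (d\<tau> e) = frame_map Y X (\<pi> \<circ> \<tau>) e"
    by (rule frame_map_compose[symmetric, OF Y.manifold Y.manifold mdiff_tau[OF y(2)] mdiff_pi[OF tau_in[OF y(2)]] y(1)])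
  also have "\<dots> = d\<pi> e"
    by (rule frame_map_cong[OF Y.manifold mdiff_compose[OF Y.manifold Y.manifold mdiff_tau[OF y(2)] mdiff_pi[OF tau_in[OF y(2)]]] openin_topspace y(2)])
      (simp add: pi_tau)
  finally show ?thesis .
qed

text \<open>The isometry property of \<tau> is derived: \<open>dpi_dtau\<close> shows that
  \<open>d\<tau>\<close> does not change the image under \<open>d\<pi>\<close>, and
  \<open>d\<pi>\<close> detects orthonormality.\<close>

lemma dtau_in: assumes e: "e \<in> orthonormal_frames Y" shows "d\<tau> e \<in> orthonormal_frames Y"
proof -
  have "d\<tau> e \<in> tangent_frames Y"
    by (rule frame_map_tangent[OF Y.manifold Y.manifold mdiff_tau Y.orthonormalD(1)[OF e]]) (rule Y.orthonormalD(2)[OF e])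
  from dpi_orthonormal_iff[OF this] show ?thesis using dpi_dtau[OF e] dpi_in[OF e] by simp
qed

lemma dtau_dtau: "e \<in> orthonormal_frames Y \<Longrightarrow> d\<tau> (d\<tau> e) = e"
  by (rule dpi_inject) (simp_all add: dtau_in dpi_dtau fst_dtau tau_tau Y.orthonormalD(2))

lemma dtau_mult: "e \<in> orthonormal_frames Y \<Longrightarrow> d\<tau> (frame_mult e A) = frame_mult (d\<tau> e) A"
  and dpi_mult: "e \<in> orthonormal_frames Y \<Longrightarrow> d\<pi> (frame_mult e A) = frame_mult (d\<pi> e) A"
  by (intro frame_map_mult[OF Y.manifold] mdiff_tau mdiff_pi Y.orthonormalD(2); assumption)+

lemma inv_dtau: "e \<in> orthonormal_frames Y \<Longrightarrow> inv_into (orthonormal_frames Y) d\<tau> e = d\<tau> e"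
proof -
  assume e: "e \<in> orthonormal_frames Y"
  have "inj_on d\<tau> (orthonormal_frames Y)" by (rule inj_on_inverseI) (rule dtau_dtau)
  from inv_into_f_f[OF this dtau_in[OF e]] show ?thesis using dtau_dtau[OF e] by simp
qed

lemma continuous_dpi: "continuous_map (frame_bundle Y) (frame_bundle X) d\<pi>"
proof (rule continuous_map_local)
  fix e assume "e \<in> topspace (frame_bundle Y)"
  then have e: "e \<in> orthonormal_frames Y" by (simp add: Y.topspace_frame_bundle)
  obtain U where U: "openin (mtop Y) U" "fst e \<in> U"
    "homeomorphic_map (subtopology (frame_bundle Y) {e. fst e \<in> U}) (subtopology (frame_bundle X) {e. fst e \<in> \<pi> ` U}) d\<pi>"
    by (rule dpi_local_homeo[OF Y.orthonormalD(2)[OF e] openin_topspace Y.orthonormalD(2)[OF e]])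
  show "\<exists>U. openin (frame_bundle Y) U \<and> e \<in> U \<and> continuous_map (subtopology (frame_bundle Y) U) (frame_bundle X) d\<pi>"
    using Y.openin_frames_over[OF U(1)] e U(2) homeomorphic_imp_continuous_map[OF U(3)]
    unfolding Y.subtopology_frames_over[of U]
    by (intro exI[of _ "{e \<in> orthonormal_frames Y. fst e \<in> U}"]) (simp add: continuous_map_in_subtopology)
qed

text \<open>As for \<tau> itself, \<open>d\<tau>\<close> is locally \<open>d\<pi>\<close> followed
  by the inverse of \<open>d\<pi>\<close> near the other point of the fibre; a continuous involution
  is a homeomorphism.\<close>

lemma homeomorphic_dtau: "homeomorphic_map (frame_bundle Y) (frame_bundle Y) d\<tau>"
proof (rule homeomorphic_map_involution)
  show "d\<tau> (d\<tau> e) = e" if "e \<in> topspace (frame_bundle Y)" for e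
    using that dtau_dtau by (simp add: Y.topspace_frame_bundle)
  show "continuous_map (frame_bundle Y) (frame_bundle Y) d\<tau>"
  proof (rule continuous_map_local)
    fix e assume "e \<in> topspace (frame_bundle Y)"
    then have e: "e \<in> orthonormal_frames Y" by (simp add: Y.topspace_frame_bundle)
    note y = Y.orthonormalD(2)[OF e]
    obtain U where U: "openin (mtop Y) U" "\<tau> (fst e) \<in> U"
      and h: "homeomorphic_map (subtopology (frame_bundle Y) {e. fst e \<in> U}) (subtopology (frame_bundle X) {e. fst e \<in> \<pi> ` U}) d\<pi>"
      by (rule dpi_local_homeo[OF tau_in[OF y] openin_topspace tau_in[OF y]])
    obtain k where k: "homeomorphic_maps (subtopology (frame_bundle Y) {e. fst e \<in> U}) (subtopology (frame_bundle X) {e. fst e \<in> \<pi> ` U}) d\<pi> k"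
      using h homeomorphic_map_maps by blast
    define V where "V = {z \<in> topspace (mtop Y). \<tau> z \<in> U}"
    have V: "openin (mtop Y) V" unfolding V_def by (rule openin_continuous_map_preimage[OF continuous_tau U(1)])
    let ?T = "subtopology (frame_bundle Y) {e. fst e \<in> V}"
    have tT: "t \<in> orthonormal_frames Y" "\<tau> (fst t) \<in> U" if "t \<in> topspace ?T" for t
      using that by (auto simp: Y.topspace_frame_bundle V_def)
    have "continuous_map ?T (subtopology (frame_bundle X) {e. fst e \<in> \<pi> ` U}) d\<pi>"
      unfolding continuous_map_in_subtopology
    proof (intro conjI continuous_map_from_subtopology continuous_dpi funcsetI)
      fix t assume "t \<in> topspace ?T"
      then have "\<pi> (\<tau> (fst t)) \<in> \<pi> ` U" "\<pi> (\<tau> (fst t)) = \<pi> (fst t)" using tT pi_tau Y.orthonormalD(2) by blast+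
      then show "d\<pi> t \<in> {e. fst e \<in> \<pi> ` U}" by (simp add: fst_dpi)
    qed
    moreover have "continuous_map (subtopology (frame_bundle X) {e. fst e \<in> \<pi> ` U}) (frame_bundle Y) k"
      using k by (auto simp: homeomorphic_maps_def continuous_map_in_subtopology)
    ultimately have "continuous_map ?T (frame_bundle Y) (k \<circ> d\<pi>)" by (rule continuous_map_compose)
    then have "continuous_map ?T (frame_bundle Y) d\<tau>"
    proof (rule continuous_map_eq)
      fix t assume t: "t \<in> topspace ?T"
      have "d\<tau> t \<in> topspace (subtopology (frame_bundle Y) {e. fst e \<in> U})"
        using tT[OF t] dtau_in by (simp add: Y.topspace_frame_bundle fst_dtau)
      then have "k (d\<pi> (d\<tau> t)) = d\<tau> t" using k by (simp add: homeomorphic_maps_def)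
      then show "(k \<circ> d\<pi>) t = d\<tau> t" using dpi_dtau[OF tT(1)[OF t]] by simp
    qed
    moreover have "e \<in> {e \<in> orthonormal_frames Y. fst e \<in> V}" using e y U(2) by (simp add: V_def)
    ultimately show "\<exists>U. openin (frame_bundle Y) U \<and> e \<in> U \<and> continuous_map (subtopology (frame_bundle Y) U) (frame_bundle Y) d\<tau>"
      using Y.openin_frames_over[OF V] unfolding Y.subtopology_frames_over[of V] by blast
  qed
qed

text \<open>Reversal is assumed for every orientation; applied to \<open>u\<close> it gives one
  implication, applied to the opposite orientation the other.\<close>

lemma dtau_orientation:
  assumes u: "orientation Y u" and e: "e \<in> orthonormal_frames Y"
  shows "d\<tau> e \<in> u \<longleftrightarrow> e \<notin> u"
proof -
  have *: "d\<tau> f \<in> opposite_orientation Y v" if "orientation Y v" "f \<in> v" for v f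
    using cover that unfolding orientable_double_cover_def by blast
  show ?thesis
  proof
    assume "d\<tau> e \<in> u"
    from *[OF u this] show "e \<notin> u" using dtau_dtau[OF e] Y.opposite_orthonormal_iff[OF e] by simp
  next
    assume "e \<notin> u"
    then have "e \<in> opposite_orientation Y u" using Y.opposite_orthonormal_iff[OF e] by simp
    from *[OF Y.orientation_opposite[OF u] this] show "d\<tau> e \<in> u" using Y.opposite_opposite[OF u] by simp
  qed
qed

end

section \<open>Pin and spin structures\<close>

lemma homeomorphic_map_id_prod:
  assumes "homeomorphic_map Z Z' f"
  shows "homeomorphic_map (prod_topology X Z) (prod_topology X Z') (\<lambda>(x, z). (x, f z))"
proof -
  obtain g where "homeomorphic_maps Z Z' f g" using assms homeomorphic_map_maps by blast
  moreover have "homeomorphic_maps X X (\<lambda>z. z) (\<lambda>z. z)" by (simp add: homeomorphic_maps_def)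
  ultimately have "homeomorphic_maps (prod_topology X Z) (prod_topology X Z') (\<lambda>(x, z). (x, f z)) (\<lambda>(x, z). (x, g z))"
    unfolding homeomorphic_maps_prod by blast
  then show ?thesis using homeomorphic_map_maps by blast
qed

lemma (in principal) trivialization_ball:
  assumes "x \<in> topspace B" "openin B W" "x \<in> W"
  obtains U \<Phi> where "openin B U" "x \<in> U" "U \<subseteq> W"
    "homeomorphic_map (prod_topology (subtopology B U) G) (subtopology P {p \<in> topspace P. pr p \<in> U}) \<Phi>"
    "\<forall>y \<in> U. \<forall>t \<in> topspace G. \<Phi> (y, t) \<in> topspace P \<and> pr (\<Phi> (y, t)) = y"
    "\<forall>y \<in> U. \<forall>t \<in> topspace G. \<forall>r \<in> topspace G. \<Phi> (y, mul t r) = act (\<Phi> (y, t)) r"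
proof (rule trivialization[OF assms])
  fix U \<Phi>
  assume U: "openin B U" "x \<in> U" "U \<subseteq> W"
    "homeomorphic_map (prod_topology (subtopology B U) G) (subtopology P {p \<in> topspace P. pr p \<in> U}) \<Phi>"
    and \<Phi>: "\<And>y t. y \<in> U \<Longrightarrow> t \<in> topspace G \<Longrightarrow> \<Phi> (y, t) \<in> topspace P"
    "\<And>y t. y \<in> U \<Longrightarrow> t \<in> topspace G \<Longrightarrow> pr (\<Phi> (y, t)) = y"
    "\<And>y t r. y \<in> U \<Longrightarrow> t \<in> topspace G \<Longrightarrow> r \<in> topspace G \<Longrightarrow> \<Phi> (y, mul t r) = act (\<Phi> (y, t)) r"
  show thesis by (rule that[OF U]) (simp_all add: \<Phi>)
qed

text \<open>Treats pin and spin structures at once, with \<open>F\<close> the bundle of frames that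
  they cover. The bound on the dimension puts -1 into both groups, which makes the sheet exchange a
  right multiplication.\<close>

locale lifted = clifford \<kappa> for \<kappa> :: real +
  fixes G :: "'m::{finite,linorder} cliff set" and M :: "('a, 'm, 'z) mfd_scheme"
    and F :: "('a, 'm) frame topology" and S :: "('p, 'a, 'm) frame_structure"
  assumes G: "G = Pin \<kappa> \<or> G = Spin \<kappa>" and lifts: "lifts_frames \<kappa> G M F S"
    and card2: "CARD('m) \<ge> 2"
begin

sublocale principal "cl_top G" "cl_mult \<kappa>" cl_one pin_inv "mtop M" "total S" "fst \<circ> cov S" "act S"
proof (intro principal.intro principal_axioms.intro)
  show "topological_group (cl_top G) (cl_mult \<kappa>) cl_one pin_inv"
    using G topological_group_Pin topological_group_Spin by metis
  show "principal_bundle (cl_top G) (cl_mult \<kappa>) cl_one (mtop M) (total S) (fst \<circ> cov S) (act S)"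
    using lifts unfolding lifts_frames_def by (elim conjE)
qed

lemmas acts = act_in[unfolded topspace_cl_top] act_act[unfolded topspace_cl_top] act_e
  act_inv[unfolded topspace_cl_top] mul_in[unfolded topspace_cl_top] inv_in[unfolded topspace_cl_top]

lemma two_cov: "two_covering (total S) F (cov S)"
  using lifts unfolding lifts_frames_def by (elim conjE)

lemma cov_act: "p \<in> topspace (total S) \<Longrightarrow> t \<in> G \<Longrightarrow> cov S (act S p t) = frame_mult (cov S p) (pin_proj \<kappa> t)"
  using lifts unfolding lifts_frames_def by (elim conjE) blast

lemma cov_in: "p \<in> topspace (total S) \<Longrightarrow> cov S p \<in> topspace F"
  using two_covering_props(1)[OF two_cov] by (auto simp: continuous_map_def)

lemma G_Pin: "t \<in> G \<Longrightarrow> t \<in> Pin \<kappa>"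
  using G Spin_Pin by blast

lemma minus_one_Pin: "- cl_one \<in> (Pin \<kappa> :: 'm cliff set)"
  by (rule Spin_Pin[OF minus_one_Spin[OF card2]])

lemma minus_one: "- cl_one \<in> G"
  using G minus_one_Pin minus_one_Spin[OF card2] by blast

lemma cov_minus:
  assumes p: "p \<in> topspace (total S)"
  shows "cov S (act S p (- cl_one)) = cov S p" "act S p (- cl_one) \<noteq> p" "act S (act S p (- cl_one)) (- cl_one) = p"
proof -
  show "cov S (act S p (- cl_one)) = cov S p"
    using cov_act[OF p minus_one] pin_proj_minus_one[OF minus_one_Pin] frame_mult_one[of "cov S p"] by simp
  show "act S p (- cl_one) \<noteq> p"
    using free[OF p] minus_one cl_one_neq(2) unfolding topspace_cl_top by metis
  show "act S (act S p (- cl_one)) (- cl_one) = p"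
    using acts(2)[OF p minus_one minus_one] by (simp add: cl_mult_linear cl_mult_one act_e[OF p])
qed

text \<open>-1 fixes every frame and acts freely, so it exchanges the two points of each fibre of
  the covering.\<close>

lemma cov_fibre:
  assumes p: "p \<in> topspace (total S)" and q: "q \<in> topspace (total S)" and pq: "cov S p = cov S q"
  shows "q = p \<or> q = act S p (- cl_one)"
proof -
  obtain a b where ab: "{r \<in> topspace (total S). cov S r = cov S p} = {a, b}"
    using two_covering_props(3)[OF two_cov cov_in[OF p]] by (meson card_2_iff)
  have "p \<in> {a, b}" "act S p (- cl_one) \<in> {a, b}" "q \<in> {a, b}"
    using p q pq cov_minus[OF p] acts(1)[OF p minus_one] unfolding ab[symmetric] by auto
  then show ?thesis using cov_minus(2)[OF p] by auto
qed

lemma sheet_exchange: "p \<in> topspace (total S) \<Longrightarrow> sheet_exchange S p = act S p (- cl_one)"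
  unfolding sheet_exchange_def
proof (rule the_equality)
  assume p: "p \<in> topspace (total S)"
  show "act S p (- cl_one) \<in> topspace (total S) \<and> act S p (- cl_one) \<noteq> p \<and> cov S (act S p (- cl_one)) = cov S p"
    using cov_minus[OF p] acts(1)[OF p minus_one] by simp
  show "q = act S p (- cl_one)" if "q \<in> topspace (total S) \<and> q \<noteq> p \<and> cov S q = cov S p" for q
    using cov_fibre[OF p, of q] that by simp
qed

lemma act_minus_commute:
  "p \<in> topspace (total S) \<Longrightarrow> t \<in> G \<Longrightarrow> act S (act S p (- cl_one)) t = act S (act S p t) (- cl_one)"
  using minus_one by (simp add: acts cl_mult_linear cl_mult_one)

lemma cov_surj: "e \<in> topspace F \<Longrightarrow> \<exists>p \<in> topspace (total S). cov S p = e"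
proof -
  assume "e \<in> topspace F"
  then have "card {r \<in> topspace (total S). cov S r = e} = 2" by (rule two_covering_props(3)[OF two_cov])
  then obtain a b where "{r \<in> topspace (total S). cov S r = e} = {a, b}" by (meson card_2_iff)
  then show ?thesis by blast
qed

lemma lifts_transport:
  fixes S' :: "('q, 'a, 'm) frame_structure"
  assumes f: "homeomorphic_map (total S) (total S') f"
    and cov: "\<And>p. p \<in> topspace (total S) \<Longrightarrow> cov S' (f p) = cov S p"
    and act: "\<And>p t. p \<in> topspace (total S) \<Longrightarrow> t \<in> G \<Longrightarrow> act S' (f p) t = f (act S p t)"
  shows "lifts_frames \<kappa> G M F S'"
  unfolding lifts_frames_def
proof (intro conjI ballI)
  show "principal_bundle (cl_top G) (cl_mult \<kappa>) cl_one (mtop M) (total S') (fst \<circ> cov S') (act S')"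
    by (rule transport_total[OF f]) (simp_all add: cov act topspace_cl_top)
  show "two_covering (total S') F (cov S')"
    by (rule two_covering_transport[OF two_cov f, of F id]) (simp_all add: cov)
  fix q t assume q: "q \<in> topspace (total S')" and t: "t \<in> G"
  obtain p where p: "p \<in> topspace (total S)" "q = f p"
    using q homeomorphic_imp_surjective_map[OF f] by blast
  show "cov S' (act S' q t) = frame_mult (cov S' q) (pin_proj \<kappa> t)"
    using cov cov_act act acts(1) p t by simp
qed

lemma lifts_transport_base:
  assumes k: "homeomorphic_map (mtop M) (mtop M) k" and K: "homeomorphic_map F F' K"
    and fst: "\<And>e. e \<in> topspace F \<Longrightarrow> fst (K e) = k (fst e)"
    and mult: "\<And>e A. e \<in> topspace F \<Longrightarrow> K (frame_mult e A) = frame_mult (K e) A"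
    and c: "\<And>p. p \<in> topspace (total S) \<Longrightarrow> c p = K (cov S p)"
  shows "lifts_frames \<kappa> G M F' (S\<lparr>cov := c\<rparr>)"
  unfolding lifts_frames_def
proof (intro conjI ballI)
  show "principal_bundle (cl_top G) (cl_mult \<kappa>) cl_one (mtop M) (total (S\<lparr>cov := c\<rparr>)) (fst \<circ> cov (S\<lparr>cov := c\<rparr>)) (act (S\<lparr>cov := c\<rparr>))"
    using transport_base[OF k, of "fst \<circ> c"] by (simp add: c fst cov_in)
  have "homeomorphic_map (total S) (total S) id" by simp
  from two_covering_transport[OF two_cov this K, of c]
  show "two_covering (total (S\<lparr>cov := c\<rparr>)) F' (cov (S\<lparr>cov := c\<rparr>))" by (simp add: c)
  fix q t assume "q \<in> topspace (total (S\<lparr>cov := c\<rparr>))" and t: "t \<in> G"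
  then have q: "q \<in> topspace (total S)" by simp
  show "cov (S\<lparr>cov := c\<rparr>) (act (S\<lparr>cov := c\<rparr>) q t) = frame_mult (cov (S\<lparr>cov := c\<rparr>) q) (pin_proj \<kappa> t)"
    using q t by (simp add: c acts cov_act mult cov_in)
qed

end

text \<open>Openness is automatic for a lift, by \<open>open_map_lift\<close>. Bijectivity is
  automatic too: the map commutes with -1, which exchanges the two points in each fibre of either
  covering.\<close>

lemma lifts_map_iso:
  fixes S :: "('p, 'a, 'm::{finite,linorder}) frame_structure" and S' :: "('q, 'a, 'm) frame_structure"
  assumes S: "lifted \<kappa> G M F S" and S': "lifted \<kappa> G M F S'"
    and f: "continuous_map (total S) (total S') f"
    and cov: "\<And>p. p \<in> topspace (total S) \<Longrightarrow> cov S' (f p) = cov S p"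
    and act: "\<And>p t. p \<in> topspace (total S) \<Longrightarrow> t \<in> G \<Longrightarrow> f (act S p t) = act S' (f p) t"
  shows "structure_iso G S S' f"
proof -
  interpret S: lifted \<kappa> G M F S by fact
  interpret S': lifted \<kappa> G M F S' by fact
  have fi: "f p \<in> topspace (total S')" if "p \<in> topspace (total S)" for p
    using f that by (auto simp: continuous_map_def)
  have "homeomorphic_map (total S) (total S') f"
  proof (rule bijective_open_imp_homeomorphic_map[OF f])
    show "open_map (total S) (total S') f"
      by (rule open_map_lift[OF two_covering_props(2)[OF S.two_cov] S'.two_cov f cov])
    show "f ` topspace (total S) = topspace (total S')"
    proof
      show "f ` topspace (total S) \<subseteq> topspace (total S')" using fi by blast
      show "topspace (total S') \<subseteq> f ` topspace (total S)"
      proof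
        fix q assume q: "q \<in> topspace (total S')"
        obtain p where p: "p \<in> topspace (total S)" "cov S p = cov S' q"
          using S.cov_surj[OF S'.cov_in[OF q]] by blast
        have "q = f p \<or> q = act S' (f p) (- cl_one)"
          by (rule S'.cov_fibre[OF fi[OF p(1)] q]) (simp add: cov p)
        then show "q \<in> f ` topspace (total S)"
          using p(1) act[OF p(1) S.minus_one] S.acts(1)[OF p(1) S.minus_one] by (metis image_eqI)
      qed
    qed
    show "inj_on f (topspace (total S))"
    proof (rule inj_onI)
      fix p q assume p: "p \<in> topspace (total S)" and q: "q \<in> topspace (total S)" and e: "f p = f q"
      have "q = p \<or> q = act S p (- cl_one)"
        by (rule S.cov_fibre[OF p q]) (metis cov e p q)
      then show "p = q"
        using act[OF p S.minus_one] S'.cov_minus(2)[OF fi[OF p]] e by auto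
    qed
  qed
  then show ?thesis using cov act by (simp add: structure_iso_def)
qed

lemma structure_isoD:
  assumes "structure_iso G S S' f"
  shows "homeomorphic_map (total S) (total S') f"
    and "continuous_map (total S) (total S') f"
    and "p \<in> topspace (total S) \<Longrightarrow> f p \<in> topspace (total S')"
    and "p \<in> topspace (total S) \<Longrightarrow> cov S' (f p) = cov S p"
    and "p \<in> topspace (total S) \<Longrightarrow> t \<in> G \<Longrightarrow> f (act S p t) = act S' (f p) t"
proof -
  show h: "homeomorphic_map (total S) (total S') f" using assms by (simp add: structure_iso_def)
  show c: "continuous_map (total S) (total S') f" by (rule homeomorphic_imp_continuous_map[OF h])
  show "p \<in> topspace (total S) \<Longrightarrow> f p \<in> topspace (total S')" using c by (auto simp: continuous_map_def)
qed (use assms in \<open>simp_all add: structure_iso_def\<close>)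

lemma structure_iso_inverse:
  assumes f: "structure_iso G S S' f"
    and act: "\<And>p t. p \<in> topspace (total S) \<Longrightarrow> t \<in> G \<Longrightarrow> act S p t \<in> topspace (total S)"
  shows "structure_iso G S' S (inv_into (topspace (total S)) f)"
proof -
  note h = structure_isoD[OF f]
  let ?g = "inv_into (topspace (total S)) f"
  have inj: "inj_on f (topspace (total S))" and im: "f ` topspace (total S) = topspace (total S')"
    using homeomorphic_imp_injective_map[OF h(1)] homeomorphic_imp_surjective_map[OF h(1)] by auto
  have gf: "?g (f p) = p" if "p \<in> topspace (total S)" for p using that inj by (simp add: inv_into_f_f)
  obtain g where g: "homeomorphic_maps (total S) (total S') f g" using h(1) homeomorphic_map_maps by blast
  have "?g q = g q" if q: "q \<in> topspace (total S')" for q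
  proof -
    obtain p where "p \<in> topspace (total S)" "q = f p" using q im by blast
    then show ?thesis using gf g by (simp add: homeomorphic_maps_def)
  qed
  moreover have "homeomorphic_map (total S') (total S) g" using g homeomorphic_maps_map by blast
  ultimately have "homeomorphic_map (total S') (total S) ?g" by (metis homeomorphic_map_eq)
  moreover have "cov S (?g q) = cov S' q \<and> (\<forall>t \<in> G. ?g (act S' q t) = act S (?g q) t)" if q: "q \<in> topspace (total S')" for q
  proof -
    obtain p where p: "p \<in> topspace (total S)" "q = f p" using q im by blast
    have "?g (act S' q t) = act S (?g q) t" if "t \<in> G" for t
      using h(5)[OF p(1) that] gf[OF act[OF p(1) that]] gf[OF p(1)] p(2) by simp
    then show ?thesis using h(4) gf p by simp
  qed
  ultimately show ?thesis unfolding structure_iso_def by blast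
qed

locale pin_setting = riemannian M + clifford \<kappa>
  for \<kappa> :: real and M :: "('a, 'm::{finite,linorder}, 'z) mfd_scheme" +
  assumes card2: "CARD('m) \<ge> 2"
begin

lemma pin_lifted: "pin_structure \<kappa> M S \<longleftrightarrow> lifted \<kappa> (Pin \<kappa>) M (frame_bundle M) S"
  unfolding pin_structure_def lifted_def lifted_axioms_def using card2 clifford_axioms by simp

lemma spin_lifted: "spin_structure \<kappa> M u S \<longleftrightarrow> lifted \<kappa> (Spin \<kappa>) M (oriented_frame_bundle M u) S"
  unfolding spin_structure_def lifted_def lifted_axioms_def using card2 clifford_axioms by simp

lemma topspace_oriented: "topspace (oriented_frame_bundle M u) = orthonormal_frames M \<inter> u"
  by (simp add: oriented_frame_bundle_def topspace_frame_bundle)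

lemma oriented_alt: "oriented_frame_bundle M u = subtopology (frame_bundle M) (orthonormal_frames M \<inter> u)"
  using subtopology_restrict[of "frame_bundle M" u] by (simp add: oriented_frame_bundle_def topspace_frame_bundle)

lemma pin_proj_oriented:
  assumes u: "orientation M u" and e: "e \<in> orthonormal_frames M" and t: "t \<in> Pin \<kappa>"
  shows "frame_mult e (pin_proj \<kappa> t) \<in> u \<longleftrightarrow> (e \<in> u \<longleftrightarrow> t \<in> Spin \<kappa>)"
proof -
  have "det (pin_proj \<kappa> t) \<noteq> 0"
    using det_orthogonal_matrix[OF pin_proj_props(2)[OF t]] by auto
  from oriented_mult_iff[OF u e this] show ?thesis using pin_proj_props(3)[OF t] by simp
qed

text \<open>The part over \<open>u\<close> is open, and an element of Pin preserves it exactly if it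
  lies in Spin, since an odd element changes the orientation of the frame. A local trivialization
  arises by translating one of the pin structure so that its unit section lies over
  \<open>u\<close>.\<close>

lemma spin_orient_restrict:
  assumes u: "orientation M u" and S: "pin_structure \<kappa> M S"
  shows "spin_structure \<kappa> M u (orient_restrict u S)"
proof -
  interpret S: lifted \<kappa> "Pin \<kappa>" M "frame_bundle M" S using S pin_lifted by blast
  interpret Sp: topological_group "cl_top (Spin \<kappa>) :: 'm cliff topology" "cl_mult \<kappa>" cl_one pin_inv by (rule topological_group_Spin)
  define R where "R = {p \<in> topspace (total S). cov S p \<in> u}"
  have tot: "total (orient_restrict u S) = subtopology (total S) R" and simps: "act (orient_restrict u S) = act S" "cov (orient_restrict u S) = cov S"
    by (simp_all add: orient_restrict_def R_def)
  have covO: "cov S p \<in> orthonormal_frames M" if "p \<in> topspace (total S)" for p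
    using S.cov_in[OF that] by (simp add: topspace_frame_bundle)
  have topR: "topspace (subtopology (total S) R) = R" by (auto simp: R_def)
  have actR: "act S p t \<in> R \<longleftrightarrow> (p \<in> R \<longleftrightarrow> t \<in> Spin \<kappa>)" if "p \<in> topspace (total S)" "t \<in> Pin \<kappa>" for p t
    using that S.acts(1)[OF that] S.cov_act[OF that] pin_proj_oriented[OF u covO[OF that(1)] that(2)] by (simp add: R_def)
  have subSpin: "cl_top (Spin \<kappa>) = subtopology (cl_top (Pin \<kappa>)) (Spin \<kappa> :: 'm cliff set)"
    using Spin_subset[where 'a = 'm] by (simp add: cl_top_def subtopology_subtopology inf.absorb2)
  show ?thesis
    unfolding spin_structure_def lifts_frames_def tot simps
  proof (intro conjI ballI)
    show "two_covering (subtopology (total S) R) (oriented_frame_bundle M u) (cov S)"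
    proof -
      have "{e \<in> topspace (total S). cov S e \<in> orthonormal_frames M \<inter> u} = R" using covO by (auto simp: R_def)
      then show ?thesis
        using two_covering_restrict[OF S.two_cov openin_oriented_frames[OF u]] by (simp add: oriented_alt)
    qed
    fix p and t :: "'m cliff" assume "p \<in> topspace (subtopology (total S) R)" "t \<in> Spin \<kappa>"
    then show "cov S (act S p t) = frame_mult (cov S p) (pin_proj \<kappa> t)"
      by (intro S.cov_act Spin_Pin) simp_all
  next
    show "principal_bundle (cl_top (Spin \<kappa>)) (cl_mult \<kappa>) cl_one (mtop M) (subtopology (total S) R) (fst \<circ> cov S) (act S)"
      unfolding principal_bundle_def topspace_cl_top
    proof (intro conjI ballI)
      show "continuous_map (subtopology (total S) R) (mtop M) (fst \<circ> cov S)"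
        by (rule continuous_map_from_subtopology[OF S.continuous_pr])
      show "continuous_map (prod_topology (subtopology (total S) R) (cl_top (Spin \<kappa>))) (subtopology (total S) R) (\<lambda>(p, t). act S p t)"
        unfolding subSpin subtopology_Times[symmetric] continuous_map_in_subtopology
      proof (intro conjI continuous_map_from_subtopology S.continuous_act funcsetI)
        fix x assume "x \<in> topspace (subtopology (prod_topology (total S) (cl_top (Pin \<kappa>))) (R \<times> (Spin \<kappa> :: 'm cliff set)))"
        then obtain p and t :: "'m cliff" where "x = (p, t)" "p \<in> R" "t \<in> Spin \<kappa>" by auto
        then show "(case x of (p, t) \<Rightarrow> act S p t) \<in> R" using actR[of p t] Spin_Pin[of t] by (simp add: R_def)
      qed
      fix p assume p: "p \<in> topspace (subtopology (total S) R)"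
      then show "act S p cl_one = p" using S.act_e by simp
      fix t :: "'m cliff" assume t: "t \<in> Spin \<kappa>"
      show "(fst \<circ> cov S) (act S p t) = (fst \<circ> cov S) p"
        using S.pr_act[of p t] p Spin_Pin[OF t] by (simp add: topspace_cl_top)
      fix r :: "'m cliff" assume r: "r \<in> Spin \<kappa>"
      show "act S (act S p t) r = act S p (cl_mult \<kappa> t r)"
        using S.acts(2)[of p t r] p Spin_Pin[OF t] Spin_Pin[OF r] by simp
    next
      fix x assume x: "x \<in> topspace (mtop M)"
      obtain U \<Phi> where U: "openin (mtop M) U" "x \<in> U"
        and h: "homeomorphic_map (prod_topology (subtopology (mtop M) U) (cl_top (Pin \<kappa>))) (subtopology (total S) {p \<in> topspace (total S). (fst \<circ> cov S) p \<in> U}) \<Phi>"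
        and \<Phi>0: "\<forall>y \<in> U. \<forall>t \<in> Pin \<kappa>. \<Phi> (y, t) \<in> topspace (total S) \<and> (fst \<circ> cov S) (\<Phi> (y, t)) = y"
        "\<forall>y \<in> U. \<forall>t \<in> Pin \<kappa>. \<forall>r \<in> Pin \<kappa>. \<Phi> (y, cl_mult \<kappa> t r) = act S (\<Phi> (y, t)) r"
        by (rule S.trivialization_ball[OF x openin_topspace x, unfolded topspace_cl_top])
      have \<Phi>: "\<Phi> (y, t) \<in> topspace (total S)" "(fst \<circ> cov S) (\<Phi> (y, t)) = y" if "y \<in> U" "t \<in> Pin \<kappa>" for y t
        using bspec[OF bspec[OF \<Phi>0(1) that(1)] that(2)] by simp_all
      have \<Phi>m: "\<Phi> (y, cl_mult \<kappa> t r) = act S (\<Phi> (y, t)) r" if "y \<in> U" "t \<in> Pin \<kappa>" "r \<in> Pin \<kappa>" for y t r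
        by (rule bspec[OF bspec[OF bspec[OF \<Phi>0(2) that(1)] that(2)] that(3)])
      obtain t0 :: "'m cliff" where t0: "t0 \<in> Pin \<kappa>" "t0 \<notin> Spin \<kappa>" using Pin_odd_ex by blast
      \<comment> \<open>If the unit section at \<open>x\<close> lies over the other orientation, the
        odd element \<open>t0\<close> moves it over \<open>u\<close>.\<close>
      obtain t1 where t1: "t1 \<in> Pin \<kappa>" "\<Phi> (x, t1) \<in> R"
      proof (cases "\<Phi> (x, cl_one) \<in> R")
        case True
        then show ?thesis using that Pin.one by blast
      next
        case False
        then have "act S (\<Phi> (x, cl_one)) t0 \<in> R" using actR[OF \<Phi>(1)[OF U(2) Pin.one] t0(1)] t0(2) by simp
        then have "\<Phi> (x, t0) \<in> R" using \<Phi>m[OF U(2) Pin.one t0(1)] by (simp add: cl_mult_one)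
        then show ?thesis using that t0(1) by blast
      qed
      \<comment> \<open>The translated section stays over \<open>u\<close> on a neighbourhood of
        \<open>x\<close>, because the part over \<open>u\<close> is open.\<close>
      define V where "V = {y \<in> U. \<Phi> (y, t1) \<in> R}"
      have "{p \<in> topspace (total S). cov S p \<in> orthonormal_frames M \<inter> u} = R" using covO by (auto simp: R_def)
      then have RO: "openin (total S) R"
        using openin_continuous_map_preimage[OF two_covering_props(1)[OF S.two_cov] openin_oriented_frames[OF u]] by simp
      have V: "openin (mtop M) V"
      proof -
        have "continuous_map (subtopology (mtop M) U) (prod_topology (subtopology (mtop M) U) (cl_top (Pin \<kappa>))) (\<lambda>y. (y, t1))"
          using t1(1) by (simp add: continuous_map_pairedI topspace_cl_top)
        from continuous_map_compose[OF this homeomorphic_imp_continuous_map[OF h]]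
        have "continuous_map (subtopology (mtop M) U) (total S) (\<Phi> \<circ> (\<lambda>y. (y, t1)))"
          unfolding continuous_map_in_subtopology by (rule conjunct1)
        from openin_preimage[OF U(1) this RO] show ?thesis by (simp add: V_def)
      qed
      have VU: "V \<subseteq> U" by (auto simp: V_def)
      have RT: "R \<subseteq> topspace (total S)" by (auto simp: R_def)
      let ?\<Psi> = "\<Phi> \<circ> (\<lambda>(y, t). (y, cl_mult \<kappa> t1 t))"
      have \<Psi>: "?\<Psi> (y, t) = act S (\<Phi> (y, t1)) t" if "y \<in> U" "t \<in> Pin \<kappa>" for y t
        using \<Phi>m[OF that(1) t1(1) that(2)] by simp
      have h1: "homeomorphic_map (prod_topology (subtopology (mtop M) U) (cl_top (Pin \<kappa>))) (prod_topology (subtopology (mtop M) U) (cl_top (Pin \<kappa>))) (\<lambda>(y, t). (y, cl_mult \<kappa> t1 t))"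
        by (rule homeomorphic_map_id_prod[OF S.homeomorphic_map_left_mul]) (simp add: topspace_cl_top t1)
      have h2: "homeomorphic_map (subtopology (prod_topology (subtopology (mtop M) U) (cl_top (Pin \<kappa>))) (V \<times> Spin \<kappa>))
         (subtopology (subtopology (total S) {p \<in> topspace (total S). (fst \<circ> cov S) p \<in> U}) {p \<in> R. (fst \<circ> cov S) p \<in> V}) ?\<Psi>"
      proof (rule homeomorphic_map_subtopologies_alt[OF homeomorphic_map_compose[OF h1 h]])
        fix z :: "'a \<times> 'm cliff" assume "z \<in> topspace (prod_topology (subtopology (mtop M) U) (cl_top (Pin \<kappa>)))"
        then obtain y and t :: "'m cliff" where z: "z = (y, t)" "y \<in> U" "t \<in> Pin \<kappa>" by (auto simp: topspace_cl_top)
        have y1: "\<Phi> (y, t1) \<in> topspace (total S)" by (rule \<Phi>(1)[OF z(2) t1(1)])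
        have "(fst \<circ> cov S) (act S (\<Phi> (y, t1)) t) = y"
          using S.pr_act[OF y1, of t] z(3) \<Phi>(2)[OF z(2) t1(1)] by (simp add: topspace_cl_top)
        then show "(?\<Psi> z \<in> {p \<in> R. (fst \<circ> cov S) p \<in> V}) = (z \<in> V \<times> Spin \<kappa>)"
          using actR[OF y1 z(3)] z \<Psi>[OF z(2,3)] by (auto simp: V_def)
      qed
      have e1: "subtopology (prod_topology (subtopology (mtop M) U) (cl_top (Pin \<kappa>))) (V \<times> (Spin \<kappa> :: 'm cliff set)) =
          prod_topology (subtopology (mtop M) V) (cl_top (Spin \<kappa>))"
        using VU by (simp add: subtopology_Times subtopology_subtopology subSpin inf.absorb2)
      have "{p \<in> topspace (total S). (fst \<circ> cov S) p \<in> U} \<inter> {p \<in> R. (fst \<circ> cov S) p \<in> V} =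
         R \<inter> {p \<in> topspace (subtopology (total S) R). (fst \<circ> cov S) p \<in> V}"
        unfolding topR using VU RT by blast
      then have e2: "subtopology (subtopology (total S) {p \<in> topspace (total S). (fst \<circ> cov S) p \<in> U}) {p \<in> R. (fst \<circ> cov S) p \<in> V} =
          subtopology (subtopology (total S) R) {p \<in> topspace (subtopology (total S) R). (fst \<circ> cov S) p \<in> V}"
        by (simp only: subtopology_subtopology)
      show "\<exists>U. openin (mtop M) U \<and> x \<in> U \<and>
          (\<exists>\<Phi>. homeomorphic_map (prod_topology (subtopology (mtop M) U) (cl_top (Spin \<kappa>)))
             (subtopology (subtopology (total S) R) {p \<in> topspace (subtopology (total S) R). (fst \<circ> cov S) p \<in> U}) \<Phi> \<and>
             (\<forall>y\<in>U. \<forall>t\<in>Spin \<kappa>. (fst \<circ> cov S) (\<Phi> (y, t)) = y \<and>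
               (\<forall>r\<in>Spin \<kappa>. \<Phi> (y, cl_mult \<kappa> t r) = act S (\<Phi> (y, t)) r)))"
      proof (intro exI[of _ V] conjI exI[of _ ?\<Psi>] ballI)
        show "openin (mtop M) V" by (rule V)
        show "x \<in> V" using U(2) t1(2) by (simp add: V_def)
        show "homeomorphic_map (prod_topology (subtopology (mtop M) V) (cl_top (Spin \<kappa>)))
             (subtopology (subtopology (total S) R) {p \<in> topspace (subtopology (total S) R). (fst \<circ> cov S) p \<in> V}) ?\<Psi>"
          using h2 unfolding e1 e2 .
        fix y and t :: "'m cliff" assume y: "y \<in> V" and t: "t \<in> Spin \<kappa>"
        have yU: "y \<in> U" using y VU by blast
        have tP: "t \<in> Pin \<kappa>" by (rule Spin_Pin[OF t])
        have y1: "\<Phi> (y, t1) \<in> topspace (total S)" by (rule \<Phi>(1)[OF yU t1(1)])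
        show "(fst \<circ> cov S) (?\<Psi> (y, t)) = y"
          unfolding \<Psi>[OF yU tP] using S.pr_act[OF y1, of t] tP \<Phi>(2)[OF yU t1(1)] by (simp add: topspace_cl_top)
        fix r :: "'m cliff" assume r: "r \<in> Spin \<kappa>"
        show "?\<Psi> (y, cl_mult \<kappa> t r) = act S (?\<Psi> (y, t)) r"
          unfolding \<Psi>[OF yU tP] \<Psi>[OF yU Pin_mult[OF tP Spin_Pin[OF r]]]
          by (rule S.acts(2)[OF y1 tP Spin_Pin[OF r], symmetric])
      qed
    qed
  qed
qed

end

locale pin_cover = double_cover X Y \<pi> \<tau> + clifford \<kappa>
  for X :: "('x, 'm::{finite,linorder}) mfd" and Y :: "('y, 'm) mfd" and \<pi> \<tau> and \<kappa> :: real +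
  assumes card2: "CARD('m) \<ge> 2"
begin

sublocale PX: pin_setting \<kappa> X by unfold_locales (rule card2)
sublocale PY: pin_setting \<kappa> Y by unfold_locales (rule card2)

lemma pullback_simps: "total (isometry_pullback Y \<tau> S) = total S" "act (isometry_pullback Y \<tau> S) = act S"
  by (simp_all add: isometry_pullback_def)

lemma pullback_cov: "cov S p \<in> orthonormal_frames Y \<Longrightarrow> cov (isometry_pullback Y \<tau> S) p = d\<tau> (cov S p)"
  by (simp add: isometry_pullback_def inv_dtau)

lemma pin_cov_in: "pin_structure \<kappa> Y S \<Longrightarrow> p \<in> topspace (total S) \<Longrightarrow> cov S p \<in> orthonormal_frames Y"
  using lifted.cov_in[of \<kappa> "Pin \<kappa>" Y "frame_bundle Y" S p] by (simp add: PY.pin_lifted Y.topspace_frame_bundle)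

lemma pin_isometry_pullback:
  assumes S: "pin_structure \<kappa> Y S" shows "pin_structure \<kappa> Y (isometry_pullback Y \<tau> S)"
proof -
  interpret S: lifted \<kappa> "Pin \<kappa>" Y "frame_bundle Y" S using S PY.pin_lifted by blast
  show ?thesis
    unfolding pin_structure_def isometry_pullback_def
    by (rule S.lifts_transport_base[OF homeomorphic_tau homeomorphic_dtau])
      (simp_all add: Y.topspace_frame_bundle fst_dtau dtau_mult inv_dtau pin_cov_in[OF S])
qed

text \<open>Since \<open>d\<tau>\<close> reverses orientation, a point of the total space lies over
  \<open>u'\<close> for the original covering exactly if it lies over \<open>u\<close> for the
  pulled-back one. The two structures are therefore equal, not only isomorphic.\<close>

lemma pullback_restrict:
  assumes u: "orientation Y u" and S: "pin_structure \<kappa> Y S"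
  shows "isometry_pullback Y \<tau> (orient_restrict (opposite_orientation Y u) S) = orient_restrict u (isometry_pullback Y \<tau> S)"
proof -
  have "cov S p \<in> opposite_orientation Y u \<longleftrightarrow> inv_into (orthonormal_frames Y) d\<tau> (cov S p) \<in> u"
    if "p \<in> topspace (total S)" for p
    using pin_cov_in[OF S that] dtau_orientation[OF u pin_cov_in[OF S that]] Y.opposite_orthonormal_iff[OF pin_cov_in[OF S that], of u]
    by (simp only: inv_dtau)
  then have "{p \<in> topspace (total S). cov S p \<in> opposite_orientation Y u} =
    {p \<in> topspace (total S). inv_into (orthonormal_frames Y) d\<tau> (cov S p) \<in> u}" by blast
  then show ?thesis by (simp add: isometry_pullback_def orient_restrict_def)
qed

lemma iso_restrict:
  assumes u: "orientation Y u" and S: "pin_structure \<kappa> Y S" and S': "pin_structure \<kappa> Y S'"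
    and f: "structure_iso (Pin \<kappa>) S S' f"
  shows "spin_equivalence \<kappa> Y u (orient_restrict u S) (orient_restrict u S') f"
proof -
  note h = structure_isoD[OF f]
  have "homeomorphic_map (subtopology (total S) {p \<in> topspace (total S). cov S p \<in> u}) (subtopology (total S') {p \<in> topspace (total S'). cov S' p \<in> u}) f"
    by (rule homeomorphic_map_subtopologies_alt[OF h(1)]) (simp add: h(4))
  then have "structure_iso (Spin \<kappa>) (orient_restrict u S) (orient_restrict u S') f"
    unfolding structure_iso_def by (simp add: orient_restrict_def h(4,5) Spin_Pin)
  then show ?thesis
    unfolding spin_equivalence_def by (intro conjI PY.spin_orient_restrict[OF u] S S')
qed

text \<open>The third claim inverts the second: over \<open>u'\<close> the lift is an equivalence
  from the restricted structure to the pull-back of the other one, whereas the second component of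
  an isomorphism of couples runs in the opposite direction.\<close>

theorem lift_restricts_to_spin:
  fixes S :: "('p, 'y, 'm) frame_structure"
  assumes u: "orientation Y u" and u': "u' = opposite_orientation Y u"
    and D: "pin_equivalence \<kappa> Y S (isometry_pullback Y \<tau> S) D"
  shows "spin_equivalence \<kappa> Y u (orient_restrict u S) (isometry_pullback Y \<tau> (orient_restrict u' S)) D"
    and "spin_equivalence \<kappa> Y u' (orient_restrict u' S) (isometry_pullback Y \<tau> (orient_restrict u S)) D"
    and "spin_equivalence \<kappa> Y u' (isometry_pullback Y \<tau> (orient_restrict u S)) (orient_restrict u' S) (inv_into (topspace (total (orient_restrict u' S))) D)"
proof -
  have S: "pin_structure \<kappa> Y S" "pin_structure \<kappa> Y (isometry_pullback Y \<tau> S)" and f: "structure_iso (Pin \<kappa>) S (isometry_pullback Y \<tau> S) D"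
    using D by (simp_all add: pin_equivalence_def)
  have v: "orientation Y u'" "opposite_orientation Y u' = u"
    unfolding u' using Y.orientation_opposite[OF u] Y.opposite_opposite[OF u] by simp_all
  show "spin_equivalence \<kappa> Y u (orient_restrict u S) (isometry_pullback Y \<tau> (orient_restrict u' S)) D"
    using iso_restrict[OF u S f] pullback_restrict[OF u S(1)] u' by simp
  show e: "spin_equivalence \<kappa> Y u' (orient_restrict u' S) (isometry_pullback Y \<tau> (orient_restrict u S)) D"
    using iso_restrict[OF v(1) S f] pullback_restrict[OF v(1) S(1)] v(2) by simp
  interpret R: lifted \<kappa> "Spin \<kappa>" Y "oriented_frame_bundle Y u'" "orient_restrict u' S"
    using conjunct1[OF e[unfolded spin_equivalence_def]] by (simp only: PY.spin_lifted)
  show "spin_equivalence \<kappa> Y u' (isometry_pullback Y \<tau> (orient_restrict u S)) (orient_restrict u' S) (inv_into (topspace (total (orient_restrict u' S))) D)"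
    using e unfolding spin_equivalence_def by (intro conjI structure_iso_inverse[OF _ R.acts(1)]) simp_all
qed

end

section \<open>The extension of a spin structure to Pin\<close>

lemma (in clifford) cl_top_Spin_subtopology: "cl_top (Spin \<kappa>) = subtopology (cl_top (Pin \<kappa>)) (Spin \<kappa> :: 'm::{finite,linorder} cliff set)"
  using Spin_subset[where 'a = 'm] by (simp add: cl_top_def subtopology_subtopology inf.absorb2)

locale extension = pin_setting \<kappa> M
  for \<kappa> :: real and M :: "('a, 'm::{finite,linorder}, 'z) mfd_scheme" +
  fixes u :: "('a, 'm) frame set" and S :: "('p, 'a, 'm) frame_structure"
  assumes u: "orientation M u" and spin: "spin_structure \<kappa> M u S"
begin

sublocale S: lifted \<kappa> "Spin \<kappa>" M "oriented_frame_bundle M u" S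
  using spin spin_lifted by blast

sublocale PG: topological_group "cl_top (Pin \<kappa>) :: 'm cliff topology" "cl_mult \<kappa>" cl_one pin_inv
  by (rule topological_group_Pin)

abbreviation "P \<equiv> topspace (total S)"
abbreviation "E \<equiv> pin_extension \<kappa> S"
abbreviation cls :: "'p \<Rightarrow> 'm cliff \<Rightarrow> ('p \<times> 'm cliff) set" where "cls \<equiv> ext_class \<kappa> S"
abbreviation "T \<equiv> prod_topology (total S) (cl_top (Pin \<kappa>) :: 'm cliff topology)"
abbreviation "Q \<equiv> \<lambda>(p, t). cls p t"

lemma ext_class_iff: "(q, s) \<in> cls p t \<longleftrightarrow> s \<in> Pin \<kappa> \<and> (\<exists>r \<in> Spin \<kappa>. q = act S p r \<and> t = cl_mult \<kappa> r s)"
  by (simp add: ext_class_def)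

lemma ext_class_self: "p \<in> P \<Longrightarrow> t \<in> Pin \<kappa> \<Longrightarrow> (p, t) \<in> cls p t"
  unfolding ext_class_iff by (auto intro!: bexI[of _ cl_one] simp: S.act_e cl_mult_one Spin_one)

text \<open>With \<open>ext_class_eq_iff\<close>, this shows that the sets \<open>ext_class\<close>
  are the orbits of Spin acting on pairs by (p, t) to (p r, r^{-1} t); the group laws of Spin make
  the one-sided definition symmetric.\<close>

lemma ext_class_act:
  assumes p: "p \<in> P" and r: "r \<in> Spin \<kappa>"
  shows "cls (act S p r) s = cls p (cl_mult \<kappa> r s)"
proof (intro set_eqI iffI)
  note rP = Spin_Pin[OF r]
  fix z
  show "z \<in> cls p (cl_mult \<kappa> r s)" if z: "z \<in> cls (act S p r) s"
  proof -
    obtain q v r' where *: "z = (q, v)" "v \<in> Pin \<kappa>" "r' \<in> Spin \<kappa>" "q = act S (act S p r) r'" "s = cl_mult \<kappa> r' v"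
      using z by (cases z) (auto simp: ext_class_iff)
    have "q = act S p (cl_mult \<kappa> r r')" "cl_mult \<kappa> r r' \<in> Spin \<kappa>"
      using * S.acts(2)[OF p r] S.acts(6)[OF r] by simp_all
    moreover have "cl_mult \<kappa> r s = cl_mult \<kappa> (cl_mult \<kappa> r r') v" using * by (simp add: cl_mult_assoc[OF sign])
    ultimately show ?thesis using *(1,2) ext_class_iff by blast
  qed
  show "z \<in> cls (act S p r) s" if z: "z \<in> cls p (cl_mult \<kappa> r s)"
  proof -
    obtain q v r' where *: "z = (q, v)" "v \<in> Pin \<kappa>" "r' \<in> Spin \<kappa>" "q = act S p r'" "cl_mult \<kappa> r s = cl_mult \<kappa> r' v"
      using z by (cases z) (auto simp: ext_class_iff)
    let ?r = "cl_mult \<kappa> (pin_inv r) r'"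
    have i: "pin_inv r \<in> Spin \<kappa>" using r pin_inv_Spin_iff[OF rP] by simp
    have "?r \<in> Spin \<kappa>" by (rule S.acts(6)[OF i *(3)])
    moreover have "act S (act S p r) ?r = q"
      using S.acts(2)[OF p r \<open>?r \<in> Spin \<kappa>\<close>] *(4) pin_inv(2)[OF rP] by (simp add: cl_mult_assoc[OF sign, symmetric] cl_mult_one)
    moreover have "s = cl_mult \<kappa> ?r v"
    proof -
      have "s = cl_mult \<kappa> (pin_inv r) (cl_mult \<kappa> r s)"
        using pin_inv(3)[OF rP] by (simp add: cl_mult_assoc[OF sign, symmetric] cl_mult_one)
      then show ?thesis by (simp add: *(5) cl_mult_assoc[OF sign])
    qed
    ultimately show ?thesis using *(1,2) ext_class_iff by blast
  qed
qed

lemma ext_class_eq_iff: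
  assumes "p \<in> P" "q \<in> P" "t \<in> Pin \<kappa>" "s \<in> Pin \<kappa>"
  shows "cls p t = cls q s \<longleftrightarrow> (\<exists>r \<in> Spin \<kappa>. q = act S p r \<and> t = cl_mult \<kappa> r s)"
proof
  assume "cls p t = cls q s"
  then have "(q, s) \<in> cls p t" using ext_class_self[OF assms(2,4)] by simp
  then show "\<exists>r \<in> Spin \<kappa>. q = act S p r \<and> t = cl_mult \<kappa> r s" by (simp add: ext_class_iff)
next
  assume "\<exists>r \<in> Spin \<kappa>. q = act S p r \<and> t = cl_mult \<kappa> r s"
  then show "cls p t = cls q s" using ext_class_act[OF assms(1)] by auto
qed

lemma act_ext:
  assumes p: "p \<in> P" and t: "t \<in> Pin \<kappa>" and r: "r \<in> Pin \<kappa>"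
  shows "act E (cls p t) r = cls p (cl_mult \<kappa> t r)"
proof -
  have "(\<lambda>(q, s). (q, cl_mult \<kappa> s r)) ` cls p t = cls p (cl_mult \<kappa> t r)"
  proof (intro set_eqI iffI)
    fix z assume "z \<in> (\<lambda>(q, s). (q, cl_mult \<kappa> s r)) ` cls p t"
    then obtain q s where z: "z = (q, cl_mult \<kappa> s r)" "(q, s) \<in> cls p t" by auto
    then show "z \<in> cls p (cl_mult \<kappa> t r)" using Pin_mult[OF _ r] by (auto simp: ext_class_iff cl_mult_assoc[OF sign])
  next
    fix z assume z: "z \<in> cls p (cl_mult \<kappa> t r)"
    then obtain q v r' where *: "z = (q, v)" "v \<in> Pin \<kappa>" "r' \<in> Spin \<kappa>" "q = act S p r'" "cl_mult \<kappa> t r = cl_mult \<kappa> r' v"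
      by (cases z) (auto simp: ext_class_iff)
    have "t = cl_mult \<kappa> (cl_mult \<kappa> t r) (pin_inv r)" using pin_inv(2)[OF r] by (simp add: cl_mult_assoc[OF sign] cl_mult_one)
    then have "t = cl_mult \<kappa> r' (cl_mult \<kappa> v (pin_inv r))" by (simp add: *(5) cl_mult_assoc[OF sign])
    then have "(q, cl_mult \<kappa> v (pin_inv r)) \<in> cls p t"
      using * Pin_mult[OF *(2) pin_inv(1)[OF r]] ext_class_iff by blast
    moreover have "cl_mult \<kappa> (cl_mult \<kappa> v (pin_inv r)) r = v" using pin_inv(3)[OF r] by (simp add: cl_mult_assoc[OF sign] cl_mult_one)
    ultimately show "z \<in> (\<lambda>(q, s). (q, cl_mult \<kappa> s r)) ` cls p t" using *(1) by force
  qed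
  then show ?thesis by (simp add: pin_extension_def)
qed

lemma cov_ext:
  assumes p: "p \<in> P" and t: "t \<in> Pin \<kappa>"
  shows "cov E (cls p t) = frame_mult (cov S p) (pin_proj \<kappa> t)"
proof -
  have "(\<lambda>(p, t). frame_mult (cov S p) (pin_proj \<kappa> t)) ` cls p t = {frame_mult (cov S p) (pin_proj \<kappa> t)}"
  proof
    show "(\<lambda>(p, t). frame_mult (cov S p) (pin_proj \<kappa> t)) ` cls p t \<subseteq> {frame_mult (cov S p) (pin_proj \<kappa> t)}"
      using p by (auto simp: ext_class_iff S.cov_act frame_mult_mult pin_proj_mult Spin_Pin)
    show "{frame_mult (cov S p) (pin_proj \<kappa> t)} \<subseteq> (\<lambda>(p, t). frame_mult (cov S p) (pin_proj \<kappa> t)) ` cls p t"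
      using ext_class_self[OF p t] by force
  qed
  then show ?thesis by (simp add: pin_extension_def)
qed

lemma topspace_T: "topspace T = P \<times> Pin \<kappa>"
  by (simp add: topspace_cl_top)

lemma total_E: "total E = quotient_top T Q"
  by (simp add: pin_extension_def)

lemma topspace_E: "topspace (total E) = Q ` (P \<times> Pin \<kappa>)"
  unfolding total_E topspace_quotient_top topspace_T ..

lemma E_cases: "C \<in> topspace (total E) \<Longrightarrow> \<exists>p \<in> P. \<exists>t \<in> Pin \<kappa>. C = cls p t"
  unfolding topspace_E by auto

lemma cls_in: "p \<in> P \<Longrightarrow> t \<in> Pin \<kappa> \<Longrightarrow> cls p t \<in> topspace (total E)"
  unfolding topspace_E by auto

lemma continuous_Q: "continuous_map T (total E) Q"
  unfolding total_E by (rule continuous_map_quotient_top)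

lemma continuous_translate:
  assumes r: "r \<in> Spin \<kappa>"
  shows "continuous_map T T (\<lambda>(p, t). (act S p r, cl_mult \<kappa> (pin_inv r) t))"
proof -
  have "continuous_map T (total S) (\<lambda>x. act S (fst x) r)"
    using continuous_map_compose[OF continuous_map_fst S.continuous_act_right] r by (simp add: comp_def topspace_cl_top)
  moreover have "continuous_map T (cl_top (Pin \<kappa>)) (\<lambda>x. cl_mult \<kappa> (pin_inv r) (snd x))"
    using continuous_map_compose[OF continuous_map_snd homeomorphic_imp_continuous_map[OF PG.homeomorphic_map_left_mul]]
      pin_inv(1)[OF Spin_Pin[OF r]] by (simp add: comp_def topspace_cl_top)
  ultimately show ?thesis unfolding case_prod_unfold by (rule continuous_map_pairedI)
qed

text \<open>The saturation of \<open>W\<close> is the union of its preimages under the translations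
  by elements of Spin, each of which is continuous.\<close>

lemma open_Q: "open_map T (total E) Q"
  unfolding open_map_def
proof (intro allI impI)
  fix W assume W: "openin T W"
  have WT: "W \<subseteq> P \<times> Pin \<kappa>" using openin_subset[OF W] topspace_T by simp
  have "{x \<in> topspace T. Q x \<in> Q ` W} = (\<Union>r\<in>Spin \<kappa>. {x \<in> topspace T. (\<lambda>(p, t). (act S p r, cl_mult \<kappa> (pin_inv r) t)) x \<in> W})"
    (is "?l = ?r")
  proof
    show "?l \<subseteq> ?r"
    proof
      fix x assume "x \<in> ?l"
      then obtain p t q s where x: "x = (p, t)" "p \<in> P" "t \<in> Pin \<kappa>" "(q, s) \<in> W" "cls p t = cls q s"
        unfolding topspace_T by auto
      then obtain r where r: "r \<in> Spin \<kappa>" "q = act S p r" "t = cl_mult \<kappa> r s"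
        using ext_class_eq_iff[of p q t s] WT by blast
      then have "cl_mult \<kappa> (pin_inv r) t = s"
        using pin_inv(3)[OF Spin_Pin[OF r(1)]] by (simp add: cl_mult_assoc[OF sign, symmetric] cl_mult_one)
      then have "(act S p r, cl_mult \<kappa> (pin_inv r) t) \<in> W" using x(4) r(2) by simp
      then show "x \<in> ?r" using x(1-3) by (intro UN_I[OF r(1)]) (simp add: topspace_cl_top)
    qed
    show "?r \<subseteq> ?l"
    proof
      fix x assume "x \<in> ?r"
      then obtain p t r where x: "x = (p, t)" "p \<in> P" "t \<in> Pin \<kappa>" "r \<in> Spin \<kappa>" "(act S p r, cl_mult \<kappa> (pin_inv r) t) \<in> W"
        unfolding topspace_T by auto
      have "cls (act S p r) (cl_mult \<kappa> (pin_inv r) t) = cls p t"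
        using ext_class_act[OF x(2,4)] pin_inv(2)[OF Spin_Pin[OF x(4)]] by (simp add: cl_mult_assoc[OF sign, symmetric] cl_mult_one)
      then have "Q x = Q (act S p r, cl_mult \<kappa> (pin_inv r) t)" using x(1) by simp
      then have "Q x \<in> Q ` W" by (rule image_eqI[OF _ x(5)])
      then show "x \<in> ?l" using x topspace_T by simp
    qed
  qed
  moreover have "openin T ?r"
  proof (rule openin_Union)
    fix A assume "A \<in> (\<lambda>r. {x \<in> topspace T. (\<lambda>(p, t). (act S p r, cl_mult \<kappa> (pin_inv r) t)) x \<in> W}) ` Spin \<kappa>"
    then obtain r where "r \<in> Spin \<kappa>" "A = {x \<in> topspace T. (\<lambda>(p, t). (act S p r, cl_mult \<kappa> (pin_inv r) t)) x \<in> W}" by blast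
    then show "openin T A" using openin_continuous_map_preimage[OF continuous_translate W] by simp
  qed
  ultimately show "openin (total E) (Q ` W)"
    unfolding total_E openin_quotient_top topspace_T using WT by auto
qed

lemma covS_in: "p \<in> P \<Longrightarrow> cov S p \<in> orthonormal_frames M \<and> cov S p \<in> u"
  using S.cov_in topspace_oriented by blast

lemma cov_E_in: "C \<in> topspace (total E) \<Longrightarrow> cov E C \<in> orthonormal_frames M"
  using E_cases[of C] cov_ext covS_in frame_mult_orthonormal pin_proj_props(2) by metis

lemma cov_E_u: "p \<in> P \<Longrightarrow> t \<in> Pin \<kappa> \<Longrightarrow> cov E (cls p t) \<in> u \<longleftrightarrow> t \<in> Spin \<kappa>"
  using pin_proj_oriented[OF u, of "cov S p" t] covS_in by (simp add: cov_ext)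

text \<open>The unit section \<open>\<Phi> (y, cl_one)\<close> of the spin bundle also trivializes
  the extension. The delicate point is openness: an open set is first pulled back along
  multiplication in the group, where all of \<Phi> is available, and then mapped down by the open
  map \<open>Q\<close>.\<close>

lemma homeomorphic_trivialization:
  assumes U: "openin (mtop M) U"
    and h: "homeomorphic_map (prod_topology (subtopology (mtop M) U) (cl_top (Spin \<kappa>))) (subtopology (total S) {p \<in> P. (fst \<circ> cov S) p \<in> U}) \<Phi>"
    and \<Phi>: "\<And>y t. y \<in> U \<Longrightarrow> t \<in> Spin \<kappa> \<Longrightarrow> \<Phi> (y, t) \<in> P" "\<And>y t. y \<in> U \<Longrightarrow> t \<in> Spin \<kappa> \<Longrightarrow> (fst \<circ> cov S) (\<Phi> (y, t)) = y"
    "\<And>y t r. y \<in> U \<Longrightarrow> t \<in> Spin \<kappa> \<Longrightarrow> r \<in> Spin \<kappa> \<Longrightarrow> \<Phi> (y, cl_mult \<kappa> t r) = act S (\<Phi> (y, t)) r"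
  shows "homeomorphic_map (prod_topology (subtopology (mtop M) U) (cl_top (Pin \<kappa>)))
      (subtopology (total E) {C \<in> topspace (total E). (fst \<circ> cov E) C \<in> U}) (\<lambda>(y, t). cls (\<Phi> (y, cl_one)) t)"
proof -
  let ?TU = "prod_topology (subtopology (mtop M) U) (cl_top (Pin \<kappa>) :: 'm cliff topology)"
  let ?\<sigma> = "\<lambda>y. \<Phi> (y, cl_one)"
  let ?\<Psi> = "\<lambda>(y, t). cls (?\<sigma> y) t"
  have UM: "U \<subseteq> topspace (mtop M)" by (rule openin_subset[OF U])
  have topTU: "topspace ?TU = U \<times> Pin \<kappa>" using UM by (simp add: topspace_cl_top inf.absorb2)
  have \<sigma>: "?\<sigma> y \<in> P" "fst (cov S (?\<sigma> y)) = y" if "y \<in> U" for y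
    using \<Phi>(1,2)[OF that Spin_one] by simp_all
  have \<Phi>\<sigma>: "\<Phi> (y, r) = act S (?\<sigma> y) r" if "y \<in> U" "r \<in> Spin \<kappa>" for y r
    using \<Phi>(3)[OF that(1) Spin_one that(2)] by (simp add: cl_mult_one)
  have oP: "openin (total S) {p \<in> P. (fst \<circ> cov S) p \<in> U}"
    by (rule openin_continuous_map_preimage[OF S.continuous_pr U])
  have oE: "Q ` (Q' :: ('p \<times> 'm cliff) set) \<subseteq> topspace (total E)" if "Q' \<subseteq> P \<times> Pin \<kappa>" for Q'
    using that unfolding topspace_E by blast
  have baseE: "(fst \<circ> cov E) (cls p t) = fst (cov S p)" if "p \<in> P" "t \<in> Pin \<kappa>" for p t
    using cov_ext[OF that] by (simp add: frame_mult_simps)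
  show ?thesis
  proof (rule bijective_open_imp_homeomorphic_map)
    have c1: "continuous_map (subtopology (mtop M) U) (total S) ?\<sigma>"
    proof -
      have "continuous_map (subtopology (mtop M) U) (prod_topology (subtopology (mtop M) U) (cl_top (Spin \<kappa>) :: 'm cliff topology)) (\<lambda>y. (y, cl_one))"
        by (intro continuous_map_pairedI) (simp_all add: topspace_cl_top Spin_one)
      from continuous_map_compose[OF this homeomorphic_imp_continuous_map[OF h]]
      show ?thesis unfolding continuous_map_in_subtopology by (simp add: comp_def)
    qed
    have "continuous_map ?TU (total E) (Q \<circ> (\<lambda>(y, t). (?\<sigma> y, t)))"
      by (rule continuous_map_compose[OF continuous_map_prod_id[OF c1] continuous_Q])
    then have "continuous_map ?TU (total E) ?\<Psi>" by (simp add: comp_def case_prod_unfold)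
    then show "continuous_map ?TU (subtopology (total E) {C \<in> topspace (total E). (fst \<circ> cov E) C \<in> U}) ?\<Psi>"
      unfolding continuous_map_in_subtopology
    proof (intro conjI funcsetI)
      fix z assume "z \<in> topspace ?TU"
      then obtain y t where z: "z = (y, t)" "y \<in> U" "t \<in> Pin \<kappa>" unfolding topTU by auto
      show "?\<Psi> z \<in> {C \<in> topspace (total E). (fst \<circ> cov E) C \<in> U}"
        unfolding z prod.case mem_Collect_eq baseE[OF \<sigma>(1)[OF z(2)] z(3)] \<sigma>(2)[OF z(2)]
        using cls_in[OF \<sigma>(1)[OF z(2)] z(3)] z(2) by simp
    qed
    show "open_map ?TU (subtopology (total E) {C \<in> topspace (total E). (fst \<circ> cov E) C \<in> U}) ?\<Psi>"
    proof (rule open_map_into_subtopology)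
      show "?\<Psi> \<in> topspace ?TU \<rightarrow> {C \<in> topspace (total E). (fst \<circ> cov E) C \<in> U}"
      proof (rule funcsetI)
        fix z assume "z \<in> topspace ?TU"
        then obtain y t where z: "z = (y, t)" "y \<in> U" "t \<in> Pin \<kappa>" unfolding topTU by auto
        show "?\<Psi> z \<in> {C \<in> topspace (total E). (fst \<circ> cov E) C \<in> U}"
          unfolding z prod.case mem_Collect_eq baseE[OF \<sigma>(1)[OF z(2)] z(3)] \<sigma>(2)[OF z(2)]
          using cls_in[OF \<sigma>(1)[OF z(2)] z(3)] z(2) by simp
      qed
      show "open_map ?TU (total E) ?\<Psi>"
        unfolding open_map_def
      proof (intro allI impI)
        fix W assume W: "openin ?TU W"
        have WU: "W \<subseteq> U \<times> Pin \<kappa>" using openin_subset[OF W] topTU by simp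
        \<comment> \<open>A section is in general not an open map, whereas \<Phi> is. Since
          [\<Phi>(y, r), t] = [\<Phi>(y, 1), r t] for r in Spin, the image of \<open>W\<close> is
          also the image of all ((y, r), t) with (y, r t) in \<open>W\<close>.\<close>
        let ?A = "prod_topology (subtopology (mtop M) U) (cl_top (Spin \<kappa>) :: 'm cliff topology)"
        let ?B = "prod_topology ?A (cl_top (Pin \<kappa>) :: 'm cliff topology)"
        let ?m = "\<lambda>x :: ('a \<times> 'm cliff) \<times> 'm cliff. (fst (fst x), cl_mult \<kappa> (snd (fst x)) (snd x))"
        have topB: "topspace ?B = (U \<times> Spin \<kappa>) \<times> Pin \<kappa>" using UM by (simp add: topspace_cl_top inf.absorb2)
        have "continuous_map ?B ?TU ?m"
        proof (rule continuous_map_pairedI)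
          show "continuous_map ?B (subtopology (mtop M) U) (\<lambda>x. fst (fst x))"
            using continuous_map_compose[OF continuous_map_fst continuous_map_fst] by (simp add: comp_def)
          have "continuous_map ?B (cl_top (Spin \<kappa>)) (\<lambda>x. snd (fst x))"
            using continuous_map_compose[OF continuous_map_fst continuous_map_snd] by (simp add: comp_def)
          then have "continuous_map ?B (cl_top (Pin \<kappa>)) (\<lambda>x. snd (fst x))"
            unfolding cl_top_Spin_subtopology continuous_map_in_subtopology by (rule conjunct1)
          from continuous_map_compose[OF continuous_map_pairedI[OF this continuous_map_snd] PG.continuous_mul]
          show "continuous_map ?B (cl_top (Pin \<kappa>)) (\<lambda>x. cl_mult \<kappa> (snd (fst x)) (snd x))" by (simp add: comp_def)
        qed
        from openin_continuous_map_preimage[OF this W]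
        have W2: "openin ?B {x \<in> topspace ?B. ?m x \<in> W}" .
        have "open_map ?A (total S) \<Phi>"
          using open_map_from_open_subtopology[OF oP homeomorphic_imp_open_map[OF h]] .
        then have "open_map ?B T (\<lambda>(x, z). (\<Phi> x, z))" by (rule open_map_prod_id)
        from open_map_compose[OF this open_Q]
        have "openin (total E) ((Q \<circ> (\<lambda>(x, z). (\<Phi> x, z))) ` {x \<in> topspace ?B. ?m x \<in> W})"
          using W2 unfolding open_map_def by blast
        moreover have "(Q \<circ> (\<lambda>(x, z). (\<Phi> x, z))) ` {x \<in> topspace ?B. ?m x \<in> W} = ?\<Psi> ` W"
        proof
          have e: "cls (\<Phi> (y, r)) t = cls (?\<sigma> y) (cl_mult \<kappa> r t)" if "y \<in> U" "r \<in> Spin \<kappa>" for y r t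
            using ext_class_act[OF \<sigma>(1)[OF that(1)] that(2)] \<Phi>\<sigma>[OF that] by simp
          show "(Q \<circ> (\<lambda>(x, z). (\<Phi> x, z))) ` {x \<in> topspace ?B. ?m x \<in> W} \<subseteq> ?\<Psi> ` W"
          proof
            fix C assume "C \<in> (Q \<circ> (\<lambda>(x, z). (\<Phi> x, z))) ` {x \<in> topspace ?B. ?m x \<in> W}"
            then obtain y r t where *: "y \<in> U" "r \<in> Spin \<kappa>" "t \<in> Pin \<kappa>" "(y, cl_mult \<kappa> r t) \<in> W" "C = cls (\<Phi> (y, r)) t"
              unfolding topB by auto
            then have "C = ?\<Psi> (y, cl_mult \<kappa> r t)" using e by simp
            then show "C \<in> ?\<Psi> ` W" using *(4) by blast
          qed
          show "?\<Psi> ` W \<subseteq> (Q \<circ> (\<lambda>(x, z). (\<Phi> x, z))) ` {x \<in> topspace ?B. ?m x \<in> W}"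
          proof
            fix C assume "C \<in> ?\<Psi> ` W"
            then obtain y t where *: "(y, t) \<in> W" "C = cls (?\<sigma> y) t" by auto
            have "((y, cl_one), t) \<in> {x \<in> topspace ?B. ?m x \<in> W}"
              unfolding topB using * WU Spin_one by (auto simp: cl_mult_one)
            moreover have "C = (Q \<circ> (\<lambda>(x, z). (\<Phi> x, z))) ((y, cl_one), t)" using * by simp
            ultimately show "C \<in> (Q \<circ> (\<lambda>(x, z). (\<Phi> x, z))) ` {x \<in> topspace ?B. ?m x \<in> W}" by blast
          qed
        qed
        ultimately show "openin (total E) (?\<Psi> ` W)" by simp
      qed
    qed
    show "?\<Psi> ` topspace ?TU = topspace (subtopology (total E) {C \<in> topspace (total E). (fst \<circ> cov E) C \<in> U})"
    proof
      show "?\<Psi> ` topspace ?TU \<subseteq> topspace (subtopology (total E) {C \<in> topspace (total E). (fst \<circ> cov E) C \<in> U})"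
      proof
        fix C assume "C \<in> ?\<Psi> ` topspace ?TU"
        then obtain y t where z: "C = cls (?\<sigma> y) t" "y \<in> U" "t \<in> Pin \<kappa>" unfolding topTU by auto
        then show "C \<in> topspace (subtopology (total E) {C \<in> topspace (total E). (fst \<circ> cov E) C \<in> U})"
          using cls_in[OF \<sigma>(1)[OF z(2)] z(3)] baseE[OF \<sigma>(1)[OF z(2)] z(3)] \<sigma>(2)[OF z(2)] by simp
      qed
      show "topspace (subtopology (total E) {C \<in> topspace (total E). (fst \<circ> cov E) C \<in> U}) \<subseteq> ?\<Psi> ` topspace ?TU"
      proof
        fix C assume "C \<in> topspace (subtopology (total E) {C \<in> topspace (total E). (fst \<circ> cov E) C \<in> U})"
        then have C: "C \<in> topspace (total E)" "(fst \<circ> cov E) C \<in> U" by auto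
        obtain p t where pt: "p \<in> P" "t \<in> Pin \<kappa>" "C = cls p t" using E_cases[OF C(1)] by blast
        let ?y = "fst (cov S p)"
        have y: "?y \<in> U" using C(2) baseE[OF pt(1,2)] pt(3) by simp
        obtain r where r: "r \<in> Spin \<kappa>" "p = act S (?\<sigma> ?y) r"
          using S.transitive[OF \<sigma>(1)[OF y] pt(1)] \<sigma>(2)[OF y] by (auto simp: topspace_cl_top)
        have "C = cls (?\<sigma> ?y) (cl_mult \<kappa> r t)"
          unfolding pt(3) by (subst r(2)) (rule ext_class_act[OF \<sigma>(1)[OF y] r(1)])
        then have "C = ?\<Psi> (?y, cl_mult \<kappa> r t)" by simp
        then show "C \<in> ?\<Psi> ` topspace ?TU"
          unfolding topTU using y Pin_mult[OF Spin_Pin[OF r(1)] pt(2)] by blast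
      qed
    qed
    show "inj_on ?\<Psi> (topspace ?TU)"
    proof (rule inj_onI)
      fix a b assume "a \<in> topspace ?TU" "b \<in> topspace ?TU" and e: "?\<Psi> a = ?\<Psi> b"
      then obtain y t z s where ab: "a = (y, t)" "b = (z, s)" "y \<in> U" "z \<in> U" "t \<in> Pin \<kappa>" "s \<in> Pin \<kappa>" unfolding topTU by auto
      have "cls (?\<sigma> y) t = cls (?\<sigma> z) s" using e by (simp add: ab)
      then obtain r where r: "r \<in> Spin \<kappa>" "?\<sigma> z = act S (?\<sigma> y) r" "t = cl_mult \<kappa> r s"
        using ext_class_eq_iff[OF \<sigma>(1)[OF ab(3)] \<sigma>(1)[OF ab(4)] ab(5,6)] by blast
      have "z = fst (cov S (?\<sigma> z))" by (rule \<sigma>(2)[OF ab(4), symmetric])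
      also have "\<dots> = fst (cov S (act S (?\<sigma> y) r))" by (simp only: r(2))
      also have "\<dots> = fst (cov S (?\<sigma> y))"
        using S.pr_act[OF \<sigma>(1)[OF ab(3)], of r] r(1) by (simp add: topspace_cl_top)
      also have "\<dots> = y" by (rule \<sigma>(2)[OF ab(3)])
      finally have "z = y" .
      then have "act S (?\<sigma> y) r = ?\<sigma> y" using r(2) by metis
      then have "r = cl_one" using S.free[OF \<sigma>(1)[OF ab(3)], of r] r(1) by (simp add: topspace_cl_top)
      then show "a = b" using r(3) \<open>z = y\<close> by (simp add: ab cl_mult_one)
    qed
  qed
qed

lemma principal_E: "principal_bundle (cl_top (Pin \<kappa>)) (cl_mult \<kappa>) cl_one (mtop M) (total E) (fst \<circ> cov E) (act E)"
  unfolding principal_bundle_def topspace_cl_top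
proof (intro conjI ballI)
  show "continuous_map (total E) (mtop M) (fst \<circ> cov E)"
    unfolding total_E
    by (rule continuous_map_from_quotient_top[OF continuous_map_compose[OF continuous_map_fst S.continuous_pr]])
      (auto simp: topspace_cl_top cov_ext frame_mult_simps)
  show "continuous_map (prod_topology (total E) (cl_top (Pin \<kappa>))) (total E) (\<lambda>(p, t). act E p t)"
  proof (rule continuous_map_from_open_quotient[OF open_map_prod_id[OF open_Q]])
    let ?B = "prod_topology T (cl_top (Pin \<kappa>) :: 'm cliff topology)"
    show "(\<lambda>(x, z). (Q x, z)) ` topspace ?B = topspace (prod_topology (total E) (cl_top (Pin \<kappa>)))"
      by (force simp: topspace_E topspace_cl_top)
    let ?m = "\<lambda>x :: ('p \<times> 'm cliff) \<times> 'm cliff. (fst (fst x), cl_mult \<kappa> (snd (fst x)) (snd x))"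
    have "continuous_map ?B T ?m"
    proof (rule continuous_map_pairedI)
      show "continuous_map ?B (total S) (\<lambda>x. fst (fst x))"
        using continuous_map_compose[OF continuous_map_fst continuous_map_fst] by (simp add: comp_def)
      have "continuous_map ?B (cl_top (Pin \<kappa>)) (\<lambda>x. snd (fst x))"
        using continuous_map_compose[OF continuous_map_fst continuous_map_snd] by (simp add: comp_def)
      from continuous_map_compose[OF continuous_map_pairedI[OF this continuous_map_snd] PG.continuous_mul]
      show "continuous_map ?B (cl_top (Pin \<kappa>)) (\<lambda>x. cl_mult \<kappa> (snd (fst x)) (snd x))" by (simp add: comp_def)
    qed
    then show "continuous_map ?B (total E) (Q \<circ> ?m)" using continuous_Q by (rule continuous_map_compose)
    fix x assume "x \<in> topspace ?B"
    then obtain p t r where "x = ((p, t), r)" "p \<in> P" "t \<in> Pin \<kappa>" "r \<in> Pin \<kappa>" by (auto simp: topspace_cl_top)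
    then show "(\<lambda>(p, t). act E p t) ((\<lambda>(x, z). (Q x, z)) x) = (Q \<circ> ?m) x" by (simp add: act_ext)
  qed
  fix C assume C: "C \<in> topspace (total E)"
  obtain p t where pt: "p \<in> P" "t \<in> Pin \<kappa>" "C = cls p t" using E_cases[OF C] by blast
  show "act E C cl_one = C" using act_ext[OF pt(1,2) Pin.one] by (simp add: pt cl_mult_one)
  fix s :: "'m cliff" assume s: "s \<in> Pin \<kappa>"
  show "(fst \<circ> cov E) (act E C s) = (fst \<circ> cov E) C"
    using pt s by (simp add: act_ext cov_ext Pin_mult frame_mult_simps)
  fix r :: "'m cliff" assume r: "r \<in> Pin \<kappa>"
  show "act E (act E C s) r = act E C (cl_mult \<kappa> s r)"
    using pt s r by (simp add: act_ext Pin_mult cl_mult_assoc[OF sign])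
next
  fix x assume x: "x \<in> topspace (mtop M)"
  obtain U \<Phi> where U: "openin (mtop M) U" "x \<in> U"
    and h: "homeomorphic_map (prod_topology (subtopology (mtop M) U) (cl_top (Spin \<kappa>))) (subtopology (total S) {p \<in> P. (fst \<circ> cov S) p \<in> U}) \<Phi>"
    and \<Phi>0: "\<forall>y \<in> U. \<forall>t \<in> Spin \<kappa>. \<Phi> (y, t) \<in> P \<and> (fst \<circ> cov S) (\<Phi> (y, t)) = y"
    "\<forall>y \<in> U. \<forall>t \<in> Spin \<kappa>. \<forall>r \<in> Spin \<kappa>. \<Phi> (y, cl_mult \<kappa> t r) = act S (\<Phi> (y, t)) r"
    by (rule S.trivialization_ball[OF x openin_topspace x, unfolded topspace_cl_top])
  have \<Phi>: "\<Phi> (y, t) \<in> P" "(fst \<circ> cov S) (\<Phi> (y, t)) = y" if "y \<in> U" "t \<in> Spin \<kappa>" for y t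
    using bspec[OF bspec[OF \<Phi>0(1) that(1)] that(2)] by simp_all
  have \<Phi>m: "\<Phi> (y, cl_mult \<kappa> t r) = act S (\<Phi> (y, t)) r" if "y \<in> U" "t \<in> Spin \<kappa>" "r \<in> Spin \<kappa>" for y t r
    by (rule bspec[OF bspec[OF bspec[OF \<Phi>0(2) that(1)] that(2)] that(3)])
  let ?\<Psi> = "\<lambda>(y, t). cls (\<Phi> (y, cl_one)) t"
  show "\<exists>U. openin (mtop M) U \<and> x \<in> U \<and>
      (\<exists>\<Phi>. homeomorphic_map (prod_topology (subtopology (mtop M) U) (cl_top (Pin \<kappa>)))
         (subtopology (total E) {C \<in> topspace (total E). (fst \<circ> cov E) C \<in> U}) \<Phi> \<and>
         (\<forall>y\<in>U. \<forall>t\<in>Pin \<kappa>. (fst \<circ> cov E) (\<Phi> (y, t)) = y \<and>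
           (\<forall>r\<in>Pin \<kappa>. \<Phi> (y, cl_mult \<kappa> t r) = act E (\<Phi> (y, t)) r)))"
  proof (intro exI[of _ U] conjI U exI[of _ ?\<Psi>] ballI homeomorphic_trivialization[OF U(1) h \<Phi> \<Phi>m])
    fix y and t :: "'m cliff" assume y: "y \<in> U" and t: "t \<in> Pin \<kappa>"
    show "(fst \<circ> cov E) (?\<Psi> (y, t)) = y"
      using cov_ext[OF \<Phi>(1)[OF y Spin_one] t] \<Phi>(2)[OF y Spin_one] by (simp add: frame_mult_simps)
    fix r :: "'m cliff" assume r: "r \<in> Pin \<kappa>"
    show "?\<Psi> (y, cl_mult \<kappa> t r) = act E (?\<Psi> (y, t)) r"
      using act_ext[OF \<Phi>(1)[OF y Spin_one] t r] by simp
  qed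
qed

text \<open>The spin structure reappears inside its extension as the part over \<open>u\<close>,
  since [p, t] lies over \<open>u\<close> exactly for t in Spin.\<close>

lemma homeomorphic_iota:
  "homeomorphic_map (total S) (subtopology (total E) {C \<in> topspace (total E). cov E C \<in> orthonormal_frames M \<inter> u}) (\<lambda>p. cls p cl_one)"
proof (rule bijective_open_imp_homeomorphic_map)
  let ?R = "{C \<in> topspace (total E). cov E C \<in> orthonormal_frames M \<inter> u}"
  have iR: "cls p cl_one \<in> ?R" if "p \<in> P" for p
    using cls_in[OF that Pin.one] cov_E_in cov_E_u[OF that Pin.one] Spin_one by simp
  have "continuous_map (total S) (total E) (Q \<circ> (\<lambda>p. (p, cl_one)))"
    by (rule continuous_map_compose[OF _ continuous_Q]) (simp add: continuous_map_pairedI topspace_cl_top Pin.one)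
  then show "continuous_map (total S) (subtopology (total E) ?R) (\<lambda>p. cls p cl_one)"
    unfolding continuous_map_in_subtopology using iR by (simp add: comp_def)
  show "open_map (total S) (subtopology (total E) ?R) (\<lambda>p. cls p cl_one)"
  proof (rule open_map_into_subtopology)
    show "(\<lambda>p. cls p cl_one) \<in> P \<rightarrow> ?R" using iR by blast
    show "open_map (total S) (total E) (\<lambda>p. cls p cl_one)"
      unfolding open_map_def
    proof (intro allI impI)
      fix W assume W: "openin (total S) W"
      have WP: "W \<subseteq> P" by (rule openin_subset[OF W])
      let ?B = "prod_topology (total S) (cl_top (Spin \<kappa>) :: 'm cliff topology)"
      \<comment> \<open>As [p, t] = [p t, 1] for t in Spin, the image of \<open>W\<close> is the
        image under the open map \<open>Q\<close> of this open set of pairs.\<close>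
      let ?A = "{x \<in> topspace ?B. (\<lambda>(p, t). act S p t) x \<in> W}"
      have "openin ?B ?A" by (rule openin_continuous_map_preimage[OF S.continuous_act W])
      moreover have "?B = subtopology T (P \<times> Spin \<kappa>)"
        by (simp add: subtopology_Times cl_top_Spin_subtopology)
      moreover have "openin T (P \<times> (Spin \<kappa> :: 'm cliff set))" using openin_Spin(1)[where 'a = 'm] by (simp add: openin_prod_Times_iff)
      ultimately have "openin T ?A" by (simp only: openin_trans_full)
      then have "openin (total E) (Q ` ?A)" using open_Q unfolding open_map_def by blast
      moreover have "Q ` ?A = (\<lambda>p. cls p cl_one) ` W"
      proof
        show "Q ` ?A \<subseteq> (\<lambda>p. cls p cl_one) ` W"
        proof
          fix C assume "C \<in> Q ` ?A"
          then obtain p t where "p \<in> P" "t \<in> Spin \<kappa>" "act S p t \<in> W" "C = cls p t" by (auto simp: topspace_cl_top)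
          then show "C \<in> (\<lambda>p. cls p cl_one) ` W"
            using ext_class_act[of p t cl_one] by (auto simp: cl_mult_one intro!: image_eqI[of _ _ "act S p t"])
        qed
        show "(\<lambda>p. cls p cl_one) ` W \<subseteq> Q ` ?A"
        proof
          fix C assume "C \<in> (\<lambda>p. cls p cl_one) ` W"
          then obtain p where p: "p \<in> W" "C = cls p cl_one" by blast
          then have "(p, cl_one) \<in> ?A" using WP Spin_one S.act_e by (auto simp: topspace_cl_top)
          moreover have "C = Q (p, cl_one)" using p by simp
          ultimately show "C \<in> Q ` ?A" by blast
        qed
      qed
      ultimately show "openin (total E) ((\<lambda>p. cls p cl_one) ` W)" by simp
    qed
  qed
  show "(\<lambda>p. cls p cl_one) ` P = topspace (subtopology (total E) ?R)"
  proof
    show "(\<lambda>p. cls p cl_one) ` P \<subseteq> topspace (subtopology (total E) ?R)" using iR by auto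
    show "topspace (subtopology (total E) ?R) \<subseteq> (\<lambda>p. cls p cl_one) ` P"
    proof
      fix C assume "C \<in> topspace (subtopology (total E) ?R)"
      then have C: "C \<in> topspace (total E)" "cov E C \<in> u" by auto
      obtain p t where pt: "p \<in> P" "t \<in> Pin \<kappa>" "C = cls p t" using E_cases[OF C(1)] by blast
      have t: "t \<in> Spin \<kappa>" using C(2) cov_E_u[OF pt(1,2)] pt(3) by simp
      have "C = cls (act S p t) cl_one" using ext_class_act[OF pt(1) t, of cl_one] by (simp add: pt cl_mult_one)
      then show "C \<in> (\<lambda>p. cls p cl_one) ` P" using S.acts(1)[OF pt(1) t] by blast
    qed
  qed
  show "inj_on (\<lambda>p. cls p cl_one) P"
  proof (rule inj_onI)
    fix p q assume pq: "p \<in> P" "q \<in> P" "cls p cl_one = cls q cl_one"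
    then obtain r where "r \<in> Spin \<kappa>" "q = act S p r" "cl_one = cl_mult \<kappa> r cl_one"
      using ext_class_eq_iff[OF pq(1,2) Pin.one Pin.one] by blast
    then show "p = q" using S.act_e[OF pq(1)] by (simp add: cl_mult_one)
  qed
qed

text \<open>The covering property is known over \<open>u\<close>, where the extension is the given
  spin structure, and is carried to the opposite orientation by right multiplication with a fixed
  odd element \<open>t0\<close>.\<close>

lemma pin_structure_E: "pin_structure \<kappa> M E"
  unfolding pin_structure_def lifts_frames_def
proof (intro conjI ballI)
  interpret PE: principal "cl_top (Pin \<kappa>) :: 'm cliff topology" "cl_mult \<kappa>" cl_one pin_inv "mtop M" "total E" "fst \<circ> cov E" "act E"
    by (intro principal.intro principal_axioms.intro topological_group_Pin principal_E)
  let ?u = "opposite_orientation M u"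
  have u': "orientation M ?u" by (rule orientation_opposite[OF u])
  note h = homeomorphic_iota
  have covM: "cov E (act E C t) = frame_mult (cov E C) (pin_proj \<kappa> t)" if C: "C \<in> topspace (total E)" "t \<in> Pin \<kappa>" for C t
  proof -
    obtain p s where "p \<in> P" "s \<in> Pin \<kappa>" "C = cls p s" using E_cases[OF C(1)] by blast
    then show ?thesis using C(2) by (simp add: act_ext cov_ext Pin_mult frame_mult_mult pin_proj_mult)
  qed
  then show "cov E (act E C t) = frame_mult (cov E C) (pin_proj \<kappa> t)" if "C \<in> topspace (total E)" "t \<in> Pin \<kappa>" for C t
    using that by blast
  show "principal_bundle (cl_top (Pin \<kappa>)) (cl_mult \<kappa>) cl_one (mtop M) (total E) (fst \<circ> cov E) (act E)"
    by (rule principal_E)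
  obtain t0 :: "'m cliff" where t0: "t0 \<in> Pin \<kappa>" "t0 \<notin> Spin \<kappa>" using Pin_odd_ex by blast
  let ?Ru = "{C \<in> topspace (total E). cov E C \<in> orthonormal_frames M \<inter> u}"
  let ?Ru' = "{C \<in> topspace (total E). cov E C \<in> orthonormal_frames M \<inter> ?u}"
  have c1: "two_covering (subtopology (total E) ?Ru) (subtopology (frame_bundle M) (orthonormal_frames M \<inter> u)) (cov E)"
  proof (rule two_covering_transport[OF S.two_cov h])
    show "homeomorphic_map (oriented_frame_bundle M u) (subtopology (frame_bundle M) (orthonormal_frames M \<inter> u)) id"
      by (simp add: oriented_alt)
    show "cov E (cls p cl_one) = id (cov S p)" if "p \<in> P" for p
      using cov_ext[OF that Pin.one] by (simp add: pin_proj_one frame_mult_one)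
  qed
  have pu: "frame_mult e (pin_proj \<kappa> t0) \<in> orthonormal_frames M \<inter> ?u \<longleftrightarrow> e \<in> orthonormal_frames M \<inter> u"
    if e: "e \<in> orthonormal_frames M" for e
    using e frame_mult_orthonormal[OF e pin_proj_props(2)[OF t0(1)]] pin_proj_oriented[OF u e t0(1)] t0(2)
      opposite_orthonormal_iff[OF frame_mult_orthonormal[OF e pin_proj_props(2)[OF t0(1)]], of u] by simp
  have c2: "two_covering (subtopology (total E) ?Ru') (subtopology (frame_bundle M) (orthonormal_frames M \<inter> ?u)) (cov E)"
  proof (rule two_covering_transport[OF c1])
    show "homeomorphic_map (subtopology (total E) ?Ru) (subtopology (total E) ?Ru') (\<lambda>C. act E C t0)"
    proof (rule homeomorphic_map_subtopologies_alt[OF PE.homeomorphic_act_right])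
      show "t0 \<in> topspace (cl_top (Pin \<kappa>))" by (simp add: topspace_cl_top t0)
      fix C assume C: "C \<in> topspace (total E)" "act E C t0 \<in> topspace (total E)"
      then show "act E C t0 \<in> ?Ru' \<longleftrightarrow> C \<in> ?Ru"
        unfolding mem_Collect_eq covM[OF C(1) t0(1)] pu[OF cov_E_in[OF C(1)]] by simp
    qed
    show "homeomorphic_map (subtopology (frame_bundle M) (orthonormal_frames M \<inter> u))
        (subtopology (frame_bundle M) (orthonormal_frames M \<inter> ?u)) (\<lambda>e. frame_mult e (pin_proj \<kappa> t0))"
      by (rule homeomorphic_map_subtopologies_alt[OF homeomorphic_frame_mult[OF pin_proj_props(2)[OF t0(1)]]])
        (simp only: topspace_frame_bundle pu)
    show "cov E (act E C t0) = frame_mult (cov E C) (pin_proj \<kappa> t0)" if "C \<in> topspace (subtopology (total E) ?Ru)" for C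
      using that covM t0(1) by simp
  qed
  show "two_covering (total E) (frame_bundle M) (cov E)"
  proof (rule two_covering_local)
    fix e assume "e \<in> topspace (frame_bundle M)"
    then have e: "e \<in> orthonormal_frames M" by (simp add: topspace_frame_bundle)
    then have "e \<in> orthonormal_frames M \<inter> u \<or> e \<in> orthonormal_frames M \<inter> ?u"
      using opposite_orthonormal_iff[OF e, of u] by simp
    then show "\<exists>U. openin (frame_bundle M) U \<and> e \<in> U \<and>
        two_covering (subtopology (total E) {C \<in> topspace (total E). cov E C \<in> U}) (subtopology (frame_bundle M) U) (cov E)"
      using openin_oriented_frames[OF u] openin_oriented_frames[OF u'] c1 c2 by (elim disjE) (intro exI conjI; assumption)+
  next
    have opR: "openin (total E) {C \<in> topspace (total E). cov E C \<in> orthonormal_frames M \<inter> u}"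
    proof -
      have "Q ` (P \<times> Spin \<kappa>) = ?Ru"
      proof
        show "Q ` (P \<times> Spin \<kappa>) \<subseteq> ?Ru"
          by (auto simp: cls_in cov_E_in cov_E_u Spin_Pin)
        show "?Ru \<subseteq> Q ` (P \<times> Spin \<kappa>)"
        proof
          fix C assume C: "C \<in> ?Ru"
          then obtain p t where pt: "p \<in> P" "t \<in> Pin \<kappa>" "C = cls p t" using E_cases[of C] by blast
          then have "t \<in> Spin \<kappa>" using C cov_E_u[OF pt(1,2)] by simp
          then have "(p, t) \<in> P \<times> Spin \<kappa>" using pt by simp
          moreover have "C = Q (p, t)" using pt by simp
          ultimately show "C \<in> Q ` (P \<times> Spin \<kappa>)" by blast
        qed
      qed
      moreover have "openin T (P \<times> (Spin \<kappa> :: 'm cliff set))" using openin_Spin(1)[where 'a = 'm] by (simp add: openin_prod_Times_iff)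
      from open_Q[unfolded open_map_def, rule_format, OF this]
      have "openin (total E) (Q ` (P \<times> Spin \<kappa>))" .
      ultimately show ?thesis by (simp only:)
    qed
    have opR': "openin (total E) ?Ru'"
    proof -
      have "(\<lambda>C. act E C t0) ` ?Ru = ?Ru'"
      proof
        show "(\<lambda>C. act E C t0) ` ?Ru \<subseteq> ?Ru'"
        proof (rule image_subsetI)
          fix C assume C: "C \<in> ?Ru"
          then have CE: "C \<in> topspace (total E)" by simp
          have "act E C t0 \<in> topspace (total E)" using PE.act_in[OF CE] t0(1) by (simp add: topspace_cl_top)
          then show "act E C t0 \<in> ?Ru'"
            unfolding mem_Collect_eq covM[OF CE t0(1)] pu[OF cov_E_in[OF CE]] using C by simp
        qed
        show "?Ru' \<subseteq> (\<lambda>C. act E C t0) ` ?Ru"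
        proof
          fix C assume C: "C \<in> ?Ru'"
          define C0 where "C0 = act E C (pin_inv t0)"
          have C0: "C0 \<in> topspace (total E)" "act E C0 t0 = C"
            using C PE.act_in[of C "pin_inv t0"] PE.act_inv(2)[of C t0] pin_inv(1)[OF t0(1)] t0(1) by (simp_all add: topspace_cl_top C0_def)
          have "C0 \<in> ?Ru"
            using C C0(1) unfolding mem_Collect_eq pu[OF cov_E_in[OF C0(1)], symmetric] covM[OF C0(1) t0(1), symmetric] C0(2)
            by simp
          then show "C \<in> (\<lambda>C. act E C t0) ` ?Ru" using C0(2) by blast
        qed
      qed
      moreover have "open_map (total E) (total E) (\<lambda>C. act E C t0)"
        by (rule homeomorphic_imp_open_map[OF PE.homeomorphic_act_right]) (simp add: topspace_cl_top t0)
      from this[unfolded open_map_def, rule_format, OF opR]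
      have "openin (total E) ((\<lambda>C. act E C t0) ` ?Ru)" .
      ultimately show ?thesis by (simp only:)
    qed
    show "continuous_map (total E) (frame_bundle M) (cov E)"
    proof (rule continuous_map_local)
      fix C assume C: "C \<in> topspace (total E)"
      have k: "continuous_map (subtopology (total E) ?Ru) (frame_bundle M) (cov E)" "continuous_map (subtopology (total E) ?Ru') (frame_bundle M) (cov E)"
        using two_covering_props(1)[OF c1] two_covering_props(1)[OF c2] unfolding continuous_map_in_subtopology by blast+
      have "C \<in> ?Ru \<or> C \<in> ?Ru'" using C cov_E_in[OF C] opposite_orthonormal_iff[OF cov_E_in[OF C], of u] by simp
      then show "\<exists>U. openin (total E) U \<and> C \<in> U \<and> continuous_map (subtopology (total E) U) (frame_bundle M) (cov E)"
        using opR opR' k by (elim disjE) (intro exI conjI; assumption)+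
    qed
  qed
qed

end

section \<open>Lifted involutions and their quotients\<close>

locale involution = pin_cover X Y \<pi> \<tau> \<kappa>
  for X :: "('x, 'm::{finite,linorder}) mfd" and Y :: "('y, 'm) mfd" and \<pi> \<tau> and \<kappa> :: real +
  fixes S :: "('p, 'y, 'm) frame_structure" and D :: "'p \<Rightarrow> 'p"
  assumes equiv: "pin_equivalence \<kappa> Y S (isometry_pullback Y \<tau> S) D"
    and D_D: "p \<in> topspace (total S) \<Longrightarrow> D (D p) = p"
begin

lemma pin_S: "pin_structure \<kappa> Y S" and iso_D: "structure_iso (Pin \<kappa>) S (isometry_pullback Y \<tau> S) D"
  using equiv by (simp_all add: pin_equivalence_def)

sublocale S: lifted \<kappa> "Pin \<kappa>" Y "frame_bundle Y" S
  using pin_S PY.pin_lifted by blast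

abbreviation "P \<equiv> topspace (total S)"
abbreviation "Q \<equiv> quotient_structure Y X \<pi> D S"
abbreviation (input) "q \<equiv> \<lambda>p. {p, D p}"

lemma cov_S_in: "p \<in> P \<Longrightarrow> cov S p \<in> orthonormal_frames Y"
  by (rule pin_cov_in[OF pin_S])

lemma base_in: "p \<in> P \<Longrightarrow> fst (cov S p) \<in> topspace (mtop Y)"
  by (rule Y.orthonormalD(2)[OF cov_S_in])

lemma D_in: "p \<in> P \<Longrightarrow> D p \<in> P"
  using structure_isoD(3)[OF iso_D] by (simp add: pullback_simps)

lemma continuous_D: "continuous_map (total S) (total S) D"
  using structure_isoD(2)[OF iso_D] by (simp add: pullback_simps)

lemma cov_D: "p \<in> P \<Longrightarrow> cov S (D p) = d\<tau> (cov S p)"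
proof -
  assume p: "p \<in> P"
  have "d\<tau> (cov S (D p)) = cov S p"
    using structure_isoD(4)[OF iso_D p] pullback_cov[OF cov_S_in[OF D_in[OF p]]] by simp
  then show ?thesis using dtau_dtau[OF cov_S_in[OF D_in[OF p]]] by metis
qed

lemma base_D: "p \<in> P \<Longrightarrow> fst (cov S (D p)) = \<tau> (fst (cov S p))"
  by (simp add: cov_D fst_dtau)

lemma D_act: "p \<in> P \<Longrightarrow> t \<in> Pin \<kappa> \<Longrightarrow> D (act S p t) = act S (D p) t"
  using structure_isoD(5)[OF iso_D] by (simp add: pullback_simps)

lemma quotient_eq_iff: "p \<in> P \<Longrightarrow> p' \<in> P \<Longrightarrow> {p, D p} = {p', D p'} \<longleftrightarrow> p' = p \<or> p' = D p"
  using D_D by (metis doubleton_eq_iff insertI1 insert_commute)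

lemma total_Q: "total Q = quotient_top (total S) q"
  by (simp add: quotient_structure_def)

lemma topspace_Q: "topspace (total Q) = q ` P"
  unfolding total_Q by (rule topspace_quotient_top)

lemma act_Q: "p \<in> P \<Longrightarrow> t \<in> Pin \<kappa> \<Longrightarrow> act Q {p, D p} t = {act S p t, D (act S p t)}"
  by (simp add: quotient_structure_def D_act)

lemma cov_Q: "p \<in> P \<Longrightarrow> cov Q {p, D p} = d\<pi> (cov S p)"
  by (simp add: quotient_structure_def cov_D dpi_dtau cov_S_in)

lemma continuous_q: "continuous_map (total S) (total Q) q"
  unfolding total_Q by (rule continuous_map_quotient_top)

lemma open_q: "open_map (total S) (total Q) q"
  unfolding open_map_def
proof (intro allI impI)
  fix W assume W: "openin (total S) W"
  have WP: "W \<subseteq> P" by (rule openin_subset[OF W])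
  have "{p \<in> P. {p, D p} \<in> q ` W} = W \<union> {p \<in> P. D p \<in> W}"
  proof (intro set_eqI iffI)
    fix p assume "p \<in> {p \<in> P. {p, D p} \<in> q ` W}"
    then obtain w where w: "p \<in> P" "w \<in> W" "{p, D p} = {w, D w}" by blast
    then have "w = p \<or> w = D p" using quotient_eq_iff[of p w] WP by blast
    then show "p \<in> W \<union> {p \<in> P. D p \<in> W}" using w by auto
  next
    fix p assume p: "p \<in> W \<union> {p \<in> P. D p \<in> W}"
    then have pP: "p \<in> P" using WP by blast
    have "{p, D p} = {D p, D (D p)}" using D_D[OF pP] by auto
    then show "p \<in> {p \<in> P. {p, D p} \<in> q ` W}" using p pP by blast
  qed
  then show "openin (total Q) (q ` W)"
    unfolding total_Q openin_quotient_top using WP W openin_continuous_map_preimage[OF continuous_D W] by auto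
qed

lemma pi_homeo:
  assumes V: "openin (mtop Y) V" "inj_on \<pi> V"
  shows "homeomorphic_map (subtopology (mtop Y) V) (subtopology (mtop X) (\<pi> ` V)) \<pi>" "openin (mtop X) (\<pi> ` V)"
proof -
  note R = two_covering_props[OF two_covering_pi]
  have VY: "V \<subseteq> topspace (mtop Y)" by (rule openin_subset[OF V(1)])
  show o: "openin (mtop X) (\<pi> ` V)" using R(2) V(1) unfolding open_map_def by blast
  show "homeomorphic_map (subtopology (mtop Y) V) (subtopology (mtop X) (\<pi> ` V)) \<pi>"
  proof (rule bijective_open_imp_homeomorphic_map)
    show "continuous_map (subtopology (mtop Y) V) (subtopology (mtop X) (\<pi> ` V)) \<pi>"
      using R(1) by (auto simp: continuous_map_in_subtopology continuous_map_from_subtopology)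
    show "open_map (subtopology (mtop Y) V) (subtopology (mtop X) (\<pi> ` V)) \<pi>"
      by (rule open_map_into_subtopology[OF open_map_from_subtopology[OF R(2) V(1)]]) auto
    show "\<pi> ` topspace (subtopology (mtop Y) V) = topspace (subtopology (mtop X) (\<pi> ` V))"
      using VY openin_subset[OF o] by (simp add: inf.absorb2)
    show "inj_on \<pi> (topspace (subtopology (mtop Y) V))" using V(2) VY by (simp add: inf.absorb2)
  qed
qed

text \<open>\<open>D\<close> moves base points by \<tau>, and \<tau> maps no point of a set on which
  \<pi> is injective into that set. So over such a \<open>V\<close> every class {p, D p} has exactly
  one representative.\<close>

lemma q_homeo:
  assumes V: "openin (mtop Y) V" "inj_on \<pi> V"
  shows "homeomorphic_map (subtopology (total S) {p \<in> P. (fst \<circ> cov S) p \<in> V})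
     (subtopology (total Q) {C \<in> topspace (total Q). (fst \<circ> cov Q) C \<in> \<pi> ` V}) q"
proof -
  let ?A = "{p \<in> P. (fst \<circ> cov S) p \<in> V}" and ?B = "{C \<in> topspace (total Q). (fst \<circ> cov Q) C \<in> \<pi> ` V}"
  have VY: "V \<subseteq> topspace (mtop Y)" by (rule openin_subset[OF V(1)])
  have oA: "openin (total S) ?A" by (rule openin_continuous_map_preimage[OF S.continuous_pr V(1)])
  have AB: "{p, D p} \<in> ?B" if "p \<in> ?A" for p
    using that cov_Q[of p] by (auto simp: topspace_Q fst_dpi)
  have tA: "topspace (subtopology (total S) ?A) = ?A" and tB: "topspace (subtopology (total Q) ?B) = ?B" by auto
  show ?thesis
  proof (rule bijective_open_imp_homeomorphic_map)
    show "continuous_map (subtopology (total S) ?A) (subtopology (total Q) ?B) q"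
      unfolding continuous_map_in_subtopology tA using AB by (intro conjI continuous_map_from_subtopology continuous_q funcsetI)
    show "open_map (subtopology (total S) ?A) (subtopology (total Q) ?B) q"
      by (rule open_map_into_subtopology[OF open_map_from_subtopology[OF open_q oA]]) (use AB tA in blast)
    show "q ` topspace (subtopology (total S) ?A) = topspace (subtopology (total Q) ?B)"
      unfolding tA tB
    proof
      show "q ` ?A \<subseteq> ?B" using AB by blast
      show "?B \<subseteq> q ` ?A"
      proof
        fix C assume C: "C \<in> ?B"
        then obtain p where p: "p \<in> P" "C = {p, D p}" unfolding topspace_Q by blast
        have "\<pi> (fst (cov S p)) \<in> \<pi> ` V" using C p cov_Q[OF p(1)] by (simp add: fst_dpi)
        then obtain v where v: "v \<in> V" "\<pi> v = \<pi> (fst (cov S p))" by (metis imageE)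
        then consider "v = fst (cov S p)" | "v = \<tau> (fst (cov S p))"
          using fibre[OF base_in[OF p(1)], of v] VY by blast
        then show "C \<in> q ` ?A"
        proof cases
          case 1
          then have "p \<in> ?A" using p v by simp
          then show ?thesis unfolding p(2) by (rule imageI)
        next
          case 2
          then have "D p \<in> ?A" using p v base_D[OF p(1)] D_in[OF p(1)] by simp
          then have "{D p, D (D p)} \<in> q ` ?A" by (rule imageI)
          then show ?thesis unfolding p(2) D_D[OF p(1)] by (simp add: insert_commute)
        qed
      qed
    qed
    show "inj_on q (topspace (subtopology (total S) ?A))"
      unfolding tA
    proof (rule inj_onI)
      fix p p' assume p: "p \<in> ?A" "p' \<in> ?A" "{p, D p} = {p', D p'}"
      then have "p' = p \<or> p' = D p" using quotient_eq_iff by simp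
      moreover have "p' \<noteq> D p"
      proof
        assume "p' = D p"
        then have "\<tau> (fst (cov S p)) \<in> V" "fst (cov S p) \<in> V" using p base_D by auto
        then have "\<tau> (fst (cov S p)) = fst (cov S p)" using V(2) pi_tau VY by (metis inj_onD subsetD)
        then show False using tau_neq base_in p(1) by simp
      qed
      ultimately show "p = p'" by blast
    qed
  qed
qed

lemma pi_surj: "x \<in> topspace (mtop X) \<Longrightarrow> \<exists>y \<in> topspace (mtop Y). \<pi> y = x"
proof -
  assume "x \<in> topspace (mtop X)"
  then obtain a b where "{e \<in> topspace (mtop Y). \<pi> e = x} = {a, b}"
    using two_covering_props(3)[OF two_covering_pi] by (meson card_2_iff)
  then show ?thesis by blast
qed

text \<open>A trivialization of \<open>S\<close> over a set \<open>V\<close> on which \<pi> is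
  injective becomes one of the quotient over the image of \<open>V\<close>, through \<open>q\<close>
  and the local inverse \<open>s\<close> of \<pi>.\<close>

lemma principal_Q: "principal_bundle (cl_top (Pin \<kappa>)) (cl_mult \<kappa>) cl_one (mtop X) (total Q) (fst \<circ> cov Q) (act Q)"
  unfolding principal_bundle_def topspace_cl_top
proof (intro conjI ballI)
  show "continuous_map (total Q) (mtop X) (fst \<circ> cov Q)"
    unfolding total_Q
    by (rule continuous_map_from_quotient_top[OF continuous_map_compose[OF S.continuous_pr two_covering_props(1)[OF two_covering_pi]]])
      (simp add: cov_Q fst_dpi)
  show "continuous_map (prod_topology (total Q) (cl_top (Pin \<kappa>))) (total Q) (\<lambda>(p, t). act Q p t)"
  proof (rule continuous_map_from_open_quotient[OF open_map_prod_id[OF open_q]])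
    let ?B = "prod_topology (total S) (cl_top (Pin \<kappa>) :: 'm cliff topology)"
    show "(\<lambda>(x, z). (q x, z)) ` topspace ?B = topspace (prod_topology (total Q) (cl_top (Pin \<kappa>)))"
      by (force simp: topspace_Q topspace_cl_top)
    show "continuous_map ?B (total Q) (q \<circ> (\<lambda>(p, t). act S p t))"
      by (rule continuous_map_compose[OF S.continuous_act continuous_q])
    fix x assume "x \<in> topspace ?B"
    then obtain p t where "x = (p, t)" "p \<in> P" "t \<in> Pin \<kappa>" by (auto simp: topspace_cl_top)
    then show "(\<lambda>(p, t). act Q p t) ((\<lambda>(x, z). (q x, z)) x) = (q \<circ> (\<lambda>(p, t). act S p t)) x" by (simp add: act_Q)
  qed
  fix C assume "C \<in> topspace (total Q)"
  then obtain p where p: "p \<in> P" "C = {p, D p}" unfolding topspace_Q by blast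
  show "act Q C cl_one = C" using act_Q[OF p(1) Pin.one] S.act_e[OF p(1)] by (simp add: p)
  fix t :: "'m cliff" assume t: "t \<in> Pin \<kappa>"
  show "(fst \<circ> cov Q) (act Q C t) = (fst \<circ> cov Q) C"
    using S.acts(1)[OF p(1) t] S.cov_act[OF p(1) t] by (simp add: p act_Q[OF p(1) t] cov_Q fst_dpi frame_mult_simps)
  fix r :: "'m cliff" assume r: "r \<in> Pin \<kappa>"
  show "act Q (act Q C t) r = act Q C (cl_mult \<kappa> t r)"
    using S.acts(1)[OF p(1) t] S.acts(2)[OF p(1) t r] by (simp add: p act_Q t r Pin_mult)
next
  fix x assume x: "x \<in> topspace (mtop X)"
  obtain y where y: "y \<in> topspace (mtop Y)" "\<pi> y = x" using pi_surj[OF x] by blast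
  obtain U where U: "openin (mtop Y) U" "y \<in> U" "inj_on \<pi> U" using two_covering_props(4)[OF two_covering_pi y(1)] by blast
  obtain V \<Phi> where V: "openin (mtop Y) V" "y \<in> V" "V \<subseteq> U"
    and h: "homeomorphic_map (prod_topology (subtopology (mtop Y) V) (cl_top (Pin \<kappa>))) (subtopology (total S) {p \<in> P. (fst \<circ> cov S) p \<in> V}) \<Phi>"
    and \<Phi>0: "\<forall>y \<in> V. \<forall>t \<in> Pin \<kappa>. \<Phi> (y, t) \<in> P \<and> (fst \<circ> cov S) (\<Phi> (y, t)) = y"
    "\<forall>y \<in> V. \<forall>t \<in> Pin \<kappa>. \<forall>r \<in> Pin \<kappa>. \<Phi> (y, cl_mult \<kappa> t r) = act S (\<Phi> (y, t)) r"
    by (rule S.trivialization_ball[OF y(1) U(1,2), unfolded topspace_cl_top])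
  have \<Phi>: "\<Phi> (y, t) \<in> P" "(fst \<circ> cov S) (\<Phi> (y, t)) = y" if "y \<in> V" "t \<in> Pin \<kappa>" for y t
    using bspec[OF bspec[OF \<Phi>0(1) that(1)] that(2)] by simp_all
  have \<Phi>m: "\<Phi> (y, cl_mult \<kappa> t r) = act S (\<Phi> (y, t)) r" if "y \<in> V" "t \<in> Pin \<kappa>" "r \<in> Pin \<kappa>" for y t r
    by (rule bspec[OF bspec[OF bspec[OF \<Phi>0(2) that(1)] that(2)] that(3)])
  have iV: "inj_on \<pi> V" using U(3) V(3) by (rule inj_on_subset)
  have VY: "V \<subseteq> topspace (mtop Y)" by (rule openin_subset[OF V(1)])
  obtain s where s: "homeomorphic_maps (subtopology (mtop Y) V) (subtopology (mtop X) (\<pi> ` V)) \<pi> s"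
    using pi_homeo(1)[OF V(1) iV] homeomorphic_map_maps by blast
  have sh: "homeomorphic_map (subtopology (mtop X) (\<pi> ` V)) (subtopology (mtop Y) V) s"
    using s homeomorphic_maps_map by blast
  have s1: "s (\<pi> y) = y" if "y \<in> V" for y using s that VY by (auto simp: homeomorphic_maps_def)
  let ?\<Psi> = "q \<circ> (\<Phi> \<circ> (\<lambda>(x, t). (s x, t)))"
  show "\<exists>U. openin (mtop X) U \<and> x \<in> U \<and>
      (\<exists>\<Phi>. homeomorphic_map (prod_topology (subtopology (mtop X) U) (cl_top (Pin \<kappa>)))
         (subtopology (total Q) {C \<in> topspace (total Q). (fst \<circ> cov Q) C \<in> U}) \<Phi> \<and>
         (\<forall>y\<in>U. \<forall>t\<in>Pin \<kappa>. (fst \<circ> cov Q) (\<Phi> (y, t)) = y \<and>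
           (\<forall>r\<in>Pin \<kappa>. \<Phi> (y, cl_mult \<kappa> t r) = act Q (\<Phi> (y, t)) r)))"
  proof (intro exI[of _ "\<pi> ` V"] conjI exI[of _ ?\<Psi>] ballI)
    show "openin (mtop X) (\<pi> ` V)" by (rule pi_homeo(2)[OF V(1) iV])
    show "x \<in> \<pi> ` V" using y(2) V(2) by blast
    show "homeomorphic_map (prod_topology (subtopology (mtop X) (\<pi> ` V)) (cl_top (Pin \<kappa>)))
         (subtopology (total Q) {C \<in> topspace (total Q). (fst \<circ> cov Q) C \<in> \<pi> ` V}) ?\<Psi>"
      by (rule homeomorphic_map_compose[OF homeomorphic_map_compose[OF homeomorphic_map_prod_id[OF sh] h] q_homeo[OF V(1) iV]])
    fix z and t :: "'m cliff" assume "z \<in> \<pi> ` V" and t: "t \<in> Pin \<kappa>"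
    then obtain v where v: "v \<in> V" "z = \<pi> v" by blast
    have pv: "?\<Psi> (z, t) = {\<Phi> (v, t), D (\<Phi> (v, t))}" if "t \<in> Pin \<kappa>" for t using s1[OF v(1)] by (simp add: v(2))
    show "(fst \<circ> cov Q) (?\<Psi> (z, t)) = z"
      unfolding pv[OF t] using \<Phi>[OF v(1) t] by (simp add: cov_Q fst_dpi v(2))
    fix r :: "'m cliff" assume r: "r \<in> Pin \<kappa>"
    show "?\<Psi> (z, cl_mult \<kappa> t r) = act Q (?\<Psi> (z, t)) r"
      unfolding pv[OF t] pv[OF Pin_mult[OF t r]] using \<Phi>m[OF v(1) t r] by (simp add: act_Q[OF \<Phi>(1)[OF v(1) t] r])
  qed
qed

lemma pin_structure_Q: "pin_structure \<kappa> X Q"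
  unfolding pin_structure_def lifts_frames_def
proof (intro conjI ballI principal_Q)
  fix C and t :: "'m cliff" assume "C \<in> topspace (total Q)" and t: "t \<in> Pin \<kappa>"
  then obtain p where p: "p \<in> P" "C = {p, D p}" unfolding topspace_Q by blast
  show "cov Q (act Q C t) = frame_mult (cov Q C) (pin_proj \<kappa> t)"
    using S.acts(1)[OF p(1) t] S.cov_act[OF p(1) t] dpi_mult[OF cov_S_in[OF p(1)]]
    by (simp add: p act_Q[OF p(1) t] cov_Q)
next
  have c: "continuous_map (total Q) (frame_bundle X) (cov Q)"
    unfolding total_Q
    by (rule continuous_map_from_quotient_top[OF continuous_map_compose[OF two_covering_props(1)[OF S.two_cov] continuous_dpi]])
      (simp add: cov_Q)
  show "two_covering (total Q) (frame_bundle X) (cov Q)"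
  proof (rule two_covering_local[OF c])
    fix e assume "e \<in> topspace (frame_bundle X)"
    then have e: "e \<in> orthonormal_frames X" by (simp add: X.topspace_frame_bundle)
    obtain y where y: "y \<in> topspace (mtop Y)" "\<pi> y = fst e" using pi_surj[OF X.orthonormalD(2)[OF e]] by blast
    obtain V where V: "openin (mtop Y) V" "y \<in> V" "V \<subseteq> topspace (mtop Y)" "inj_on \<pi> V" "openin (mtop X) (\<pi> ` V)"
      and hV: "homeomorphic_map (subtopology (frame_bundle Y) {e. fst e \<in> V}) (subtopology (frame_bundle X) {e. fst e \<in> \<pi> ` V}) d\<pi>"
      by (rule dpi_local_homeo[OF y(1) openin_topspace y(1)])
    let ?U = "{e \<in> orthonormal_frames X. fst e \<in> \<pi> ` V}"
    let ?W = "{e \<in> orthonormal_frames Y. fst e \<in> V}"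
    have "{p \<in> P. cov S p \<in> ?W} = {p \<in> P. (fst \<circ> cov S) p \<in> V}" using cov_S_in by auto
    then have t1: "two_covering (subtopology (total S) {p \<in> P. (fst \<circ> cov S) p \<in> V}) (subtopology (frame_bundle Y) ?W) (cov S)"
      using two_covering_restrict[OF S.two_cov Y.openin_frames_over[OF V(1)]] by simp
    have "{C \<in> topspace (total Q). cov Q C \<in> ?U} = {C \<in> topspace (total Q). (fst \<circ> cov Q) C \<in> \<pi> ` V}"
      using cov_Q dpi_in[OF cov_S_in] by (auto simp: topspace_Q)
    then have "two_covering (subtopology (total Q) {C \<in> topspace (total Q). cov Q C \<in> ?U}) (subtopology (frame_bundle X) ?U) (cov Q)"
      using two_covering_transport[OF t1 q_homeo[OF V(1,4)] hV[unfolded Y.subtopology_frames_over X.subtopology_frames_over], of "cov Q"]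
      by (simp add: cov_Q)
    moreover have "e \<in> ?U" using e y(2) V(2) by (metis (mono_tags, lifting) image_eqI mem_Collect_eq)
    ultimately show "\<exists>U. openin (frame_bundle X) U \<and> e \<in> U \<and>
       two_covering (subtopology (total Q) {C \<in> topspace (total Q). cov Q C \<in> U}) (subtopology (frame_bundle X) U) (cov Q)"
      using X.openin_frames_over[OF V(5)] by (intro exI[of _ ?U] conjI)
  qed
qed

lemma frame_pair_inverse:
  "e \<in> orthonormal_frames Y \<Longrightarrow> inv_into (orthonormal_frames Y) (\<lambda>e. (d\<pi> e, fst e)) (d\<pi> e, fst e) = e"
proof -
  assume e: "e \<in> orthonormal_frames Y"
  have "inj_on (\<lambda>e. (d\<pi> e, fst e)) (orthonormal_frames Y)"
    by (rule inj_onI) (use dpi_inject in blast)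
  from inv_into_f_f[OF this e] show ?thesis .
qed

text \<open>A point of \<open>S\<close> is recovered from its class and its base point, because the
  two members of a class lie over different points of the cover.\<close>

lemma pin_equivalent_pullback: "pin_equivalent \<kappa> Y S (cover_pullback Y X \<pi> Q)"
proof -
  let ?PB = "cover_pullback Y X \<pi> Q"
  let ?R = "{(y, C). y \<in> topspace (mtop Y) \<and> C \<in> topspace (total Q) \<and> \<pi> y = fst (cov Q C)}"
  let ?f = "\<lambda>p. (fst (cov S p), {p, D p})"
  have tot: "total ?PB = subtopology (prod_topology (mtop Y) (total Q)) ?R" by (simp add: cover_pullback_def)
  have topPB: "topspace (total ?PB) = ?R" unfolding tot by auto
  have fR: "?f p \<in> ?R" if "p \<in> P" for p
    using that base_in[OF that] cov_Q[OF that] by (auto simp: topspace_Q fst_dpi)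
  have h: "homeomorphic_map (total S) (total ?PB) ?f"
  proof (rule bijective_open_imp_homeomorphic_map)
    have "continuous_map (total S) (prod_topology (mtop Y) (total Q)) ?f"
      using continuous_map_pairedI[OF S.continuous_pr continuous_q] by (simp add: comp_def)
    then show "continuous_map (total S) (total ?PB) ?f"
      unfolding tot continuous_map_in_subtopology using fR by (intro conjI funcsetI)
    show "?f ` topspace (total S) = topspace (total ?PB)"
      unfolding topPB
    proof
      show "?f ` P \<subseteq> ?R" using fR by (rule image_subsetI)
      show "?R \<subseteq> ?f ` P"
      proof
        fix z assume "z \<in> ?R"
        then obtain y p where z: "z = (y, {p, D p})" "y \<in> topspace (mtop Y)" "p \<in> P" "\<pi> y = \<pi> (fst (cov S p))"
          using cov_Q by (auto simp: topspace_Q fst_dpi)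
        then consider "y = fst (cov S p)" | "y = \<tau> (fst (cov S p))" using fibre[OF base_in] by blast
        then show "z \<in> ?f ` P"
        proof cases
          case 1
          then have "z = ?f p" using z by simp
          then show ?thesis using z(3) by (rule image_eqI)
        next
          case 2
          then have "z = ?f (D p)" using z(1) base_D[OF z(3)] D_D[OF z(3)] by (simp add: insert_commute)
          then show ?thesis using D_in[OF z(3)] by (rule image_eqI)
        qed
      qed
    qed
    show "inj_on ?f P"
    proof (rule inj_onI)
      fix p p' assume p: "p \<in> P" "p' \<in> P" "?f p = ?f p'"
      then have "p' = p \<or> p' = D p" using quotient_eq_iff[of p p'] by simp
      moreover have "p' \<noteq> D p"
      proof
        assume "p' = D p"
        then have "\<tau> (fst (cov S p)) = fst (cov S p)" using p(3) base_D[OF p(1)] by simp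
        then show False using tau_neq[OF base_in[OF p(1)]] by simp
      qed
      ultimately show "p = p'" by blast
    qed
    show "open_map (total S) (total ?PB) ?f"
      unfolding tot
    proof (rule open_map_local)
      fix p assume p: "p \<in> P"
      obtain V where V: "openin (mtop Y) V" "fst (cov S p) \<in> V" "inj_on \<pi> V"
        using two_covering_props(4)[OF two_covering_pi base_in[OF p]] by blast
      have VY: "V \<subseteq> topspace (mtop Y)" by (rule openin_subset[OF V(1)])
      let ?A = "{p \<in> P. (fst \<circ> cov S) p \<in> V}"
      have oA: "openin (total S) ?A" by (rule openin_continuous_map_preimage[OF S.continuous_pr V(1)])
      have "open_map (subtopology (total S) ?A) (subtopology (prod_topology (mtop Y) (total Q)) ?R) ?f"
        unfolding open_map_def
      proof (intro allI impI)
        fix W assume "openin (subtopology (total S) ?A) W"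
        then have W: "openin (total S) W" "W \<subseteq> ?A"
          using oA openin_trans_full openin_subset[of "subtopology (total S) ?A" W] by auto
        have "openin (total Q) (q ` W)" using open_q[unfolded open_map_def, rule_format, OF W(1)] .
        then have "openin (prod_topology (mtop Y) (total Q)) (V \<times> q ` W)" using V(1) by (simp add: openin_prod_Times_iff)
        then have "openin (subtopology (prod_topology (mtop Y) (total Q)) ?R) ((V \<times> q ` W) \<inter> ?R)" by (rule openin_subtopology_Int)
        \<comment> \<open>As \<pi> is injective on \<open>V\<close>, the condition defining
          \<open>?R\<close> forces the base coordinate to be that of the representative in
          \<open>W\<close>.\<close>
        moreover have "(V \<times> q ` W) \<inter> ?R = ?f ` W"
        proof (intro set_eqI iffI)
          fix z assume z: "z \<in> (V \<times> q ` W) \<inter> ?R"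
          then obtain w where w: "w \<in> W" "snd z = {w, D w}" by auto
          have wA: "w \<in> P" "fst (cov S w) \<in> V" using w(1) W(2) by auto
          have "\<pi> (fst z) = \<pi> (fst (cov S w))" using z w(2) cov_Q[OF wA(1)] by (auto simp: fst_dpi)
          then have "fst z = fst (cov S w)" using inj_onD[OF V(3)] z wA(2) by auto
          then have "z = ?f w" using w(2) by (simp add: prod_eq_iff)
          then show "z \<in> ?f ` W" using w(1) by (rule image_eqI)
        next
          fix z assume "z \<in> ?f ` W"
          then obtain w where w: "w \<in> W" "z = ?f w" by blast
          then have "w \<in> P" "fst (cov S w) \<in> V" using W(2) by auto
          then show "z \<in> (V \<times> q ` W) \<inter> ?R" using fR[of w] w by auto
        qed
        ultimately show "openin (subtopology (prod_topology (mtop Y) (total Q)) ?R) (?f ` W)" by simp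
      qed
      then show "\<exists>U. openin (total S) U \<and> p \<in> U \<and> open_map (subtopology (total S) U) (subtopology (prod_topology (mtop Y) (total Q)) ?R) ?f"
        using oA p V(2) by (intro exI[of _ ?A]) simp
    qed
  qed
  have cv: "cov ?PB (?f p) = cov S p" if "p \<in> P" for p
    using frame_pair_inverse[OF cov_S_in[OF that]] cov_Q[OF that] by (simp add: cover_pullback_def)
  have ac: "act ?PB (?f p) t = ?f (act S p t)" if "p \<in> P" "t \<in> Pin \<kappa>" for p t
    using act_Q[OF that] S.cov_act[OF that] by (simp add: cover_pullback_def frame_mult_simps)
  have "pin_structure \<kappa> Y ?PB"
    unfolding pin_structure_def by (rule S.lifts_transport[OF h cv ac])
  moreover have "structure_iso (Pin \<kappa>) S ?PB ?f"
    unfolding structure_iso_def using h cv ac by simp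
  ultimately show ?thesis unfolding pin_equivalent_def pin_equivalence_def by (intro exI[of _ ?f] conjI pin_S)
qed

text \<open>With \<open>ascend\<close>, equivalences from the quotient to \<open>Z\<close> amount to
  equivariant maps from \<open>S\<close> to \<open>Z\<close> that cover \<open>d\<pi>\<close> and
  are invariant under \<open>D\<close>. Deciding which quotient is \<open>Z\<close> thus becomes a
  question about maps on \<open>S\<close>.\<close>

lemma descend:
  fixes Z :: "('r, 'x, 'm) frame_structure"
  assumes Z: "pin_structure \<kappa> X Z" and h: "continuous_map (total S) (total Z) h"
    and cv: "\<And>p. p \<in> P \<Longrightarrow> cov Z (h p) = d\<pi> (cov S p)"
    and ac: "\<And>p t. p \<in> P \<Longrightarrow> t \<in> Pin \<kappa> \<Longrightarrow> h (act S p t) = act Z (h p) t"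
    and inv: "\<And>p. p \<in> P \<Longrightarrow> h (D p) = h p"
  shows "pin_equivalent \<kappa> X Q Z"
proof -
  define k where "k C = the_elem (h ` C)" for C
  have k: "k {p, D p} = h p" if "p \<in> P" for p using inv[OF that] by (simp add: k_def)
  have "continuous_map (total Q) (total Z) k"
    unfolding total_Q by (rule continuous_map_from_quotient_top[OF h]) (rule k)
  then have "structure_iso (Pin \<kappa>) Q Z k"
  proof (rule lifts_map_iso[OF PX.pin_lifted[THEN iffD1, OF pin_structure_Q] PX.pin_lifted[THEN iffD1, OF Z]])
    fix C assume "C \<in> topspace (total Q)"
    then obtain p where p: "p \<in> P" "C = {p, D p}" unfolding topspace_Q by blast
    show "cov Z (k C) = cov Q C" using k[OF p(1)] cv[OF p(1)] cov_Q[OF p(1)] by (simp add: p)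
    fix t :: "'m cliff" assume t: "t \<in> Pin \<kappa>"
    show "k (act Q C t) = act Z (k C) t"
      using k[OF p(1)] ac[OF p(1) t] k[OF S.acts(1)[OF p(1) t]] act_Q[OF p(1) t] by (simp add: p)
  qed
  then show ?thesis unfolding pin_equivalent_def pin_equivalence_def by (intro exI[of _ k] conjI pin_structure_Q Z)
qed

lemma ascend:
  fixes Z :: "('r, 'x, 'm) frame_structure"
  assumes "pin_equivalent \<kappa> X Q Z"
  obtains h where "continuous_map (total S) (total Z) h" "\<forall>p \<in> P. cov Z (h p) = d\<pi> (cov S p)"
    "\<forall>p \<in> P. \<forall>t \<in> Pin \<kappa>. h (act S p t) = act Z (h p) t" "\<forall>p \<in> P. h (D p) = h p"
proof -
  obtain g where g: "structure_iso (Pin \<kappa>) Q Z g" using assms unfolding pin_equivalent_def pin_equivalence_def by blast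
  note gD = structure_isoD[OF g]
  have qQ: "{p, D p} \<in> topspace (total Q)" if "p \<in> P" for p using that topspace_Q by blast
  show ?thesis
  proof (rule that[of "g \<circ> q"])
    show "continuous_map (total S) (total Z) (g \<circ> q)" by (rule continuous_map_compose[OF continuous_q gD(2)])
    show "\<forall>p \<in> P. cov Z ((g \<circ> q) p) = d\<pi> (cov S p)" using gD(4)[OF qQ] cov_Q by simp
    show "\<forall>p \<in> P. \<forall>t \<in> Pin \<kappa>. (g \<circ> q) (act S p t) = act Z ((g \<circ> q) p) t"
      using gD(5)[OF qQ] act_Q by simp
    show "\<forall>p \<in> P. (g \<circ> q) (D p) = (g \<circ> q) p" using D_D by (simp add: insert_commute)
  qed
qed

lemma D_sheet: "p \<in> P \<Longrightarrow> (D \<circ> sheet_exchange S) p = act S (D p) (- cl_one)"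
  using S.sheet_exchange D_act S.minus_one by simp

text \<open>\<open>D\<close> commutes with right multiplication by -1, whose square is the identity;
  so changing the sign of an involutive lift keeps it involutive.\<close>

lemma involution_sheet: "involution X Y \<pi> \<tau> \<kappa> S (D \<circ> sheet_exchange S)"
proof
  let ?D = "D \<circ> sheet_exchange S"
  note m = S.minus_one
  have e: "?D p = act S (D p) (- cl_one)" if "p \<in> P" for p using D_sheet[OF that] .
  show "pin_equivalence \<kappa> Y S (isometry_pullback Y \<tau> S) ?D"
    unfolding pin_equivalence_def
  proof (intro conjI pin_S pin_isometry_pullback[OF pin_S])
    have LS: "lifted \<kappa> (Pin \<kappa>) Y (frame_bundle Y) S" using pin_S PY.pin_lifted by blast
    have L: "lifted \<kappa> (Pin \<kappa>) Y (frame_bundle Y) (isometry_pullback Y \<tau> S)"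
      using pin_isometry_pullback[OF pin_S] PY.pin_lifted by blast
    show "structure_iso (Pin \<kappa>) S (isometry_pullback Y \<tau> S) ?D"
    proof (rule lifts_map_iso[OF LS L])
      have "continuous_map (total S) (total S) ((\<lambda>p. act S p (- cl_one)) \<circ> D)"
        by (rule continuous_map_compose[OF continuous_D S.continuous_act_right]) (simp add: topspace_cl_top m)
      then have "continuous_map (total S) (total S) ?D" by (rule continuous_map_eq) (simp add: e del: comp_apply, simp)
      then show "continuous_map (total S) (total (isometry_pullback Y \<tau> S)) ?D" by (simp only: pullback_simps)
      fix p assume p: "p \<in> P"
      note Dp = D_in[OF p]
      have c: "cov S (?D p) = d\<tau> (cov S p)" unfolding e[OF p] using S.cov_minus(1)[OF Dp] cov_D[OF p] by simp
      show "cov (isometry_pullback Y \<tau> S) (?D p) = cov S p"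
        using pullback_cov[of S "?D p"] dtau_in[OF cov_S_in[OF p]] dtau_dtau[OF cov_S_in[OF p]] unfolding c by simp
      fix t :: "'m cliff" assume t: "t \<in> Pin \<kappa>"
      show "?D (act S p t) = act (isometry_pullback Y \<tau> S) (?D p) t"
        unfolding e[OF p] e[OF S.acts(1)[OF p t]] pullback_simps using D_act[OF p t] S.act_minus_commute[OF Dp t] by simp
    qed
  qed
  show "?D (?D p) = p" if p: "p \<in> P" for p
  proof -
    note Dp = D_in[OF p]
    have "?D (?D p) = act S (D (act S (D p) (- cl_one))) (- cl_one)"
      unfolding e[OF p] by (rule e[OF S.acts(1)[OF Dp m]])
    also have "\<dots> = p" using D_act[OF Dp m] D_D[OF p] S.cov_minus(3)[OF p] by simp
    finally show ?thesis .
  qed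
qed

text \<open>At least one: the equivalence with the pull-back, followed by the projection, is a map
  \<open>h\<close> to \<open>Z\<close>, to be compared with \<open>h \<circ> D\<close>. At most one:
  a map invariant under \<open>D\<close> and one invariant under the other lift would be equal
  everywhere or differ by -1 everywhere, and each of these fails at any point; a point exists
  because the cover is nonempty.\<close>

lemma quotient_dichotomy:
  fixes Z :: "('r, 'x, 'm) frame_structure"
  assumes Z: "pin_structure \<kappa> X Z" and eq: "pin_equivalent \<kappa> Y S (cover_pullback Y X \<pi> Z)"
    and ne: "topspace (mtop Y) \<noteq> {}"
  shows "pin_equivalent \<kappa> X Q Z \<longleftrightarrow> \<not> pin_equivalent \<kappa> X (quotient_structure Y X \<pi> (D \<circ> sheet_exchange S) S) Z"
proof -
  interpret D': involution X Y \<pi> \<tau> \<kappa> S "D \<circ> sheet_exchange S" by (rule involution_sheet)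
  interpret Z: lifted \<kappa> "Pin \<kappa>" X "frame_bundle X" Z using Z PX.pin_lifted by blast
  note m = S.minus_one
  have dich: "(\<forall>p \<in> P. h p = h' p) \<or> (\<forall>p \<in> P. h p \<noteq> h' p)"
    if h: "continuous_map (total S) (total Z) h" "continuous_map (total S) (total Z) h'"
      and cv: "\<And>p. p \<in> P \<Longrightarrow> cov Z (h p) = cov Z (h' p)"
      and ac: "\<And>p t. p \<in> P \<Longrightarrow> t \<in> Pin \<kappa> \<Longrightarrow> h (act S p t) = act Z (h p) t"
        "\<And>p t. p \<in> P \<Longrightarrow> t \<in> Pin \<kappa> \<Longrightarrow> h' (act S p t) = act Z (h' p) t" for h h'
  proof (rule S.equivariant_lifts_agree[OF connected Z.two_cov h cv])
    fix p and t :: "'m cliff" assume p: "p \<in> P" and "t \<in> topspace (cl_top (Pin \<kappa>))"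
    then have t: "t \<in> Pin \<kappa>" by (simp add: topspace_cl_top)
    have hp: "h p \<in> topspace (total Z)" "h' p \<in> topspace (total Z)" using h p by (auto simp: continuous_map_def)
    show "h (act S p t) = h' (act S p t) \<longleftrightarrow> h p = h' p"
      unfolding ac(1)[OF p t] ac(2)[OF p t] using Z.acts(4)[OF hp(1) t] Z.acts(4)[OF hp(2) t] by metis
  qed
  have Zfib: "b = act Z a (- cl_one)" if "a \<in> topspace (total Z)" "b \<in> topspace (total Z)" "cov Z a = cov Z b" "a \<noteq> b" for a b
    using Z.cov_fibre[OF that(1,2,3)] that(4) by blast
  have "pin_equivalent \<kappa> X Q Z \<or> pin_equivalent \<kappa> X D'.Q Z"
  proof -
    obtain f where f: "structure_iso (Pin \<kappa>) S (cover_pullback Y X \<pi> Z) f"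
      using eq unfolding pin_equivalent_def pin_equivalence_def by blast
    note F = structure_isoD[OF f]
    define h where "h p = snd (f p)" for p
    have tot: "total (cover_pullback Y X \<pi> Z) = subtopology (prod_topology (mtop Y) (total Z))
       {(y, C). y \<in> topspace (mtop Y) \<and> C \<in> topspace (total Z) \<and> \<pi> y = fst (cov Z C)}" by (simp add: cover_pullback_def)
    have hc: "continuous_map (total S) (total Z) h"
      using continuous_map_compose[OF F(2)[unfolded tot] continuous_map_subtopology_snd] by (simp add: h_def[abs_def] comp_def)
    have fp: "fst (f p) \<in> topspace (mtop Y)" "h p \<in> topspace (total Z)" "\<pi> (fst (f p)) = fst (cov Z (h p))" if "p \<in> P" for p
      using F(3)[OF that] unfolding tot by (auto simp: h_def)
    have cv: "cov Z (h p) = d\<pi> (cov S p)" if p: "p \<in> P" for p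
    proof -
      have "cov Z (h p) \<in> orthonormal_frames X" using Z.cov_in[OF fp(2)[OF p]] by (simp add: X.topspace_frame_bundle)
      then obtain e where e: "e \<in> orthonormal_frames Y" "fst e = fst (f p)" "d\<pi> e = cov Z (h p)"
        using dpi_surj[OF _ fp(1)[OF p] fp(3)[OF p]] by blast
      have "cov (cover_pullback Y X \<pi> Z) (f p) = e"
        using frame_pair_inverse[OF e(1)] e(2,3) by (simp add: cover_pullback_def h_def case_prod_unfold)
      then show ?thesis using F(4)[OF p] e(3) by simp
    qed
    have ac: "h (act S p t) = act Z (h p) t" if "p \<in> P" "t \<in> Pin \<kappa>" for p t
      using F(5)[OF that] by (simp add: h_def cover_pullback_def case_prod_unfold)
    have hD: "(h \<circ> D) (act S p t) = act Z ((h \<circ> D) p) t" if "p \<in> P" "t \<in> Pin \<kappa>" for p t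
      using D_act[OF that] ac[OF D_in[OF that(1)] that(2)] by simp
    have cvD: "cov Z (h p) = cov Z ((h \<circ> D) p)" if "p \<in> P" for p
      using cv[OF that] cv[OF D_in[OF that]] cov_D[OF that] dpi_dtau[OF cov_S_in[OF that]] by simp
    from dich[OF hc continuous_map_compose[OF continuous_D hc] cvD ac hD]
    show ?thesis
    proof
      assume "\<forall>p \<in> P. h p = (h \<circ> D) p"
      then have "pin_equivalent \<kappa> X Q Z" by (intro descend[OF Z hc cv ac]) simp_all
      then show ?thesis ..
    next
      assume ne: "\<forall>p \<in> P. h p \<noteq> (h \<circ> D) p"
      have "h ((D \<circ> sheet_exchange S) p) = h p" if p: "p \<in> P" for p
      proof -
        have "h (D p) = act Z (h p) (- cl_one)"
          by (rule Zfib[OF fp(2)[OF p] fp(2)[OF D_in[OF p]]]) (use cvD[OF p] ne p in auto)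
        then show ?thesis
          unfolding D_sheet[OF p] ac[OF D_in[OF p] m] using Z.cov_minus(3)[OF fp(2)[OF p]] by simp
      qed
      then have "pin_equivalent \<kappa> X D'.Q Z" by (intro D'.descend[OF Z hc cv ac])
      then show ?thesis ..
    qed
  qed
  moreover have "\<not> (pin_equivalent \<kappa> X Q Z \<and> pin_equivalent \<kappa> X D'.Q Z)"
  proof
    assume both: "pin_equivalent \<kappa> X Q Z \<and> pin_equivalent \<kappa> X D'.Q Z"
    obtain h where h: "continuous_map (total S) (total Z) h" "\<forall>p \<in> P. cov Z (h p) = d\<pi> (cov S p)"
      "\<forall>p \<in> P. \<forall>t \<in> Pin \<kappa>. h (act S p t) = act Z (h p) t" "\<forall>p \<in> P. h (D p) = h p"
      by (rule ascend[OF conjunct1[OF both]])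
    obtain h' where h': "continuous_map (total S) (total Z) h'" "\<forall>p \<in> P. cov Z (h' p) = d\<pi> (cov S p)"
      "\<forall>p \<in> P. \<forall>t \<in> Pin \<kappa>. h' (act S p t) = act Z (h' p) t" "\<forall>p \<in> P. h' ((D \<circ> sheet_exchange S) p) = h' p"
      by (rule D'.ascend[OF conjunct2[OF both]])
    obtain p where p: "p \<in> P" using ne S.fibre_ex by blast
    note Dp = D_in[OF p]
    have hi: "h r \<in> topspace (total Z)" "h' r \<in> topspace (total Z)" if "r \<in> P" for r
      using h(1) h'(1) that by (auto simp: continuous_map_def)
    \<comment> \<open>Passing from \<open>p\<close> to \<open>D p\<close> leaves \<open>h\<close>
      unchanged but changes \<open>h'\<close> by -1, so neither equality nor opposite sign can hold
      at both points.\<close>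
    have c: "h (D p) = h p" "act Z (h' (D p)) (- cl_one) = h' p"
      using h(4) p h'(4) D_sheet[OF p] h'(3) Dp m by (auto simp del: comp_apply)
    have "(\<forall>p \<in> P. h p = h' p) \<or> (\<forall>p \<in> P. h p \<noteq> h' p)"
      by (rule dich[OF h(1) h'(1)]) (simp_all add: h(2,3) h'(2,3))
    then show False
    proof
      assume "\<forall>p \<in> P. h p = h' p"
      then have "act Z (h p) (- cl_one) = h p" using c p Dp by simp
      then show False using Z.cov_minus(2)[OF hi(1)[OF p]] by simp
    next
      assume n: "\<forall>p \<in> P. h p \<noteq> h' p"
      have g: "h' r = act Z (h r) (- cl_one)" if "r \<in> P" for r
        by (rule Zfib[OF hi[OF that]]) (use n that h(2) h'(2) in auto)
      have "h p = h' p" using c g[OF Dp] Z.cov_minus(3)[OF hi(1)[OF p]] by simp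
      then show False using n p by blast
    qed
  qed
  ultimately show ?thesis by blast
qed

end

context pin_cover
begin

text \<open>The extension is forced: [p, t] must go to \<open>act E (D\<^sub>1 p) t\<close>.
  \<open>D\<^sub>2\<close> is the inverse of the second component, so that it covers the
  differential of \<tau> from \<open>u'\<close> to \<open>u\<close>. The element of Pin outside Spin
  in the hypothesis tests at one point the global sign by which the extension and
  \<open>D\<^sub>2\<close> may differ over \<open>u'\<close>.\<close>

theorem couple_iso_extends_to_pin:
  fixes S :: "('q, 'y, 'm) frame_structure"
  defines "E \<equiv> pin_extension \<kappa> S" and "\<iota> \<equiv> \<lambda>p. ext_class \<kappa> S p cl_one"
  assumes u: "orientation Y u" and u': "u' = opposite_orientation Y u"
    and spin: "spin_structure \<kappa> Y u S"
    and iso: "couple_iso \<kappa> Y u u' (S, isometry_pullback Y \<tau> S)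
       (isometry_pullback Y \<tau> (orient_restrict u' E), orient_restrict u' E) (D\<^sub>1, g)"
    and D2: "D\<^sub>2 = inv_into (topspace (total S)) g"
    and inv1: "\<forall>p \<in> topspace (total S). D\<^sub>2 (D\<^sub>1 p) = p"
    and inv2: "\<forall>q \<in> topspace (total (orient_restrict u' E)). D\<^sub>1 (D\<^sub>2 q) = q"
  shows "\<exists>D. pin_equivalence \<kappa> Y E (isometry_pullback Y \<tau> E) D \<and>
     (\<forall>p \<in> topspace (total S). D (\<iota> p) = D\<^sub>1 p) \<and>
     ((\<exists>p \<in> topspace (total S). \<exists>t \<in> Pin \<kappa> - Spin \<kappa>. \<iota> (D\<^sub>2 (act E (\<iota> p) t)) = act E (D\<^sub>1 p) t) \<longrightarrow>
        (\<forall>q \<in> topspace (total (orient_restrict u' E)). D q = \<iota> (D\<^sub>2 q)) \<and>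
        (\<forall>q \<in> topspace (total E). D (D q) = q) \<and>
        pin_structure \<kappa> X (quotient_structure Y X \<pi> D E) \<and>
        pin_equivalent \<kappa> Y E (cover_pullback Y X \<pi> (quotient_structure Y X \<pi> D E)))"
proof -
  interpret Ext: extension \<kappa> Y u S by unfold_locales (rule u, rule spin)
  have EE: "pin_extension \<kappa> S = E" by (simp add: E_def)
  let ?P = "topspace (total S)" and ?R = "orient_restrict u' E"
  have pinE: "pin_structure \<kappa> Y E" using Ext.pin_structure_E EE by simp
  have pinE': "pin_structure \<kappa> Y (isometry_pullback Y \<tau> E)" by (rule pin_isometry_pullback[OF pinE])
  have LE: "lifted \<kappa> (Pin \<kappa>) Y (frame_bundle Y) E" using pinE PY.pin_lifted by blast
  have LE': "lifted \<kappa> (Pin \<kappa>) Y (frame_bundle Y) (isometry_pullback Y \<tau> E)" using pinE' PY.pin_lifted by blast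
  interpret E: lifted \<kappa> "Pin \<kappa>" Y "frame_bundle Y" E by (rule LE)
  have uo: "orientation Y u'" unfolding u' by (rule Y.orientation_opposite[OF u])
  have "spin_structure \<kappa> Y u' ?R" by (rule PY.spin_orient_restrict[OF uo pinE])
  then interpret R: lifted \<kappa> "Spin \<kappa>" Y "oriented_frame_bundle Y u'" ?R using PY.spin_lifted by blast
  have R_simps: "total ?R = subtopology (total E) {C \<in> topspace (total E). cov E C \<in> u'}" "act ?R = act E" "cov ?R = cov E"
    by (simp_all add: orient_restrict_def)
  have topR: "topspace (total ?R) = {C \<in> topspace (total E). cov E C \<in> u'}" unfolding R_simps by auto
  have covE: "cov E C \<in> orthonormal_frames Y" if "C \<in> topspace (total E)" for C using pin_cov_in[OF pinE that] .
  have covS: "cov S p \<in> orthonormal_frames Y" if "p \<in> ?P" for p using Ext.covS_in[OF that] by blast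
  have iso1: "structure_iso (Spin \<kappa>) S (isometry_pullback Y \<tau> ?R) D\<^sub>1" and iso2: "structure_iso (Spin \<kappa>) (isometry_pullback Y \<tau> S) ?R g"
    using iso unfolding couple_iso_def spin_equivalence_def by simp_all
  note F1 = structure_isoD[OF iso1, unfolded pullback_simps R_simps(2)]
  note F2 = structure_isoD[OF iso2, unfolded pullback_simps R_simps(2,3)]
  have D1R: "D\<^sub>1 p \<in> topspace (total ?R)" if "p \<in> ?P" for p using F1(3)[OF that] .
  have D1E: "D\<^sub>1 p \<in> topspace (total E)" if "p \<in> ?P" for p using D1R[OF that] topR by simp
  have covD1: "cov E (D\<^sub>1 p) = d\<tau> (cov S p)" if p: "p \<in> ?P" for p
  proof -
    have "d\<tau> (cov E (D\<^sub>1 p)) = cov S p"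
      using F1(4)[OF p] pullback_cov[of ?R "D\<^sub>1 p"] covE[OF D1E[OF p]] by (simp add: R_simps)
    then show ?thesis using dtau_dtau[OF covE[OF D1E[OF p]]] by metis
  qed
  note cE = Ext.E_cases[unfolded EE]
  note \<iota>act = Ext.act_ext[unfolded EE] and \<iota>cov = Ext.cov_ext[unfolded EE] and \<iota>in = Ext.cls_in[unfolded EE]
  \<comment> \<open>Well defined on classes because \<open>D\<^sub>1\<close> is equivariant under
    Spin.\<close>
  define D where "D C = the_elem ((\<lambda>(p, t). act E (D\<^sub>1 p) t) ` C)" for C
  have D_cls: "D (ext_class \<kappa> S p t) = act E (D\<^sub>1 p) t" if p: "p \<in> ?P" and t: "t \<in> Pin \<kappa>" for p t
  proof -
    have "(\<lambda>(p, t). act E (D\<^sub>1 p) t) ` ext_class \<kappa> S p t = {act E (D\<^sub>1 p) t}"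
    proof
      show "{act E (D\<^sub>1 p) t} \<subseteq> (\<lambda>(p, t). act E (D\<^sub>1 p) t) ` ext_class \<kappa> S p t"
        using Ext.ext_class_self[OF p t] by (auto intro: rev_image_eqI)
      show "(\<lambda>(p, t). act E (D\<^sub>1 p) t) ` ext_class \<kappa> S p t \<subseteq> {act E (D\<^sub>1 p) t}"
      proof (rule image_subsetI)
        fix z assume "z \<in> ext_class \<kappa> S p t"
        then obtain q s r where z: "z = (q, s)" "s \<in> Pin \<kappa>" "r \<in> Spin \<kappa>" "q = act S p r" "t = cl_mult \<kappa> r s"
          by (cases z) (auto simp: Ext.ext_class_iff)
        have "act E (D\<^sub>1 q) s = act E (act E (D\<^sub>1 p) r) s" using F1(5)[OF p z(3)] z(4) by simp
        also have "\<dots> = act E (D\<^sub>1 p) t" using E.acts(2)[OF D1E[OF p] Spin_Pin[OF z(3)] z(2)] z(5) by simp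
        finally show "(\<lambda>(p, t). act E (D\<^sub>1 p) t) z \<in> {act E (D\<^sub>1 p) t}" using z(1) by simp
      qed
    qed
    then show ?thesis by (simp add: D_def)
  qed
  have D\<iota>: "D (\<iota> p) = D\<^sub>1 p" if "p \<in> ?P" for p
    using D_cls[OF that Pin.one] E.act_e[OF D1E[OF that]] by (simp add: \<iota>_def)
  have D1c: "continuous_map (total S) (total E) D\<^sub>1"
    using F1(2) unfolding R_simps continuous_map_in_subtopology by blast
  have Dc: "continuous_map (total E) (total E) D"
  proof -
    have "continuous_map Ext.T (total E) ((\<lambda>(p, t). act E p t) \<circ> (\<lambda>(p, t). (D\<^sub>1 p, t)))"
      by (rule continuous_map_compose[OF continuous_map_prod_id[OF D1c] E.continuous_act])
    then have "continuous_map (quotient_top Ext.T Ext.Q) (total E) D"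
      by (rule continuous_map_from_quotient_top) (auto simp: topspace_cl_top D_cls)
    then show ?thesis using Ext.total_E EE by simp
  qed
  have D_act: "D (act E C t) = act E (D C) t" if C: "C \<in> topspace (total E)" and t: "t \<in> Pin \<kappa>" for C t
  proof -
    obtain p s where "p \<in> ?P" "s \<in> Pin \<kappa>" "C = ext_class \<kappa> S p s" using cE[OF C] by blast
    then show ?thesis using t by (simp add: \<iota>act D_cls Pin_mult E.acts D1E)
  qed
  have covD: "cov E (D C) = d\<tau> (cov E C)" and D_in: "D C \<in> topspace (total E)" if C: "C \<in> topspace (total E)" for C
  proof -
    obtain p s where ps: "p \<in> ?P" "s \<in> Pin \<kappa>" "C = ext_class \<kappa> S p s" using cE[OF C] by blast
    show "cov E (D C) = d\<tau> (cov E C)"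
      using dtau_mult[OF covS[OF ps(1)]] by (simp add: ps D_cls \<iota>cov E.cov_act D1E covD1)
    show "D C \<in> topspace (total E)" using ps E.acts(1)[OF D1E] by (simp add: D_cls)
  qed
  have isoD: "structure_iso (Pin \<kappa>) E (isometry_pullback Y \<tau> E) D"
  proof (rule lifts_map_iso[OF LE LE'])
    show "continuous_map (total E) (total (isometry_pullback Y \<tau> E)) D" using Dc by (simp only: pullback_simps)
    show "cov (isometry_pullback Y \<tau> E) (D C) = cov E C" if "C \<in> topspace (total E)" for C
      using pullback_cov[of E "D C"] dtau_in[OF covE[OF that]] dtau_dtau[OF covE[OF that]] unfolding covD[OF that] by simp
    show "D (act E C t) = act (isometry_pullback Y \<tau> E) (D C) t" if "C \<in> topspace (total E)" "t \<in> Pin \<kappa>" for C t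
      using D_act[OF that] by (simp only: pullback_simps)
  qed
  have eqD: "pin_equivalence \<kappa> Y E (isometry_pullback Y \<tau> E) D"
    unfolding pin_equivalence_def by (intro conjI pinE pinE' isoD)
  have step: "(\<forall>q \<in> topspace (total ?R). D q = \<iota> (D\<^sub>2 q)) \<and> (\<forall>q \<in> topspace (total E). D (D q) = q) \<and>
        pin_structure \<kappa> X (quotient_structure Y X \<pi> D E) \<and>
        pin_equivalent \<kappa> Y E (cover_pullback Y X \<pi> (quotient_structure Y X \<pi> D E))"
    if ex: "\<exists>p \<in> ?P. \<exists>t \<in> Pin \<kappa> - Spin \<kappa>. \<iota> (D\<^sub>2 (act E (\<iota> p) t)) = act E (D\<^sub>1 p) t"
  proof -
    have iso3: "structure_iso (Spin \<kappa>) ?R (isometry_pullback Y \<tau> S) D\<^sub>2"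
      unfolding D2 using structure_iso_inverse[OF iso2] Ext.S.acts(1) by (simp only: pullback_simps)
    note F3 = structure_isoD[OF iso3, unfolded pullback_simps R_simps(2,3)]
    have covD2: "cov S (D\<^sub>2 q) = d\<tau> (cov E q)" if q: "q \<in> topspace (total ?R)" for q
    proof -
      note c = covS[OF F3(3)[OF q]]
      have "d\<tau> (cov S (D\<^sub>2 q)) = cov E q" using F3(4)[OF q] pullback_cov[OF c] by simp
      then show ?thesis using dtau_dtau[OF c] by metis
    qed
    have \<iota>c: "continuous_map (total S) (total E) \<iota>"
      using homeomorphic_imp_continuous_map[OF Ext.homeomorphic_iota] unfolding EE \<iota>_def continuous_map_in_subtopology by blast
    have c1: "continuous_map (total ?R) (total E) D" unfolding R_simps by (rule continuous_map_from_subtopology[OF Dc])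
    have c2: "continuous_map (total ?R) (total E) (\<iota> \<circ> D\<^sub>2)" by (rule continuous_map_compose[OF F3(2) \<iota>c])
    have RE: "q \<in> topspace (total E)" if "q \<in> topspace (total ?R)" for q using that topR by simp
    have \<iota>S: "\<iota> (act S p t) = act E (\<iota> p) t" if "p \<in> ?P" "t \<in> Spin \<kappa>" for p t
      using Ext.ext_class_act[OF that, of cl_one] \<iota>act[OF that(1) Pin.one Spin_Pin[OF that(2)]] by (simp add: \<iota>_def cl_mult_one)
    have \<iota>E: "\<iota> p \<in> topspace (total E)" "cov E (\<iota> p) = cov S p" if "p \<in> ?P" for p
      using \<iota>in[OF that Pin.one] \<iota>cov[OF that Pin.one] by (simp_all add: \<iota>_def pin_proj_one frame_mult_one)
    have "(\<forall>q \<in> topspace (total ?R). D q = (\<iota> \<circ> D\<^sub>2) q) \<or> (\<forall>q \<in> topspace (total ?R). D q \<noteq> (\<iota> \<circ> D\<^sub>2) q)"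
    proof (rule R.equivariant_lifts_agree[OF connected E.two_cov c1 c2])
      fix q assume q: "q \<in> topspace (total ?R)"
      note d = F3(3)[OF q]
      show "cov E (D q) = cov E ((\<iota> \<circ> D\<^sub>2) q)" using covD[OF RE[OF q]] covD2[OF q] \<iota>E(2)[OF d] by simp
      fix t :: "'m cliff" assume "t \<in> topspace (cl_top (Spin \<kappa>))"
      then have t: "t \<in> Spin \<kappa>" by (simp add: topspace_cl_top)
      have 1: "D (act E q t) = act E (D q) t" by (rule D_act[OF RE[OF q] Spin_Pin[OF t]])
      have 2: "(\<iota> \<circ> D\<^sub>2) (act E q t) = act E ((\<iota> \<circ> D\<^sub>2) q) t" using F3(5)[OF q t] \<iota>S[OF d t] by simp
      have "act E (D q) t = act E ((\<iota> \<circ> D\<^sub>2) q) t \<longleftrightarrow> D q = (\<iota> \<circ> D\<^sub>2) q"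
        using E.acts(4)[OF D_in[OF RE[OF q]] Spin_Pin[OF t]] E.acts(4)[OF \<iota>E(1)[OF d] Spin_Pin[OF t]] by (metis comp_apply)
      then show "D (act ?R q t) = (\<iota> \<circ> D\<^sub>2) (act ?R q t) \<longleftrightarrow> D q = (\<iota> \<circ> D\<^sub>2) q"
        unfolding R_simps(2) 1 2 .
    qed
    \<comment> \<open>The point [p, t] lies over \<open>u'\<close> because \<open>t\<close> is odd,
      and the hypothesis says that the two lifts agree there.\<close>
    moreover have "\<exists>q \<in> topspace (total ?R). D q = (\<iota> \<circ> D\<^sub>2) q"
    proof -
      obtain p t where pt: "p \<in> ?P" "t \<in> Pin \<kappa>" "t \<notin> Spin \<kappa>" "\<iota> (D\<^sub>2 (act E (\<iota> p) t)) = act E (D\<^sub>1 p) t" using ex by blast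
      let ?q = "act E (\<iota> p) t"
      have q: "?q = ext_class \<kappa> S p t" using \<iota>act[OF pt(1) Pin.one pt(2)] by (simp add: \<iota>_def cl_mult_one)
      have qE: "?q \<in> topspace (total E)" using \<iota>in[OF pt(1,2)] q by simp
      have "cov E ?q \<notin> u" using Ext.cov_E_u[OF pt(1,2)] pt(3) unfolding EE q by simp
      then have "?q \<in> topspace (total ?R)" using topR qE Y.opposite_orthonormal_iff[OF covE[OF qE], of u] u' by simp
      moreover have "D ?q = (\<iota> \<circ> D\<^sub>2) ?q" using D_act[OF \<iota>E(1)[OF pt(1)] pt(2)] D\<iota>[OF pt(1)] pt(4) by simp
      ultimately show ?thesis by blast
    qed
    ultimately have ag: "D q = \<iota> (D\<^sub>2 q)" if "q \<in> topspace (total ?R)" for q using that by auto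
    \<comment> \<open>Over \<open>u\<close> the map is \<open>D\<^sub>1\<close>, and over
      \<open>u'\<close> it is \<open>D\<^sub>2\<close> followed by \<open>\<iota>\<close>; so each
      case is one of the two assumed identities between \<open>D\<^sub>1\<close> and
      \<open>D\<^sub>2\<close>.\<close>
    have DD: "D (D q) = q" if q: "q \<in> topspace (total E)" for q
    proof (cases "cov E q \<in> u'")
      case True
      then have qR: "q \<in> topspace (total ?R)" using q topR by simp
      show ?thesis using ag[OF qR] D\<iota>[OF F3(3)[OF qR]] inv2 qR by simp
    next
      case False
      then have "cov E q \<in> u" using Y.opposite_orthonormal_iff[OF covE[OF q], of u] u' by simp
      then have "q \<in> topspace (subtopology (total E) {C \<in> topspace (total E). cov E C \<in> orthonormal_frames Y \<inter> u})"
        using q covE[OF q] by simp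
      then obtain p where p: "p \<in> ?P" "q = \<iota> p"
        using homeomorphic_imp_surjective_map[OF Ext.homeomorphic_iota] unfolding EE \<iota>_def by blast
      show ?thesis using D\<iota>[OF p(1)] ag[OF D1R[OF p(1)]] inv1 p by simp
    qed
    interpret I: involution X Y \<pi> \<tau> \<kappa> E D by unfold_locales (rule eqD, rule DD)
    show ?thesis using ag DD I.pin_structure_Q I.pin_equivalent_pullback by blast
  qed
  show ?thesis using eqD D\<iota> step by (intro exI[of _ D]) blast
qed

end

section \<open>Pinors as equivariant functions\<close>

lemma ck_on_cong:
  assumes "open S" "\<And>x. x \<in> S \<Longrightarrow> f x = g x" "ck_on k S f"
  shows "ck_on k S g"
  using assms(2,3)
proof (induction k arbitrary: f g)
  case 0
  then show ?case using continuous_on_cong[of S S f g] by simp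
next
  case (Suc k)
  have d: "(g has_derivative frechet_derivative f (at x)) (at x)" if x: "x \<in> S" for x
  proof (rule has_derivative_transform_within_open[OF _ assms(1) x])
    show "(f has_derivative frechet_derivative f (at x)) (at x)"
      using Suc.prems(2) x by (simp add: frechet_derivative_works)
  qed (rule Suc.prems(1))
  have e: "frechet_derivative f (at x) v = frechet_derivative g (at x) v" if "x \<in> S" for x v
    using frechet_derivative_at[OF d[OF that]] by simp
  have "g differentiable (at x)" if "x \<in> S" for x using d[OF that] by (rule differentiableI)
  moreover have "ck_on k S (\<lambda>x. frechet_derivative g (at x) v)" for v
    by (rule Suc.IH[of "\<lambda>x. frechet_derivative f (at x) v"]) (use e Suc.prems(2) in auto)
  ultimately show ?case by simp
qed

lemma ck_on_subset: "T \<subseteq> S \<Longrightarrow> ck_on k S f \<Longrightarrow> ck_on k T f"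
proof (induction k arbitrary: f)
  case 0
  then show ?case using continuous_on_subset by auto
qed auto

lemma ck_on_Un: "open S \<Longrightarrow> open T \<Longrightarrow> ck_on k S f \<Longrightarrow> ck_on k T f \<Longrightarrow> ck_on k (S \<union> T) f"
proof (induction k arbitrary: f)
  case 0
  then show ?case using continuous_on_open_Un by auto
qed auto

text \<open>Covers the operations applied below to smooth functions apart from sums: right
  multiplication of frame matrices by a constant matrix, the action of a fixed element of Pin on
  spinors, and the chirality projections.\<close>

lemma ck_on_linear:
  fixes L :: "'b::euclidean_space \<Rightarrow> 'c::real_normed_vector"
  assumes "open S" "linear L" "ck_on k S f"
  shows "ck_on k S (\<lambda>x. L (f x))"
  using assms(3)
proof (induction k arbitrary: f)
  case 0
  then show ?case using bounded_linear.continuous_on[of L S f] assms(2) by (simp add: linear_conv_bounded_linear)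
next
  case (Suc k)
  have bl: "bounded_linear L" using assms(2) by (simp add: linear_conv_bounded_linear)
  have d: "((\<lambda>x. L (f x)) has_derivative (\<lambda>v. L (frechet_derivative f (at x) v))) (at x)" if x: "x \<in> S" for x
    by (rule bounded_linear.has_derivative[OF bl]) (use Suc.prems x in \<open>simp add: frechet_derivative_works\<close>)
  have e: "frechet_derivative (\<lambda>x. L (f x)) (at x) v = L (frechet_derivative f (at x) v)" if "x \<in> S" for x v
    using frechet_derivative_at[OF d[OF that]] by metis
  have "(\<lambda>x. L (f x)) differentiable (at x)" if "x \<in> S" for x using d[OF that] by (rule differentiableI)
  moreover have "ck_on k S (\<lambda>x. frechet_derivative (\<lambda>x. L (f x)) (at x) v)" for v
    by (rule ck_on_cong[OF assms(1) e[symmetric] Suc.IH]) (use Suc.prems in auto)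
  ultimately show ?case by simp
qed

lemma ck_on_add:
  assumes "open S" "ck_on k S f" "ck_on k S g"
  shows "ck_on k S (\<lambda>x. f x + g x)"
  using assms(2,3)
proof (induction k arbitrary: f g)
  case 0
  then show ?case using continuous_on_add by auto
next
  case (Suc k)
  have d: "((\<lambda>x. f x + g x) has_derivative (\<lambda>v. frechet_derivative f (at x) v + frechet_derivative g (at x) v)) (at x)"
    if x: "x \<in> S" for x
    using Suc.prems x by (intro has_derivative_add) (simp_all add: frechet_derivative_works)
  have e: "frechet_derivative (\<lambda>x. f x + g x) (at x) v = frechet_derivative f (at x) v + frechet_derivative g (at x) v" if "x \<in> S" for x v
    using frechet_derivative_at[OF d[OF that]] by metis
  have "(\<lambda>x. f x + g x) differentiable (at x)" if "x \<in> S" for x using d[OF that] by (rule differentiableI)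
  moreover have "ck_on k S (\<lambda>x. frechet_derivative (\<lambda>x. f x + g x) (at x) v)" for v
    by (rule ck_on_cong[OF assms(1) e[symmetric] Suc.IH]) (use Suc.prems in auto)
  ultimately show ?case by simp
qed

context manifold
begin

lemma smooth_fun_on_open: "openin (mtop M) U \<Longrightarrow> c \<in> atlas M \<Longrightarrow> open (snd c ` (U \<inter> fst c))"
  using chart_open[of c U] by (simp add: Int_commute)

lemma smooth_fun_on_cong:
  assumes "openin (mtop M) U" "\<And>x. x \<in> U \<Longrightarrow> f x = g x" "smooth_fun_on M U f"
  shows "smooth_fun_on M U g"
  unfolding smooth_fun_on_def smooth_on_def
proof (intro ballI allI)
  fix c k assume c: "c \<in> atlas M"
  show "ck_on k (snd c ` (U \<inter> fst c)) (g \<circ> inv_chart c)"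
  proof (rule ck_on_cong[OF smooth_fun_on_open[OF assms(1) c]])
    show "ck_on k (snd c ` (U \<inter> fst c)) (f \<circ> inv_chart c)"
      using assms(3) c unfolding smooth_fun_on_def smooth_on_def by blast
    fix y assume "y \<in> snd c ` (U \<inter> fst c)"
    then show "(f \<circ> inv_chart c) y = (g \<circ> inv_chart c) y" using inv_chart[OF c] assms(2) by auto
  qed
qed

lemma smooth_fun_on_subset: "U' \<subseteq> U \<Longrightarrow> smooth_fun_on M U f \<Longrightarrow> smooth_fun_on M U' f"
  unfolding smooth_fun_on_def smooth_on_def by (meson ck_on_subset image_mono Int_mono order_refl)

lemma smooth_fun_on_Un:
  assumes "openin (mtop M) U" "openin (mtop M) V" "smooth_fun_on M U f" "smooth_fun_on M V f"
  shows "smooth_fun_on M (U \<union> V) f"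
  using assms(3,4) unfolding smooth_fun_on_def smooth_on_def Int_Un_distrib2 image_Un
  by (intro ballI allI ck_on_Un smooth_fun_on_open assms(1,2)) auto

lemma smooth_fun_on_linear:
  fixes L :: "'b::euclidean_space \<Rightarrow> 'c::real_normed_vector"
  assumes "openin (mtop M) U" "linear L" "smooth_fun_on M U f"
  shows "smooth_fun_on M U (\<lambda>x. L (f x))"
  using assms ck_on_linear[OF smooth_fun_on_open assms(2)]
  unfolding smooth_fun_on_def smooth_on_def comp_def by blast

lemma smooth_fun_on_add:
  assumes "openin (mtop M) U" "smooth_fun_on M U f" "smooth_fun_on M U g"
  shows "smooth_fun_on M U (\<lambda>x. f x + g x)"
  using assms ck_on_add[OF smooth_fun_on_open]
  unfolding smooth_fun_on_def smooth_on_def comp_def by blast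

end

text \<open>The usual condition \<phi>(p t) = \<rho>(t)^{-1} \<phi>(p), written without
  inverses.\<close>

definition equivariant :: "'m::{finite,linorder} cliff set \<Rightarrow> ('m cliff \<Rightarrow> complex^'k::finite^'k) \<Rightarrow>
     ('p, 'a, 'm) frame_structure \<Rightarrow> ('p \<Rightarrow> complex^'k) \<Rightarrow> bool" where
  "equivariant G \<rho> S \<phi> \<longleftrightarrow> (\<forall>p \<in> topspace (total S). \<forall>t \<in> G. \<rho> t *v \<phi> (act S p t) = \<phi> p)"

text \<open>An element of an associated bundle is encoded as a set of pairs (p, z); the value at
  \<open>x\<close> of the section belonging to \<phi> is therefore the graph of \<phi> over the
  fibre of \<open>x\<close>.\<close>

definition fibre_graph :: "('p, 'a, 'm::finite) frame_structure \<Rightarrow> ('p \<Rightarrow> complex^'k::finite) \<Rightarrow> 'a \<Rightarrow> ('p, 'k) spinor" where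
  "fibre_graph S \<phi> x = {(p, z). p \<in> topspace (total S) \<and> fst (cov S p) = x \<and> z = \<phi> p}"

definition smooth_along :: "('a, 'm::finite, 'z) mfd_scheme \<Rightarrow> ('p, 'a, 'm) frame_structure \<Rightarrow> ('p \<Rightarrow> 'v::real_normed_vector) \<Rightarrow> bool" where
  "smooth_along M S \<phi> \<longleftrightarrow> (\<forall>U \<sigma>. smooth_local_section M S U \<sigma> \<longrightarrow> smooth_fun_on M U (\<lambda>x. \<phi> (\<sigma> x)))"

lemma smooth_local_sectionD:
  assumes "smooth_local_section M S U \<sigma>"
  shows "openin (mtop M) U" "continuous_map (subtopology (mtop M) U) (total S) \<sigma>" "x \<in> U \<Longrightarrow> fst (cov S (\<sigma> x)) = x"
    "c \<in> atlas M \<Longrightarrow> smooth_fun_on M (U \<inter> fst c) (\<lambda>x. frame_matrix c (cov S (\<sigma> x)))"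
    "x \<in> U \<Longrightarrow> \<sigma> x \<in> topspace (total S)"
proof -
  show o: "openin (mtop M) U" and c: "continuous_map (subtopology (mtop M) U) (total S) \<sigma>"
    using assms by (simp_all add: smooth_local_section_def)
  show "x \<in> U \<Longrightarrow> \<sigma> x \<in> topspace (total S)"
    using continuous_map_image_subset_topspace[OF c] openin_subset[OF o] by auto
qed (use assms in \<open>simp_all add: smooth_local_section_def\<close>)

context spinor_module
begin

text \<open>The class consists of the pairs (p t, \<rho>(t)^{-1} \<phi>(p)). By equivariance they
  lie on the graph, and by transitivity on fibres they exhaust it.\<close>

lemma assoc_class_graph:
  fixes M :: "('a, 'm, 'z) mfd_scheme" and S :: "('p, 'a, 'm) frame_structure"
  assumes L: "lifted \<kappa> G M F S" and \<phi>: "equivariant G \<rho> S \<phi>" and p: "p \<in> topspace (total S)"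
  shows "assoc_class G \<rho> S p (\<phi> p) = fibre_graph S \<phi> (fst (cov S p))"
proof (intro set_eqI iffI)
  interpret S: lifted \<kappa> G M F S by fact
  fix z assume "z \<in> assoc_class G \<rho> S p (\<phi> p)"
  then obtain t where t: "t \<in> G" "fst z = act S p t" "\<rho> t *v snd z = \<phi> p" by (auto simp: assoc_class_def)
  have "\<rho> t *v \<phi> (act S p t) = \<rho> t *v snd z" using \<phi> p t by (simp add: equivariant_def)
  then have "\<phi> (act S p t) = snd z" using rep_inv(1)[OF S.G_Pin[OF t(1)]] by metis
  then show "z \<in> fibre_graph S \<phi> (fst (cov S p))"
    using S.acts(1)[OF p t(1)] S.cov_act[OF p t(1)] t(2) by (auto simp: fibre_graph_def frame_mult_simps prod_eq_iff)
next
  interpret S: lifted \<kappa> G M F S by fact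
  fix z assume "z \<in> fibre_graph S \<phi> (fst (cov S p))"
  then have z: "fst z \<in> topspace (total S)" "fst (cov S (fst z)) = fst (cov S p)" "snd z = \<phi> (fst z)" by (auto simp: fibre_graph_def)
  obtain t where t: "t \<in> G" "fst z = act S p t" using S.transitive[OF p z(1)] z(2) by (auto simp: topspace_cl_top)
  have "\<rho> t *v snd z = \<phi> p" using \<phi> p t z(3) by (simp add: equivariant_def)
  then show "z \<in> assoc_class G \<rho> S p (\<phi> p)" using t by (auto simp: assoc_class_def)
qed

text \<open>The classical correspondence between sections of an associated bundle and equivariant
  functions. The value \<phi>(q) is the entry paired with q in the section, unique because the
  action is free. Smoothness carries over because both sides are tested on the same expression along
  local sections.\<close>

lemma spinor_sections_iff:
  fixes M :: "('a, 'm, 'z) mfd_scheme" and S :: "('p, 'a, 'm) frame_structure"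
  assumes M: "manifold M" and L: "lifted \<kappa> G M F S" and V: "\<And>t z. t \<in> G \<Longrightarrow> z \<in> V \<Longrightarrow> \<rho> t *v z \<in> V"
  shows "s \<in> spinor_sections M G \<rho> S V \<longleftrightarrow>
    (\<exists>\<phi>. equivariant G \<rho> S \<phi> \<and> (\<forall>p \<in> topspace (total S). \<phi> p \<in> V) \<and> smooth_along M S \<phi> \<and>
       s = restrict (fibre_graph S \<phi>) (topspace (mtop M)))"
proof -
  interpret M: manifold M by fact
  interpret S: lifted \<kappa> G M F S by fact
  let ?P = "topspace (total S)"
  note graph = assoc_class_graph[OF L]
  have the: "(THE z. (\<sigma> x, z) \<in> restrict (fibre_graph S \<phi>) (topspace (mtop M)) x) = \<phi> (\<sigma> x)"
    if "smooth_local_section M S U \<sigma>" "x \<in> U" for \<phi> U \<sigma> x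
    proof -
    have "x \<in> topspace (mtop M)" using openin_subset[OF smooth_local_sectionD(1)[OF that(1)]] that(2) by blast
    then show ?thesis using smooth_local_sectionD(3,5)[OF that] by (simp add: fibre_graph_def)
  qed
  show ?thesis
  proof
    assume s: "s \<in> spinor_sections M G \<rho> S V"
    define \<phi> where "\<phi> q = (THE w. (q, w) \<in> s (fst (cov S q)))" for q
    \<comment> \<open>The class at the base point of \<open>q\<close> may be presented at another
      point \<open>p\<close> of the fibre; the element \<open>t\<close> that moves \<open>p\<close>
      to \<open>q\<close> then expresses the value at \<open>q\<close>.\<close>
    have rep: "\<exists>p z t. p \<in> ?P \<and> z \<in> V \<and> t \<in> G \<and> q = act S p t \<and> s (fst (cov S q)) = assoc_class G \<rho> S p z \<and> \<phi> q = \<rho> (pin_inv t) *v z"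
      if q: "q \<in> ?P" for q
    proof -
      have "fst (cov S q) \<in> topspace (mtop M)" using S.pr_in[OF q] by simp
      then have "s (fst (cov S q)) \<in> assoc_fibre G \<rho> S V (fst (cov S q))" using s by (simp add: spinor_sections_def)
      then obtain p z where pz: "s (fst (cov S q)) = assoc_class G \<rho> S p z" "p \<in> ?P" "fst (cov S p) = fst (cov S q)" "z \<in> V"
        unfolding assoc_fibre_def by blast
      obtain t where t: "t \<in> G" "q = act S p t" using S.transitive[OF pz(2) q] pz(3) by (auto simp: topspace_cl_top)
      have tP: "t \<in> Pin \<kappa>" by (rule S.G_Pin[OF t(1)])
      have "\<phi> q = \<rho> (pin_inv t) *v z"
        unfolding \<phi>_def pz(1)
      proof (rule the_equality)
        show "(q, \<rho> (pin_inv t) *v z) \<in> assoc_class G \<rho> S p z"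
          unfolding assoc_class_def using t rep_inv(2)[OF tP] by auto
        fix w assume "(q, w) \<in> assoc_class G \<rho> S p z"
        then obtain t' where t': "t' \<in> G" "act S p t' = act S p t" "\<rho> t' *v w = z" using t(2) by (auto simp: assoc_class_def)
        then have "t' = t" using S.act_cancel[OF pz(2)] t(1) by (simp add: topspace_cl_top)
        then show "w = \<rho> (pin_inv t) *v z" using t'(3) rep_inv(1)[OF tP] by metis
      qed
      then show ?thesis using pz t by blast
    qed
    have eq: "equivariant G \<rho> S \<phi>"
      unfolding equivariant_def
    proof (intro ballI)
      fix q r assume q: "q \<in> ?P" and r: "r \<in> G"
      obtain p z t where 1: "p \<in> ?P" "z \<in> V" "t \<in> G" "q = act S p t" "s (fst (cov S q)) = assoc_class G \<rho> S p z" "\<phi> q = \<rho> (pin_inv t) *v z"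
        using rep[OF q] by blast
      have qr: "act S q r \<in> ?P" by (rule S.acts(1)[OF q r])
      have b: "fst (cov S (act S q r)) = fst (cov S q)" using S.cov_act[OF q r] by (simp add: frame_mult_simps)
      have tr: "cl_mult \<kappa> t r \<in> G" by (rule S.acts(6)[OF 1(3) r])
      have trP: "cl_mult \<kappa> t r \<in> Pin \<kappa>" by (rule S.G_Pin[OF tr])
      have qe: "act S q r = act S p (cl_mult \<kappa> t r)" using S.acts(2)[OF 1(1,3) r] 1(4) by simp
      have "\<phi> (act S q r) = \<rho> (pin_inv (cl_mult \<kappa> t r)) *v z"
        unfolding \<phi>_def b 1(5)
      proof (rule the_equality)
        show "(act S q r, \<rho> (pin_inv (cl_mult \<kappa> t r)) *v z) \<in> assoc_class G \<rho> S p z"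
          unfolding assoc_class_def using tr qe rep_inv(2)[OF trP] by auto
        fix w assume "(act S q r, w) \<in> assoc_class G \<rho> S p z"
        then obtain t' where t': "t' \<in> G" "act S p t' = act S p (cl_mult \<kappa> t r)" "\<rho> t' *v w = z" using qe by (auto simp: assoc_class_def)
        then have "t' = cl_mult \<kappa> t r" using S.act_cancel[OF 1(1)] tr by (simp add: topspace_cl_top)
        then show "w = \<rho> (pin_inv (cl_mult \<kappa> t r)) *v z" using t'(3) rep_inv(1)[OF trP] by metis
      qed
      then have "\<rho> (cl_mult \<kappa> t r) *v \<phi> (act S q r) = z" using rep_inv(2)[OF trP] by simp
      then have "\<rho> t *v (\<rho> r *v \<phi> (act S q r)) = z" by (simp add: rep_mult matrix_vector_mul_assoc)
      then show "\<rho> r *v \<phi> (act S q r) = \<phi> q" using 1(6) rep_inv(1)[OF S.G_Pin[OF 1(3)]] by metis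
    qed
    have val: "\<phi> q \<in> V" if q: "q \<in> ?P" for q
    proof -
      obtain p z t where 1: "z \<in> V" "t \<in> G" "\<phi> q = \<rho> (pin_inv t) *v z" using rep[OF q] by blast
      have "pin_inv t \<in> G" using S.inv_in 1(2) by (simp add: topspace_cl_top)
      then show ?thesis using V 1 by simp
    qed
    have sx: "s x = fibre_graph S \<phi> x" if x: "x \<in> topspace (mtop M)" for x
    proof -
      obtain q where q: "q \<in> ?P" "fst (cov S q) = x" using S.fibre_ex[OF x] by auto
      obtain p z t where 1: "p \<in> ?P" "z \<in> V" "t \<in> G" "q = act S p t" "s x = assoc_class G \<rho> S p z" "\<phi> q = \<rho> (pin_inv t) *v z"
        using rep[OF q(1)] q(2) by blast
      have "\<phi> p = \<rho> t *v \<phi> q" using eq 1(1,3,4) by (simp add: equivariant_def)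
      then have "\<phi> p = z" using 1(6) rep_inv(2)[OF S.G_Pin[OF 1(3)]] by simp
      moreover have "fst (cov S p) = x" using q(2) 1(4) S.cov_act[OF 1(1,3)] by (simp add: frame_mult_simps)
      ultimately show ?thesis using graph[OF eq 1(1)] 1(5) by simp
    qed
    have ss: "s = restrict (fibre_graph S \<phi>) (topspace (mtop M))"
    proof
      fix x show "s x = restrict (fibre_graph S \<phi>) (topspace (mtop M)) x"
        using sx s by (cases "x \<in> topspace (mtop M)") (auto simp: spinor_sections_def extensional_def)
    qed
    have "smooth_along M S \<phi>"
      unfolding smooth_along_def
    proof (intro allI impI)
      fix U \<sigma> assume \<sigma>: "smooth_local_section M S U \<sigma>"
      have "smooth_fun_on M U (\<lambda>x. THE z. (\<sigma> x, z) \<in> s x)" using s \<sigma> by (simp add: spinor_sections_def)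
      then show "smooth_fun_on M U (\<lambda>x. \<phi> (\<sigma> x))"
        by (rule M.smooth_fun_on_cong[OF smooth_local_sectionD(1)[OF \<sigma>], rotated]) (simp only: ss the[OF \<sigma>])
    qed
    then show "\<exists>\<phi>. equivariant G \<rho> S \<phi> \<and> (\<forall>p \<in> ?P. \<phi> p \<in> V) \<and> smooth_along M S \<phi> \<and>
       s = restrict (fibre_graph S \<phi>) (topspace (mtop M))" using eq val ss by blast
  next
    assume "\<exists>\<phi>. equivariant G \<rho> S \<phi> \<and> (\<forall>p \<in> ?P. \<phi> p \<in> V) \<and> smooth_along M S \<phi> \<and>
       s = restrict (fibre_graph S \<phi>) (topspace (mtop M))"
    then obtain \<phi> where \<phi>: "equivariant G \<rho> S \<phi>" "\<forall>p \<in> ?P. \<phi> p \<in> V" "smooth_along M S \<phi>" and s: "s = restrict (fibre_graph S \<phi>) (topspace (mtop M))" by blast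
    show "s \<in> spinor_sections M G \<rho> S V"
      unfolding spinor_sections_def
    proof (intro CollectI conjI ballI allI impI)
      show "s \<in> extensional (topspace (mtop M))" unfolding s by (rule restrict_extensional)
      fix x assume x: "x \<in> topspace (mtop M)"
      obtain p where p: "p \<in> ?P" "fst (cov S p) = x" using S.fibre_ex[OF x] by auto
      have "s x = assoc_class G \<rho> S p (\<phi> p)" using graph[OF \<phi>(1) p(1)] p(2) x s by simp
      then show "s x \<in> assoc_fibre G \<rho> S V x" unfolding assoc_fibre_def using p \<phi>(2) by blast
    next
      fix U \<sigma> assume \<sigma>: "smooth_local_section M S U \<sigma>"
      then have "smooth_fun_on M U (\<lambda>x. \<phi> (\<sigma> x))" using \<phi>(3) by (simp add: smooth_along_def)
      then show "smooth_fun_on M U (\<lambda>x. THE z. (\<sigma> x, z) \<in> s x)"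
        by (rule M.smooth_fun_on_cong[OF smooth_local_sectionD(1)[OF \<sigma>], rotated]) (simp only: s the[OF \<sigma>])
    qed
  qed
qed

lemma chiral_space_iff: "z \<in> chiral_space \<rho> \<epsilon> \<longleftrightarrow> chirality \<rho> z = \<epsilon> *\<^sub>R z"
  by (simp add: chiral_space_def)

lemma chiral_space_Pin:
  assumes "t \<in> Pin \<kappa>" "z \<in> chiral_space \<rho> \<epsilon>"
  shows "\<rho> t *v z \<in> chiral_space \<rho> (if t \<in> Spin \<kappa> then \<epsilon> else - \<epsilon>)"
proof -
  have s: "A *v (c *\<^sub>R z) = c *\<^sub>R (A *v z)" for A :: "complex^'k^'k" and c z
    by (simp add: vec_eq_iff matrix_vector_mult_def scaleR_sum_right)
  show ?thesis using assms by (simp add: chiral_space_iff chirality_Pin s)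
qed

lemma chiral_proj_in: "\<epsilon> = 1 \<or> \<epsilon> = - 1 \<Longrightarrow> chiral_proj \<rho> \<epsilon> z \<in> chiral_space \<rho> \<epsilon>"
  by (auto simp: chiral_space_iff chiral_proj_def chirality_linear chirality_chirality algebra_simps)

lemma chiral_proj_linear:
  "chiral_proj \<rho> \<epsilon> (z + w) = chiral_proj \<rho> \<epsilon> z + chiral_proj \<rho> \<epsilon> w" "chiral_proj \<rho> \<epsilon> (c *\<^sub>R z) = c *\<^sub>R chiral_proj \<rho> \<epsilon> z"
  by (simp_all add: chiral_proj_def chirality_linear algebra_simps)

lemma chiral_proj_sum: "chiral_proj \<rho> 1 z + chiral_proj \<rho> (- 1) z = z"
  by (simp add: chiral_proj_def algebra_simps flip: scaleR_add_left)

lemma chiral_proj_space: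
  "z \<in> chiral_space \<rho> \<epsilon> \<Longrightarrow> \<epsilon> = 1 \<or> \<epsilon> = - 1 \<Longrightarrow> chiral_proj \<rho> \<epsilon> z = z"
  "z \<in> chiral_space \<rho> (- \<epsilon>) \<Longrightarrow> \<epsilon> = 1 \<or> \<epsilon> = - 1 \<Longrightarrow> chiral_proj \<rho> \<epsilon> z = 0"
  by (auto simp: chiral_space_iff chiral_proj_def simp flip: scaleR_add_left)

lemma chiral_proj_Pin:
  assumes "t \<in> Pin \<kappa>"
  shows "\<rho> t *v chiral_proj \<rho> (if t \<in> Spin \<kappa> then \<epsilon> else - \<epsilon>) z = chiral_proj \<rho> \<epsilon> (\<rho> t *v z)"
proof -
  have s: "A *v (c *\<^sub>R z) = c *\<^sub>R (A *v z)" for A :: "complex^'k^'k" and c z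
    by (simp add: vec_eq_iff matrix_vector_mult_def scaleR_sum_right)
  show ?thesis by (simp add: chiral_proj_def s matrix_vector_right_distrib chirality_Pin[OF assms])
qed

lemma rep_minus_vec: "\<rho> (- cl_one) *v z = - z"
  by (simp add: rep_minus rep_one matrix_vector_mult_def vec_eq_iff mat_def sum_negf if_distrib if_distribR cong: if_cong)

end

lemma smooth_local_section_subset:
  assumes M: "manifold M" and s: "smooth_local_section M S U \<sigma>" and W: "openin (mtop M) W" "W \<subseteq> U"
  shows "smooth_local_section M S W \<sigma>"
  unfolding smooth_local_section_def
proof (intro conjI ballI W(1))
  note h = smooth_local_sectionD[OF s]
  interpret manifold M by fact
  show "continuous_map (subtopology (mtop M) W) (total S) \<sigma>"
    by (rule continuous_map_from_subtopology_mono[OF h(2) W(2)])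
  show "fst (cov S (\<sigma> x)) = x" if "x \<in> W" for x using h(3) W(2) that by blast
  show "smooth_fun_on M (W \<inter> fst c) (\<lambda>x. frame_matrix c (cov S (\<sigma> x)))" if c: "c \<in> atlas M" for c
    by (rule smooth_fun_on_subset[OF _ h(4)[OF c]]) (use W(2) in blast)
qed

text \<open>The frame matrix along the section is multiplied on the right by the constant
  \<open>A\<close>, a linear operation, and so stays smooth.\<close>

lemma smooth_local_section_map:
  assumes M: "manifold M" and s: "smooth_local_section M S U \<sigma>"
    and c: "continuous_map (subtopology (mtop M) U) (total S') (\<lambda>x. f (\<sigma> x))"
    and A: "\<And>x. x \<in> U \<Longrightarrow> cov S' (f (\<sigma> x)) = frame_mult (cov S (\<sigma> x)) A"
  shows "smooth_local_section M S' U (\<lambda>x. f (\<sigma> x))"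
  unfolding smooth_local_section_def
proof (intro conjI ballI c)
  note h = smooth_local_sectionD[OF s]
  interpret manifold M by fact
  show U: "openin (mtop M) U" by (rule h(1))
  show "fst (cov S' (f (\<sigma> x))) = x" if "x \<in> U" for x using h(3)[OF that] A[OF that] by (simp add: frame_mult_simps)
  fix c assume c: "c \<in> atlas M"
  have o: "openin (mtop M) (U \<inter> fst c)" using U chart_openin[OF c] by blast
  have "linear (\<lambda>B. B ** A)" by (rule linearI) (simp_all add: vec_eq_iff matrix_matrix_mult_def algebra_simps sum.distrib sum_distrib_left)
  from smooth_fun_on_linear[OF o this h(4)[OF c]]
  have "smooth_fun_on M (U \<inter> fst c) (\<lambda>x. frame_matrix c (cov S (\<sigma> x)) ** A)" .
  then show "smooth_fun_on M (U \<inter> fst c) (\<lambda>x. frame_matrix c (cov S' (f (\<sigma> x))))"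
    by (rule smooth_fun_on_cong[OF o, rotated]) (simp add: A frame_matrix_mult)
qed

lemma smooth_along_map:
  assumes M: "manifold M" and f: "continuous_map (total S) (total S') f"
    and cov: "\<And>p. p \<in> topspace (total S) \<Longrightarrow> cov S' (f p) = cov S p" and \<phi>: "smooth_along M S' \<phi>"
  shows "smooth_along M S (\<phi> \<circ> f)"
  unfolding smooth_along_def
proof (intro allI impI)
  fix U \<sigma> assume s: "smooth_local_section M S U \<sigma>"
  note h = smooth_local_sectionD[OF s]
  have "smooth_local_section M S' U (\<lambda>x. f (\<sigma> x))"
  proof (rule smooth_local_section_map[OF M s])
    show "continuous_map (subtopology (mtop M) U) (total S') (\<lambda>x. f (\<sigma> x))"
      using continuous_map_compose[OF h(2) f] by (simp add: comp_def)
    show "cov S' (f (\<sigma> x)) = frame_mult (cov S (\<sigma> x)) (mat 1)" if "x \<in> U" for x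
      using cov[OF h(5)[OF that]] by (simp add: frame_mult_one)
  qed
  then show "smooth_fun_on M U (\<lambda>x. (\<phi> \<circ> f) (\<sigma> x))" using \<phi> by (simp add: smooth_along_def)
qed

lemma smooth_along_add:
  assumes M: "manifold M" and "smooth_along M S \<phi>" "smooth_along M S \<psi>"
  shows "smooth_along M S (\<lambda>p. \<phi> p + \<psi> p)"
  unfolding smooth_along_def
proof (intro allI impI)
  interpret manifold M by fact
  fix U \<sigma> assume s: "smooth_local_section M S U \<sigma>"
  show "smooth_fun_on M U (\<lambda>x. \<phi> (\<sigma> x) + \<psi> (\<sigma> x))"
    by (rule smooth_fun_on_add[OF smooth_local_sectionD(1)[OF s]]) (use assms s in \<open>auto simp: smooth_along_def\<close>)
qed

lemma topspace_orient_restrict: "topspace (total (orient_restrict u S)) = {p \<in> topspace (total S). cov S p \<in> u}"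
  and orient_restrict_simps: "act (orient_restrict u S) = act S" "cov (orient_restrict u S) = cov S"
    "total (orient_restrict u S) = subtopology (total S) {p \<in> topspace (total S). cov S p \<in> u}"
  by (auto simp: orient_restrict_def)

lemma fibre_graph_cong:
  "(\<And>p. p \<in> topspace (total S) \<Longrightarrow> fst (cov S p) = x \<Longrightarrow> \<phi> p = \<psi> p) \<Longrightarrow> fibre_graph S \<phi> x = fibre_graph S \<psi> x"
  by (auto simp: fibre_graph_def)

lemma fibre_graph_eqD:
  "fibre_graph S \<phi> (fst (cov S p)) = fibre_graph S \<psi> (fst (cov S p)) \<Longrightarrow> p \<in> topspace (total S) \<Longrightarrow> \<phi> p = \<psi> p"
proof -
  assume "fibre_graph S \<phi> (fst (cov S p)) = fibre_graph S \<psi> (fst (cov S p))" "p \<in> topspace (total S)"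
  moreover from this(2) have "(p, \<phi> p) \<in> fibre_graph S \<phi> (fst (cov S p))" by (simp add: fibre_graph_def)
  ultimately show ?thesis by (simp add: fibre_graph_def)
qed

lemma chiral_part_graph: "chiral_part \<rho> \<epsilon> (fibre_graph S \<phi> x) = fibre_graph S (\<lambda>p. chiral_proj \<rho> \<epsilon> (\<phi> p)) x"
  and scale_graph: "scale_spinor c (fibre_graph S \<phi> x) = fibre_graph S (\<lambda>p. c *\<^sub>R \<phi> p) x"
  and restrict_graph: "restrict_pinor u S (fibre_graph S \<phi> x) = fibre_graph (orient_restrict u S) \<phi> x"
  unfolding chiral_part_def scale_spinor_def restrict_pinor_def fibre_graph_def orient_restrict_simps topspace_orient_restrict
  by (auto simp: image_iff)

definition pinor_funs :: "real \<Rightarrow> ('a, 'm::{finite,linorder}, 'z) mfd_scheme \<Rightarrow> ('m cliff \<Rightarrow> complex^'k::finite^'k) \<Rightarrow>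
     ('p, 'a, 'm) frame_structure \<Rightarrow> ('p \<Rightarrow> complex^'k) set" where
  "pinor_funs \<kappa> M \<rho> S = {\<psi>. equivariant (Pin \<kappa>) \<rho> S \<psi> \<and> smooth_along M S \<psi>}"

text \<open>
  Chiral spinors of \<open>\<xi>\<^sub>u\<close> are regarded as pinors; over the frames outside \<open>u\<close> their chirality is
  reversed.
\<close>

definition chiral_funs :: "real \<Rightarrow> ('a, 'm::{finite,linorder}, 'z) mfd_scheme \<Rightarrow> ('m cliff \<Rightarrow> complex^'k::finite^'k) \<Rightarrow>
     ('p, 'a, 'm) frame_structure \<Rightarrow> ('a, 'm) frame set \<Rightarrow> real \<Rightarrow> ('p \<Rightarrow> complex^'k) set" where
  "chiral_funs \<kappa> M \<rho> S u \<epsilon> = {a \<in> pinor_funs \<kappa> M \<rho> S.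
     \<forall>p \<in> topspace (total S). a p \<in> chiral_space \<rho> (if cov S p \<in> u then \<epsilon> else - \<epsilon>)}"

text \<open>The sign is exchanged over frames outside \<open>u\<close> because odd elements of Pin
  reverse chirality; with this choice the component is equivariant under all of Pin and not only
  under Spin.\<close>

definition chiral_component :: "('m::{finite,linorder} cliff \<Rightarrow> complex^'k::finite^'k) \<Rightarrow>
     ('p, 'a, 'm) frame_structure \<Rightarrow> ('a, 'm) frame set \<Rightarrow> real \<Rightarrow> ('p \<Rightarrow> complex^'k) \<Rightarrow> 'p \<Rightarrow> complex^'k" where
  "chiral_component \<rho> S u \<epsilon> \<psi> p = chiral_proj \<rho> (if cov S p \<in> u then \<epsilon> else - \<epsilon>) (\<psi> p)"

locale pinor_bundle = spinor_module \<kappa> n \<rho> + PM: pin_setting \<kappa> M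
  for \<kappa> :: real and M :: "('a, 'm::{finite,linorder}, 'z) mfd_scheme" and n :: nat
    and \<rho> :: "'m cliff \<Rightarrow> complex^'k::finite^'k" +
  fixes S :: "('p, 'a, 'm) frame_structure" and u u' :: "('a, 'm) frame set"
  assumes pin: "pin_structure \<kappa> M S" and u: "orientation M u" and u': "u' = opposite_orientation M u"
begin

sublocale S: lifted \<kappa> "Pin \<kappa>" M "frame_bundle M" S
  using pin PM.pin_lifted by blast

text \<open>The setting is symmetric in the two orientations. Re-entering it with \<open>u\<close>
  and \<open>u'\<close> exchanged supplies the facts about the pulled-back member of a couple and
  the statements of (4).\<close>

lemma reverse: "pinor_bundle \<kappa> M n \<rho> S u' u"
  by unfold_locales (simp_all add: pin u' PM.orientation_opposite[OF u] PM.opposite_opposite[OF u])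

lemma cov_frames: "p \<in> topspace (total S) \<Longrightarrow> cov S p \<in> orthonormal_frames M"
  using S.cov_in PM.topspace_frame_bundle by blast

lemma cov_u': "p \<in> topspace (total S) \<Longrightarrow> cov S p \<in> u' \<longleftrightarrow> cov S p \<notin> u"
  by (simp add: u' PM.opposite_orthonormal_iff cov_frames)

lemma cov_act_u: "p \<in> topspace (total S) \<Longrightarrow> t \<in> Pin \<kappa> \<Longrightarrow> cov S (act S p t) \<in> u \<longleftrightarrow> (cov S p \<in> u \<longleftrightarrow> t \<in> Spin \<kappa>)"
  by (simp add: S.cov_act PM.pin_proj_oriented[OF u] cov_frames)

lemma openin_u: "openin (total S) {p \<in> topspace (total S). cov S p \<in> u}"
proof -
  have "openin (total S) {p \<in> topspace (total S). cov S p \<in> orthonormal_frames M \<inter> u}"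
    by (rule openin_continuous_map_preimage[OF two_covering_props(1)[OF S.two_cov] PM.openin_oriented_frames[OF u]])
  moreover have "{p \<in> topspace (total S). cov S p \<in> orthonormal_frames M \<inter> u} = {p \<in> topspace (total S). cov S p \<in> u}"
    using cov_frames by blast
  ultimately show ?thesis by simp
qed

lemma openin_not_u: "openin (total S) {p \<in> topspace (total S). cov S p \<notin> u}"
proof -
  have "{p \<in> topspace (total S). cov S p \<notin> u} = {p \<in> topspace (total S). cov S p \<in> u'}" using cov_u' by blast
  then show ?thesis using pinor_bundle.openin_u[OF reverse] by simp
qed

text \<open>A local section may take values over both orientations. The corresponding two parts of
  its domain are open, so smoothness can be checked with the orientation fixed.\<close>

lemma section_parts:
  assumes s: "smooth_local_section M S U \<sigma>"
    and 1: "\<And>W. smooth_local_section M S W \<sigma> \<Longrightarrow> (\<And>x. x \<in> W \<Longrightarrow> cov S (\<sigma> x) \<in> u) \<Longrightarrow> smooth_fun_on M W f"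
    and 2: "\<And>W. smooth_local_section M S W \<sigma> \<Longrightarrow> (\<And>x. x \<in> W \<Longrightarrow> cov S (\<sigma> x) \<notin> u) \<Longrightarrow> smooth_fun_on M W f"
  shows "smooth_fun_on M U f"
proof -
  note h = smooth_local_sectionD[OF s]
  have M: "manifold M" by (rule PM.manifold_axioms)
  have UM: "U \<subseteq> topspace (mtop M)" using h(1) by (rule openin_subset)
  have o: "openin (mtop M) {x \<in> U. \<sigma> x \<in> V}" if "openin (total S) V" for V
  proof -
    have "openin (subtopology (mtop M) U) {x \<in> topspace (subtopology (mtop M) U). \<sigma> x \<in> V}"
      by (rule openin_continuous_map_preimage[OF h(2) that])
    moreover have "{x \<in> topspace (subtopology (mtop M) U). \<sigma> x \<in> V} = {x \<in> U. \<sigma> x \<in> V}" using UM by auto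
    ultimately show ?thesis using openin_trans_full[OF _ h(1)] by metis
  qed
  define A where "A = {x \<in> U. cov S (\<sigma> x) \<in> u}"
  define B where "B = {x \<in> U. cov S (\<sigma> x) \<notin> u}"
  have A: "openin (mtop M) A" using o[OF openin_u] h(5) by (simp add: A_def cong: conj_cong)
  have B: "openin (mtop M) B" using o[OF openin_not_u] h(5) by (simp add: B_def cong: conj_cong)
  have "smooth_fun_on M A f" by (rule 1[OF smooth_local_section_subset[OF M s A]]) (auto simp: A_def)
  moreover have "smooth_fun_on M B f" by (rule 2[OF smooth_local_section_subset[OF M s B]]) (auto simp: B_def)
  ultimately have "smooth_fun_on M (A \<union> B) f" by (rule PM.smooth_fun_on_Un[OF A B])
  moreover have "A \<union> B = U" by (auto simp: A_def B_def)
  ultimately show ?thesis by simp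
qed

lemma section_restrict:
  assumes s: "smooth_local_section M S W \<sigma>" and u: "\<And>x. x \<in> W \<Longrightarrow> cov S (\<sigma> x) \<in> u"
  shows "smooth_local_section M (orient_restrict u S) W \<sigma>"
  unfolding smooth_local_section_def orient_restrict_simps
proof (intro conjI ballI)
  note h = smooth_local_sectionD[OF s]
  show "continuous_map (subtopology (mtop M) W) (subtopology (total S) {p \<in> topspace (total S). cov S p \<in> u}) \<sigma>"
    by (rule continuous_map_into_subtopology[OF h(2)]) (use h(5) u in auto)
qed (use smooth_local_sectionD[OF s] in auto)

lemma section_act:
  assumes s: "smooth_local_section M S W \<sigma>" and t: "t \<in> Pin \<kappa>"
  shows "smooth_local_section M S W (\<lambda>x. act S (\<sigma> x) t)"
proof (rule smooth_local_section_map[OF PM.manifold_axioms s])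
  note h = smooth_local_sectionD[OF s]
  have "continuous_map (total S) (total S) (\<lambda>p. act S p t)" by (rule S.continuous_act_right) (simp add: t topspace_cl_top)
  from continuous_map_compose[OF h(2) this]
  show "continuous_map (subtopology (mtop M) W) (total S) (\<lambda>x. act S (\<sigma> x) t)" by (simp add: comp_def)
  show "cov S (act S (\<sigma> x) t) = frame_mult (cov S (\<sigma> x)) (pin_proj \<kappa> t)" if "x \<in> W" for x
    by (rule S.cov_act[OF h(5)[OF that] t])
qed

lemma linear_rep: "linear (\<lambda>z. \<rho> t *v z)"
  by (rule matrix_vector_mul_linear)

lemma linear_chiral_proj: "linear (chiral_proj \<rho> \<epsilon>)"
  by (rule linearI) (simp_all add: chiral_proj_linear)

lemma spin_restrict: "spin_structure \<kappa> M u (orient_restrict u S)"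
  by (rule PM.spin_orient_restrict[OF u pin])

text \<open>Inverse to restriction to the part over \<open>u\<close>: over the other orientation the
  value is fetched from \<open>u\<close> by an odd element \<open>t\<close>, and equivariance under
  Spin makes the result independent of that element.\<close>

lemma chiral_extension:
  assumes \<phi>: "equivariant (Spin \<kappa>) \<rho> (orient_restrict u S) \<phi>" "smooth_along M (orient_restrict u S) \<phi>"
    and V: "\<forall>p \<in> topspace (total (orient_restrict u S)). \<phi> p \<in> chiral_space \<rho> \<epsilon>"
  shows "\<exists>a \<in> chiral_funs \<kappa> M \<rho> S u \<epsilon>. \<forall>p \<in> topspace (total (orient_restrict u S)). a p = \<phi> p"
proof -
  let ?P = "topspace (total S)"
  obtain t :: "'m cliff" where t: "t \<in> Pin \<kappa>" "t \<notin> Spin \<kappa>" using Pin_odd_ex by blast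
  define a where "a p = (if cov S p \<in> u then \<phi> p else \<rho> t *v \<phi> (act S p t))" for p
  have eq: "\<rho> r *v \<phi> (act S p r) = \<phi> p" if "p \<in> ?P" "cov S p \<in> u" "r \<in> Spin \<kappa>" for p and r :: "'m cliff"
    using \<phi>(1) that by (simp add: equivariant_def orient_restrict_simps)
  \<comment> \<open>Another odd element \<open>r\<close> is \<open>t\<close> times an element
    \<open>r'\<close> of Spin, for which equivariance is given.\<close>
  have odd: "\<rho> r *v \<phi> (act S p r) = \<rho> t *v \<phi> (act S p t)"
    if p: "p \<in> ?P" "cov S p \<notin> u" and r: "r \<in> Pin \<kappa>" "r \<notin> Spin \<kappa>" for p and r :: "'m cliff"
  proof -
    define r' where "r' = cl_mult \<kappa> (pin_inv t) r"
    have i: "pin_inv t \<in> Pin \<kappa>" "pin_inv t \<notin> Spin \<kappa>" using t pin_inv(1)[OF t(1)] pin_inv_Spin_iff[OF t(1)] by auto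
    have r': "r' \<in> Spin \<kappa>" unfolding r'_def using Spin_mult_iff[OF i(1) r(1)] i r by blast
    have e: "cl_mult \<kappa> t r' = r"
      unfolding r'_def using pin_inv[OF t(1)] by (simp add: cl_mult_one flip: cl_mult_assoc[OF sign])
    have q: "act S p t \<in> ?P" "cov S (act S p t) \<in> u" using S.acts(1)[OF p(1) t(1)] cov_act_u[OF p(1) t(1)] p t by auto
    have "act S (act S p t) r' = act S p r" using S.acts(2)[OF p(1) t(1) Spin_Pin[OF r']] e by simp
    with eq[OF q r'] have "\<rho> r' *v \<phi> (act S p r) = \<phi> (act S p t)" by simp
    then have "\<rho> t *v (\<rho> r' *v \<phi> (act S p r)) = \<rho> t *v \<phi> (act S p t)" by simp
    then show ?thesis by (simp add: matrix_vector_mul_assoc e flip: rep_mult)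
  qed
  have "equivariant (Pin \<kappa>) \<rho> S a"
    unfolding equivariant_def
  proof (intro ballI)
    fix p and r :: "'m cliff" assume p: "p \<in> ?P" and r: "r \<in> Pin \<kappa>"
    \<comment> \<open>When the frame of \<open>act S p r\<close> lies outside \<open>u\<close>, the
      value of \<open>a\<close> there involves the product of \<open>r\<close> and \<open>t\<close>,
      which is even if the frame of \<open>p\<close> lies in \<open>u\<close> and odd otherwise;
      these are the cases \<open>eq\<close> and \<open>odd\<close>.\<close>
    have rt: "cl_mult \<kappa> r t \<in> Pin \<kappa>" "cl_mult \<kappa> r t \<in> Spin \<kappa> \<longleftrightarrow> r \<notin> Spin \<kappa>"
      using Pin_mult[OF r t(1)] Spin_mult_iff[OF r t(1)] t(2) by auto
    have m: "\<rho> r *v (\<rho> t *v \<phi> (act S (act S p r) t)) = \<rho> (cl_mult \<kappa> r t) *v \<phi> (act S p (cl_mult \<kappa> r t))"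
      using S.acts(2)[OF p r t(1)] by (simp add: matrix_vector_mul_assoc rep_mult)
    show "\<rho> r *v a (act S p r) = a p"
    proof (cases "cov S p \<in> u")
      case True
      show ?thesis
        by (cases "r \<in> Spin \<kappa>") (use True eq[OF p True] m rt(2) cov_act_u[OF p r] in \<open>auto simp: a_def\<close>)
    next
      case False
      show ?thesis
        by (cases "r \<in> Spin \<kappa>") (use False odd[OF p False] r m rt cov_act_u[OF p r] in \<open>auto simp: a_def\<close>)
    qed
  qed
  moreover have "smooth_along M S a"
    unfolding smooth_along_def
  proof (intro allI impI)
    fix U \<sigma> assume s: "smooth_local_section M S U \<sigma>"
    show "smooth_fun_on M U (\<lambda>x. a (\<sigma> x))"
    proof (rule section_parts[OF s])
      fix W assume w: "smooth_local_section M S W \<sigma>" and wu: "\<And>x. x \<in> W \<Longrightarrow> cov S (\<sigma> x) \<in> u"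
      have "smooth_fun_on M W (\<lambda>x. \<phi> (\<sigma> x))" using section_restrict[OF w wu] \<phi>(2) by (simp add: smooth_along_def)
      then show "smooth_fun_on M W (\<lambda>x. a (\<sigma> x))"
        by (rule PM.smooth_fun_on_cong[OF smooth_local_sectionD(1)[OF w], rotated]) (simp add: a_def wu)
    next
      fix W assume w: "smooth_local_section M S W \<sigma>" and wu: "\<And>x. x \<in> W \<Longrightarrow> cov S (\<sigma> x) \<notin> u"
      have "smooth_local_section M (orient_restrict u S) W (\<lambda>x. act S (\<sigma> x) t)"
        by (rule section_restrict[OF section_act[OF w t(1)]]) (use cov_act_u[OF smooth_local_sectionD(5)[OF w] t(1)] wu t(2) in auto)
      then have "smooth_fun_on M W (\<lambda>x. \<phi> (act S (\<sigma> x) t))" using \<phi>(2) by (simp add: smooth_along_def)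
      from PM.smooth_fun_on_linear[OF smooth_local_sectionD(1)[OF w] linear_rep this]
      have "smooth_fun_on M W (\<lambda>x. \<rho> t *v \<phi> (act S (\<sigma> x) t))" .
      then show "smooth_fun_on M W (\<lambda>x. a (\<sigma> x))"
        by (rule PM.smooth_fun_on_cong[OF smooth_local_sectionD(1)[OF w], rotated]) (simp add: a_def wu)
    qed
  qed
  moreover have "a p \<in> chiral_space \<rho> (if cov S p \<in> u then \<epsilon> else - \<epsilon>)" if p: "p \<in> ?P" for p
  proof (cases "cov S p \<in> u")
    case True
    then show ?thesis using V p by (simp add: a_def topspace_orient_restrict)
  next
    case False
    have "\<phi> (act S p t) \<in> chiral_space \<rho> \<epsilon>"
      using V S.acts(1)[OF p t(1)] cov_act_u[OF p t(1)] False t(2) by (simp add: topspace_orient_restrict)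
    from chiral_space_Pin[OF t(1) this] show ?thesis using False t(2) by (simp add: a_def)
  qed
  ultimately show ?thesis
    by (intro bexI[of _ a]) (auto simp: chiral_funs_def pinor_funs_def a_def topspace_orient_restrict)
qed

lemma chiral_restriction:
  assumes a: "a \<in> chiral_funs \<kappa> M \<rho> S u \<epsilon>"
  shows "equivariant (Spin \<kappa>) \<rho> (orient_restrict u S) a" "smooth_along M (orient_restrict u S) a"
    "\<forall>p \<in> topspace (total (orient_restrict u S)). a p \<in> chiral_space \<rho> \<epsilon>"
proof -
  have e: "equivariant (Pin \<kappa>) \<rho> S a" and s: "smooth_along M S a"
    and c: "\<forall>p \<in> topspace (total S). a p \<in> chiral_space \<rho> (if cov S p \<in> u then \<epsilon> else - \<epsilon>)"
    using a by (simp_all add: chiral_funs_def pinor_funs_def)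
  show "equivariant (Spin \<kappa>) \<rho> (orient_restrict u S) a"
    using e Spin_Pin by (auto simp: equivariant_def orient_restrict_simps)
  show "\<forall>p \<in> topspace (total (orient_restrict u S)). a p \<in> chiral_space \<rho> \<epsilon>"
    using c by (auto simp: topspace_orient_restrict)
  have "smooth_along M (orient_restrict u S) (a \<circ> (\<lambda>p. p))"
    by (rule smooth_along_map[OF PM.manifold_axioms _ _ s])
      (simp_all add: orient_restrict_simps continuous_map_from_subtopology)
  then show "smooth_along M (orient_restrict u S) a" by (simp add: comp_def)
qed

lemma pinors_eq: "pinors \<kappa> M \<rho> S = (\<lambda>\<psi>. restrict (fibre_graph S \<psi>) (topspace (mtop M))) ` pinor_funs \<kappa> M \<rho> S"
proof -
  have "s \<in> pinors \<kappa> M \<rho> S \<longleftrightarrow> s \<in> (\<lambda>\<psi>. restrict (fibre_graph S \<psi>) (topspace (mtop M))) ` pinor_funs \<kappa> M \<rho> S" for s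
    unfolding pinors_def
    by (subst spinor_sections_iff[OF PM.manifold_axioms S.lifted_axioms]) (auto simp: pinor_funs_def)
  then show ?thesis by blast
qed

text \<open>Represents chiral spinors of one orientation by Pin-equivariant functions on the whole
  total space, so that spinors relative to \<open>u\<close> and to \<open>u'\<close> can be compared
  and added there.\<close>

lemma chiral_spinors_eq:
  "chiral_spinors \<kappa> M \<rho> (orient_restrict u S) \<epsilon> =
    (\<lambda>a. restrict (fibre_graph (orient_restrict u S) a) (topspace (mtop M))) ` chiral_funs \<kappa> M \<rho> S u \<epsilon>"
proof -
  let ?R = "orient_restrict u S"
  have L: "lifted \<kappa> (Spin \<kappa>) M (oriented_frame_bundle M u) ?R" using spin_restrict PM.spin_lifted by blast
  have V: "\<rho> t *v z \<in> chiral_space \<rho> \<epsilon>" if "t \<in> Spin \<kappa>" "z \<in> chiral_space \<rho> \<epsilon>" for t :: "'m cliff" and z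
    using chiral_space_Pin[OF Spin_Pin[OF that(1)] that(2)] that(1) by simp
  have iff: "s \<in> spinor_sections M (Spin \<kappa>) \<rho> ?R (chiral_space \<rho> \<epsilon>) \<longleftrightarrow>
      (\<exists>\<phi>. equivariant (Spin \<kappa>) \<rho> ?R \<phi> \<and> (\<forall>p \<in> topspace (total ?R). \<phi> p \<in> chiral_space \<rho> \<epsilon>) \<and>
         smooth_along M ?R \<phi> \<and> s = restrict (fibre_graph ?R \<phi>) (topspace (mtop M)))" for s
    by (rule spinor_sections_iff[OF PM.manifold_axioms L]) (rule V)
  show ?thesis
  proof (intro equalityI subsetI)
    fix s assume "s \<in> chiral_spinors \<kappa> M \<rho> ?R \<epsilon>"
    then have "s \<in> spinor_sections M (Spin \<kappa>) \<rho> ?R (chiral_space \<rho> \<epsilon>)" by (simp add: chiral_spinors_def)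
    then obtain \<phi> where \<phi>: "equivariant (Spin \<kappa>) \<rho> ?R \<phi>" "smooth_along M ?R \<phi>"
        "\<forall>p \<in> topspace (total ?R). \<phi> p \<in> chiral_space \<rho> \<epsilon>" and s: "s = restrict (fibre_graph ?R \<phi>) (topspace (mtop M))"
      using iff by blast
    obtain a where a: "a \<in> chiral_funs \<kappa> M \<rho> S u \<epsilon>" "\<forall>p \<in> topspace (total ?R). a p = \<phi> p"
      using chiral_extension[OF \<phi>] by blast
    have "fibre_graph ?R a x = fibre_graph ?R \<phi> x" for x by (rule fibre_graph_cong) (use a(2) in blast)
    then have "s = restrict (fibre_graph ?R a) (topspace (mtop M))" unfolding s by (intro restrict_ext) simp
    then show "s \<in> (\<lambda>a. restrict (fibre_graph ?R a) (topspace (mtop M))) ` chiral_funs \<kappa> M \<rho> S u \<epsilon>" using a(1) by blast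
  next
    fix s assume "s \<in> (\<lambda>a. restrict (fibre_graph ?R a) (topspace (mtop M))) ` chiral_funs \<kappa> M \<rho> S u \<epsilon>"
    then obtain a where a: "a \<in> chiral_funs \<kappa> M \<rho> S u \<epsilon>" and s: "s = restrict (fibre_graph ?R a) (topspace (mtop M))" by blast
    have "s \<in> spinor_sections M (Spin \<kappa>) \<rho> ?R (chiral_space \<rho> \<epsilon>)"
      by (rule iff[THEN iffD2], intro exI[of _ a] conjI) (rule chiral_restriction[OF a] s)+
    then show "s \<in> chiral_spinors \<kappa> M \<rho> ?R \<epsilon>" by (simp add: chiral_spinors_def)
  qed
qed

lemma chiral_component_in:
  assumes \<psi>: "\<psi> \<in> pinor_funs \<kappa> M \<rho> S" and \<epsilon>: "\<epsilon> = 1 \<or> \<epsilon> = - 1"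
  shows "chiral_component \<rho> S u \<epsilon> \<psi> \<in> chiral_funs \<kappa> M \<rho> S u \<epsilon>"
proof -
  let ?a = "chiral_component \<rho> S u \<epsilon> \<psi>"
  have e: "equivariant (Pin \<kappa>) \<rho> S \<psi>" and s: "smooth_along M S \<psi>" using \<psi> by (simp_all add: pinor_funs_def)
  have "equivariant (Pin \<kappa>) \<rho> S ?a"
    unfolding equivariant_def
  proof (intro ballI)
    fix p and t :: "'m cliff" assume p: "p \<in> topspace (total S)" and t: "t \<in> Pin \<kappa>"
    define \<epsilon>' where "\<epsilon>' = (if cov S p \<in> u then \<epsilon> else - \<epsilon>)"
    have "?a (act S p t) = chiral_proj \<rho> (if t \<in> Spin \<kappa> then \<epsilon>' else - \<epsilon>') (\<psi> (act S p t))"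
      using cov_act_u[OF p t] by (auto simp: chiral_component_def \<epsilon>'_def)
    then have "\<rho> t *v ?a (act S p t) = chiral_proj \<rho> \<epsilon>' (\<rho> t *v \<psi> (act S p t))" by (simp add: chiral_proj_Pin[OF t])
    then show "\<rho> t *v ?a (act S p t) = ?a p" using e p t by (simp add: equivariant_def chiral_component_def \<epsilon>'_def)
  qed
  moreover have "smooth_along M S ?a"
    unfolding smooth_along_def
  proof (intro allI impI)
    fix U \<sigma> assume \<sigma>: "smooth_local_section M S U \<sigma>"
    have l: "smooth_fun_on M W (\<lambda>x. chiral_proj \<rho> c (\<psi> (\<sigma> x)))" if "smooth_local_section M S W \<sigma>" for W c
      by (rule PM.smooth_fun_on_linear[OF smooth_local_sectionD(1)[OF that] linear_chiral_proj])
        (use s that in \<open>simp add: smooth_along_def\<close>)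
    show "smooth_fun_on M U (\<lambda>x. ?a (\<sigma> x))"
    proof (rule section_parts[OF \<sigma>])
      fix W assume w: "smooth_local_section M S W \<sigma>" and wu: "\<And>x. x \<in> W \<Longrightarrow> cov S (\<sigma> x) \<in> u"
      show "smooth_fun_on M W (\<lambda>x. ?a (\<sigma> x))"
        by (rule PM.smooth_fun_on_cong[OF smooth_local_sectionD(1)[OF w] _ l[OF w]]) (simp add: chiral_component_def wu)
    next
      fix W assume w: "smooth_local_section M S W \<sigma>" and wu: "\<And>x. x \<in> W \<Longrightarrow> cov S (\<sigma> x) \<notin> u"
      show "smooth_fun_on M W (\<lambda>x. ?a (\<sigma> x))"
        by (rule PM.smooth_fun_on_cong[OF smooth_local_sectionD(1)[OF w] _ l[OF w]]) (simp add: chiral_component_def wu)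
    qed
  qed
  moreover have "?a p \<in> chiral_space \<rho> (if cov S p \<in> u then \<epsilon> else - \<epsilon>)" for p
    unfolding chiral_component_def by (rule chiral_proj_in) (use \<epsilon> in auto)
  ultimately show ?thesis by (simp add: chiral_funs_def pinor_funs_def)
qed

lemma chiral_component_sum: "chiral_component \<rho> S u 1 \<psi> p + chiral_component \<rho> S u (- 1) \<psi> p = \<psi> p"
  using chiral_proj_sum[of "\<psi> p"] by (auto simp: chiral_component_def add.commute)

lemma chiral_component_add:
  assumes a: "a \<in> chiral_funs \<kappa> M \<rho> S u 1" and b: "b \<in> chiral_funs \<kappa> M \<rho> S u (- 1)" and p: "p \<in> topspace (total S)"
  shows "chiral_component \<rho> S u 1 (\<lambda>p. a p + b p) p = a p" "chiral_component \<rho> S u (- 1) (\<lambda>p. a p + b p) p = b p"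
proof -
  let ?c = "\<lambda>\<epsilon>::real. if cov S p \<in> u then \<epsilon> else - \<epsilon>"
  have A: "a p \<in> chiral_space \<rho> (?c 1)" and B: "b p \<in> chiral_space \<rho> (?c (- 1))" using a b p by (auto simp: chiral_funs_def)
  show "chiral_component \<rho> S u 1 (\<lambda>p. a p + b p) p = a p" "chiral_component \<rho> S u (- 1) (\<lambda>p. a p + b p) p = b p"
    using A B by (auto simp: chiral_component_def chiral_proj_linear chiral_proj_space split: if_splits)
qed

lemma pinor_funs_add: "a \<in> pinor_funs \<kappa> M \<rho> S \<Longrightarrow> b \<in> pinor_funs \<kappa> M \<rho> S \<Longrightarrow> (\<lambda>p. a p + b p) \<in> pinor_funs \<kappa> M \<rho> S"
  by (simp add: pinor_funs_def equivariant_def matrix_vector_right_distrib smooth_along_add[OF PM.manifold_axioms])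

lemma chiral_funs_reverse: "chiral_funs \<kappa> M \<rho> S u' \<epsilon> = chiral_funs \<kappa> M \<rho> S u (- \<epsilon>)"
  by (auto simp: chiral_funs_def cov_u' split: if_splits)

text \<open>Every pair of the restricted graph generates the whole graph over the fibre, and such a
  pair exists as soon as the fibre is nonempty, because an odd element of Pin brings a point over
  \<open>u\<close>.\<close>

lemma as_pinor_graph:
  assumes a: "equivariant (Pin \<kappa>) \<rho> S a"
  shows "as_pinor \<kappa> \<rho> S (fibre_graph (orient_restrict u S) a x) = fibre_graph S a x"
proof -
  let ?C = "fibre_graph (orient_restrict u S) a x"
  have 1: "assoc_class (Pin \<kappa>) \<rho> S p z = fibre_graph S a x" if "(p, z) \<in> ?C" for p z
  proof -
    have "p \<in> topspace (total S)" "fst (cov S p) = x" "z = a p"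
      using that by (auto simp: fibre_graph_def topspace_orient_restrict orient_restrict_simps(2))
    then show ?thesis using assoc_class_graph[OF S.lifted_axioms a] by blast
  qed
  have 2: "\<exists>p z. (p, z) \<in> ?C" if "fibre_graph S a x \<noteq> {}"
  proof -
    from that obtain p where p: "p \<in> topspace (total S)" "fst (cov S p) = x" unfolding fibre_graph_def by blast
    obtain t :: "'m cliff" where t: "t \<in> Pin \<kappa>" "t \<notin> Spin \<kappa>" using Pin_odd_ex by blast
    have "fst (cov S (act S p t)) = x" using S.cov_act[OF p(1) t(1)] p(2) by (simp add: frame_mult_simps)
    moreover have "cov S (act S p t) \<in> u" if "cov S p \<notin> u" using cov_act_u[OF p(1) t(1)] that t(2) by simp
    ultimately have "(if cov S p \<in> u then p else act S p t, a (if cov S p \<in> u then p else act S p t)) \<in> ?C"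
      using p S.acts(1)[OF p(1) t(1)] by (simp add: fibre_graph_def topspace_orient_restrict orient_restrict_simps(2))
    then show ?thesis by blast
  qed
  show ?thesis
  proof (cases "?C = {}")
    case True
    then show ?thesis using 2 by (auto simp: as_pinor_def)
  next
    case False
    then show ?thesis using 1 unfolding as_pinor_def by auto
  qed
qed

end

section \<open>Couples of spinors\<close>

text \<open>Normal form of a couple, in which \<open>a\<close> and \<open>b\<close> are both
  functions on the total space of the pin structure. The fibre over \<open>x\<close> of the
  pulled-back structure sits over \<tau> x in the original one, and \<open>E\<close> carries it back
  to \<open>x\<close>; hence the argument \<open>E p\<close> of \<open>b\<close>.\<close>

definition graph_couple :: "('a, 'm::{finite,linorder}, 'z) mfd_scheme \<Rightarrow> ('a \<Rightarrow> 'a) \<Rightarrow> ('p, 'a, 'm) frame_structure \<Rightarrow>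
     ('a, 'm) frame set \<Rightarrow> ('a, 'm) frame set \<Rightarrow> ('p \<Rightarrow> 'p) \<Rightarrow> ('p \<Rightarrow> complex^'k::finite) \<Rightarrow> ('p \<Rightarrow> complex^'k) \<Rightarrow>
     ('a \<Rightarrow> ('p, 'k) spinor) \<times> ('a \<Rightarrow> ('p, 'k) spinor)" where
  "graph_couple M \<tau> S u u' E a b =
     (restrict (fibre_graph (orient_restrict u S) a) (topspace (mtop M)),
      restrict (fibre_graph (isometry_pullback M \<tau> (orient_restrict u' S)) (\<lambda>p. b (E p))) (topspace (mtop M)))"

text \<open>Two lifts occur below. \<open>E\<close> is fixed and identifies the pulled-back
  structure with the original one; the lemmas quantify over a further involutive lift
  \<open>F\<close>, with which invariance is formed. They are kept apart because the relation may be
  formed with one lift while the identification uses the lift of opposite sign.\<close>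

locale spinor_involution = involution X Y \<pi> \<tau> \<kappa> S E + pinor_bundle \<kappa> Y n \<rho> S u u'
  for X :: "('x, 'm::{finite,linorder}) mfd" and Y :: "('y, 'm) mfd" and \<pi> \<tau> and \<kappa> :: real
    and S :: "('p, 'y, 'm) frame_structure" and E and n :: nat
    and \<rho> :: "'m cliff \<Rightarrow> complex^'k::finite^'k" and u u'
begin

lemma reverse_involution: "spinor_involution X Y \<pi> \<tau> \<kappa> S E n \<rho> u' u"
  by (intro spinor_involution.intro involution_axioms reverse)

lemma cov_E_u: "p \<in> P \<Longrightarrow> cov S (E p) \<in> u \<longleftrightarrow> cov S p \<notin> u"
  by (simp add: cov_D dtau_orientation[OF u cov_S_in])

lemma base_E_iff: "p \<in> P \<Longrightarrow> fst (cov S (E p)) = x \<longleftrightarrow> \<tau> (fst (cov S p)) = x"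
  by (simp add: base_D)

lemma pullback_total: "topspace (total (isometry_pullback Y \<tau> (orient_restrict u S))) = {p \<in> P. cov S p \<in> u}"
  by (simp add: pullback_simps topspace_orient_restrict)

lemma pullback_restrict_cov: "p \<in> P \<Longrightarrow> cov (isometry_pullback Y \<tau> (orient_restrict u S)) p = d\<tau> (cov S p)"
  using pullback_cov[of "orient_restrict u S" p] cov_S_in by (simp add: orient_restrict_simps)

lemma mem_graph_u:
  "(p, z) \<in> fibre_graph (orient_restrict u S) a x \<longleftrightarrow> p \<in> P \<and> cov S p \<in> u \<and> fst (cov S p) = x \<and> z = a p"
  by (auto simp: fibre_graph_def topspace_orient_restrict orient_restrict_simps(2))

lemma mem_graph_tau:
  "(p, z) \<in> fibre_graph (isometry_pullback Y \<tau> (orient_restrict u S)) a x \<longleftrightarrow>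
     p \<in> P \<and> cov S p \<in> u \<and> \<tau> (fst (cov S p)) = x \<and> z = a p"
  unfolding fibre_graph_def pullback_total
  by (auto simp: pullback_restrict_cov fst_dtau)

lemma cov_E_u': "p \<in> P \<Longrightarrow> cov S (E p) \<in> u' \<longleftrightarrow> cov S p \<in> u"
  using cov_u'[OF D_in] cov_E_u by blast

text \<open>\<open>F\<close> carries the fibre over \<tau> x to that over \<open>x\<close> and is
  its own inverse, so pushing a graph forward by \<open>F\<close> amounts to composing the function
  with \<open>F\<close>.\<close>

lemma bundle_map_graph:
  assumes F: "involution X Y \<pi> \<tau> \<kappa> S F" and x: "x \<in> topspace (mtop Y)"
  shows "bundle_map F (fibre_graph S a (\<tau> x)) = fibre_graph S (\<lambda>p. a (F p)) x"
proof (intro set_eqI iffI)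
  interpret F: involution X Y \<pi> \<tau> \<kappa> S F by fact
  fix w assume "w \<in> bundle_map F (fibre_graph S a (\<tau> x))"
  then obtain p where p: "p \<in> P" "fst (cov S p) = \<tau> x" "w = (F p, a p)" by (auto simp: bundle_map_def fibre_graph_def)
  then show "w \<in> fibre_graph S (\<lambda>p. a (F p)) x"
    using F.D_in[OF p(1)] F.D_D[OF p(1)] F.base_D[OF p(1)] tau_tau[OF x] by (simp add: fibre_graph_def)
next
  interpret F: involution X Y \<pi> \<tau> \<kappa> S F by fact
  fix w assume "w \<in> fibre_graph S (\<lambda>p. a (F p)) x"
  then obtain p where p: "p \<in> P" "fst (cov S p) = x" "w = (p, a (F p))" unfolding fibre_graph_def by blast
  have "(F p, a (F p)) \<in> fibre_graph S a (\<tau> x)"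
    using F.D_in[OF p(1)] F.base_D[OF p(1)] p(2) by (simp add: fibre_graph_def)
  then have "(F (F p), a (F p)) \<in> bundle_map F (fibre_graph S a (\<tau> x))" unfolding bundle_map_def by (intro image_eqI) auto
  then show "w \<in> bundle_map F (fibre_graph S a (\<tau> x))" using F.D_D[OF p(1)] p(3) by simp
qed

lemma bundle_map_couple:
  "bundle_map E (fibre_graph (isometry_pullback Y \<tau> (orient_restrict u' S)) (\<lambda>p. b (E p)) x) =
     fibre_graph (orient_restrict u S) b x"
proof (intro set_eqI iffI)
  interpret V: spinor_involution X Y \<pi> \<tau> \<kappa> S E n \<rho> u' u by (rule reverse_involution)
  let ?C = "fibre_graph (isometry_pullback Y \<tau> (orient_restrict u' S)) (\<lambda>p. b (E p)) x"
  fix w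
  { assume "w \<in> bundle_map E ?C"
    then obtain p z where pz: "(p, z) \<in> ?C" "w = (E p, z)" unfolding bundle_map_def by auto
    then have p: "p \<in> P" "cov S p \<in> u'" "\<tau> (fst (cov S p)) = x" "z = b (E p)" unfolding V.mem_graph_tau by blast+
    show "w \<in> fibre_graph (orient_restrict u S) b x"
      unfolding pz(2) mem_graph_u using D_in[OF p(1)] V.cov_E_u'[OF p(1)] base_E_iff[OF p(1)] p by simp }
  { assume "w \<in> fibre_graph (orient_restrict u S) b x"
    moreover obtain q z where w: "w = (q, z)" by (cases w)
    ultimately have q: "q \<in> P" "cov S q \<in> u" "fst (cov S q) = x" "z = b q" unfolding w mem_graph_u by blast+
    have "(E q, z) \<in> ?C"
      unfolding V.mem_graph_tau using D_in[OF q(1)] cov_E_u'[OF q(1)] D_D[OF q(1)] base_D[OF q(1)] q tau_tau base_in[OF q(1)] by simp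
    then have "(E (E q), z) \<in> bundle_map E ?C" unfolding bundle_map_def by (intro image_eqI) auto
    then show "w \<in> bundle_map E ?C" using D_D[OF q(1)] w by simp }
qed

lemma bundle_map_inv_couple:
  fixes a :: "'p \<Rightarrow> complex^'k"
  shows "bundle_map_inv S E (fibre_graph (orient_restrict u S) a x) =
     fibre_graph (isometry_pullback Y \<tau> (orient_restrict u' S)) (\<lambda>p. a (E p)) x"
proof (rule set_eqI)
  interpret V: spinor_involution X Y \<pi> \<tau> \<kappa> S E n \<rho> u' u by (rule reverse_involution)
  fix w :: "'p \<times> (complex^'k)"
  obtain p z where w: "w = (p, z)" by (cases w)
  show "w \<in> bundle_map_inv S E (fibre_graph (orient_restrict u S) a x) \<longleftrightarrow>
      w \<in> fibre_graph (isometry_pullback Y \<tau> (orient_restrict u' S)) (\<lambda>p. a (E p)) x"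
    unfolding w V.mem_graph_tau
    using D_in V.cov_E_u'[of p] base_E_iff[of p x] by (auto simp: bundle_map_inv_def mem_graph_u)
qed

lemma bundle_map_inv_restrict:
  fixes \<psi> :: "'p \<Rightarrow> complex^'k"
  shows "restrict_pinor u' S (bundle_map_inv S E (fibre_graph S \<psi> x)) =
     fibre_graph (isometry_pullback Y \<tau> (orient_restrict u' S)) (\<lambda>p. \<psi> (E p)) x"
proof (rule set_eqI)
  interpret V: spinor_involution X Y \<pi> \<tau> \<kappa> S E n \<rho> u' u by (rule reverse_involution)
  fix w :: "'p \<times> (complex^'k)"
  obtain p z where w: "w = (p, z)" by (cases w)
  show "w \<in> restrict_pinor u' S (bundle_map_inv S E (fibre_graph S \<psi> x)) \<longleftrightarrow>
      w \<in> fibre_graph (isometry_pullback Y \<tau> (orient_restrict u' S)) (\<lambda>p. \<psi> (E p)) x"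
    unfolding w V.mem_graph_tau
    using D_in[of p] base_E_iff[of p x]
    by (auto simp: bundle_map_inv_def restrict_pinor_def fibre_graph_def topspace_orient_restrict)
qed

abbreviation "Yt \<equiv> topspace (mtop Y)"
abbreviation "pinor_of \<psi> \<equiv> restrict (fibre_graph S \<psi>) Yt"
abbreviation "couple \<equiv> graph_couple Y \<tau> S u u' E"

lemma graph_eq_iff:
  "(\<forall>x \<in> Yt. fibre_graph S \<phi> x = fibre_graph S \<psi> x) \<longleftrightarrow> (\<forall>p \<in> P. \<phi> p = \<psi> p)"
proof
  assume h: "\<forall>x \<in> Yt. fibre_graph S \<phi> x = fibre_graph S \<psi> x"
  show "\<forall>p \<in> P. \<phi> p = \<psi> p" using h base_in fibre_graph_eqD by metis
next
  assume "\<forall>p \<in> P. \<phi> p = \<psi> p"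
  then show "\<forall>x \<in> Yt. fibre_graph S \<phi> x = fibre_graph S \<psi> x" using fibre_graph_cong[of S _ \<phi> \<psi>] by blast
qed

text \<open>The projections in \<open>couple_of_pinor\<close> have fixed signs, on the part over
  \<open>u\<close> in the first member and over \<open>u'\<close> in the second. As \<open>E\<close>
  takes the latter to frames in \<open>u\<close>, both are restrictions of components whose sign is
  taken relative to \<open>u\<close>.\<close>

lemma couple_of_pinor_graph:
  "couple_of_pinor Y \<rho> S u u' E (pinor_of \<psi>) =
     couple (chiral_component \<rho> S u 1 \<psi>) (chiral_component \<rho> S u (- 1) \<psi>)"
proof -
  interpret V: spinor_involution X Y \<pi> \<tau> \<kappa> S E n \<rho> u' u by (rule reverse_involution)
  have 1: "fibre_graph (orient_restrict u S) (\<lambda>p. chiral_proj \<rho> 1 (\<psi> p)) x =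
      fibre_graph (orient_restrict u S) (chiral_component \<rho> S u 1 \<psi>) x" for x
    by (rule fibre_graph_cong) (simp add: topspace_orient_restrict chiral_component_def)
  have 2: "fibre_graph (isometry_pullback Y \<tau> (orient_restrict u' S)) (\<lambda>p. chiral_proj \<rho> (- 1) (\<psi> (E p))) x =
      fibre_graph (isometry_pullback Y \<tau> (orient_restrict u' S)) (\<lambda>p. chiral_component \<rho> S u (- 1) \<psi> (E p)) x" for x
    by (rule fibre_graph_cong) (simp add: V.pullback_total chiral_component_def V.cov_E_u')
  show ?thesis
    unfolding couple_of_pinor_def graph_couple_def
    by (simp add: restrict_graph chiral_part_graph bundle_map_inv_restrict 1 2 cong: restrict_cong)
qed

text \<open>A couple sees \<open>a\<close> and \<open>b\<close> only over the orientation
  \<open>u\<close>; equivariance determines them over the other one, and \<open>as_pinor\<close>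
  performs this recovery.\<close>

lemma couple_eq_iff:
  assumes a: "equivariant (Pin \<kappa>) \<rho> S a" "equivariant (Pin \<kappa>) \<rho> S a'"
    and b: "equivariant (Pin \<kappa>) \<rho> S b" "equivariant (Pin \<kappa>) \<rho> S b'"
  shows "couple a b = couple a' b' \<longleftrightarrow> (\<forall>p \<in> P. a p = a' p \<and> b p = b' p)"
proof
  assume e: "couple a b = couple a' b'"
  have "fibre_graph S a x = fibre_graph S a' x" if x: "x \<in> Yt" for x
    using arg_cong[where f = "\<lambda>c. as_pinor \<kappa> \<rho> S (fst c x)", OF e] x
    by (simp add: graph_couple_def as_pinor_graph[OF a(1)] as_pinor_graph[OF a(2)])
  moreover have "fibre_graph S b x = fibre_graph S b' x" if x: "x \<in> Yt" for x
    using arg_cong[where f = "\<lambda>c. as_pinor \<kappa> \<rho> S (bundle_map E (snd c x))", OF e] x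
    by (simp add: graph_couple_def bundle_map_couple as_pinor_graph[OF b(1)] as_pinor_graph[OF b(2)])
  ultimately show "\<forall>p \<in> P. a p = a' p \<and> b p = b' p" using graph_eq_iff by blast
next
  interpret V: spinor_involution X Y \<pi> \<tau> \<kappa> S E n \<rho> u' u by (rule reverse_involution)
  assume h: "\<forall>p \<in> P. a p = a' p \<and> b p = b' p"
  have "fibre_graph (orient_restrict u S) a x = fibre_graph (orient_restrict u S) a' x" for x
    by (rule fibre_graph_cong) (use h in \<open>simp add: topspace_orient_restrict\<close>)
  moreover have "fibre_graph (isometry_pullback Y \<tau> (orient_restrict u' S)) (\<lambda>p. b (E p)) x =
      fibre_graph (isometry_pullback Y \<tau> (orient_restrict u' S)) (\<lambda>p. b' (E p)) x" for x
    by (rule fibre_graph_cong) (use h D_in in \<open>simp add: V.pullback_total\<close>)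
  ultimately show "couple a b = couple a' b'" by (simp add: graph_couple_def cong: restrict_cong)
qed

text \<open>\<open>E\<close> is an equivalence from the restriction to \<open>u\<close> to the
  pulled-back structure, so composing with \<open>E\<close> reduces the claim to
  \<open>chiral_extension\<close> and \<open>chiral_restriction\<close>.\<close>

lemma chiral_spinors_pullback_eq:
  "chiral_spinors \<kappa> Y \<rho> (isometry_pullback Y \<tau> (orient_restrict u' S)) \<epsilon> =
    (\<lambda>b. restrict (fibre_graph (isometry_pullback Y \<tau> (orient_restrict u' S)) (\<lambda>p. b (E p))) Yt) ` chiral_funs \<kappa> Y \<rho> S u \<epsilon>"
proof -
  interpret V: spinor_involution X Y \<pi> \<tau> \<kappa> S E n \<rho> u' u by (rule reverse_involution)
  let ?R = "orient_restrict u S" and ?T = "isometry_pullback Y \<tau> (orient_restrict u' S)"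
  have eqv: "spin_equivalence \<kappa> Y u ?R ?T E" by (rule lift_restricts_to_spin(1)[OF u u' equiv])
  have L: "lifted \<kappa> (Spin \<kappa>) Y (oriented_frame_bundle Y u) ?T"
    using eqv PY.spin_lifted unfolding spin_equivalence_def by blast
  have V: "\<rho> t *v z \<in> chiral_space \<rho> \<epsilon>" if "t \<in> Spin \<kappa>" "z \<in> chiral_space \<rho> \<epsilon>" for t :: "'m cliff" and z
    using chiral_space_Pin[OF Spin_Pin[OF that(1)] that(2)] that(1) by simp
  have iff: "s \<in> spinor_sections Y (Spin \<kappa>) \<rho> ?T (chiral_space \<rho> \<epsilon>) \<longleftrightarrow>
      (\<exists>\<phi>. equivariant (Spin \<kappa>) \<rho> ?T \<phi> \<and> (\<forall>p \<in> topspace (total ?T). \<phi> p \<in> chiral_space \<rho> \<epsilon>) \<and>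
         smooth_along Y ?T \<phi> \<and> s = restrict (fibre_graph ?T \<phi>) (topspace (mtop Y)))" for s
    by (rule spinor_sections_iff[OF Y.manifold_axioms L]) (rule V)
  have top: "topspace (total ?R) = {p \<in> P. cov S p \<in> u}" "topspace (total ?T) = {p \<in> P. cov S p \<in> u'}"
    by (rule topspace_orient_restrict, rule V.pullback_total)
  have act: "act ?R = act S" "act ?T = act S" by (simp_all add: orient_restrict_simps pullback_simps)
  note iso = structure_isoD[of "Spin \<kappa>" ?R ?T E]
  have c1: "continuous_map (total ?R) (total ?T) E" and cov1: "\<And>p. p \<in> topspace (total ?R) \<Longrightarrow> cov ?T (E p) = cov ?R p"
    using iso(2,4) eqv unfolding spin_equivalence_def by blast+
  have c2: "continuous_map (total ?T) (total ?R) E"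
    unfolding pullback_simps orient_restrict_simps
    by (rule continuous_map_into_subtopology[OF continuous_map_from_subtopology[OF continuous_D]])
      (use D_in V.cov_E_u' in auto)
  have cov2: "cov ?R (E p) = cov ?T p" if "p \<in> topspace (total ?T)" for p
    using that V.pullback_restrict_cov[of p] cov_D[of p] by (simp add: top orient_restrict_simps)
  show ?thesis
  proof (intro equalityI subsetI)
    fix s assume "s \<in> chiral_spinors \<kappa> Y \<rho> ?T \<epsilon>"
    then have "s \<in> spinor_sections Y (Spin \<kappa>) \<rho> ?T (chiral_space \<rho> \<epsilon>)" by (simp add: chiral_spinors_def)
    then obtain \<phi> where \<phi>: "equivariant (Spin \<kappa>) \<rho> ?T \<phi>" "\<forall>p \<in> topspace (total ?T). \<phi> p \<in> chiral_space \<rho> \<epsilon>"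
        "smooth_along Y ?T \<phi>" and s: "s = restrict (fibre_graph ?T \<phi>) Yt"
      using iff by blast
    have "equivariant (Spin \<kappa>) \<rho> ?R (\<phi> \<circ> E)"
      using \<phi>(1) D_in cov_E_u' D_act by (simp add: equivariant_def top act Spin_Pin)
    moreover have "smooth_along Y ?R (\<phi> \<circ> E)" by (rule smooth_along_map[OF Y.manifold_axioms c1 cov1 \<phi>(3)])
    moreover have "\<forall>p \<in> topspace (total ?R). (\<phi> \<circ> E) p \<in> chiral_space \<rho> \<epsilon>"
      using \<phi>(2) D_in cov_E_u' by (simp add: top)
    ultimately obtain b where b: "b \<in> chiral_funs \<kappa> Y \<rho> S u \<epsilon>" "\<forall>p \<in> topspace (total ?R). b p = (\<phi> \<circ> E) p"
      using chiral_extension by blast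
    have "fibre_graph ?T (\<lambda>p. b (E p)) x = fibre_graph ?T \<phi> x" for x
      by (rule fibre_graph_cong) (use b(2) D_in V.cov_E_u' D_D in \<open>simp add: top\<close>)
    then have "s = restrict (fibre_graph ?T (\<lambda>p. b (E p))) Yt" unfolding s by (intro restrict_ext) simp
    then show "s \<in> (\<lambda>b. restrict (fibre_graph ?T (\<lambda>p. b (E p))) Yt) ` chiral_funs \<kappa> Y \<rho> S u \<epsilon>" using b(1) by blast
  next
    fix s assume "s \<in> (\<lambda>b. restrict (fibre_graph ?T (\<lambda>p. b (E p))) Yt) ` chiral_funs \<kappa> Y \<rho> S u \<epsilon>"
    then obtain b where b: "b \<in> chiral_funs \<kappa> Y \<rho> S u \<epsilon>" and s: "s = restrict (fibre_graph ?T (\<lambda>p. b (E p))) Yt" by blast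
    note h = chiral_restriction[OF b]
    have "equivariant (Spin \<kappa>) \<rho> ?T (\<lambda>p. b (E p))"
      using h(1) D_in V.cov_E_u' D_act by (simp add: equivariant_def top act Spin_Pin)
    moreover have "smooth_along Y ?T (\<lambda>p. b (E p))"
      using smooth_along_map[OF Y.manifold_axioms c2 cov2 h(2)] by (simp add: comp_def)
    moreover have "\<forall>p \<in> topspace (total ?T). b (E p) \<in> chiral_space \<rho> \<epsilon>"
      using h(3) D_in V.cov_E_u' by (simp add: top)
    ultimately have "s \<in> spinor_sections Y (Spin \<kappa>) \<rho> ?T (chiral_space \<rho> \<epsilon>)"
      by (intro iff[THEN iffD2] exI[of _ "\<lambda>p. b (E p)"] conjI s)
    then show "s \<in> chiral_spinors \<kappa> Y \<rho> ?T \<epsilon>" by (simp add: chiral_spinors_def)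
  qed
qed

lemma spinor_couples_eq:
  "spinor_couples \<kappa> Y \<rho> \<tau> S u u' = {couple a b | a b. a \<in> chiral_funs \<kappa> Y \<rho> S u 1 \<and> b \<in> chiral_funs \<kappa> Y \<rho> S u (- 1)}"
  unfolding spinor_couples_def chiral_spinors_eq chiral_spinors_pullback_eq graph_couple_def by blast

lemma chiral_funs_equivariant: "a \<in> chiral_funs \<kappa> Y \<rho> S u \<epsilon> \<Longrightarrow> equivariant (Pin \<kappa>) \<rho> S a"
  by (simp add: chiral_funs_def pinor_funs_def)

lemma couple_relation_graph:
  assumes F: "involution X Y \<pi> \<tau> \<kappa> S F"
    and a: "equivariant (Pin \<kappa>) \<rho> S a" and b: "equivariant (Pin \<kappa>) \<rho> S b"
  shows "couple_relation \<kappa> Y \<rho> \<tau> S E \<epsilon> F (couple a b) \<longleftrightarrow> (\<forall>p \<in> P. b p = \<epsilon> *\<^sub>R a (F p))"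
proof -
  have "couple_relation \<kappa> Y \<rho> \<tau> S E \<epsilon> F (couple a b) \<longleftrightarrow>
      (\<forall>x \<in> Yt. fibre_graph S b x = fibre_graph S (\<lambda>p. \<epsilon> *\<^sub>R a (F p)) x)"
    unfolding couple_relation_def
  proof (rule ball_cong[OF refl])
    fix x assume x: "x \<in> Yt"
    have l: "as_pinor \<kappa> \<rho> S (bundle_map E (snd (couple a b) x)) = fibre_graph S b x"
      using x by (simp add: graph_couple_def bundle_map_couple as_pinor_graph[OF b])
    have "eta Y \<tau> (fst (couple a b)) x = fibre_graph (orient_restrict u S) a (\<tau> x)"
      using x tau_in[OF x] by (simp add: eta_def graph_couple_def)
    then have "as_pinor \<kappa> \<rho> S (eta Y \<tau> (fst (couple a b)) x) = fibre_graph S a (\<tau> x)" by (simp add: as_pinor_graph[OF a])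
    then have "scale_spinor \<epsilon> (bundle_map F (as_pinor \<kappa> \<rho> S (eta Y \<tau> (fst (couple a b)) x))) = fibre_graph S (\<lambda>p. \<epsilon> *\<^sub>R a (F p)) x"
      by (simp add: bundle_map_graph[OF F x] scale_graph)
    then show "as_pinor \<kappa> \<rho> S (bundle_map E (snd (couple a b) x)) =
          scale_spinor \<epsilon> (bundle_map F (as_pinor \<kappa> \<rho> S (eta Y \<tau> (fst (couple a b)) x))) \<longleftrightarrow>
        fibre_graph S b x = fibre_graph S (\<lambda>p. \<epsilon> *\<^sub>R a (F p)) x" using l by simp
  qed
  also have "\<dots> \<longleftrightarrow> (\<forall>p \<in> P. b p = \<epsilon> *\<^sub>R a (F p))" by (rule graph_eq_iff)
  finally show ?thesis .
qed

text \<open>Treats both signs uniformly: invariance under \<open>F\<close> is the eigenvalue 1,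
  invariance under \<open>F\<close> composed with the sheet exchange is the eigenvalue -1, as the
  sheet exchange acts on equivariant functions by -1.\<close>

definition eigenpinors :: "real \<Rightarrow> ('p \<Rightarrow> 'p) \<Rightarrow> ('y \<Rightarrow> ('p, 'k) spinor) set" where
  "eigenpinors \<epsilon> F = pinor_of ` {\<psi> \<in> pinor_funs \<kappa> Y \<rho> S. \<forall>p \<in> P. \<psi> (F p) = \<epsilon> *\<^sub>R \<psi> p}"

lemma invariant_pinors_eq:
  assumes F: "involution X Y \<pi> \<tau> \<kappa> S F"
  shows "invariant_pinors \<kappa> Y \<rho> \<tau> S F = eigenpinors 1 F"
    and "invariant_pinors \<kappa> Y \<rho> \<tau> S (F \<circ> sheet_exchange S) = eigenpinors (- 1) F"
proof -
  interpret F: involution X Y \<pi> \<tau> \<kappa> S F by fact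
  have *: "invariant_pinors \<kappa> Y \<rho> \<tau> S H = pinor_of ` {\<psi> \<in> pinor_funs \<kappa> Y \<rho> S. \<forall>p \<in> P. \<psi> p = \<psi> (H p)}"
    if H: "involution X Y \<pi> \<tau> \<kappa> S H" for H
  proof -
    have "(\<forall>x \<in> Yt. pinor_of \<psi> x = bundle_map H (eta Y \<tau> (pinor_of \<psi>) x)) \<longleftrightarrow> (\<forall>p \<in> P. \<psi> p = \<psi> (H p))" for \<psi> :: "'p \<Rightarrow> complex^'k"
      using graph_eq_iff[of \<psi> "\<lambda>p. \<psi> (H p)"] bundle_map_graph[OF H, of _ \<psi>] tau_in by (simp add: eta_def)
    then show ?thesis unfolding invariant_pinors_def pinors_eq by blast
  qed
  show "invariant_pinors \<kappa> Y \<rho> \<tau> S F = eigenpinors 1 F"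
    unfolding *[OF F] eigenpinors_def by (simp add: eq_commute)
  have "\<psi> p = \<psi> ((F \<circ> sheet_exchange S) p) \<longleftrightarrow> \<psi> (F p) = (- 1) *\<^sub>R \<psi> p" if \<psi>: "\<psi> \<in> pinor_funs \<kappa> Y \<rho> S" and p: "p \<in> P"
    for \<psi> :: "'p \<Rightarrow> complex^'k" and p
  proof -
    have "equivariant (Pin \<kappa>) \<rho> S \<psi>" using \<psi> by (simp add: pinor_funs_def)
    then have "\<rho> (- cl_one) *v \<psi> (act S (F p) (- cl_one)) = \<psi> (F p)"
      using F.D_in[OF p] S.minus_one by (simp add: equivariant_def)
    then have "\<psi> ((F \<circ> sheet_exchange S) p) = - \<psi> (F p)" using F.D_sheet[OF p] rep_minus_vec by (metis minus_minus)
    then show ?thesis by (metis minus_minus scaleR_minus_left scaleR_one)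
  qed
  then have "{\<psi> \<in> pinor_funs \<kappa> Y \<rho> S. \<forall>p \<in> P. \<psi> p = \<psi> ((F \<circ> sheet_exchange S) p)} =
      {\<psi> \<in> pinor_funs \<kappa> Y \<rho> S. \<forall>p \<in> P. \<psi> (F p) = (- 1) *\<^sub>R \<psi> p}" by blast
  then show "invariant_pinors \<kappa> Y \<rho> \<tau> S (F \<circ> sheet_exchange S) = eigenpinors (- 1) F"
    unfolding *[OF F.involution_sheet] eigenpinors_def by simp
qed

text \<open>\<open>F\<close> exchanges the two orientations and with them the signs in
  \<open>chiral_component\<close>, so the eigenvalue equation becomes a relation between the two
  components. One relation suffices for the converse: evaluated at \<open>F p\<close> it yields the
  other half.\<close>

lemma eigen_iff:
  assumes F: "involution X Y \<pi> \<tau> \<kappa> S F" and \<epsilon>: "\<epsilon> = 1 \<or> \<epsilon> = - 1"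
  shows "(\<forall>p \<in> P. \<psi> (F p) = \<epsilon> *\<^sub>R \<psi> p) \<longleftrightarrow>
    (\<forall>p \<in> P. chiral_component \<rho> S u (- 1) \<psi> p = \<epsilon> *\<^sub>R chiral_component \<rho> S u 1 \<psi> (F p))"
proof -
  interpret F: involution X Y \<pi> \<tau> \<kappa> S F by fact
  interpret G: spinor_involution X Y \<pi> \<tau> \<kappa> S F n \<rho> u u' by (intro spinor_involution.intro F pinor_bundle_axioms)
  have sq: "\<epsilon> * \<epsilon> = 1" using \<epsilon> by auto
  let ?a = "chiral_component \<rho> S u 1 \<psi>" and ?b = "chiral_component \<rho> S u (- 1) \<psi>"
  show ?thesis
  proof
    assume h: "\<forall>p \<in> P. \<psi> (F p) = \<epsilon> *\<^sub>R \<psi> p"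
    show "\<forall>p \<in> P. ?b p = \<epsilon> *\<^sub>R ?a (F p)"
    proof
      fix p assume p: "p \<in> P"
      show "?b p = \<epsilon> *\<^sub>R ?a (F p)" using G.cov_E_u[OF p] h p sq by (simp add: chiral_component_def chiral_proj_linear)
    qed
  next
    assume h: "\<forall>p \<in> P. ?b p = \<epsilon> *\<^sub>R ?a (F p)"
    show "\<forall>p \<in> P. \<psi> (F p) = \<epsilon> *\<^sub>R \<psi> p"
    proof
      fix p assume p: "p \<in> P"
      have "?b (F p) = \<epsilon> *\<^sub>R ?a p" using h F.D_in[OF p] F.D_D[OF p] by simp
      moreover have "?a (F p) = \<epsilon> *\<^sub>R ?b p" using h p sq by simp
      ultimately show "\<psi> (F p) = \<epsilon> *\<^sub>R \<psi> p"
        using chiral_component_sum[of \<psi> p] chiral_component_sum[of \<psi> "F p"] by (metis add.commute scaleR_add_right)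
    qed
  qed
qed

lemma eigenpinor_correspondence:
  assumes F: "involution X Y \<pi> \<tau> \<kappa> S F" and \<epsilon>: "\<epsilon> = 1 \<or> \<epsilon> = - 1"
  shows "\<forall>s \<in> eigenpinors \<epsilon> F. couple_relation \<kappa> Y \<rho> \<tau> S E \<epsilon> F (couple_of_pinor Y \<rho> S u u' E s)"
    and "bij_betw (couple_of_pinor Y \<rho> S u u' E) (eigenpinors \<epsilon> F) (invariant_couples \<kappa> Y \<rho> \<tau> S u u' E \<epsilon> F)"
proof -
  let ?c = "\<lambda>c \<psi>. chiral_component \<rho> S u c \<psi>"
  have ch: "?c 1 \<psi> \<in> chiral_funs \<kappa> Y \<rho> S u 1" "?c (- 1) \<psi> \<in> chiral_funs \<kappa> Y \<rho> S u (- 1)" if "\<psi> \<in> pinor_funs \<kappa> Y \<rho> S" for \<psi>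
    using chiral_component_in[OF that] by auto
  note eqv = ch[THEN chiral_funs_equivariant]
  have rel: "couple_relation \<kappa> Y \<rho> \<tau> S E \<epsilon> F (couple_of_pinor Y \<rho> S u u' E (pinor_of \<psi>)) \<longleftrightarrow> (\<forall>p \<in> P. \<psi> (F p) = \<epsilon> *\<^sub>R \<psi> p)"
    if \<psi>: "\<psi> \<in> pinor_funs \<kappa> Y \<rho> S" for \<psi>
    unfolding couple_of_pinor_graph couple_relation_graph[OF F eqv[OF \<psi>]] eigen_iff[OF F \<epsilon>] ..
  then show r: "\<forall>s \<in> eigenpinors \<epsilon> F. couple_relation \<kappa> Y \<rho> \<tau> S E \<epsilon> F (couple_of_pinor Y \<rho> S u u' E s)"
    unfolding eigenpinors_def by blast
  show "bij_betw (couple_of_pinor Y \<rho> S u u' E) (eigenpinors \<epsilon> F) (invariant_couples \<kappa> Y \<rho> \<tau> S u u' E \<epsilon> F)"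
    unfolding bij_betw_def
  proof (intro conjI inj_onI equalityI subsetI)
    fix s s' assume s: "s \<in> eigenpinors \<epsilon> F" "s' \<in> eigenpinors \<epsilon> F"
      and e: "couple_of_pinor Y \<rho> S u u' E s = couple_of_pinor Y \<rho> S u u' E s'"
    obtain \<psi> \<psi>' where \<psi>: "\<psi> \<in> pinor_funs \<kappa> Y \<rho> S" "\<psi>' \<in> pinor_funs \<kappa> Y \<rho> S" "s = pinor_of \<psi>" "s' = pinor_of \<psi>'"
      using s unfolding eigenpinors_def by blast
    have "\<forall>p \<in> P. ?c 1 \<psi> p = ?c 1 \<psi>' p \<and> ?c (- 1) \<psi> p = ?c (- 1) \<psi>' p"
      using e unfolding \<psi>(3,4) couple_of_pinor_graph
      by (simp only: couple_eq_iff[OF eqv(1)[OF \<psi>(1)] eqv(1)[OF \<psi>(2)] eqv(2)[OF \<psi>(1)] eqv(2)[OF \<psi>(2)]])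
    then have "\<forall>p \<in> P. \<psi> p = \<psi>' p" using chiral_component_sum[of \<psi>] chiral_component_sum[of \<psi>'] by metis
    then have "\<forall>x \<in> Yt. fibre_graph S \<psi> x = fibre_graph S \<psi>' x" using graph_eq_iff by blast
    then show "s = s'" unfolding \<psi>(3,4) by (intro restrict_ext) blast
  next
    fix c assume "c \<in> couple_of_pinor Y \<rho> S u u' E ` eigenpinors \<epsilon> F"
    then obtain s where s: "s \<in> eigenpinors \<epsilon> F" "c = couple_of_pinor Y \<rho> S u u' E s" by blast
    obtain \<psi> where \<psi>: "\<psi> \<in> pinor_funs \<kappa> Y \<rho> S" "s = pinor_of \<psi>" using s(1) unfolding eigenpinors_def by blast
    have "c \<in> spinor_couples \<kappa> Y \<rho> \<tau> S u u'"
      unfolding spinor_couples_eq s(2) \<psi>(2) couple_of_pinor_graph using ch[OF \<psi>(1)] by blast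
    then show "c \<in> invariant_couples \<kappa> Y \<rho> \<tau> S u u' E \<epsilon> F" using r s by (simp add: invariant_couples_def)
  next
    fix c assume c: "c \<in> invariant_couples \<kappa> Y \<rho> \<tau> S u u' E \<epsilon> F"
    then have "c \<in> spinor_couples \<kappa> Y \<rho> \<tau> S u u'" and cr: "couple_relation \<kappa> Y \<rho> \<tau> S E \<epsilon> F c" by (simp_all add: invariant_couples_def)
    then obtain a b where ab: "a \<in> chiral_funs \<kappa> Y \<rho> S u 1" "b \<in> chiral_funs \<kappa> Y \<rho> S u (- 1)" "c = couple a b"
      unfolding spinor_couples_eq by blast
    \<comment> \<open>The inverse of the correspondence adds the two members of the couple, viewed
      as functions on the same total space.\<close>
    let ?\<psi> = "\<lambda>p. a p + b p"
    have \<psi>: "?\<psi> \<in> pinor_funs \<kappa> Y \<rho> S" by (rule pinor_funs_add) (use ab in \<open>simp_all add: chiral_funs_def\<close>)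
    have e: "couple_of_pinor Y \<rho> S u u' E (pinor_of ?\<psi>) = c"
      unfolding couple_of_pinor_graph ab(3)
        couple_eq_iff[OF eqv(1)[OF \<psi>] chiral_funs_equivariant[OF ab(1)] eqv(2)[OF \<psi>] chiral_funs_equivariant[OF ab(2)]]
      using chiral_component_add[OF ab(1,2)] by blast
    with rel[OF \<psi>] cr have "pinor_of ?\<psi> \<in> eigenpinors \<epsilon> F" using \<psi> unfolding eigenpinors_def by blast
    then show "c \<in> couple_of_pinor Y \<rho> S u u' E ` eigenpinors \<epsilon> F" using e by blast
  qed
qed

lemma pinor_correspondence:
  assumes F: "involution X Y \<pi> \<tau> \<kappa> S F"
  shows "\<forall>s \<in> invariant_pinors \<kappa> Y \<rho> \<tau> S F. couple_relation \<kappa> Y \<rho> \<tau> S E 1 F (couple_of_pinor Y \<rho> S u u' E s)"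
    and "bij_betw (couple_of_pinor Y \<rho> S u u' E) (invariant_pinors \<kappa> Y \<rho> \<tau> S F) (invariant_couples \<kappa> Y \<rho> \<tau> S u u' E 1 F)"
    and "\<forall>s \<in> invariant_pinors \<kappa> Y \<rho> \<tau> S (F \<circ> sheet_exchange S).
      couple_relation \<kappa> Y \<rho> \<tau> S E (- 1) F (couple_of_pinor Y \<rho> S u u' E s)"
    and "bij_betw (couple_of_pinor Y \<rho> S u u' E) (invariant_pinors \<kappa> Y \<rho> \<tau> S (F \<circ> sheet_exchange S))
      (invariant_couples \<kappa> Y \<rho> \<tau> S u u' E (- 1) F)"
  unfolding invariant_pinors_eq[OF F] by (rule eigenpinor_correspondence[OF F]; simp)+

lemma change_orientation_couple:
  assumes a: "equivariant (Pin \<kappa>) \<rho> S a" and b: "equivariant (Pin \<kappa>) \<rho> S b"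
  shows "change_orientation \<kappa> Y \<rho> S u' E (couple a b) = graph_couple Y \<tau> S u' u E b a"
proof -
  interpret V: spinor_involution X Y \<pi> \<tau> \<kappa> S E n \<rho> u' u by (rule reverse_involution)
  show ?thesis
    unfolding change_orientation_def graph_couple_def[of Y \<tau> S u' u E b a]
    by (simp add: graph_couple_def bundle_map_couple as_pinor_graph[OF a] as_pinor_graph[OF b] restrict_graph
        V.bundle_map_inv_couple cong: restrict_cong)
qed

lemma change_orientation_spinor_couples:
  "c \<in> spinor_couples \<kappa> Y \<rho> \<tau> S u u' \<Longrightarrow> change_orientation \<kappa> Y \<rho> S u' E c \<in> spinor_couples \<kappa> Y \<rho> \<tau> S u' u \<and>
     change_orientation \<kappa> Y \<rho> S u E (change_orientation \<kappa> Y \<rho> S u' E c) = c"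
proof -
  interpret V: spinor_involution X Y \<pi> \<tau> \<kappa> S E n \<rho> u' u by (rule reverse_involution)
  assume "c \<in> spinor_couples \<kappa> Y \<rho> \<tau> S u u'"
  then obtain a b where ab: "a \<in> chiral_funs \<kappa> Y \<rho> S u 1" "b \<in> chiral_funs \<kappa> Y \<rho> S u (- 1)" "c = couple a b"
    unfolding spinor_couples_eq by blast
  note e = ab(1,2)[THEN chiral_funs_equivariant]
  have "b \<in> chiral_funs \<kappa> Y \<rho> S u' 1" "a \<in> chiral_funs \<kappa> Y \<rho> S u' (- 1)" using ab(1,2) by (simp_all add: chiral_funs_reverse)
  then show ?thesis
    unfolding V.spinor_couples_eq ab(3) change_orientation_couple[OF e] V.change_orientation_couple[OF e(2,1)] by blast
qed

text \<open>Exchanging the members turns b = \<epsilon> (a \<circ> F) into a = \<epsilon> (b \<circ>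
  F). The two are equivalent because \<open>F\<close> is an involution and \<epsilon> squares to
  1.\<close>

lemma change_orientation_relation:
  assumes F: "involution X Y \<pi> \<tau> \<kappa> S F" and \<epsilon>: "\<epsilon> = 1 \<or> \<epsilon> = - 1"
    and c: "c \<in> spinor_couples \<kappa> Y \<rho> \<tau> S u u'"
  shows "couple_relation \<kappa> Y \<rho> \<tau> S E \<epsilon> F (change_orientation \<kappa> Y \<rho> S u' E c) \<longleftrightarrow> couple_relation \<kappa> Y \<rho> \<tau> S E \<epsilon> F c"
proof -
  interpret V: spinor_involution X Y \<pi> \<tau> \<kappa> S E n \<rho> u' u by (rule reverse_involution)
  interpret F: involution X Y \<pi> \<tau> \<kappa> S F by fact
  obtain a b where ab: "a \<in> chiral_funs \<kappa> Y \<rho> S u 1" "b \<in> chiral_funs \<kappa> Y \<rho> S u (- 1)" "c = couple a b"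
    using c unfolding spinor_couples_eq by blast
  note e = ab(1,2)[THEN chiral_funs_equivariant]
  have *: "\<forall>p \<in> P. g p = \<epsilon> *\<^sub>R f (F p)" if h: "\<forall>p \<in> P. f p = \<epsilon> *\<^sub>R g (F p)" for f g :: "'p \<Rightarrow> complex^'k"
  proof
    fix p assume p: "p \<in> P"
    have "f (F p) = \<epsilon> *\<^sub>R g p" using h F.D_in[OF p] F.D_D[OF p] by simp
    then show "g p = \<epsilon> *\<^sub>R f (F p)" using \<epsilon> by auto
  qed
  show ?thesis
    unfolding ab(3) change_orientation_couple[OF e] couple_relation_graph[OF F e] V.couple_relation_graph[OF F e(2,1)]
    using *[of a b] *[of b a] by blast
qed

lemma bij_change_orientation:
  assumes F: "involution X Y \<pi> \<tau> \<kappa> S F" and \<epsilon>: "\<epsilon> = 1 \<or> \<epsilon> = - 1"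
  shows "bij_betw (change_orientation \<kappa> Y \<rho> S u' E) (spinor_couples \<kappa> Y \<rho> \<tau> S u u') (spinor_couples \<kappa> Y \<rho> \<tau> S u' u)"
    and "bij_betw (change_orientation \<kappa> Y \<rho> S u' E) (invariant_couples \<kappa> Y \<rho> \<tau> S u u' E \<epsilon> F) (invariant_couples \<kappa> Y \<rho> \<tau> S u' u E \<epsilon> F)"
proof -
  interpret V: spinor_involution X Y \<pi> \<tau> \<kappa> S E n \<rho> u' u by (rule reverse_involution)
  note c = change_orientation_spinor_couples and c' = V.change_orientation_spinor_couples
  show "bij_betw (change_orientation \<kappa> Y \<rho> S u' E) (spinor_couples \<kappa> Y \<rho> \<tau> S u u') (spinor_couples \<kappa> Y \<rho> \<tau> S u' u)"
    by (rule bij_betwI[of _ _ _ "change_orientation \<kappa> Y \<rho> S u E"]) (use c c' in auto)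
  show "bij_betw (change_orientation \<kappa> Y \<rho> S u' E) (invariant_couples \<kappa> Y \<rho> \<tau> S u u' E \<epsilon> F) (invariant_couples \<kappa> Y \<rho> \<tau> S u' u E \<epsilon> F)"
    by (rule bij_betwI[of _ _ _ "change_orientation \<kappa> Y \<rho> S u E"])
      (use c c' change_orientation_relation[OF F \<epsilon>] V.change_orientation_relation[OF F \<epsilon>] in \<open>auto simp: invariant_couples_def\<close>)
qed

text \<open>The component of sign 1 relative to \<open>u'\<close> is the component of sign -1
  relative to \<open>u\<close>, and vice versa.\<close>

lemma change_orientation_couple_of_pinor:
  assumes s: "s \<in> pinors \<kappa> Y \<rho> S"
  shows "change_orientation \<kappa> Y \<rho> S u' E (couple_of_pinor Y \<rho> S u u' E s) = couple_of_pinor Y \<rho> S u' u E s"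
proof -
  interpret V: spinor_involution X Y \<pi> \<tau> \<kappa> S E n \<rho> u' u by (rule reverse_involution)
  obtain \<psi> where \<psi>: "\<psi> \<in> pinor_funs \<kappa> Y \<rho> S" "s = pinor_of \<psi>" using s unfolding pinors_eq by blast
  have e: "equivariant (Pin \<kappa>) \<rho> S (chiral_component \<rho> S u \<epsilon> \<psi>)" "equivariant (Pin \<kappa>) \<rho> S (chiral_component \<rho> S u' \<epsilon> \<psi>)"
    if "\<epsilon> = 1 \<or> \<epsilon> = - 1" for \<epsilon>
    using chiral_component_in[OF \<psi>(1) that, THEN chiral_funs_equivariant]
      V.chiral_component_in[OF \<psi>(1) that, THEN V.chiral_funs_equivariant] by blast+
  have pm: "(1::real) = 1 \<or> 1 = (- 1 :: real)" "(- 1 :: real) = 1 \<or> - 1 = (- 1 :: real)" by simp_all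
  show ?thesis
    unfolding \<psi>(2) couple_of_pinor_graph V.couple_of_pinor_graph change_orientation_couple[OF e(1)[OF pm(1)] e(1)[OF pm(2)]]
      V.couple_eq_iff[OF e(1)[OF pm(2)] e(2)[OF pm(1)] e(1)[OF pm(1)] e(2)[OF pm(2)]]
    by (simp add: chiral_component_def cov_u')
qed

end

text \<open>The empty manifold is orientable, so non-orientability makes \<open>X\<close>, and with
  it the cover, nonempty. Without a point the two quotients in (3) could not be told apart.\<close>

lemma orientation_empty:
  assumes "smooth_manifold M" "topspace (mtop M) = {}"
  shows "orientation M {}"
  using assms by (simp add: orientation_def smooth_manifold_def)

text \<open>In the clauses with sign -1, \<open>E\<close> is the lift by which the pulled-back
  structure is identified with \<xi>. For couples invariant under \<open>D\<gamma>\<close> both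
  \<open>D\<close> and \<open>D\<gamma>\<close> are natural choices, and both are covered, while the
  relation itself is always formed with \<open>D\<close>.\<close>

theorem mainTheorem4:
  fixes X :: "('x, 'm::{finite,linorder}) mfd"
    and Xt :: "('y, 'm) mfd"
    and \<pi> :: "'y \<Rightarrow> 'x" and \<tau> :: "'y \<Rightarrow> 'y"
    and u u' :: "('y, 'm) frame set"
    and \<kappa> :: real and n :: nat
    and \<rho> :: "'m cliff \<Rightarrow> complex^'k::finite^'k"
  assumes dim: "CARD('m) = 2 * n" and spinor_dim: "CARD('k) = 2 ^ n"
    and sign: "\<kappa> = 1 \<or> \<kappa> = - 1"
    and X: "riemannian_manifold X" "connected_space (mtop X)" "\<not> orientable X"
    and cover: "orientable_double_cover Xt X \<pi> \<tau>"
    and u: "orientation Xt u" and u': "u' = opposite_orientation Xt u"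
    and \<rho>: "clifford_module \<kappa> \<rho>"
  shows "
    \<comment> \<open>(1)\<close>
    (\<forall>(\<xi> :: ('p, 'y, 'm) frame_structure) D.
       pin_equivalence \<kappa> Xt \<xi> (isometry_pullback Xt \<tau> \<xi>) D \<longrightarrow>
       (let \<xi>u = orient_restrict u \<xi>; \<xi>u' = orient_restrict u' \<xi> in
          spin_equivalence \<kappa> Xt u \<xi>u (isometry_pullback Xt \<tau> \<xi>u') D \<and>
          spin_equivalence \<kappa> Xt u' \<xi>u' (isometry_pullback Xt \<tau> \<xi>u) D \<and>
          couple_iso \<kappa> Xt u u'
            (\<xi>u, isometry_pullback Xt \<tau> \<xi>u) (isometry_pullback Xt \<tau> \<xi>u', \<xi>u')
            (D, inv_into (topspace (total \<xi>u')) D))) \<and>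
    \<comment> \<open>(2): \<open>D\<^sub>1\<close>, \<open>D\<^sub>2\<close> are the two lifts of \<open>d\<tau>\<close> given by the isomorphism of couples; they are
      parts of one lift if they are compatible with right multiplication by an element of Pin
      outside Spin\<close>
    (\<forall>(\<xi>u :: ('q, 'y, 'm) frame_structure) D\<^sub>1 g.
       (let \<xi> = pin_extension \<kappa> \<xi>u; \<xi>u' = orient_restrict u' \<xi>;
            \<iota> = (\<lambda>p. ext_class \<kappa> \<xi>u p cl_one);
            D\<^sub>2 = inv_into (topspace (total \<xi>u)) g in
          spin_structure \<kappa> Xt u \<xi>u \<and>
          couple_iso \<kappa> Xt u u'
            (\<xi>u, isometry_pullback Xt \<tau> \<xi>u) (isometry_pullback Xt \<tau> \<xi>u', \<xi>u') (D\<^sub>1, g) \<and>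
          (\<forall>p \<in> topspace (total \<xi>u). D\<^sub>2 (D\<^sub>1 p) = p) \<and>
          (\<forall>q \<in> topspace (total \<xi>u'). D\<^sub>1 (D\<^sub>2 q) = q) \<longrightarrow>
          (\<exists>D. pin_equivalence \<kappa> Xt \<xi> (isometry_pullback Xt \<tau> \<xi>) D \<and>
             (\<forall>p \<in> topspace (total \<xi>u). D (\<iota> p) = D\<^sub>1 p) \<and>
             ((\<exists>p \<in> topspace (total \<xi>u). \<exists>t \<in> Pin \<kappa> - Spin \<kappa>.
                  \<iota> (D\<^sub>2 (act \<xi> (\<iota> p) t)) = act \<xi> (D\<^sub>1 p) t) \<longrightarrow>
                (\<forall>q \<in> topspace (total \<xi>u'). D q = \<iota> (D\<^sub>2 q)) \<and>
                (\<forall>q \<in> topspace (total \<xi>). D (D q) = q) \<and>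
                pin_structure \<kappa> X (quotient_structure Xt X \<pi> D \<xi>) \<and>
                pin_equivalent \<kappa> Xt \<xi> (cover_pullback Xt X \<pi> (quotient_structure Xt X \<pi> D \<xi>)))))) \<and>
    \<comment> \<open>(3): quotients of \<open>\<xi>\<close> are structures on \<open>X\<close> that pull back to \<open>\<xi>\<close>\<close>
    (\<forall>(\<xi> :: ('p, 'y, 'm) frame_structure) D.
       pin_equivalence \<kappa> Xt \<xi> (isometry_pullback Xt \<tau> \<xi>) D \<and>
       (\<forall>p \<in> topspace (total \<xi>). D (D p) = p) \<longrightarrow>
       pin_structure \<kappa> X (quotient_structure Xt X \<pi> D \<xi>) \<and>
       pin_equivalent \<kappa> Xt \<xi> (cover_pullback Xt X \<pi> (quotient_structure Xt X \<pi> D \<xi>))) \<and>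
    \<comment> \<open>(3): the prescribed structure \<open>\<zeta>\<close> fixes the sign of \<open>D\<close>\<close>
    (\<forall>(\<xi> :: ('p, 'y, 'm) frame_structure) D (\<zeta> :: ('r, 'x, 'm) frame_structure).
       pin_equivalence \<kappa> Xt \<xi> (isometry_pullback Xt \<tau> \<xi>) D \<and>
       (\<forall>p \<in> topspace (total \<xi>). D (D p) = p) \<and>
       pin_structure \<kappa> X \<zeta> \<and> pin_equivalent \<kappa> Xt \<xi> (cover_pullback Xt X \<pi> \<zeta>) \<longrightarrow>
       (pin_equivalent \<kappa> X (quotient_structure Xt X \<pi> D \<xi>) \<zeta> \<longleftrightarrow>
          \<not> pin_equivalent \<kappa> X (quotient_structure Xt X \<pi> (D \<circ> sheet_exchange \<xi>) \<xi>) \<zeta>)) \<and>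
    \<comment> \<open>(3): correspondence of invariant pinors and invariant couples\<close>
    (\<forall>(\<xi> :: ('p, 'y, 'm) frame_structure) D (\<zeta> :: ('r, 'x, 'm) frame_structure).
       pin_equivalence \<kappa> Xt \<xi> (isometry_pullback Xt \<tau> \<xi>) D \<and>
       (\<forall>p \<in> topspace (total \<xi>). D (D p) = p) \<and>
       pin_structure \<kappa> X \<zeta> \<and> pin_equivalent \<kappa> Xt \<xi> (cover_pullback Xt X \<pi> \<zeta>) \<and>
       pin_equivalent \<kappa> X (quotient_structure Xt X \<pi> D \<xi>) \<zeta> \<longrightarrow>
       (let D\<gamma> = D \<circ> sheet_exchange \<xi> in
          (\<forall>s \<in> invariant_pinors \<kappa> Xt \<rho> \<tau> \<xi> D.
             couple_relation \<kappa> Xt \<rho> \<tau> \<xi> D 1 D (couple_of_pinor Xt \<rho> \<xi> u u' D s)) \<and>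
          bij_betw (couple_of_pinor Xt \<rho> \<xi> u u' D)
            (invariant_pinors \<kappa> Xt \<rho> \<tau> \<xi> D) (invariant_couples \<kappa> Xt \<rho> \<tau> \<xi> u u' D 1 D) \<and>
          (\<forall>E \<in> {D, D\<gamma>}.
             (\<forall>s \<in> invariant_pinors \<kappa> Xt \<rho> \<tau> \<xi> D\<gamma>.
                couple_relation \<kappa> Xt \<rho> \<tau> \<xi> E (- 1) D (couple_of_pinor Xt \<rho> \<xi> u u' E s)) \<and>
             bij_betw (couple_of_pinor Xt \<rho> \<xi> u u' E)
               (invariant_pinors \<kappa> Xt \<rho> \<tau> \<xi> D\<gamma>) (invariant_couples \<kappa> Xt \<rho> \<tau> \<xi> u u' E (- 1) D)))) \<and>
    \<comment> \<open>(4)\<close>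
    (\<forall>(\<xi> :: ('p, 'y, 'm) frame_structure) D (\<zeta> :: ('r, 'x, 'm) frame_structure).
       pin_equivalence \<kappa> Xt \<xi> (isometry_pullback Xt \<tau> \<xi>) D \<and>
       (\<forall>p \<in> topspace (total \<xi>). D (D p) = p) \<and>
       pin_structure \<kappa> X \<zeta> \<and> pin_equivalent \<kappa> Xt \<xi> (cover_pullback Xt X \<pi> \<zeta>) \<and>
       pin_equivalent \<kappa> X (quotient_structure Xt X \<pi> D \<xi>) \<zeta> \<longrightarrow>
       (let D\<gamma> = D \<circ> sheet_exchange \<xi> in
          (\<forall>s \<in> invariant_pinors \<kappa> Xt \<rho> \<tau> \<xi> D.
             couple_relation \<kappa> Xt \<rho> \<tau> \<xi> D 1 D (couple_of_pinor Xt \<rho> \<xi> u' u D s)) \<and>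
          bij_betw (couple_of_pinor Xt \<rho> \<xi> u' u D)
            (invariant_pinors \<kappa> Xt \<rho> \<tau> \<xi> D) (invariant_couples \<kappa> Xt \<rho> \<tau> \<xi> u' u D 1 D) \<and>
          bij_betw (change_orientation \<kappa> Xt \<rho> \<xi> u' D)
            (invariant_couples \<kappa> Xt \<rho> \<tau> \<xi> u u' D 1 D) (invariant_couples \<kappa> Xt \<rho> \<tau> \<xi> u' u D 1 D) \<and>
          (\<forall>E \<in> {D, D\<gamma>}.
             (\<forall>s \<in> invariant_pinors \<kappa> Xt \<rho> \<tau> \<xi> D\<gamma>.
                couple_relation \<kappa> Xt \<rho> \<tau> \<xi> E (- 1) D (couple_of_pinor Xt \<rho> \<xi> u' u E s)) \<and>
             bij_betw (couple_of_pinor Xt \<rho> \<xi> u' u E)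
               (invariant_pinors \<kappa> Xt \<rho> \<tau> \<xi> D\<gamma>) (invariant_couples \<kappa> Xt \<rho> \<tau> \<xi> u' u E (- 1) D) \<and>
             bij_betw (change_orientation \<kappa> Xt \<rho> \<xi> u' E)
               (invariant_couples \<kappa> Xt \<rho> \<tau> \<xi> u u' E (- 1) D)
               (invariant_couples \<kappa> Xt \<rho> \<tau> \<xi> u' u E (- 1) D) \<and>
             bij_betw (change_orientation \<kappa> Xt \<rho> \<xi> u' E)
               (spinor_couples \<kappa> Xt \<rho> \<tau> \<xi> u u') (spinor_couples \<kappa> Xt \<rho> \<tau> \<xi> u' u) \<and>
             (\<forall>s \<in> pinors \<kappa> Xt \<rho> \<xi>.
                change_orientation \<kappa> Xt \<rho> \<xi> u' E (couple_of_pinor Xt \<rho> \<xi> u u' E s) =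
                couple_of_pinor Xt \<rho> \<xi> u' u E s))))"
proof -
  have "CARD('m) > 0" by simp
  \<comment> \<open>Index types are nonempty, so n > 0 and the dimension is at least two, as
    required for -1 to lie in Spin.\<close>
  then have card2: "CARD('m) \<ge> 2" using dim by (cases n) simp_all
  have Xt: "riemannian_manifold Xt" using cover by (simp add: orientable_double_cover_def)
  interpret pin_cover X Xt \<pi> \<tau> \<kappa>
    by unfold_locales (rule X(1) Xt cover sign card2)+
  have "topspace (mtop Xt) \<noteq> {}"
  proof
    assume "topspace (mtop Xt) = {}"
    then have "topspace (mtop X) = {}" using two_covering_props(3)[OF two_covering_pi] by fastforce
    then have "orientation X {}" by (rule orientation_empty[OF X.smooth_manifold])
    with X(3) show False by (auto simp: orientable_def)
  qed
  note ne = this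
  have inv: "involution X Xt \<pi> \<tau> \<kappa> \<xi> D"
    if "pin_equivalence \<kappa> Xt \<xi> (isometry_pullback Xt \<tau> \<xi>) D" "\<forall>p \<in> topspace (total \<xi>). D (D p) = p"
    for \<xi> :: "('p, 'y, 'm) frame_structure" and D
    by unfold_locales (use that in auto)
  have spinors: "spinor_involution X Xt \<pi> \<tau> \<kappa> \<xi> D n \<rho> u u'" if i: "involution X Xt \<pi> \<tau> \<kappa> \<xi> D"
    for \<xi> :: "('p, 'y, 'm) frame_structure" and D
  proof -
    interpret I: involution X Xt \<pi> \<tau> \<kappa> \<xi> D by (rule i)
    show ?thesis by unfold_locales (rule dim \<rho> I.pin_S u u')+
  qed
  have both: "involution X Xt \<pi> \<tau> \<kappa> \<xi> E" if i: "involution X Xt \<pi> \<tau> \<kappa> \<xi> D" and E: "E \<in> {D, D \<circ> sheet_exchange \<xi>}"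
    for \<xi> :: "('p, 'y, 'm) frame_structure" and D E
    using E i involution.involution_sheet[OF i] by blast
  note corr = spinor_involution.pinor_correspondence and change = spinor_involution.bij_change_orientation
    and rev = spinor_involution.reverse_involution and couple = spinor_involution.change_orientation_couple_of_pinor
  have pm: "(1::real) = 1 \<or> 1 = (- 1 :: real)" "(- 1 :: real) = 1 \<or> - 1 = (- 1 :: real)" by simp_all
  show ?thesis
  proof (intro conjI allI impI, goal_cases)
    case (1 \<xi> D)
    show ?case
      unfolding Let_def couple_iso_def fst_conv snd_conv by (intro conjI lift_restricts_to_spin[OF u u' 1])
  next
    case (2 \<xi>u D\<^sub>1 g)
    show ?case
      unfolding Let_def by (intro impI, elim conjE) (rule couple_iso_extends_to_pin[OF u u' _ _ refl]; assumption)
  next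
    case (3 \<xi> D)
    then show ?case using inv involution.pin_structure_Q by blast
  next
    case (4 \<xi> D)
    then show ?case using inv involution.pin_equivalent_pullback by blast
  next
    case (5 \<xi> D \<zeta>)
    then show ?case using involution.quotient_dichotomy[OF inv _ _ ne] by blast
  next
    case (6 \<xi> D \<zeta>)
    then have i: "involution X Xt \<pi> \<tau> \<kappa> \<xi> D" using inv by blast
    show ?case
      unfolding Let_def
    proof (intro conjI corr(1,2)[OF spinors[OF i] i] ballI[where A = "{D, D \<circ> sheet_exchange \<xi>}"])
      fix E assume "E \<in> {D, D \<circ> sheet_exchange \<xi>}"
      note s = spinors[OF both[OF i this]]
      show "\<forall>s \<in> invariant_pinors \<kappa> Xt \<rho> \<tau> \<xi> (D \<circ> sheet_exchange \<xi>).
          couple_relation \<kappa> Xt \<rho> \<tau> \<xi> E (- 1) D (couple_of_pinor Xt \<rho> \<xi> u u' E s)"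
        "bij_betw (couple_of_pinor Xt \<rho> \<xi> u u' E) (invariant_pinors \<kappa> Xt \<rho> \<tau> \<xi> (D \<circ> sheet_exchange \<xi>))
          (invariant_couples \<kappa> Xt \<rho> \<tau> \<xi> u u' E (- 1) D)"
        by (rule corr(3,4)[OF s i])+
    qed
  next
    case (7 \<xi> D \<zeta>)
    then have i: "involution X Xt \<pi> \<tau> \<kappa> \<xi> D" using inv by blast
    show ?case
      unfolding Let_def
    proof (intro conjI corr(1,2)[OF rev[OF spinors[OF i]] i] change(2)[OF spinors[OF i] i pm(1)]
        ballI[where A = "{D, D \<circ> sheet_exchange \<xi>}"])
      fix E assume "E \<in> {D, D \<circ> sheet_exchange \<xi>}"
      note s = spinors[OF both[OF i this]]
      show "\<forall>s \<in> invariant_pinors \<kappa> Xt \<rho> \<tau> \<xi> (D \<circ> sheet_exchange \<xi>).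
          couple_relation \<kappa> Xt \<rho> \<tau> \<xi> E (- 1) D (couple_of_pinor Xt \<rho> \<xi> u' u E s)"
        "bij_betw (couple_of_pinor Xt \<rho> \<xi> u' u E) (invariant_pinors \<kappa> Xt \<rho> \<tau> \<xi> (D \<circ> sheet_exchange \<xi>))
          (invariant_couples \<kappa> Xt \<rho> \<tau> \<xi> u' u E (- 1) D)"
        by (rule corr(3,4)[OF rev[OF s] i])+
      show "bij_betw (change_orientation \<kappa> Xt \<rho> \<xi> u' E) (invariant_couples \<kappa> Xt \<rho> \<tau> \<xi> u u' E (- 1) D)
          (invariant_couples \<kappa> Xt \<rho> \<tau> \<xi> u' u E (- 1) D)"
        by (rule change(2)[OF s i pm(2)])
      show "bij_betw (change_orientation \<kappa> Xt \<rho> \<xi> u' E) (spinor_couples \<kappa> Xt \<rho> \<tau> \<xi> u u') (spinor_couples \<kappa> Xt \<rho> \<tau> \<xi> u' u)"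
        by (rule change(1)[OF s i pm(1)])
      show "\<forall>s \<in> pinors \<kappa> Xt \<rho> \<xi>. change_orientation \<kappa> Xt \<rho> \<xi> u' E (couple_of_pinor Xt \<rho> \<xi> u u' E s) =
          couple_of_pinor Xt \<rho> \<xi> u' u E s"
        by (rule ballI) (rule couple[OF s])
    qed
  qed
qed

end
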